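(* Assume (A1)-(A4). Let $u\in H^1_0(\Omega)$ be the positive $L^2$-normalized ground state with eigenvalue $\lambda$, and let $u^n\in H^1_0(\Omega)$ be generated by the basic inverse iteration $$u^{n+1}:=\frac{\mathcal{G}_{u^n}(u^n)}{\|\mathcal{G}_{u^n}(u^n)\|},\qquad n\ge 0 .$$ Let $V_u^\perp:=\{w\in H^1_0(\Omega): (u,w)_{L^2(\Omega)}=0\}$ and let $\mu_1$ be the largest eigenvalue in magnitude of the weighted linear eigenvalue problem seeking $v_i\in V_u^\perp\setminus\{0\}$ and $\mu_i\in\mathbb{R}$ such that $$(v_i,(\lambda-2\beta|u|^2)w)_{L^2(\Omega)}=\mu_i\,a_u(v_i,w)\qquad\text{for all } w\in V_u^\perp .$$ Then $|\mu_1|<1$, and for every $\varepsilon>0$ there exist a neighborhood $S_\varepsilon\subset H^1_0(\Omega)$ of $u$ and a constant $C_\varepsilon>0$ such that $$\|u^n-u\|_{H^1(\Omega)}\le C_\varepsilon\,\big(|\mu_1|+\varepsilon\big)^n\,\|u^0-u\|_{H^1(\Omega)}$$ for all $L^2$-normalized starting values $u^0\in S_\varepsilon$ and all $n\ge 1$. Moreover, $|\mu_1|\le\frac{\lambda_1}{\lambda_2}$, with equality only if $\beta=0$.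
   Context: All functions are real-valued and $\|\cdot\|:=\|\cdot\|_{L^2(\Omega)}$. Assumptions: (A1) $\Omega\subset\mathbb{R}^d$ is a bounded convex domain, $d\in\{1,2,3\}$. (A2) $V\in L^\infty(\Omega)$ with $V\ge 0$ a.e. in $\Omega$. (A3) $\beta\ge 0$ is a real constant. (A4) For all $x\in\Omega$ and $\varepsilon>0$: $\|V\|_{L^\infty(\Omega\cap B_\varepsilon(x))}>0$, where $B_\varepsilon(x)$ is the ball of radius $\varepsilon$ around $x$. Energy: $E(v):=\frac12\int_\Omega \frac12|\nabla v|^2+V|v|^2+\frac{\beta}{2}|v|^4\,dx$ for $v\in H^1_0(\Omega)$. The ground state $u$ is the unique positive minimizer of $E$ over $\{v\in H^1_0(\Omega):\|v\|=1\}$ (under (A1)-(A3) it is known that exactly two minimizers exist, $u>0$ and $-u$, and $u\in H^2(\Omega)\cap C^{0,\alpha}(\overline\Omega)$ for some $0<\alpha<1$). For $z\in H^1_0(\Omega)$ let $a_z(w,v):=\frac12(\nabla w,\nabla v)_{L^2(\Omega)}+(Vw,v)_{L^2(\Omega)}+\beta(|z|^2w,v)_{L^2(\Omega)}$ for $w,v\in H^1_0(\Omega)$. The ground state eigenvalue $\lambda>0$ is the number with $a_u(u,v)=\lambda(u,v)_{L^2(\Omega)}$ for all $v\in H^1_0(\Omega)$. Linearized eigenvalue problem: find $\lambda_i\in\mathbb{R}$ and $u_i\in H^1_0(\Omega)$, $\|u_i\|=1$, with $a_u(u_i,v)=\lambda_i(u_i,v)_{L^2(\Omega)}$ for all $v\in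 H^1_0(\Omega)$. Its eigenvalues, ordered with multiplicity, are $0<\lambda_1<\lambda_2\le\lambda_3\le\dots\to\infty$, and it is known that $\lambda_1=\lambda$ is simple with eigenfunction $u$. For $v\in H^1_0(\Omega)$, $\mathcal{G}_v w\in H^1_0(\Omega)$ denotes the unique solution of $a_v(\mathcal{G}_vw,\varphi)=(w,\varphi)_{L^2(\Omega)}$ for all $\varphi\in H^1_0(\Omega)$. "Neighborhood" is with respect to the $H^1$-norm. *)

theory Defs
  imports "HOL-Analysis.Analysis" "HOL-Probability.Essential_Supremum"
begin

text \<open>
  Elements of Lebesgue and Sobolev spaces on \<open>\<Omega>\<close> are represented by functions on the whole
  Euclidean space; only their values on \<open>\<Omega>\<close>, up to null sets, matter. Equality of two elements
  is equality almost everywhere on \<open>\<Omega>\<close>, and being zero is being zero almost everywhere on \<open>\<Omega>\<close>.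
\<close>

subsection \<open>Lebesgue spaces\<close>

definition L2 :: "'a::euclidean_space set \<Rightarrow> ('a \<Rightarrow> 'b::euclidean_space) set" where
  "L2 \<Omega> = {f. f \<in> borel_measurable (lebesgue_on \<Omega>) \<and>
               integrable (lebesgue_on \<Omega>) (\<lambda>x. (norm (f x))\<^sup>2)}"

definition l2_inner ::
    "'a::euclidean_space set \<Rightarrow> ('a \<Rightarrow> 'b::euclidean_space) \<Rightarrow> ('a \<Rightarrow> 'b) \<Rightarrow> real" where
  "l2_inner \<Omega> f g = (LINT x|lebesgue_on \<Omega>. f x \<bullet> g x)"

definition l2_norm :: "'a::euclidean_space set \<Rightarrow> ('a \<Rightarrow> 'b::euclidean_space) \<Rightarrow> real" where
  "l2_norm \<Omega> f = sqrt (l2_inner \<Omega> f f)"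

definition linf_norm :: "'a::euclidean_space set \<Rightarrow> ('a \<Rightarrow> real) \<Rightarrow> ereal" where
  "linf_norm \<Omega> f = esssup (lebesgue_on \<Omega>) (\<lambda>x. ereal \<bar>f x\<bar>)"

definition Linf :: "'a::euclidean_space set \<Rightarrow> ('a \<Rightarrow> real) set" where
  "Linf \<Omega> = {f. f \<in> borel_measurable (lebesgue_on \<Omega>) \<and> linf_norm \<Omega> f < \<infinity>}"

subsection \<open>Sobolev spaces\<close>

definition partial :: "'a::euclidean_space \<Rightarrow> ('a \<Rightarrow> real) \<Rightarrow> 'a \<Rightarrow> real" where
  "partial b f x = frechet_derivative f (at x) b"

primrec Ck :: "nat \<Rightarrow> ('a::euclidean_space \<Rightarrow> real) \<Rightarrow> bool" where
  "Ck 0 f \<longleftrightarrow> continuous_on UNIV f"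
| "Ck (Suc k) f \<longleftrightarrow> (\<forall>x. f differentiable (at x)) \<and> (\<forall>b\<in>Basis. Ck k (partial b f))"

definition test_functions :: "'a::euclidean_space set \<Rightarrow> ('a \<Rightarrow> real) set" where
  "test_functions \<Omega> =
     {\<phi>. (\<forall>k. Ck k \<phi>) \<and> compact (closure {x. \<phi> x \<noteq> 0}) \<and> closure {x. \<phi> x \<noteq> 0} \<subseteq> \<Omega>}"

definition has_weak_gradient ::
    "'a::euclidean_space set \<Rightarrow> ('a \<Rightarrow> real) \<Rightarrow> ('a \<Rightarrow> 'a) \<Rightarrow> bool" where
  "has_weak_gradient \<Omega> w g \<longleftrightarrow>
     (\<forall>\<phi>\<in>test_functions \<Omega>. \<forall>b\<in>Basis.
        (LINT x|lebesgue_on \<Omega>. w x * partial b \<phi> x) =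
        - (LINT x|lebesgue_on \<Omega>. (g x \<bullet> b) * \<phi> x))"

definition H1 :: "'a::euclidean_space set \<Rightarrow> ('a \<Rightarrow> real) set" where
  "H1 \<Omega> = {w. w \<in> L2 \<Omega> \<and> (\<exists>g\<in>L2 \<Omega>. has_weak_gradient \<Omega> w g)}"

text \<open>The square integrable weak gradient is unique up to null sets; any choice will do.\<close>

definition wgrad :: "'a::euclidean_space set \<Rightarrow> ('a \<Rightarrow> real) \<Rightarrow> 'a \<Rightarrow> 'a" where
  "wgrad \<Omega> w = (SOME g. g \<in> L2 \<Omega> \<and> has_weak_gradient \<Omega> w g)"

definition h1_norm :: "'a::euclidean_space set \<Rightarrow> ('a \<Rightarrow> real) \<Rightarrow> real" where
  "h1_norm \<Omega> w = sqrt ((l2_norm \<Omega> w)\<^sup>2 + (l2_norm \<Omega> (wgrad \<Omega> w))\<^sup>2)"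

definition H10 :: "'a::euclidean_space set \<Rightarrow> ('a \<Rightarrow> real) set" where
  "H10 \<Omega> = {w \<in> H1 \<Omega>. \<forall>e>0. \<exists>\<phi>\<in>test_functions \<Omega>. h1_norm \<Omega> (\<lambda>x. w x - \<phi> x) < e}"

definition H10_neighborhood ::
    "'a::euclidean_space set \<Rightarrow> ('a \<Rightarrow> real) \<Rightarrow> ('a \<Rightarrow> real) set \<Rightarrow> bool" where
  "H10_neighborhood \<Omega> u S \<longleftrightarrow>
     S \<subseteq> H10 \<Omega> \<and> (\<exists>r>0. \<forall>v\<in>H10 \<Omega>. h1_norm \<Omega> (\<lambda>x. v x - u x) < r \<longrightarrow> v \<in> S)"

subsection \<open>The Gross--Pitaevskii problem\<close>

definition energy ::
    "'a::euclidean_space set \<Rightarrow> ('a \<Rightarrow> real) \<Rightarrow> real \<Rightarrow> ('a \<Rightarrow> real) \<Rightarrow> real" where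
  "energy \<Omega> V \<beta> v =
     1/2 * (LINT x|lebesgue_on \<Omega>.
              1/2 * (norm (wgrad \<Omega> v x))\<^sup>2 + V x * \<bar>v x\<bar>^2 + \<beta>/2 * \<bar>v x\<bar>^4)"

definition ground_state ::
    "'a::euclidean_space set \<Rightarrow> ('a \<Rightarrow> real) \<Rightarrow> real \<Rightarrow> ('a \<Rightarrow> real) \<Rightarrow> bool" where
  "ground_state \<Omega> V \<beta> u \<longleftrightarrow>
     u \<in> H10 \<Omega> \<and> l2_norm \<Omega> u = 1 \<and> (AE x in lebesgue_on \<Omega>. u x > 0) \<and>
     (\<forall>v\<in>H10 \<Omega>. l2_norm \<Omega> v = 1 \<longrightarrow> energy \<Omega> V \<beta> u \<le> energy \<Omega> V \<beta> v)"

definition a_form ::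
    "'a::euclidean_space set \<Rightarrow> ('a \<Rightarrow> real) \<Rightarrow> real \<Rightarrow>
     ('a \<Rightarrow> real) \<Rightarrow> ('a \<Rightarrow> real) \<Rightarrow> ('a \<Rightarrow> real) \<Rightarrow> real" where
  "a_form \<Omega> V \<beta> z w v =
     1/2 * l2_inner \<Omega> (wgrad \<Omega> w) (wgrad \<Omega> v) +
     l2_inner \<Omega> (\<lambda>x. V x * w x) v +
     \<beta> * l2_inner \<Omega> (\<lambda>x. \<bar>z x\<bar>^2 * w x) v"

definition ground_state_eigenvalue ::
    "'a::euclidean_space set \<Rightarrow> ('a \<Rightarrow> real) \<Rightarrow> real \<Rightarrow> ('a \<Rightarrow> real) \<Rightarrow> real \<Rightarrow> bool" where
  "ground_state_eigenvalue \<Omega> V \<beta> u ev \<longleftrightarrow>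
     (\<forall>v\<in>H10 \<Omega>. a_form \<Omega> V \<beta> u u v = ev * l2_inner \<Omega> u v)"

text \<open>The solution of the variational problem is unique up to null sets; any choice will do.\<close>

definition G_op ::
    "'a::euclidean_space set \<Rightarrow> ('a \<Rightarrow> real) \<Rightarrow> real \<Rightarrow>
     ('a \<Rightarrow> real) \<Rightarrow> ('a \<Rightarrow> real) \<Rightarrow> ('a \<Rightarrow> real)" where
  "G_op \<Omega> V \<beta> v w =
     (SOME z. z \<in> H10 \<Omega> \<and> (\<forall>\<phi>\<in>H10 \<Omega>. a_form \<Omega> V \<beta> v z \<phi> = l2_inner \<Omega> w \<phi>))"

primrec inverse_iteration ::
    "'a::euclidean_space set \<Rightarrow> ('a \<Rightarrow> real) \<Rightarrow> real \<Rightarrow>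
     ('a \<Rightarrow> real) \<Rightarrow> nat \<Rightarrow> ('a \<Rightarrow> real)" where
  "inverse_iteration \<Omega> V \<beta> u0 0 = u0"
| "inverse_iteration \<Omega> V \<beta> u0 (Suc n) =
     (let w = G_op \<Omega> V \<beta> (inverse_iteration \<Omega> V \<beta> u0 n) (inverse_iteration \<Omega> V \<beta> u0 n)
      in (\<lambda>x. w x / l2_norm \<Omega> w))"

subsection \<open>Eigenvalue problems\<close>

definition linearized_eigenpair ::
    "'a::euclidean_space set \<Rightarrow> ('a \<Rightarrow> real) \<Rightarrow> real \<Rightarrow> ('a \<Rightarrow> real) \<Rightarrow>
     real \<Rightarrow> ('a \<Rightarrow> real) \<Rightarrow> bool" where
  "linearized_eigenpair \<Omega> V \<beta> u ev w \<longleftrightarrow>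
     w \<in> H10 \<Omega> \<and> l2_norm \<Omega> w = 1 \<and>
     (\<forall>v\<in>H10 \<Omega>. a_form \<Omega> V \<beta> u w v = ev * l2_inner \<Omega> w v)"

text \<open>
  An enumeration, starting at index 1, of all eigenvalues in nondecreasing order and repeated
  according to multiplicity. Orthonormality of the eigenfunctions rules out that an eigenvalue
  is listed too often; the last clause (no eigenfunction is orthogonal to all listed ones)
  rules out that it is listed too rarely.
\<close>

definition ordered_linearized_eigenpairs ::
    "'a::euclidean_space set \<Rightarrow> ('a \<Rightarrow> real) \<Rightarrow> real \<Rightarrow> ('a \<Rightarrow> real) \<Rightarrow>
     (nat \<Rightarrow> real) \<Rightarrow> (nat \<Rightarrow> 'a \<Rightarrow> real) \<Rightarrow> bool" where
  "ordered_linearized_eigenpairs \<Omega> V \<beta> u lam e \<longleftrightarrow>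
     (\<forall>i\<ge>1. linearized_eigenpair \<Omega> V \<beta> u (lam i) (e i)) \<and>
     (\<forall>i\<ge>1. \<forall>j\<ge>i. lam i \<le> lam j) \<and>
     (\<forall>i\<ge>1. \<forall>j\<ge>1. i \<noteq> j \<longrightarrow> l2_inner \<Omega> (e i) (e j) = 0) \<and>
     (\<forall>ev w. linearized_eigenpair \<Omega> V \<beta> u ev w \<longrightarrow> (\<exists>i\<ge>1. l2_inner \<Omega> w (e i) \<noteq> 0))"

definition V_perp :: "'a::euclidean_space set \<Rightarrow> ('a \<Rightarrow> real) \<Rightarrow> ('a \<Rightarrow> real) set" where
  "V_perp \<Omega> u = {w \<in> H10 \<Omega>. l2_inner \<Omega> u w = 0}"

definition weighted_eigenvalue ::
    "'a::euclidean_space set \<Rightarrow> ('a \<Rightarrow> real) \<Rightarrow> real \<Rightarrow> ('a \<Rightarrow> real) \<Rightarrow>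
     real \<Rightarrow> real \<Rightarrow> bool" where
  "weighted_eigenvalue \<Omega> V \<beta> u ev \<mu> \<longleftrightarrow>
     (\<exists>v\<in>V_perp \<Omega> u. \<not> (AE x in lebesgue_on \<Omega>. v x = 0) \<and>
        (\<forall>w\<in>V_perp \<Omega> u.
           l2_inner \<Omega> v (\<lambda>x. (ev - 2 * \<beta> * \<bar>u x\<bar>^2) * w x) = \<mu> * a_form \<Omega> V \<beta> u v w))"

definition largest_weighted_eigenvalue ::
    "'a::euclidean_space set \<Rightarrow> ('a \<Rightarrow> real) \<Rightarrow> real \<Rightarrow> ('a \<Rightarrow> real) \<Rightarrow>
     real \<Rightarrow> real \<Rightarrow> bool" where
  "largest_weighted_eigenvalue \<Omega> V \<beta> u ev \<mu> \<longleftrightarrow>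
     weighted_eigenvalue \<Omega> V \<beta> u ev \<mu> \<and>
     (\<forall>\<nu>. weighted_eigenvalue \<Omega> V \<beta> u ev \<nu> \<longrightarrow> \<bar>\<nu>\<bar> \<le> \<bar>\<mu>\<bar>)"

end

(*
  Write u^n = u + h and y = ev * G_{u^n} u^n - u.  Comparing the equations of u and of G_{u^n} u^n
  gives a_u(y, phi) = ((ev - 2 beta u^2) h, phi) + O(|h|^2 |phi|), the remainder being controlled by
  the embedding of H^1_0 into L^4.  Up to quadratic terms h and the error of u^{n+1} are orthogonal
  to u, and there the weighted form is bounded by |mu_1| in the a_u-norm: it is compact, so the
  maximum of its Rayleigh quotient is attained at an eigenvector.  Hence each step contracts the
  error by |mu_1| + O(|h|).

  The bound on |mu_1| combines a_u(v, v) >= lam_2 |v|^2 on the orthogonal complement of u with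
  |ev - 2 beta u^2| <= ev, that is, beta u^2 <= ev, which is a maximum principle.  If beta > 0, the strong
  maximum principle gives beta u^2 < ev almost everywhere, and the bound is strict.
*)

theory Submission
  imports Defs "HOL-Complex_Analysis.Great_Picard" "HOL-Library.Diagonal_Subsequence"
begin

subsection \<open>Semi-inner product spaces of functions\<close>

text \<open>Functions represent classes modulo null sets, so every inner product is only
  semidefinite; the Hilbert space arguments are carried out for semi-inner products with
  \<open>lc\<close> as the vector operation. Errors are measured in the norm of \<open>a u\<close>:
  because a_u(u, v) = ev (u, v), orthogonality to u means the same for a_u and for L2, removing the
  u-component does not increase the norm, and mu_1 enters without a constant factor. Passing to and
  from the H^1 norm only affects C_epsilon and the neighborhood. Near-orthogonality comes from
  normalisation: |u + h| = 1 gives (u, h) = - |h|^2 / 2, and dividing the new iterate by its norm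
  cancels the first-order u-component of its error. For the strict bound beta u^2 < ev, u enters as
  an element of H^1_0, where an interior maximum point has no meaning; the bound is drawn from an
  integral estimate for a regularised logarithm of k - u and Poincare's inequality on convex compact
  sets, and convexity of Omega places any two boxes in one such set. The embedding into L^4 and
  compactness rest on the same device, averages of smooth functions over small cubes.\<close>

definition lc :: "real \<Rightarrow> ('x \<Rightarrow> 'r::real_vector) \<Rightarrow> real \<Rightarrow> ('x \<Rightarrow> 'r) \<Rightarrow> 'x \<Rightarrow> 'r" where
  "lc a f b g = (\<lambda>x. a *\<^sub>R f x + b *\<^sub>R g x)"

text \<open>\<open>ip\<close> is assumed nonnegative but not definite, since a nonzero function may
  vanish almost everywhere; vectors of seminorm zero therefore need separate cases in the proofs
  below.\<close>

locale sip =
  fixes H :: "('x \<Rightarrow> 'r::real_vector) set"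
    and ip :: "('x \<Rightarrow> 'r) \<Rightarrow> ('x \<Rightarrow> 'r) \<Rightarrow> real"
  assumes lc_closed: "f \<in> H \<Longrightarrow> g \<in> H \<Longrightarrow> lc a f b g \<in> H"
    and zero_closed: "(\<lambda>x. 0) \<in> H"
    and ip_sym: "f \<in> H \<Longrightarrow> g \<in> H \<Longrightarrow> ip f g = ip g f"
    and ip_lc: "f \<in> H \<Longrightarrow> g \<in> H \<Longrightarrow> k \<in> H \<Longrightarrow> ip (lc a f b g) k = a * ip f k + b * ip g k"
    and ip_nonneg: "f \<in> H \<Longrightarrow> ip f f \<ge> 0"
begin

definition nrm :: "('x \<Rightarrow> 'r) \<Rightarrow> real" where
  "nrm f = sqrt (ip f f)"

abbreviation dif :: "('x \<Rightarrow> 'r) \<Rightarrow> ('x \<Rightarrow> 'r) \<Rightarrow> 'x \<Rightarrow> 'r" where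
  "dif f g \<equiv> lc 1 f (-1) g"

lemma ip_lc_right: "f \<in> H \<Longrightarrow> g \<in> H \<Longrightarrow> k \<in> H \<Longrightarrow> ip k (lc a f b g) = a * ip k f + b * ip k g"
  by (metis ip_sym ip_lc lc_closed)

lemma nrm_nonneg [simp]: "f \<in> H \<Longrightarrow> nrm f \<ge> 0"
  by (simp add: nrm_def ip_nonneg)

lemma nrm_sq: "f \<in> H \<Longrightarrow> (nrm f)\<^sup>2 = ip f f"
  by (simp add: nrm_def ip_nonneg)

lemma ip_lc_self:
  assumes "f \<in> H" "g \<in> H"
  shows "ip (lc a f b g) (lc a f b g) = a\<^sup>2 * ip f f + 2 * a * b * ip f g + b\<^sup>2 * ip g g"
  using assms ip_sym[of g f]
  by (simp add: ip_lc ip_lc_right lc_closed power2_eq_square algebra_simps)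

text \<open>If \<open>ip g g = 0\<close>, then \<open>ip (f - t g) (f - t g)\<close> is affine in
  \<open>t\<close> and bounded below, so its slope \<open>ip f g\<close> vanishes. Otherwise expand
  the square of \<open>ip g g * f - ip f g * g\<close>.\<close>

lemma ip_cs_sq:
  assumes "f \<in> H" "g \<in> H"
  shows "(ip f g)\<^sup>2 \<le> ip f f * ip g g"
proof (cases "ip g g = 0")
  case True
  have *: "0 \<le> ip f f - 2 * t * ip f g" for t
    using ip_nonneg[OF lc_closed[OF assms, of 1 "- t"]] ip_lc_self[OF assms, of 1 "- t"] True by simp
  have "ip f g = 0"
  proof (rule ccontr)
    assume n: "ip f g \<noteq> 0"
    have "0 \<le> ip f f - 2 * ((ip f f + 1) / (2 * ip f g)) * ip f g" by (rule *)
    then show False using n by simp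
  qed
  then show ?thesis using True by simp
next
  case False
  then have pos: "ip g g > 0" using ip_nonneg[OF assms(2)] by simp
  have "0 \<le> (ip g g)\<^sup>2 * ip f f - 2 * ip g g * ip f g * ip f g + (ip f g)\<^sup>2 * ip g g"
    using ip_nonneg[OF lc_closed[OF assms, of "ip g g" "- ip f g"]]
      ip_lc_self[OF assms, of "ip g g" "- ip f g"] by simp
  also have "\<dots> = ip g g * (ip f f * ip g g - (ip f g)\<^sup>2)"
    by (simp add: power2_eq_square algebra_simps)
  finally show ?thesis using pos by (simp add: zero_le_mult_iff)
qed

lemma ip_cs: "f \<in> H \<Longrightarrow> g \<in> H \<Longrightarrow> \<bar>ip f g\<bar> \<le> nrm f * nrm g"
  using ip_cs_sq[of f g] ip_nonneg
  by (metis nrm_def real_sqrt_abs real_sqrt_le_iff real_sqrt_mult)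

lemma nrm_lc_le:
  assumes "f \<in> H" "g \<in> H"
  shows "nrm (lc a f b g) \<le> \<bar>a\<bar> * nrm f + \<bar>b\<bar> * nrm g"
proof -
  have "2 * a * b * ip f g \<le> \<bar>2 * a * b * ip f g\<bar>" by simp
  also have "\<dots> \<le> 2 * \<bar>a\<bar> * \<bar>b\<bar> * (nrm f * nrm g)"
    using mult_left_mono[OF ip_cs[OF assms], of "2 * \<bar>a\<bar> * \<bar>b\<bar>"] by (simp add: abs_mult)
  finally have "(nrm (lc a f b g))\<^sup>2 \<le> (\<bar>a\<bar> * nrm f + \<bar>b\<bar> * nrm g)\<^sup>2"
    using assms
    by (simp add: nrm_sq lc_closed ip_lc_self power2_sum power_mult_distrib mult.left_commute)
  then show ?thesis
    by (rule power2_le_imp_le) (simp add: assms)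
qed

lemma nrm_dif_sym: "f \<in> H \<Longrightarrow> g \<in> H \<Longrightarrow> nrm (dif f g) = nrm (dif g f)"
  unfolding nrm_def by (simp add: ip_lc_self ip_sym[of f g])

lemma ip_self_dif:
  "f \<in> H \<Longrightarrow> g \<in> H \<Longrightarrow> ip (dif f g) (dif f g) = ip f f - 2 * ip f g + ip g g"
  by (simp add: ip_lc_self)

lemma ip_self_dif_triangle:
  assumes "f \<in> H" "g \<in> H" "k \<in> H"
  shows "nrm (dif f k) \<le> nrm (dif f g) + nrm (dif g k)"
proof -
  have "dif f k = lc 1 (dif f g) 1 (dif g k)" by (simp add: lc_def)
  then show ?thesis using nrm_lc_le[OF lc_closed[OF assms(1,2), of 1 "-1"] lc_closed[OF assms(2,3), of 1 "-1"], of 1 1] by simp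
qed

lemma nrm_le_dif:
  assumes "f \<in> H" "g \<in> H"
  shows "\<bar>nrm f - nrm g\<bar> \<le> nrm (dif f g)"
proof -
  have "f = lc 1 (dif f g) 1 g" "g = lc 1 (dif g f) 1 f" by (simp_all add: lc_def)
  then have "nrm f \<le> nrm (dif f g) + nrm g" "nrm g \<le> nrm (dif g f) + nrm f"
    using nrm_lc_le[OF lc_closed[OF assms, of 1 "-1"] assms(2), of 1 1]
      nrm_lc_le[OF lc_closed[OF assms(2,1), of 1 "-1"] assms(1), of 1 1] by simp_all
  then show ?thesis using nrm_dif_sym[OF assms] by simp
qed

end

text \<open>Convergence is in the seminorm, so limits are determined only up to elements of seminorm
  zero.\<close>

locale complete_sip = sip +
  assumes complete: "(\<And>n::nat. h n \<in> H) \<Longrightarrow>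
      (\<And>e. e > 0 \<Longrightarrow> \<exists>N. \<forall>m\<ge>N. \<forall>n\<ge>N. nrm (dif (h m) (h n)) < e) \<Longrightarrow>
      \<exists>l\<in>H. (\<lambda>n. nrm (dif (h n) l)) \<longlonglongrightarrow> 0"
begin

text \<open>Riesz representation, by minimising \<open>ip f f - 2 * L f\<close>; a minimising sequence is Cauchy
  by the parallelogram law.\<close>

lemma riesz:
  assumes L_lc: "\<And>f g a b. f \<in> H \<Longrightarrow> g \<in> H \<Longrightarrow> L (lc a f b g) = a * L f + b * L g"
    and L_bd: "\<And>f. f \<in> H \<Longrightarrow> \<bar>L f\<bar> \<le> K * nrm f"
  obtains z where "z \<in> H" "\<And>f. f \<in> H \<Longrightarrow> ip z f = L f"
proof -
  define J where "J f = ip f f - 2 * L f" for f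
  have J_ge: "J f \<ge> - (K\<^sup>2)" if "f \<in> H" for f
  proof -
    have "J f \<ge> (nrm f)\<^sup>2 - 2 * (K * nrm f)"
      using L_bd[OF that] by (simp add: J_def nrm_sq that)
    also have "(nrm f)\<^sup>2 - 2 * (K * nrm f) = (nrm f - K)\<^sup>2 - K\<^sup>2"
      by (simp add: power2_eq_square algebra_simps)
    finally show ?thesis using zero_le_power2[of "nrm f - K"] by linarith
  qed
  define m where "m = Inf (J ` H)"
  have bdd: "bdd_below (J ` H)" using J_ge by (auto simp: bdd_below_def)
  have m_le: "m \<le> J f" if "f \<in> H" for f
    unfolding m_def using that bdd by (auto intro: cInf_lower)
  have "\<exists>f\<in>H. J f < m + e" if "e > 0" for e
    using cInf_lessD[of "J ` H" "m + e"] zero_closed that unfolding m_def by auto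
  then have "\<exists>f\<in>H. J f < m + inverse (Suc n)" for n :: nat by simp
  then obtain h where h: "\<And>n. h n \<in> H" "\<And>n::nat. J (h n) < m + inverse (Suc n)" by metis
  have par: "ip (dif f g) (dif f g) \<le> 2 * (J f - m) + 2 * (J g - m)" if "f \<in> H" "g \<in> H" for f g
  proof -
    have "m \<le> J (lc (1/2) f (1/2) g)" using that by (intro m_le lc_closed)
    also have "\<dots> = ip f f / 4 + ip f g / 2 + ip g g / 4 - L f - L g"
      unfolding J_def by (simp add: ip_lc_self L_lc that power2_eq_square field_simps)
    finally show ?thesis using that by (simp add: ip_self_dif J_def)
  qed
  have "\<exists>N. \<forall>i\<ge>N. \<forall>j\<ge>N. nrm (dif (h i) (h j)) < e" if "e > 0" for e
  proof -
    obtain N where N: "inverse (real (Suc N)) < e\<^sup>2 / 4"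
      using reals_Archimedean[of "e\<^sup>2 / 4"] \<open>e > 0\<close> zero_less_power[of e 2] by fastforce
    have "nrm (dif (h i) (h j)) < e" if "i \<ge> N" "j \<ge> N" for i j
    proof -
      have "inverse (real (Suc i)) \<le> inverse (real (Suc N))"
        "inverse (real (Suc j)) \<le> inverse (real (Suc N))" using that by (auto intro: le_imp_inverse_le)
      then have "J (h i) - m < e\<^sup>2 / 4" "J (h j) - m < e\<^sup>2 / 4"
        using h(2)[of i] h(2)[of j] N by (smt (verit))+
      then have "ip (dif (h i) (h j)) (dif (h i) (h j)) < e\<^sup>2"
        using par[OF h(1)[of i] h(1)[of j]] by (simp add: field_simps)
      then have "(nrm (dif (h i) (h j)))\<^sup>2 < e\<^sup>2" using h by (simp add: nrm_sq lc_closed)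
      then show ?thesis using \<open>e > 0\<close> by (simp add: power2_less_imp_less)
    qed
    then show ?thesis by blast
  qed
  then obtain z where z: "z \<in> H" "(\<lambda>n. nrm (dif (h n) z)) \<longlonglongrightarrow> 0"
    using complete[of h] h(1) by blast
  have bound: "\<bar>ip z f - L f\<bar> \<le> nrm (dif (h n) z) * nrm f + sqrt (inverse (Suc n) * ip f f)"
    if f: "f \<in> H" for f n
  proof -
    \<comment> \<open>\<open>2 * t\<close> is the derivative of \<open>J\<close> at
      \<open>h n\<close> in direction \<open>f\<close>. As \<open>h n\<close> minimises up to
      \<open>inverse (Suc n)\<close>, completing the square in the step size \<open>s\<close> bounds
      \<open>t\<close> by the root of that gap.\<close>
    define t where "t = ip (h n) f - L f"
    have "t\<^sup>2 \<le> inverse (Suc n) * ip f f"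
    proof -
      have q: "0 \<le> inverse (Suc n) + 2 * s * t + s\<^sup>2 * ip f f" for s
      proof -
        have "m \<le> J (lc 1 (h n) s f)" using h f by (intro m_le lc_closed)
        also have "\<dots> = J (h n) + 2 * s * t + s\<^sup>2 * ip f f"
          unfolding J_def t_def by (simp add: ip_lc_self L_lc h f algebra_simps)
        finally show ?thesis using h(2)[of n] by linarith
      qed
      show ?thesis
      proof (cases "ip f f = 0")
        case True
        \<comment> \<open>Boundedness by the seminorm makes \<open>L\<close> vanish on vectors of
          seminorm zero.\<close>
        then have "\<bar>ip (h n) f\<bar> \<le> 0" "\<bar>L f\<bar> \<le> 0" using ip_cs[OF h(1) f] L_bd[OF f] by (simp_all add: nrm_def)
        then show ?thesis using True by (simp add: t_def)
      next
        case False
        then have p: "ip f f > 0" using ip_nonneg[OF f] by simp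
        have "2 * (- t / ip f f) * t + (- t / ip f f)\<^sup>2 * ip f f = - (t\<^sup>2 / ip f f)"
          using p by (simp add: power2_eq_square)
        then have "t\<^sup>2 / ip f f \<le> inverse (Suc n)"
          using q[of "- t / ip f f"] by linarith
        then show ?thesis using p by (simp only: pos_divide_le_eq)
      qed
    qed
    then have "\<bar>t\<bar> \<le> sqrt (inverse (Suc n) * ip f f)"
      by (metis real_sqrt_abs real_sqrt_le_iff)
    moreover have "\<bar>ip (dif (h n) z) f\<bar> \<le> nrm (dif (h n) z) * nrm f"
      using h z f by (intro ip_cs lc_closed)
    moreover have "ip z f - L f = t - ip (dif (h n) z) f"
      using h z f by (simp add: ip_lc t_def)
    ultimately show ?thesis by linarith
  qed
  have "ip z f = L f" if f: "f \<in> H" for f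
  proof -
    have "(\<lambda>n. nrm (dif (h n) z) * nrm f + sqrt (inverse (Suc n) * ip f f)) \<longlonglongrightarrow> 0 * nrm f + sqrt (0 * ip f f)"
      by (intro tendsto_intros z(2) LIMSEQ_inverse_real_of_nat)
    then have "\<bar>ip z f - L f\<bar> \<le> 0"
      using bound[OF f] by (intro LIMSEQ_le_const[of _ 0]) auto
    then show ?thesis by simp
  qed
  then show ?thesis using z(1) that by blast
qed

text \<open>Polarisation writes \<open>4 a b B f g\<close> as a difference of two diagonal values,
  and the parallelogram law bounds their sum. The choice \<open>a = nrm g\<close>,
  \<open>b = nrm f\<close> balances the two terms; if one seminorm vanishes, the coefficient of that
  vector may be taken so large that a nonzero \<open>B f g\<close> is impossible.\<close>

lemma polarized_bound:
  assumes B_lc: "\<And>f g k a b. f \<in> H \<Longrightarrow> g \<in> H \<Longrightarrow> k \<in> H \<Longrightarrow> B (lc a f b g) k = a * B f k + b * B g k"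
    and B_sym: "\<And>f g. f \<in> H \<Longrightarrow> g \<in> H \<Longrightarrow> B f g = B g f"
    and B_le: "\<And>f. f \<in> H \<Longrightarrow> \<bar>B f f\<bar> \<le> M * ip f f"
    and f: "f \<in> H" and g: "g \<in> H" and M: "M \<ge> 0"
  shows "\<bar>B f g\<bar> \<le> M * nrm f * nrm g"
proof -
  have quad: "B (lc a f b g) (lc a f b g) = a\<^sup>2 * B f f + 2 * a * b * B f g + b\<^sup>2 * B g g" for a b
    using f g B_lc[of f g f a b] B_lc[of f g g a b] B_lc[of f g "lc a f b g" a b]
      B_sym[of f "lc a f b g"] B_sym[of g "lc a f b g"] B_sym[of g f]
    by (simp add: lc_closed power2_eq_square algebra_simps)
  have main: "2 * a * b * \<bar>B f g\<bar> \<le> M * (a\<^sup>2 * ip f f + b\<^sup>2 * ip g g)" if "a \<ge> 0" "b \<ge> 0" for a b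
  proof -
    have 1: "\<bar>B (lc a f b g) (lc a f b g)\<bar> \<le> M * ip (lc a f b g) (lc a f b g)"
      "\<bar>B (lc a f (-b) g) (lc a f (-b) g)\<bar> \<le> M * ip (lc a f (-b) g) (lc a f (-b) g)"
      using f g by (auto intro: B_le lc_closed)
    have "4 * a * b * \<bar>B f g\<bar> = \<bar>4 * a * b * B f g\<bar>" using that by (simp add: abs_mult)
    also have "\<dots> = \<bar>B (lc a f b g) (lc a f b g) - B (lc a f (-b) g) (lc a f (-b) g)\<bar>"
      unfolding quad by simp
    also have "\<dots> \<le> M * ip (lc a f b g) (lc a f b g) + M * ip (lc a f (-b) g) (lc a f (-b) g)"
      using 1 by linarith
    also have "\<dots> = 2 * (M * (a\<^sup>2 * ip f f + b\<^sup>2 * ip g g))"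
      using f g by (simp add: ip_lc_self algebra_simps)
    finally show ?thesis by simp
  qed
  consider "nrm f > 0" "nrm g > 0" | "nrm f = 0" | "nrm g = 0" using f g by (metis nrm_nonneg less_eq_real_def)
  then show ?thesis
  proof cases
    case 1
    have "2 * nrm g * nrm f * \<bar>B f g\<bar> \<le> M * ((nrm g)\<^sup>2 * (nrm f)\<^sup>2 + (nrm f)\<^sup>2 * (nrm g)\<^sup>2)"
      using main[of "nrm g" "nrm f"] f g by (simp add: nrm_sq)
    also have "\<dots> = 2 * nrm g * nrm f * (M * nrm f * nrm g)" by (simp add: power2_eq_square)
    finally show ?thesis using 1 by (simp add: mult_le_cancel_left)
  next
    case 2
    then have z: "ip f f = 0" using f nrm_sq by force
    have "\<bar>B f g\<bar> \<le> 0"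
    proof (rule ccontr)
      assume "\<not> \<bar>B f g\<bar> \<le> 0"
      then have p: "\<bar>B f g\<bar> > 0" by simp
      define a where "a = (M * ip g g + 1) / (2 * \<bar>B f g\<bar>)"
      have "a \<ge> 0" unfolding a_def using M ip_nonneg[OF g] by simp
      from main[OF this, of 1] z p show False by (simp add: a_def)
    qed
    then show ?thesis using 2 by simp
  next
    case 3
    then have z: "ip g g = 0" using g nrm_sq by force
    have "\<bar>B f g\<bar> \<le> 0"
    proof (rule ccontr)
      assume "\<not> \<bar>B f g\<bar> \<le> 0"
      then have p: "\<bar>B f g\<bar> > 0" by simp
      define a where "a = (M * ip f f + 1) / (2 * \<bar>B f g\<bar>)"
      have "a \<ge> 0" unfolding a_def using M ip_nonneg[OF f] by simp
      from main[of 1, OF _ this] z p show False by (simp add: a_def)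
    qed
    then show ?thesis using 3 by simp
  qed
qed

text \<open>A compact symmetric form attains the supremum of its Rayleigh quotient in modulus at an
  eigenvector.  With \<open>T\<close> representing \<open>B\<close> and \<open>h n\<close> maximising,
  \<open>\<parallel>T (h n) - s M h n\<parallel>\<^sup>2 \<le> 2 M\<^sup>2 - 2 s M B (h n) (h n) \<longrightarrow> 0\<close>.\<close>

lemma rayleigh_attained:
  assumes B_lc: "\<And>f g k a b. f \<in> H \<Longrightarrow> g \<in> H \<Longrightarrow> k \<in> H \<Longrightarrow> B (lc a f b g) k = a * B f k + b * B g k"
    and B_sym: "\<And>f g. f \<in> H \<Longrightarrow> g \<in> H \<Longrightarrow> B f g = B g f"
    and B_bd: "\<And>f g. f \<in> H \<Longrightarrow> g \<in> H \<Longrightarrow> \<bar>B f g\<bar> \<le> K * nrm f * nrm g"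
    and B_compact: "\<And>h. (\<And>n::nat. h n \<in> H) \<Longrightarrow> (\<And>n. nrm (h n) \<le> 1) \<Longrightarrow>
      \<exists>r::nat\<Rightarrow>nat. strict_mono r \<and> (\<forall>e>0. \<exists>N. \<forall>m\<ge>N. \<forall>n\<ge>N. \<forall>w\<in>H.
        \<bar>B (dif (h (r m)) (h (r n))) w\<bar> \<le> e * nrm w)"
    and nz: "f0 \<in> H" "B f0 f0 \<noteq> 0"
  obtains v \<nu> where "v \<in> H" "ip v v = 1" "\<nu> \<noteq> 0" "\<And>w. w \<in> H \<Longrightarrow> B v w = \<nu> * ip v w"
    "\<And>f. f \<in> H \<Longrightarrow> \<bar>B f f\<bar> \<le> \<bar>\<nu>\<bar> * ip f f"
proof -
  have B_scale: "B (lc a f 0 f) (lc a f 0 f) = a\<^sup>2 * B f f" if "f \<in> H" for a f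
    using that B_lc[of f f f a 0] B_lc[of f f "lc a f 0 f" a 0] B_sym[of f "lc a f 0 f"]
    by (simp add: lc_closed power2_eq_square)
  have ip_scale: "ip (lc a f 0 f) (lc a f 0 f) = a\<^sup>2 * ip f f" if "f \<in> H" for a f
    using that by (simp add: ip_lc_self)
  define U where "U = {f \<in> H. ip f f = 1}"
  define M where "M = Sup ((\<lambda>f. \<bar>B f f\<bar>) ` U)"
  have nrmU: "nrm f = 1" if "f \<in> U" for f using that by (simp add: U_def nrm_def)
  have bdd: "bdd_above ((\<lambda>f. \<bar>B f f\<bar>) ` U)"
    using B_bd nrmU unfolding bdd_above_def U_def
    by (intro exI[of _ K]) (fastforce simp: U_def)
  have ip0: "B f f = 0" if "f \<in> H" "ip f f = 0" for f
    using B_bd[OF that(1,1)] that by (simp add: nrm_def)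
  have normalize: "lc (1 / nrm f) f 0 f \<in> U" if "f \<in> H" "ip f f \<noteq> 0" for f
    using that ip_nonneg[OF that(1)] by (simp add: U_def lc_closed ip_scale power_divide nrm_sq)
  have B_le: "\<bar>B f f\<bar> \<le> M * ip f f" if f: "f \<in> H" for f
  proof (cases "ip f f = 0")
    case True
    then show ?thesis using ip0[OF f] by simp
  next
    case False
    let ?g = "lc (1 / nrm f) f 0 f"
    have p: "ip f f > 0" using False ip_nonneg[OF f] by simp
    have "\<bar>B ?g ?g\<bar> \<le> M" unfolding M_def using normalize[OF f False] bdd by (auto intro: cSup_upper)
    then have "\<bar>B f f\<bar> / ip f f \<le> M"
      using p by (simp add: B_scale f abs_mult power_divide nrm_sq)
    then show ?thesis using p by (simp add: field_simps)
  qed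
  have f0: "ip f0 f0 \<noteq> 0" using ip0 nz by blast
  have Mpos: "M > 0"
  proof -
    have "0 < \<bar>B f0 f0\<bar>" using nz by simp
    also have "\<dots> \<le> M * ip f0 f0" by (rule B_le[OF nz(1)])
    finally show ?thesis using ip_nonneg[OF nz(1)] by (simp add: zero_less_mult_iff)
  qed
  have Une: "U \<noteq> {}" using normalize[OF nz(1) f0] by auto
  have "\<exists>f\<in>U. \<bar>B f f\<bar> > M - inverse (Suc n)" for n :: nat
    using less_cSupD[of "(\<lambda>f. \<bar>B f f\<bar>) ` U" "M - inverse (Suc n)"] Une unfolding M_def by auto
  then obtain h0 where h0: "\<And>n. h0 n \<in> U" "\<And>n::nat. \<bar>B (h0 n) (h0 n)\<bar> > M - inverse (Suc n)" by metis
  have "infinite {n. B (h0 n) (h0 n) \<ge> 0} \<or> infinite {n. B (h0 n) (h0 n) < 0}"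
  proof -
    have "{n. B (h0 n) (h0 n) \<ge> 0} \<union> {n. B (h0 n) (h0 n) < 0} = (UNIV :: nat set)" by auto
    then show ?thesis by (metis finite_Un infinite_UNIV_nat)
  qed
  \<comment> \<open>The maximising sequence controls only
    \<open>\<bar>B (h0 n) (h0 n)\<bar>\<close>; one sign \<open>s\<close> occurs infinitely often,
    and along those indices \<open>s * B\<close> tends to \<open>M\<close>.\<close>
  then obtain s :: real and I where I: "infinite I" "s = 1 \<or> s = -1" "\<And>n. n \<in> I \<Longrightarrow> \<bar>B (h0 n) (h0 n)\<bar> = s * B (h0 n) (h0 n)"
    by (elim disjE; force)
  have s1: "\<bar>s\<bar> = 1" "s * s = 1" using I(2) by auto
  define h where "h = h0 \<circ> enumerate I"
  have hU: "h n \<in> U" for n by (simp add: h_def h0)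
  then have hH: "h n \<in> H" for n by (simp add: U_def)
  have hB: "s * B (h n) (h n) > M - inverse (Suc n)" for n
  proof -
    have "n \<le> enumerate I n" using I(1) by (simp add: le_enumerate)
    then have "inverse (real (Suc (enumerate I n))) \<le> inverse (Suc n)" by (simp add: le_imp_inverse_le)
    moreover have "enumerate I n \<in> I" using I(1) by (simp add: enumerate_in_set)
    ultimately show ?thesis using I(3)[of "enumerate I n"] h0(2)[of "enumerate I n"]
      unfolding h_def o_def by linarith
  qed
  have "\<exists>z\<in>H. \<forall>w\<in>H. ip z w = B f w" if fH: "f \<in> H" for f
  proof -
    obtain z where "z \<in> H" "\<And>w. w \<in> H \<Longrightarrow> ip z w = B f w"
      by (rule riesz[of "B f" "K * nrm f"]) (use fH B_bd[OF fH] B_sym[OF fH] in \<open>auto simp: B_lc lc_closed\<close>)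
    then show ?thesis by blast
  qed
  then obtain T where T: "\<And>f. f \<in> H \<Longrightarrow> T f \<in> H" "\<And>f w. f \<in> H \<Longrightarrow> w \<in> H \<Longrightarrow> ip (T f) w = B f w" by metis
  have T_le: "nrm (T f) \<le> M * nrm f" if f: "f \<in> H" for f
  proof -
    have "(nrm (T f))\<^sup>2 = B f (T f)" using T f by (simp add: nrm_sq)
    also have "\<dots> \<le> M * nrm f * nrm (T f)"
      using polarized_bound[of B M f "T f", OF B_lc B_sym B_le f T(1)[OF f]] Mpos by linarith
    finally have "nrm (T f) * nrm (T f) \<le> (M * nrm f) * nrm (T f)" by (simp add: power2_eq_square)
    then show ?thesis using f T(1)[OF f] Mpos
      by (metis less_eq_real_def mult_le_cancel_right_pos nrm_nonneg mult_nonneg_nonneg)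
  qed
  have Tdif: "(nrm (lc 1 (T (h n)) (- (s * M)) (h n)))\<^sup>2 \<le> 2 * M * inverse (Suc n)" for n
  proof -
    have "(nrm (T (h n)))\<^sup>2 \<le> M\<^sup>2"
      using T_le[OF hH[of n]] nrmU[OF hU[of n]] T(1)[OF hH[of n]] by (intro power_mono) auto
    moreover have "(nrm (lc 1 (T (h n)) (- (s * M)) (h n)))\<^sup>2
        = (nrm (T (h n)))\<^sup>2 - 2 * M * (s * B (h n) (h n)) + M\<^sup>2 * (s * s)"
      using hH[of n] T hU[of n]
      by (simp add: nrm_sq ip_lc_self lc_closed U_def) (simp add: power2_eq_square algebra_simps)
    moreover have "2 * M * (s * B (h n) (h n)) \<ge> 2 * M * (M - inverse (Suc n))"
      using hB[of n] Mpos by (intro mult_left_mono) auto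
    ultimately show ?thesis using s1 by (simp add: power2_eq_square algebra_simps)
  qed
  obtain r where r: "strict_mono (r :: nat \<Rightarrow> nat)" "\<forall>e>0. \<exists>N. \<forall>m\<ge>N. \<forall>n\<ge>N. \<forall>w\<in>H.
        \<bar>B (dif (h (r m)) (h (r n))) w\<bar> \<le> e * nrm w"
    using B_compact[of h] hH nrmU[OF hU] by auto
  \<comment> \<open>Compactness of \<open>B\<close> makes the images under \<open>T\<close> Cauchy:
    test the difference of two images with itself.\<close>
  have "\<exists>l\<in>H. (\<lambda>n. nrm (dif (T (h (r n))) l)) \<longlonglongrightarrow> 0"
  proof (rule complete)
    show "T (h (r n)) \<in> H" for n using T(1) hH by simp
    fix e :: real assume e: "e > 0"
    then obtain N where N: "\<forall>m\<ge>N. \<forall>n\<ge>N. \<forall>w\<in>H. \<bar>B (dif (h (r m)) (h (r n))) w\<bar> \<le> (e/2) * nrm w"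
      using r(2)[rule_format, of "e/2"] by auto
    have "nrm (dif (T (h (r m))) (T (h (r n)))) < e" if "m \<ge> N" "n \<ge> N" for m n
    proof -
      let ?w = "dif (T (h (r m))) (T (h (r n)))"
      have w: "?w \<in> H" using T(1) hH by (simp add: lc_closed)
      have "(nrm ?w)\<^sup>2 = B (dif (h (r m)) (h (r n))) ?w"
        unfolding nrm_sq[OF w] using hH w T by (simp add: ip_lc[of _ _ ?w] B_lc[of _ _ ?w])
      also have "\<dots> \<le> (e/2) * nrm ?w" using N that w by (smt (verit))
      finally have "nrm ?w * nrm ?w \<le> (e/2) * nrm ?w" by (simp add: power2_eq_square)
      then have "nrm ?w \<le> e/2" using e nrm_nonneg[OF w]
        by (metis less_eq_real_def mult_le_cancel_right_pos half_gt_zero)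
      then show ?thesis using e by simp
    qed
    then show "\<exists>N. \<forall>m\<ge>N. \<forall>n\<ge>N. nrm (dif (T (h (r m))) (T (h (r n)))) < e" by blast
  qed
  then obtain g where g: "g \<in> H" "(\<lambda>n. nrm (dif (T (h (r n))) g)) \<longlonglongrightarrow> 0" by blast
  \<comment> \<open>\<open>T (h n) - s M h n\<close> tends to zero and \<open>s * s = 1\<close>, so
    \<open>h (r n)\<close> itself converges, to \<open>s / M\<close> times the limit
    \<open>g\<close> of the images.\<close>
  define v where "v = lc (s / M) g 0 g"
  have v: "v \<in> H" by (simp add: v_def g lc_closed)
  have Td0: "(\<lambda>n. nrm (lc 1 (T (h (r n))) (- (s * M)) (h (r n)))) \<longlonglongrightarrow> 0"
  proof -
    have "(\<lambda>n. sqrt (2 * M * inverse (Suc n))) \<longlonglongrightarrow> sqrt (2 * M * 0)"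
      by (intro tendsto_intros LIMSEQ_inverse_real_of_nat)
    then have "(\<lambda>n. sqrt (2 * M * inverse (Suc n))) \<longlonglongrightarrow> 0" by simp
    then have "(\<lambda>n. nrm (lc 1 (T (h n)) (- (s * M)) (h n))) \<longlonglongrightarrow> 0"
    proof (rule Lim_null_comparison[rotated])
      show "\<forall>\<^sub>F n in sequentially. norm (nrm (lc 1 (T (h n)) (- (s * M)) (h n))) \<le> sqrt (2 * M * inverse (Suc n))"
        using Tdif hH T(1) by (intro always_eventually allI) (simp add: lc_closed real_le_rsqrt)
    qed
    then show ?thesis using LIMSEQ_subseq_LIMSEQ[OF _ r(1)] by (auto simp: o_def)
  qed
  have conv: "(\<lambda>n. nrm (dif (h (r n)) v)) \<longlonglongrightarrow> 0"
  proof (rule Lim_null_comparison)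
    show "\<forall>\<^sub>F n in sequentially. norm (nrm (dif (h (r n)) v))
       \<le> (1/M) * nrm (lc 1 (T (h (r n))) (- (s * M)) (h (r n))) + (1/M) * nrm (dif (T (h (r n))) g)"
    proof (intro always_eventually allI)
      fix n
      let ?a = "lc 1 (T (h (r n))) (- (s * M)) (h (r n))" and ?b = "dif (T (h (r n))) g"
      have ab: "?a \<in> H" "?b \<in> H" using T(1) hH g by (auto intro: lc_closed)
      have "dif (h (r n)) v = lc (- s / M) ?a (s / M) ?b"
        using s1(2) Mpos by (auto simp: lc_def v_def fun_eq_iff algebra_simps)
      then show "norm (nrm (dif (h (r n)) v)) \<le> (1/M) * nrm ?a + (1/M) * nrm ?b"
        using nrm_lc_le[OF ab, of "- s / M" "s / M"] s1 Mpos nrm_nonneg[OF lc_closed[OF ab]] by simp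
    qed
    have "(\<lambda>n. (1/M) * nrm (lc 1 (T (h (r n))) (- (s * M)) (h (r n))) + (1/M) * nrm (dif (T (h (r n))) g))
       \<longlonglongrightarrow> (1/M) * 0 + (1/M) * 0" by (intro tendsto_intros Td0 g(2))
    then show "(\<lambda>n. (1/M) * nrm (lc 1 (T (h (r n))) (- (s * M)) (h (r n))) + (1/M) * nrm (dif (T (h (r n))) g))
       \<longlonglongrightarrow> 0" by simp
  qed
  have "nrm v = 1"
  proof -
    have "\<bar>1 - nrm v\<bar> \<le> nrm (dif (h (r n)) v)" for n
      using nrm_le_dif[OF hH[of "r n"] v] nrmU[OF hU[of "r n"]] by simp
    then have "\<bar>1 - nrm v\<bar> \<le> 0" using conv by (intro LIMSEQ_le_const[of _ 0]) auto
    then show ?thesis by simp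
  qed
  then have v1: "ip v v = 1" using nrm_sq[OF v] by simp
  have "B v w = s * M * ip v w" if w: "w \<in> H" for w
  proof -
    have "\<bar>B v w - ip g w\<bar> \<le> K * nrm (dif (h (r n)) v) * nrm w + nrm (dif (T (h (r n))) g) * nrm w" for n
    proof -
      have "\<bar>B (dif (h (r n)) v) w\<bar> \<le> K * nrm (dif (h (r n)) v) * nrm w"
        "\<bar>ip (dif (T (h (r n))) g) w\<bar> \<le> nrm (dif (T (h (r n))) g) * nrm w"
        using hH v w T(1) g by (auto intro!: B_bd ip_cs lc_closed)
      moreover have "B (dif (h (r n)) v) w = B (h (r n)) w - B v w"
        "ip (dif (T (h (r n))) g) w = B (h (r n)) w - ip g w"
        using hH v w T g by (simp_all add: B_lc ip_lc)
      ultimately show ?thesis by linarith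
    qed
    moreover have "(\<lambda>n. K * nrm (dif (h (r n)) v) * nrm w + nrm (dif (T (h (r n))) g) * nrm w)
        \<longlonglongrightarrow> K * 0 * nrm w + 0 * nrm w" by (intro tendsto_intros conv g(2))
    ultimately have "\<bar>B v w - ip g w\<bar> \<le> 0" by (intro LIMSEQ_le_const[of _ 0]) auto
    moreover have "ip v w = s / M * ip g w" unfolding v_def using g w by (simp add: ip_lc)
    moreover from this have "s * M * ip v w = (s * s) * ip g w" using Mpos by simp
    ultimately show ?thesis using s1(2) by simp
  qed
  moreover have "\<bar>s * M\<bar> = M" using s1 Mpos by (simp add: abs_mult)
  ultimately show ?thesis using that[of v "s * M"] v v1 B_le Mpos s1 by auto
qed

end

subsection \<open>Square integrable functions\<close>

lemma L2_measurable: "f \<in> L2 \<Omega> \<Longrightarrow> f \<in> borel_measurable (lebesgue_on \<Omega>)"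
  by (simp add: L2_def)

lemma L2_sq_integrable: "f \<in> L2 \<Omega> \<Longrightarrow> integrable (lebesgue_on \<Omega>) (\<lambda>x. (norm (f x))\<^sup>2)"
  by (simp add: L2_def)

lemma integrable_inner_of_L2:
  assumes "f \<in> L2 \<Omega>" "g \<in> L2 \<Omega>"
  shows "integrable (lebesgue_on \<Omega>) (\<lambda>x. f x \<bullet> g x)"
proof (rule Bochner_Integration.integrable_bound)
  show "integrable (lebesgue_on \<Omega>) (\<lambda>x. (norm (f x))\<^sup>2 + (norm (g x))\<^sup>2)"
    using assms by (simp add: L2_sq_integrable)
  show "(\<lambda>x. f x \<bullet> g x) \<in> borel_measurable (lebesgue_on \<Omega>)"
    using assms by (intro borel_measurable_inner L2_measurable)
  show "AE x in lebesgue_on \<Omega>. norm (f x \<bullet> g x) \<le> norm ((norm (f x))\<^sup>2 + (norm (g x))\<^sup>2)"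
  proof (rule AE_I2)
    fix x
    have "\<bar>f x \<bullet> g x\<bar> \<le> norm (f x) * norm (g x)" by (rule Cauchy_Schwarz_ineq2)
    also have "\<dots> \<le> (norm (f x))\<^sup>2 + (norm (g x))\<^sup>2"
      using sum_squares_bound[of "norm (f x)" "norm (g x)"] mult_nonneg_nonneg[OF norm_ge_zero norm_ge_zero, of "f x" "g x"]
      by linarith
    finally show "norm (f x \<bullet> g x) \<le> norm ((norm (f x))\<^sup>2 + (norm (g x))\<^sup>2)" by simp
  qed
qed

lemma L2I_dominated:
  assumes "f \<in> borel_measurable (lebesgue_on \<Omega>)" "g \<in> L2 \<Omega>"
    and "AE x in lebesgue_on \<Omega>. norm (f x) \<le> norm (g x)"
  shows "f \<in> L2 \<Omega>"
  unfolding L2_def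
proof (safe intro!: assms(1))
  show "integrable (lebesgue_on \<Omega>) (\<lambda>x. (norm (f x))\<^sup>2)"
    by (rule Bochner_Integration.integrable_bound[OF L2_sq_integrable[OF assms(2)]])
      (use assms in \<open>auto elim!: eventually_mono intro: power_mono\<close>)
qed

lemma L2_lc:
  assumes "f \<in> L2 \<Omega>" "g \<in> L2 \<Omega>"
  shows "lc a f b g \<in> L2 \<Omega>"
proof -
  have m: "lc a f b g \<in> borel_measurable (lebesgue_on \<Omega>)"
    unfolding lc_def using assms by (intro borel_measurable_add borel_measurable_scaleR borel_measurable_const L2_measurable)
  have "integrable (lebesgue_on \<Omega>) (\<lambda>x. a\<^sup>2 * (norm (f x))\<^sup>2 + 2 * a * b * (f x \<bullet> g x) + b\<^sup>2 * (norm (g x))\<^sup>2)"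
    using assms by (intro Bochner_Integration.integrable_add integrable_mult_right L2_sq_integrable integrable_inner_of_L2)
  moreover have "(\<lambda>x. a\<^sup>2 * (norm (f x))\<^sup>2 + 2 * a * b * (f x \<bullet> g x) + b\<^sup>2 * (norm (g x))\<^sup>2) = (\<lambda>x. (norm (lc a f b g x))\<^sup>2)"
    unfolding lc_def power2_norm_eq_inner
    by (auto simp: fun_eq_iff inner_add inner_commute power2_eq_square algebra_simps)
  ultimately show ?thesis using m by (simp add: L2_def)
qed

lemma L2_zero: "(\<lambda>x. 0) \<in> L2 \<Omega>"
  by (simp add: L2_def)

lemma l2_inner_commute: "l2_inner \<Omega> f g = l2_inner \<Omega> g f"
  by (simp add: l2_inner_def inner_commute)

lemma l2_inner_lc:
  assumes "f \<in> L2 \<Omega>" "g \<in> L2 \<Omega>" "k \<in> L2 \<Omega>"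
  shows "l2_inner \<Omega> (lc a f b g) k = a * l2_inner \<Omega> f k + b * l2_inner \<Omega> g k"
  unfolding l2_inner_def lc_def inner_add_left inner_scaleR_left
  using integrable_inner_of_L2[OF assms(1,3)] integrable_inner_of_L2[OF assms(2,3)] by simp

interpretation L2: sip "L2 \<Omega>" "l2_inner \<Omega>"
  by unfold_locales (rule L2_lc L2_zero l2_inner_lc l2_inner_commute | assumption | simp add: l2_inner_def)+

lemma l2_norm_nrm: "l2_norm \<Omega> = L2.nrm \<Omega>"
  by (auto simp: fun_eq_iff l2_norm_def L2.nrm_def)

lemma l2_norm_sq: "(l2_norm \<Omega> f)\<^sup>2 = l2_inner \<Omega> f f"
  by (simp add: l2_norm_def l2_inner_def)

lemma l2_norm_nonneg [simp]: "l2_norm \<Omega> f \<ge> 0"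
  by (simp add: l2_norm_def l2_inner_def)

lemmas l2_cs = L2.ip_cs[folded l2_norm_nrm]
lemmas l2_norm_lc_le = L2.nrm_lc_le[folded l2_norm_nrm]

lemma l2_norm_sq_int: "(l2_norm \<Omega> f)\<^sup>2 = (LINT x|lebesgue_on \<Omega>. (norm (f x))\<^sup>2)"
  by (simp add: l2_norm_sq l2_inner_def power2_norm_eq_inner)

lemma l2_inner_cong_AE:
  assumes "AE x in lebesgue_on \<Omega>. f x = f' x" "AE x in lebesgue_on \<Omega>. g x = g' x"
    and "f \<in> L2 \<Omega>" "f' \<in> L2 \<Omega>" "g \<in> L2 \<Omega>" "g' \<in> L2 \<Omega>"
  shows "l2_inner \<Omega> f g = l2_inner \<Omega> f' g'"
  unfolding l2_inner_def
  by (rule integral_cong_AE) (use assms in \<open>auto intro!: borel_measurable_inner dest: L2_measurable\<close>)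

lemma l2_norm_cong_AE:
  assumes "AE x in lebesgue_on \<Omega>. f x = f' x" "f \<in> L2 \<Omega>" "f' \<in> L2 \<Omega>"
  shows "l2_norm \<Omega> f = l2_norm \<Omega> f'"
  unfolding l2_norm_def using l2_inner_cong_AE[OF assms(1,1)] assms by simp

lemma l2_norm_eq_0_iff:
  assumes "f \<in> L2 \<Omega>"
  shows "l2_norm \<Omega> f = 0 \<longleftrightarrow> (AE x in lebesgue_on \<Omega>. f x = 0)"
proof -
  have "l2_norm \<Omega> f = 0 \<longleftrightarrow> (l2_norm \<Omega> f)\<^sup>2 = 0" by simp
  also have "\<dots> \<longleftrightarrow> (AE x in lebesgue_on \<Omega>. (norm (f x))\<^sup>2 = 0)"
    unfolding l2_norm_sq_int by (rule integral_nonneg_eq_0_iff_AE) (auto intro: L2_sq_integrable assms)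
  finally show ?thesis by simp
qed

lemma L2_mult_bounded:
  fixes f :: "'a::euclidean_space \<Rightarrow> 'b::euclidean_space"
  assumes "f \<in> L2 \<Omega>" "c \<in> borel_measurable (lebesgue_on \<Omega>)" "AE x in lebesgue_on \<Omega>. \<bar>c x\<bar> \<le> K"
  shows "(\<lambda>x. c x *\<^sub>R f x) \<in> L2 \<Omega>" "l2_norm \<Omega> (\<lambda>x. c x *\<^sub>R f x) \<le> \<bar>K\<bar> * l2_norm \<Omega> f"
proof -
  let ?k = "lc K f 0 f"
  have k: "?k \<in> L2 \<Omega>" by (intro L2_lc assms)
  have le: "AE x in lebesgue_on \<Omega>. norm (c x *\<^sub>R f x) \<le> norm (?k x)"
    using assms(3) by eventually_elim (auto simp: lc_def intro!: mult_right_mono)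
  show 1: "(\<lambda>x. c x *\<^sub>R f x) \<in> L2 \<Omega>"
    by (rule L2I_dominated[OF _ k le]) (intro borel_measurable_scaleR assms L2_measurable)
  have "(l2_norm \<Omega> (\<lambda>x. c x *\<^sub>R f x))\<^sup>2 \<le> (l2_norm \<Omega> ?k)\<^sup>2"
    unfolding l2_norm_sq_int
    by (rule integral_mono_AE[OF L2_sq_integrable[OF 1] L2_sq_integrable[OF k]])
      (use le in \<open>auto elim!: eventually_mono intro: power_mono\<close>)
  then have "l2_norm \<Omega> (\<lambda>x. c x *\<^sub>R f x) \<le> l2_norm \<Omega> ?k" by (rule power2_le_imp_le) simp
  also have "\<dots> \<le> \<bar>K\<bar> * l2_norm \<Omega> f" using l2_norm_lc_le[OF assms(1,1), of K 0] by simp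
  finally show "l2_norm \<Omega> (\<lambda>x. c x *\<^sub>R f x) \<le> \<bar>K\<bar> * l2_norm \<Omega> f" .
qed

lemma finite_measure_lebesgue_on_bounded:
  fixes \<Omega> :: "'a::euclidean_space set"
  assumes "bounded \<Omega>" "\<Omega> \<in> sets lebesgue"
  shows "finite_measure (lebesgue_on \<Omega>)"
proof
  have "emeasure lebesgue \<Omega> \<noteq> \<infinity>"
    using fmeasurableD2[OF bounded_set_imp_lmeasurable[OF assms]] unfolding infinity_ennreal_def .
  then show "emeasure (lebesgue_on \<Omega>) (space (lebesgue_on \<Omega>)) \<noteq> \<infinity>"
    using assms by (simp add: emeasure_restrict_space)
qed

text \<open>Cauchy-Schwarz against the constant 1, which is square integrable because a bounded set
  has finite measure. It makes almost everywhere convergent subsequences available through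
  L1.\<close>

lemma L1_le_L2:
  fixes \<Omega> :: "'a::euclidean_space set" and f :: "'a \<Rightarrow> 'b::euclidean_space"
  assumes "bounded \<Omega>" "\<Omega> \<in> sets lebesgue" "f \<in> L2 \<Omega>"
  shows "integrable (lebesgue_on \<Omega>) f"
    "(LINT x|lebesgue_on \<Omega>. norm (f x)) \<le> l2_norm \<Omega> (\<lambda>x. 1 :: real) * l2_norm \<Omega> f"
    "(\<lambda>x. 1 :: real) \<in> L2 \<Omega>"
proof -
  interpret finite_measure "lebesgue_on \<Omega>" by (rule finite_measure_lebesgue_on_bounded) fact+
  show one: "(\<lambda>x. 1 :: real) \<in> L2 \<Omega>" by (simp add: L2_def)
  have n: "(\<lambda>x. norm (f x)) \<in> L2 \<Omega>"
    using assms(3) by (auto simp: L2_def intro: measurable_compose[OF _ borel_measurable_norm])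
  have "integrable (lebesgue_on \<Omega>) (\<lambda>x. (1::real) \<bullet> norm (f x))"
    by (rule integrable_inner_of_L2[OF one n])
  then have "integrable (lebesgue_on \<Omega>) (\<lambda>x. norm (f x))" by simp
  then show "integrable (lebesgue_on \<Omega>) f"
    using assms(3) by (simp add: integrable_norm_iff L2_measurable)
  have "\<bar>l2_inner \<Omega> (\<lambda>x. 1 :: real) (\<lambda>x. norm (f x))\<bar> \<le> l2_norm \<Omega> (\<lambda>x. 1 :: real) * l2_norm \<Omega> (\<lambda>x. norm (f x))"
    by (rule l2_cs[OF one n])
  moreover have "l2_norm \<Omega> (\<lambda>x. norm (f x)) = l2_norm \<Omega> f"
    by (simp add: l2_norm_def l2_inner_def power2_norm_eq_inner[symmetric] power2_eq_square)
  ultimately show "(LINT x|lebesgue_on \<Omega>. norm (f x)) \<le> l2_norm \<Omega> (\<lambda>x. 1 :: real) * l2_norm \<Omega> f"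
    by (simp add: l2_inner_def)
qed

text \<open>An L2-Cauchy sequence is L1-Cauchy here, so a subsequence converges almost everywhere;
  Fatou's lemma, applied to the differences with a fixed member of the sequence, shows that the
  pointwise limit is also the L2 limit of the whole sequence.\<close>

lemma L2_complete:
  fixes \<Omega> :: "'a::euclidean_space set" and h :: "nat \<Rightarrow> 'a \<Rightarrow> 'b::euclidean_space"
  assumes \<Omega>: "bounded \<Omega>" "\<Omega> \<in> sets lebesgue" and h: "\<And>n. h n \<in> L2 \<Omega>"
    and cauchy: "\<And>e. e > 0 \<Longrightarrow> \<exists>N. \<forall>m\<ge>N. \<forall>n\<ge>N. l2_norm \<Omega> (\<lambda>x. h m x - h n x) < e"
  obtains l r where "l \<in> L2 \<Omega>" "(\<lambda>n. l2_norm \<Omega> (\<lambda>x. h n x - l x)) \<longlonglongrightarrow> 0"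
    "strict_mono (r :: nat \<Rightarrow> nat)" "AE x in lebesgue_on \<Omega>. (\<lambda>n. h (r n) x) \<longlonglongrightarrow> l x"
proof -
  let ?M = "lebesgue_on \<Omega>"
  have dL: "(\<lambda>x. f x - g x) \<in> L2 \<Omega>" if "f \<in> L2 \<Omega>" "g \<in> L2 \<Omega>" for f g :: "'a \<Rightarrow> 'b"
    using L2_lc[OF that, of 1 "-1"] by (simp add: lc_def)
  let ?c = "l2_norm \<Omega> (\<lambda>x. 1 :: real)"
  have "\<exists>N. \<forall>i\<ge>N. \<forall>j\<ge>N. (LINT x|?M. norm (h i x - h j x)) < e" if "e > 0" for e
  proof -
    have "e / (?c + 1) > 0" using that by (simp add: add_nonneg_pos)
    from cauchy[OF this] obtain N where N: "\<forall>m\<ge>N. \<forall>n\<ge>N. l2_norm \<Omega> (\<lambda>x. h m x - h n x) < e / (?c + 1)" by blast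
    have "(LINT x|?M. norm (h i x - h j x)) < e" if "i \<ge> N" "j \<ge> N" for i j
    proof -
      have "(LINT x|?M. norm (h i x - h j x)) \<le> ?c * l2_norm \<Omega> (\<lambda>x. h i x - h j x)"
        by (rule L1_le_L2[OF \<Omega> dL[OF h h]])
      also have "\<dots> \<le> ?c * (e / (?c + 1))" using N that by (intro mult_left_mono) (auto intro: less_imp_le)
      also have "\<dots> < e" 
      proof -
        have "?c * e < e * (?c + 1)" using \<open>e > 0\<close> by (simp add: algebra_simps)
        then show ?thesis by (simp add: add_nonneg_pos pos_divide_less_eq)
      qed
      finally show ?thesis .
    qed
    then show ?thesis by blast
  qed
  then obtain r where r: "strict_mono (r :: nat \<Rightarrow> nat)" "AE x in ?M. Cauchy (\<lambda>i. h (r i) x)"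
    using cauchy_L1_AE_cauchy_subseq[of ?M h] L1_le_L2(1)[OF \<Omega> h] by blast
  define l where "l x = (if x \<in> \<Omega> then lim (\<lambda>i. h (r i) x) else 0)" for x
  have hm: "h n \<in> borel_measurable ?M" for n using h L2_measurable by blast
  have lm: "l \<in> borel_measurable ?M"
  proof -
    have "(\<lambda>x. lim (\<lambda>i. h (r i) x)) \<in> borel_measurable ?M"
      by (rule borel_measurable_lim_metric) (rule hm)
    then show ?thesis by (rule measurable_cong[THEN iffD1, rotated]) (simp add: l_def)
  qed
  have lim: "AE x in ?M. (\<lambda>n. h (r n) x) \<longlonglongrightarrow> l x"
    using r(2) AE_space by eventually_elim (auto simp: l_def Cauchy_convergent_iff convergent_LIMSEQ_iff)
  have bound: "integrable ?M (\<lambda>x. (norm (h m x - l x))\<^sup>2) \<and> (LINT x|?M. (norm (h m x - l x))\<^sup>2) \<le> e\<^sup>2"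
    if e: "e > 0" and N: "\<forall>n\<ge>N. l2_norm \<Omega> (\<lambda>x. h m x - h n x) < e" for m N e
  proof -
    have "(\<integral>\<^sup>+x. ennreal ((norm (h m x - l x))\<^sup>2) \<partial>?M) =
        (\<integral>\<^sup>+x. liminf (\<lambda>n. ennreal ((norm (h m x - h (r n) x))\<^sup>2)) \<partial>?M)"
    proof (rule nn_integral_cong_AE)
      show "AE x in ?M. ennreal ((norm (h m x - l x))\<^sup>2) = liminf (\<lambda>n. ennreal ((norm (h m x - h (r n) x))\<^sup>2))"
        using lim
      proof eventually_elim
        case (elim x)
        have "(\<lambda>n. ennreal ((norm (h m x - h (r n) x))\<^sup>2)) \<longlonglongrightarrow> ennreal ((norm (h m x - l x))\<^sup>2)"
          by (intro tendsto_ennrealI tendsto_intros elim)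
        then show ?case by (rule lim_imp_Liminf[OF sequentially_bot, symmetric])
      qed
    qed
    also have "\<dots> \<le> liminf (\<lambda>n. \<integral>\<^sup>+x. ennreal ((norm (h m x - h (r n) x))\<^sup>2) \<partial>?M)"
      using hm by (intro nn_integral_liminf) auto
    also have "\<dots> \<le> ennreal (e\<^sup>2)"
    proof (rule order_trans[OF Liminf_le_Limsup])
      show "Limsup sequentially (\<lambda>n. \<integral>\<^sup>+x. ennreal ((norm (h m x - h (r n) x))\<^sup>2) \<partial>?M) \<le> ennreal (e\<^sup>2)"
      proof (rule Limsup_bounded)
        show "\<forall>\<^sub>F n in sequentially. (\<integral>\<^sup>+x. ennreal ((norm (h m x - h (r n) x))\<^sup>2) \<partial>?M) \<le> ennreal (e\<^sup>2)"
          using eventually_ge_at_top[of N]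
        proof eventually_elim
          case (elim n)
          then have "r n \<ge> N" using seq_suble[OF r(1), of n] by simp
          then have "l2_norm \<Omega> (\<lambda>x. h m x - h (r n) x) < e" using N by blast
          then have "(l2_norm \<Omega> (\<lambda>x. h m x - h (r n) x))\<^sup>2 \<le> e\<^sup>2" by (intro power_mono) auto
          moreover have "(\<integral>\<^sup>+x. ennreal ((norm (h m x - h (r n) x))\<^sup>2) \<partial>?M)
            = ennreal ((l2_norm \<Omega> (\<lambda>x. h m x - h (r n) x))\<^sup>2)"
            unfolding l2_norm_sq_int by (rule nn_integral_eq_integral) (auto intro!: L2_sq_integrable dL h)
          ultimately show ?case by (simp add: ennreal_leI)
        qed
      qed
    qed simp
    finally have le: "(\<integral>\<^sup>+x. ennreal ((norm (h m x - l x))\<^sup>2) \<partial>?M) \<le> ennreal (e\<^sup>2)" .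
    have i: "integrable ?M (\<lambda>x. (norm (h m x - l x))\<^sup>2)"
    proof (rule integrableI_bounded)
      show "(\<lambda>x. (norm (h m x - l x))\<^sup>2) \<in> borel_measurable ?M" using hm lm by simp
      show "(\<integral>\<^sup>+x. ennreal (norm ((norm (h m x - l x))\<^sup>2)) \<partial>?M) < \<infinity>"
        using le by (simp add: order_le_less_trans)
    qed
    then have "ennreal (LINT x|?M. (norm (h m x - l x))\<^sup>2) \<le> ennreal (e\<^sup>2)"
      using le by (subst nn_integral_eq_integral[symmetric]) auto
    then show ?thesis using i e by simp
  qed
  have dl: "(\<lambda>x. h m x - l x) \<in> L2 \<Omega> \<and> l2_norm \<Omega> (\<lambda>x. h m x - l x) \<le> e"
    if e: "e > 0" and N: "\<forall>n\<ge>N. l2_norm \<Omega> (\<lambda>x. h m x - h n x) < e" for m N e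
  proof
    note b = bound[OF that]
    show "(\<lambda>x. h m x - l x) \<in> L2 \<Omega>" using b hm lm by (simp add: L2_def)
    have "(l2_norm \<Omega> (\<lambda>x. h m x - l x))\<^sup>2 \<le> e\<^sup>2" using b by (simp add: l2_norm_sq_int)
    then show "l2_norm \<Omega> (\<lambda>x. h m x - l x) \<le> e" by (rule power2_le_imp_le) (use e in simp)
  qed
  obtain N1 where "\<forall>m\<ge>N1. \<forall>n\<ge>N1. l2_norm \<Omega> (\<lambda>x. h m x - h n x) < 1" using cauchy[OF zero_less_one] by blast
  then have "(\<lambda>x. h N1 x - l x) \<in> L2 \<Omega>" using dl[of 1 N1 N1] by auto
  from dL[OF h this, of N1] have lL: "l \<in> L2 \<Omega>" by simp
  have "(\<lambda>n. l2_norm \<Omega> (\<lambda>x. h n x - l x)) \<longlonglongrightarrow> 0"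
  proof (rule LIMSEQ_I)
    fix e :: real assume e: "e > 0"
    then obtain N where N: "\<forall>m\<ge>N. \<forall>n\<ge>N. l2_norm \<Omega> (\<lambda>x. h m x - h n x) < e/2" using cauchy[of "e/2"] by auto
    have "norm (l2_norm \<Omega> (\<lambda>x. h n x - l x) - 0) < e" if "n \<ge> N" for n
    proof -
      have "l2_norm \<Omega> (\<lambda>x. h n x - l x) \<le> e/2" using dl[of "e/2" N n] N that e by auto
      then show ?thesis using e by simp
    qed
    then show "\<exists>no. \<forall>n\<ge>no. norm (l2_norm \<Omega> (\<lambda>x. h n x - l x) - 0) < e" by blast
  qed
  then show ?thesis using that lL r(1) lim by blast
qed

text \<open>An \<open>L2\<close>-convergent sequence converges almost everywhere along a subsequence.\<close>

lemma L2_tendsto_AE_subseq: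
  fixes \<Omega> :: "'a::euclidean_space set" and h :: "nat \<Rightarrow> 'a \<Rightarrow> 'b::euclidean_space"
  assumes \<Omega>: "bounded \<Omega>" "\<Omega> \<in> sets lebesgue" and h: "\<And>n. h n \<in> L2 \<Omega>" and l: "l \<in> L2 \<Omega>"
    and lim: "(\<lambda>n. l2_norm \<Omega> (\<lambda>x. h n x - l x)) \<longlonglongrightarrow> 0"
  obtains r where "strict_mono (r :: nat \<Rightarrow> nat)" "AE x in lebesgue_on \<Omega>. (\<lambda>n. h (r n) x) \<longlonglongrightarrow> l x"
proof -
  have d: "(\<lambda>x. h n x - l x) \<in> L2 \<Omega>" for n
    using L2_lc[OF h l, of 1 n "-1"] by (simp add: lc_def)
  have "(\<lambda>n. LINT x|lebesgue_on \<Omega>. norm (h n x - l x)) \<longlonglongrightarrow> 0"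
  proof (rule Lim_null_comparison)
    show "\<forall>\<^sub>F n in sequentially. norm (LINT x|lebesgue_on \<Omega>. norm (h n x - l x))
       \<le> l2_norm \<Omega> (\<lambda>x. 1 :: real) * l2_norm \<Omega> (\<lambda>x. h n x - l x)"
      using L1_le_L2(2)[OF \<Omega> d] by (intro always_eventually allI) simp
    show "(\<lambda>n. l2_norm \<Omega> (\<lambda>x. 1 :: real) * l2_norm \<Omega> (\<lambda>x. h n x - l x)) \<longlonglongrightarrow> 0"
      using tendsto_mult_right_zero[OF lim] by simp
  qed
  then obtain r where r: "strict_mono (r :: nat \<Rightarrow> nat)" "AE x in lebesgue_on \<Omega>. (\<lambda>n. h (r n) x - l x) \<longlonglongrightarrow> 0"
    using tendsto_L1_AE_subseq[of "lebesgue_on \<Omega>" "\<lambda>n x. h n x - l x"] L1_le_L2(1)[OF \<Omega> d] by blast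
  from r(2) have "AE x in lebesgue_on \<Omega>. (\<lambda>n. h (r n) x) \<longlonglongrightarrow> l x"
    by eventually_elim (simp add: LIM_zero_iff)
  then show ?thesis using r(1) that by blast
qed

subsection \<open>Smooth functions\<close>

lemma partial_eqI: "(f has_derivative D) (at x) \<Longrightarrow> partial b f x = D b"
  unfolding partial_def by (drule frechet_derivative_at) simp

lemma Ck_SucI:
  assumes "\<And>x. (f has_derivative (D x)) (at x)" "\<And>b. b \<in> Basis \<Longrightarrow> Ck k (\<lambda>x. D x b)"
  shows "Ck (Suc k) f"
proof -
  have "partial b f = (\<lambda>x. D x b)" for b using partial_eqI[OF assms(1)] by auto
  then show ?thesis using assms by (auto simp: differentiable_def)
qed

lemma Ck_Suc_has_derivative:
  "Ck (Suc k) f \<Longrightarrow> (f has_derivative frechet_derivative f (at x)) (at x)"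
  by (simp add: frechet_derivative_works[symmetric])

lemma Ck_Suc_partial: "Ck (Suc k) f \<Longrightarrow> b \<in> Basis \<Longrightarrow> Ck k (\<lambda>x. frechet_derivative f (at x) b)"
  by (simp add: partial_def[abs_def])

lemma Ck_SucD: "Ck (Suc k) f \<Longrightarrow> Ck k f"
proof (induction k arbitrary: f)
  case 0
  then have "isCont f x" for x by (simp add: differentiable_imp_continuous_within)
  then show ?case by (simp add: continuous_at_imp_continuous_on)
next
  case (Suc k)
  then show ?case by (simp del: Ck.simps(1))
qed

lemma Ck_continuous: "Ck k f \<Longrightarrow> continuous_on S f"
proof (induction k)
  case (Suc k)
  show ?case by (rule Suc.IH[OF Ck_SucD[OF Suc.prems]])
qed (use continuous_on_subset[OF _ subset_UNIV] in simp)

lemma Ck_const [simp]: "Ck k (\<lambda>x. c)"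
proof (induction k arbitrary: c)
  case (Suc k)
  show ?case by (rule Ck_SucI[where D = "\<lambda>_ _. 0"]) (auto intro: Suc)
qed simp

lemma Ck_add: "Ck k f \<Longrightarrow> Ck k g \<Longrightarrow> Ck k (\<lambda>x. f x + g x)"
proof (induction k arbitrary: f g)
  case (Suc k)
  show ?case
  proof (rule Ck_SucI)
    show "((\<lambda>x. f x + g x) has_derivative (\<lambda>h. frechet_derivative f (at x) h + frechet_derivative g (at x) h)) (at x)" for x
      by (rule has_derivative_add[OF Suc.prems[THEN Ck_Suc_has_derivative]])
    show "Ck k (\<lambda>x. frechet_derivative f (at x) b + frechet_derivative g (at x) b)" if "b \<in> Basis" for b
      by (rule Suc.IH[OF Ck_Suc_partial[OF Suc.prems(1) that] Ck_Suc_partial[OF Suc.prems(2) that]])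
  qed
qed (simp add: continuous_on_add)

lemma Ck_mult: "Ck k f \<Longrightarrow> Ck k g \<Longrightarrow> Ck k (\<lambda>x. f x * g x)"
proof (induction k arbitrary: f g)
  case (Suc k)
  show ?case
  proof (rule Ck_SucI)
    show "((\<lambda>x. f x * g x) has_derivative (\<lambda>h. f x * frechet_derivative g (at x) h + frechet_derivative f (at x) h * g x)) (at x)" for x
      by (rule has_derivative_mult[OF Suc.prems[THEN Ck_Suc_has_derivative]])
    show "Ck k (\<lambda>x. f x * frechet_derivative g (at x) b + frechet_derivative f (at x) b * g x)" if "b \<in> Basis" for b
      by (rule Ck_add[OF Suc.IH[OF Ck_SucD[OF Suc.prems(1)] Ck_Suc_partial[OF Suc.prems(2) that]]
        Suc.IH[OF Ck_Suc_partial[OF Suc.prems(1) that] Ck_SucD[OF Suc.prems(2)]]])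
  qed
qed (simp add: continuous_on_mult)

lemma Ck_compose:
  fixes F :: "real \<Rightarrow> real"
  shows "Ck k F \<Longrightarrow> Ck k f \<Longrightarrow> Ck k (\<lambda>x. F (f x))"
proof (induction k arbitrary: F f)
  case 0
  then show ?case using continuous_on_compose2[of UNIV F UNIV f] by simp
next
  case (Suc k)
  let ?F' = "\<lambda>t. frechet_derivative F (at t) 1"
  have lin: "frechet_derivative F (at t) h = h * ?F' t" for t h
    using linear_frechet_derivative[of F "at t"] Suc.prems(1) linear_scale[of "frechet_derivative F (at t)" h 1]
    by simp
  show ?case
  proof (rule Ck_SucI)
    show "((\<lambda>x. F (f x)) has_derivative (\<lambda>h. frechet_derivative f (at x) h * ?F' (f x))) (at x)" for x
      using has_derivative_compose[OF Ck_Suc_has_derivative[OF Suc.prems(2)] Ck_Suc_has_derivative[OF Suc.prems(1)], of x]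
      by (simp add: lin[symmetric])
    show "Ck k (\<lambda>x. frechet_derivative f (at x) b * ?F' (f x))" if "b \<in> Basis" for b
    proof (rule Ck_mult[OF Ck_Suc_partial[OF Suc.prems(2) that]])
      have "Ck k ?F'" by (rule Ck_Suc_partial[OF Suc.prems(1)]) simp
      then show "Ck k (\<lambda>x. ?F' (f x))" by (rule Suc.IH[OF _ Ck_SucD[OF Suc.prems(2)]])
    qed
  qed
qed

lemma Ck_real_SucI:
  fixes F :: "real \<Rightarrow> real"
  assumes "\<And>t. (F has_real_derivative F' t) (at t)" "Ck k F'"
  shows "Ck (Suc k) F"
  by (rule Ck_SucI[OF assms(1)[unfolded has_field_derivative_def]]) (use assms(2) in auto)

lemma Ck_inner [simp]: "Ck k (\<lambda>x. x \<bullet> b)"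
proof (cases k)
  case (Suc j)
  show ?thesis unfolding Suc by (rule Ck_SucI[where D = "\<lambda>_ h. h \<bullet> b"]) (auto intro!: derivative_eq_intros)
qed (simp add: continuous_on_inner)

lemma Ck_prod: "(\<And>i. i \<in> I \<Longrightarrow> Ck k (f i)) \<Longrightarrow> Ck k (\<lambda>x. \<Prod>i\<in>I. f i x)"
  by (induction I rule: infinite_finite_induct) (auto intro: Ck_mult)

definition grad :: "('a::euclidean_space \<Rightarrow> real) \<Rightarrow> 'a \<Rightarrow> 'a" where
  "grad f x = (\<Sum>b\<in>Basis. partial b f x *\<^sub>R b)"

lemma grad_inner_Basis: "b \<in> Basis \<Longrightarrow> grad f x \<bullet> b = partial b f x"
  by (simp add: grad_def inner_sum_left inner_Basis if_distrib cong: if_cong)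

lemma has_derivative_grad:
  assumes "f differentiable at x"
  shows "(f has_derivative (\<lambda>h. grad f x \<bullet> h)) (at x)"
proof -
  have "frechet_derivative f (at x) h = grad f x \<bullet> h" for h
  proof -
    have l: "linear (frechet_derivative f (at x))" using assms by (rule linear_frechet_derivative)
    have "frechet_derivative f (at x) h = frechet_derivative f (at x) (\<Sum>b\<in>Basis. (h \<bullet> b) *\<^sub>R b)"
      by (simp add: euclidean_representation)
    also have "\<dots> = (\<Sum>b\<in>Basis. (h \<bullet> b) * partial b f x)"
      using l by (simp add: linear_sum linear_scale partial_def)
    also have "\<dots> = grad f x \<bullet> h"
      unfolding grad_def inner_sum_left by (rule sum.cong) (simp_all add: inner_commute mult.commute)
    finally show ?thesis .
  qed
  then have "frechet_derivative f (at x) = (\<lambda>h. grad f x \<bullet> h)" by blast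
  then show ?thesis using assms unfolding frechet_derivative_works by simp
qed

lemma grad_eqI:
  assumes "(f has_derivative (\<lambda>h. v \<bullet> h)) (at x)"
  shows "grad f x = v"
  using partial_eqI[OF assms] by (simp add: grad_def euclidean_representation)

lemma continuous_grad: "Ck 1 f \<Longrightarrow> continuous_on S (grad f)"
  unfolding grad_def[abs_def]
  by (intro continuous_intros Ck_continuous[of 0]) auto

subsection \<open>Test functions\<close>

lemma test_functionsI:
  assumes "\<And>k. Ck k f" "compact K" "K \<subseteq> \<Omega>" "\<And>x. x \<notin> K \<Longrightarrow> f x = 0"
  shows "f \<in> test_functions \<Omega>"
proof -
  have "closure {x. f x \<noteq> 0} \<subseteq> K"
    using assms by (intro closure_minimal) (auto simp: compact_imp_closed)
  moreover from this have "compact (closure {x. f x \<noteq> 0})"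
    using assms(2) compact_Int_closed[of K "closure {x. f x \<noteq> 0}"] by (simp add: Int_absorb1)
  ultimately show ?thesis using assms by (auto simp: test_functions_def)
qed

lemma test_functionsE:
  assumes "f \<in> test_functions \<Omega>"
  obtains K where "compact K" "K \<subseteq> \<Omega>" "\<And>x. x \<notin> K \<Longrightarrow> f x = 0"
    "\<And>x. x \<notin> K \<Longrightarrow> grad f x = 0" "\<And>b x. x \<notin> K \<Longrightarrow> b \<in> Basis \<Longrightarrow> partial b f x = 0"
proof -
  let ?K = "closure {x. f x \<noteq> 0}"
  have K: "compact ?K" "?K \<subseteq> \<Omega>" using assms by (auto simp: test_functions_def)
  have z: "f x = 0" if "x \<notin> ?K" for x using that closure_subset[of "{x. f x \<noteq> 0}"] by auto
  have g: "grad f x = 0" if "x \<notin> ?K" for x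
  proof (rule grad_eqI)
    have "(f has_derivative (\<lambda>h. 0)) (at x)"
    proof (rule has_derivative_transform_within_open[OF has_derivative_const open_Compl[OF closed_closure]])
      show "x \<in> - ?K" using that by (simp only: Compl_iff simp_thms)
      show "0 = f y" if "y \<in> - ?K" for y using z[of y] that by (simp only: Compl_iff simp_thms)
    qed
    then show "(f has_derivative (\<lambda>h. 0 \<bullet> h)) (at x)" by simp
  qed
  moreover have "partial b f x = 0" if "x \<notin> ?K" "b \<in> Basis" for x b
    using g[OF that(1)] grad_inner_Basis[OF that(2), of f x] by simp
  ultimately show ?thesis by (intro that[OF K z g]) auto
qed

lemma test_functions_Ck: "f \<in> test_functions \<Omega> \<Longrightarrow> Ck k f"
  by (simp add: test_functions_def)

lemma test_functions_differentiable: "f \<in> test_functions \<Omega> \<Longrightarrow> f differentiable at x"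
  by (metis test_functions_Ck Ck.simps(2))

lemma test_functions_add:
  assumes "f \<in> test_functions \<Omega>" "g \<in> test_functions \<Omega>"
  shows "(\<lambda>x. f x + g x) \<in> test_functions \<Omega>"
proof -
  obtain K L where "compact K" "K \<subseteq> \<Omega>" "\<And>x. x \<notin> K \<Longrightarrow> f x = 0" "compact L" "L \<subseteq> \<Omega>" "\<And>x. x \<notin> L \<Longrightarrow> g x = 0"
    using test_functionsE[OF assms(1)] test_functionsE[OF assms(2)] by metis
  then show ?thesis
    by (intro test_functionsI[OF Ck_add[OF test_functions_Ck[OF assms(1)] test_functions_Ck[OF assms(2)]], of "K \<union> L"]) auto
qed

lemma test_functions_mult:
  assumes "\<And>k. Ck k p" "g \<in> test_functions \<Omega>"
  shows "(\<lambda>x. p x * g x) \<in> test_functions \<Omega>"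
proof -
  obtain L where "compact L" "L \<subseteq> \<Omega>" "\<And>x. x \<notin> L \<Longrightarrow> g x = 0"
    using test_functionsE[OF assms(2)] by metis
  then show ?thesis
    by (intro test_functionsI[OF Ck_mult[OF assms(1) test_functions_Ck[OF assms(2)]], of L]) auto
qed

lemma test_functions_compose:
  fixes F :: "real \<Rightarrow> real"
  assumes "\<And>k. Ck k F" "F 0 = 0" "g \<in> test_functions \<Omega>"
  shows "(\<lambda>x. F (g x)) \<in> test_functions \<Omega>"
proof -
  obtain L where "compact L" "L \<subseteq> \<Omega>" "\<And>x. x \<notin> L \<Longrightarrow> g x = 0"
    using test_functionsE[OF assms(3)] by metis
  then show ?thesis
    by (intro test_functionsI[OF Ck_compose[OF assms(1) test_functions_Ck[OF assms(3)]], of L]) (auto simp: assms(2))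
qed

lemma test_functions_zero: "(\<lambda>x. 0) \<in> test_functions \<Omega>"
  by (rule test_functionsI[of _ "{}"]) auto

lemma test_functions_lc:
  assumes "f \<in> test_functions \<Omega>" "g \<in> test_functions \<Omega>"
  shows "lc a f b g \<in> test_functions \<Omega>"
  unfolding lc_def real_scaleR_def
  by (rule test_functions_add[OF test_functions_mult[OF _ assms(1)] test_functions_mult[OF _ assms(2)]]) simp_all

lemma test_functions_partial:
  assumes "f \<in> test_functions \<Omega>" "b \<in> Basis"
  shows "partial b f \<in> test_functions \<Omega>"
proof -
  obtain K where K: "compact K" "K \<subseteq> \<Omega>" "\<And>x. x \<notin> K \<Longrightarrow> partial b f x = 0"
    using test_functionsE[OF assms(1)] assms(2) by metis
  have "Ck k (partial b f)" for k using test_functions_Ck[OF assms(1), of "Suc k"] assms(2) by simp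
  then show ?thesis using K by (intro test_functionsI) auto
qed

lemma integrable_compact_support:
  fixes f :: "'a::euclidean_space \<Rightarrow> 'b::euclidean_space"
  assumes "continuous_on UNIV f" "compact K" "\<And>x. x \<notin> K \<Longrightarrow> f x = 0"
  shows "integrable lborel f"
proof -
  have "integrable lborel (\<lambda>x. indicator K x *\<^sub>R f x)"
    by (intro borel_integrable_compact assms(2) continuous_on_subset[OF assms(1) subset_UNIV])
  moreover have "(\<lambda>x. indicator K x *\<^sub>R f x) = f" using assms(3) by (auto simp: fun_eq_iff indicator_def)
  ultimately show ?thesis by simp
qed

text \<open>The spaces use Lebesgue measure on \<open>\<Omega>\<close>, while translation and Fubini
  arguments use \<open>lborel\<close>; this connects the two for Borel functions that vanish outside
  \<open>\<Omega>\<close>.\<close>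

lemma lebesgue_on_eq_lborel:
  fixes f :: "'a::euclidean_space \<Rightarrow> 'b::euclidean_space"
  assumes "\<Omega> \<in> sets lebesgue" "f \<in> borel_measurable borel" "\<And>x. x \<notin> \<Omega> \<Longrightarrow> f x = 0"
  shows "(LINT x|lebesgue_on \<Omega>. f x) = (LINT x|lborel. f x)"
    "integrable (lebesgue_on \<Omega>) f \<longleftrightarrow> integrable lborel f"
    "f \<in> borel_measurable (lebesgue_on \<Omega>)"
proof -
  have e: "(\<lambda>x. indicator \<Omega> x *\<^sub>R f x) = f" using assms(3) by (auto simp: fun_eq_iff indicator_def)
  have m: "f \<in> borel_measurable lborel" using assms(2) by simp
  show "(LINT x|lebesgue_on \<Omega>. f x) = (LINT x|lborel. f x)"
    using assms(1) by (simp add: integral_restrict_space e integral_completion[OF m])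
  show "integrable (lebesgue_on \<Omega>) f \<longleftrightarrow> integrable lborel f"
    using assms(1) by (simp add: integrable_restrict_space e integrable_completion[OF m])
  have "f \<in> borel_measurable lebesgue" using m by (rule measurable_completion)
  then show "f \<in> borel_measurable (lebesgue_on \<Omega>)" by (rule measurable_restrict_space1)
qed

lemma translation_invariant_integral:
  fixes f :: "'a::euclidean_space \<Rightarrow> real"
  assumes "f \<in> borel_measurable borel"
  shows "(LINT x|lborel. f (h + x)) = (LINT x|lborel. f x)"
proof -
  have "(LINT x|lborel. f x) = (LINT x|distr lborel borel ((+) h). f x)" by (simp add: lborel_distr_plus)
  also have "\<dots> = (LINT x|lborel. f (h + x))" by (rule integral_distr) (use assms in auto)
  finally show ?thesis by simp
qed

text \<open>The difference quotients of \<open>f\<close> have integral zero and converge to the derivative boundedly.\<close>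

lemma integral_partial_eq_0:
  fixes f :: "'a::euclidean_space \<Rightarrow> real"
  assumes f: "f \<in> test_functions \<Omega>" and b: "b \<in> Basis"
  shows "(LINT x|lborel. partial b f x) = 0"
proof -
  obtain K where K: "compact K" "\<And>x. x \<notin> K \<Longrightarrow> f x = 0" "\<And>x. x \<notin> K \<Longrightarrow> partial b f x = 0"
    using test_functionsE[OF f] b by metis
  have C1: "Ck 1 f" using f by (rule test_functions_Ck)
  then have cont: "continuous_on S f" "continuous_on S (partial b f)" for S
    using b Ck_continuous[of 1 f] Ck_continuous[of 0 "partial b f"] by auto
  have intf: "integrable lborel f" by (rule integrable_compact_support[OF cont(1) K(1,2)])
  obtain B where B: "\<And>x. x \<in> K \<Longrightarrow> \<bar>partial b f x\<bar> \<le> B"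
    using compact_imp_bounded[OF compact_continuous_image[OF cont(2) K(1)]]
    unfolding bounded_iff by auto
  have B': "\<bar>partial b f x\<bar> \<le> \<bar>B\<bar>" for x using B[of x] K(3)[of x] by (cases "x \<in> K") auto
  obtain R where R: "R > 0" "\<And>x. x \<in> K \<Longrightarrow> norm x \<le> R"
    using compact_imp_bounded[OF K(1)] bounded_pos by blast
  define q where "q n x = (f (inverse (real (Suc n)) *\<^sub>R b + x) - f x) / inverse (real (Suc n))" for n x
  \<comment> \<open>The dominating function: the mean value theorem bounds the quotient by the
    supremum of the derivative, and shifts of length at most 1 keep the supports in the ball of
    radius \<open>R + 1\<close>.\<close>
  have q_le: "norm (q n x) \<le> \<bar>B\<bar> * indicator (cball 0 (R + 1)) x" for n x
  proof (cases "x \<in> cball 0 (R + 1)")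
    case True
    let ?t = "inverse (real (Suc n))"
    have "\<bar>f (x + ?t *\<^sub>R b) - f x\<bar> \<le> \<bar>B\<bar> * ?t"
    proof -
      have "\<exists>z. z > 0 \<and> z < ?t \<and> f (x + ?t *\<^sub>R b) - f (x + 0 *\<^sub>R b) = (?t - 0) * partial b f (x + z *\<^sub>R b)"
      proof (rule MVT2)
        fix s
        have "((\<lambda>s. f (x + s *\<^sub>R b)) has_derivative (\<lambda>h. grad f (x + s *\<^sub>R b) \<bullet> (h *\<^sub>R b))) (at s)"
          by (rule has_derivative_compose[OF _ has_derivative_grad[OF test_functions_differentiable[OF f]]])
            (auto intro!: derivative_eq_intros)
        then show "((\<lambda>s. f (x + s *\<^sub>R b)) has_real_derivative partial b f (x + s *\<^sub>R b)) (at s)"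
          using b by (simp add: has_field_derivative_def grad_inner_Basis mult.commute[of _ "partial b f _"])
      qed simp
      then obtain z where "f (x + ?t *\<^sub>R b) - f x = ?t * partial b f (x + z *\<^sub>R b)" by auto
      then show ?thesis using B'[of "x + z *\<^sub>R b"] by (simp add: abs_mult mult.commute mult_left_mono divide_right_mono)
    qed
    then have "\<bar>f (x + ?t *\<^sub>R b) - f x\<bar> / ?t \<le> \<bar>B\<bar>" by (subst pos_divide_le_eq) auto
    then show ?thesis using True by (simp add: q_def add.commute)
  next
    case False
    then have n: "norm x > R + 1" by simp
    have "norm (inverse (real (Suc n)) *\<^sub>R b) \<le> 1" using b by (simp add: divide_simps)
    then have "norm (inverse (real (Suc n)) *\<^sub>R b + x) > R"
      using norm_triangle_ineq4[of "inverse (real (Suc n)) *\<^sub>R b + x" "inverse (real (Suc n)) *\<^sub>R b"] n by simp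
    then have "inverse (real (Suc n)) *\<^sub>R b + x \<notin> K" "x \<notin> K" using R n by fastforce+
    then show ?thesis using K by (simp add: q_def)
  qed
  have q_lim: "(\<lambda>n. q n x) \<longlonglongrightarrow> partial b f x" for x
  proof -
    have "((\<lambda>s. f (x + s *\<^sub>R b)) has_derivative (\<lambda>h. grad f (x + 0 *\<^sub>R b) \<bullet> (h *\<^sub>R b))) (at 0)"
      by (rule has_derivative_compose[OF _ has_derivative_grad[OF test_functions_differentiable[OF f]]])
        (auto intro!: derivative_eq_intros)
    then have "((\<lambda>s. f (x + s *\<^sub>R b)) has_real_derivative partial b f x) (at 0)"
      using b by (simp add: has_field_derivative_def grad_inner_Basis mult.commute[of _ "partial b f _"])
    then have "((\<lambda>h. (f (x + h *\<^sub>R b) - f x) / h) \<longlongrightarrow> partial b f x) (at 0)"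
      by (simp add: DERIV_def)
    moreover have "filterlim (\<lambda>n. inverse (real (Suc n))) (at 0) sequentially"
      using LIMSEQ_inverse_real_of_nat by (simp add: filterlim_at)
    ultimately have "(\<lambda>n. (f (x + inverse (real (Suc n)) *\<^sub>R b) - f x) / inverse (real (Suc n))) \<longlonglongrightarrow> partial b f x"
      by (rule filterlim_compose)
    then show ?thesis by (simp add: q_def add.commute)
  qed
  have fm: "f \<in> borel_measurable borel" using cont(1) by (rule borel_measurable_continuous_onI)
  have "(\<lambda>n. LINT x|lborel. q n x) \<longlonglongrightarrow> (LINT x|lborel. partial b f x)"
  proof (rule integral_dominated_convergence)
    show "partial b f \<in> borel_measurable lborel" using cont(2) by (simp add: borel_measurable_continuous_onI)
    show "q n \<in> borel_measurable lborel" for n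
      unfolding q_def using fm by simp
    show "integrable lborel (\<lambda>x. \<bar>B\<bar> * indicator (cball 0 (R + 1)) x)"
      by (intro integrable_mult_right integrable_real_indicator)
        (auto simp: emeasure_lborel_cball_finite[unfolded infinity_ennreal_def])
  qed (use q_lim q_le in auto)
  moreover have "(LINT x|lborel. q n x) = 0" for n
  proof -
    have "integrable lborel (\<lambda>x. f (inverse (real (Suc n)) *\<^sub>R b + x))"
      using integrable_distr[of "(+) (inverse (real (Suc n)) *\<^sub>R b)" lborel borel f] intf by (simp add: lborel_distr_plus)
    then show ?thesis unfolding q_def
      using intf translation_invariant_integral[OF fm, of "inverse (real (Suc n)) *\<^sub>R b"] by simp
  qed
  ultimately have "(\<lambda>n. 0) \<longlonglongrightarrow> (LINT x|lborel. partial b f x)" by simp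
  then show ?thesis by (rule LIMSEQ_unique[OF _ tendsto_const])
qed

text \<open>Integration by parts: \<open>f * \<phi>\<close> is again a test function, so its partial
  derivative integrates to zero.\<close>

lemma weak_gradient_test:
  assumes \<Omega>: "\<Omega> \<in> sets lebesgue" and f: "f \<in> test_functions \<Omega>"
  shows "has_weak_gradient \<Omega> f (grad f)"
  unfolding has_weak_gradient_def
proof (intro ballI)
  fix \<phi> and b :: 'a assume \<phi>: "\<phi> \<in> test_functions \<Omega>" and b: "b \<in> Basis"
  have fp: "(\<lambda>x. f x * \<phi> x) \<in> test_functions \<Omega>" by (rule test_functions_mult[OF test_functions_Ck[OF f] \<phi>])
  have t: "(\<lambda>x. f x * partial b \<phi> x) \<in> test_functions \<Omega>" "(\<lambda>x. partial b f x * \<phi> x) \<in> test_functions \<Omega>"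
    by (rule test_functions_mult[OF test_functions_Ck[OF f] test_functions_partial[OF \<phi> b]])
      (rule test_functions_mult[OF test_functions_Ck[OF test_functions_partial[OF f b]] \<phi>])
  have int: "integrable lborel g" "(LINT x|lebesgue_on \<Omega>. g x) = (LINT x|lborel. g x)"
    if g: "g \<in> test_functions \<Omega>" for g
  proof -
    obtain K where K: "compact K" "K \<subseteq> \<Omega>" "\<And>x. x \<notin> K \<Longrightarrow> g x = 0" using test_functionsE[OF g] by metis
    have c: "continuous_on UNIV g" using test_functions_Ck[OF g, of 0] by simp
    show "integrable lborel g" by (rule integrable_compact_support[OF c K(1,3)])
    show "(LINT x|lebesgue_on \<Omega>. g x) = (LINT x|lborel. g x)"
      using K by (intro lebesgue_on_eq_lborel \<Omega> borel_measurable_continuous_onI c) auto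
  qed
  have "partial b (\<lambda>x. f x * \<phi> x) x = f x * partial b \<phi> x + partial b f x * \<phi> x" for x
    using b partial_eqI[OF has_derivative_mult[OF has_derivative_grad[OF test_functions_differentiable[OF f]]
      has_derivative_grad[OF test_functions_differentiable[OF \<phi>]]], of b x]
    by (simp add: grad_inner_Basis)
  then have "0 = (LINT x|lborel. f x * partial b \<phi> x + partial b f x * \<phi> x)"
    using integral_partial_eq_0[OF fp b] by simp
  also have "\<dots> = (LINT x|lborel. f x * partial b \<phi> x) + (LINT x|lborel. partial b f x * \<phi> x)"
    using int(1)[OF t(1)] int(1)[OF t(2)] by simp
  finally show "(LINT x|lebesgue_on \<Omega>. f x * partial b \<phi> x) = - (LINT x|lebesgue_on \<Omega>. (grad f x \<bullet> b) * \<phi> x)"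
    using int(2)[OF t(1)] int(2)[OF t(2)] b by (simp add: grad_inner_Basis)
qed

subsection \<open>Bump functions\<close>

text \<open>With a polynomial factor in \<open>1 / t\<close> the family is closed under
  differentiation: \<open>p\<close> is replaced by \<open>x^2 (p - p')\<close>. Smoothness of
  \<open>exp (- 1 / t)\<close>, extended by zero, then follows by induction for all \<open>p\<close>
  at once.\<close>

definition flat :: "real poly \<Rightarrow> real \<Rightarrow> real" where
  "flat p t = (if t > 0 then poly p (1 / t) * exp (- (1 / t)) else 0)"

lemma poly_div_exp_tendsto_0: "((\<lambda>x::real. x ^ k * poly p x / exp x) \<longlongrightarrow> 0) at_top"
proof (induction p arbitrary: k)
  case (pCons a p)
  have "((\<lambda>x::real. a * (x ^ k / exp x) + x ^ Suc k * poly p x / exp x) \<longlongrightarrow> a * 0 + 0) at_top"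
    by (intro tendsto_intros tendsto_power_div_exp_0 pCons.IH)
  then show ?case by (simp add: algebra_simps add_divide_distrib)
qed simp

lemma flat_has_derivative:
  "(flat p has_real_derivative flat ([:0, 0, 1:] * (p - pderiv p)) t) (at t)"
proof -
  consider "t > 0" | "t < 0" | "t = 0" by linarith
  then show ?thesis
  proof cases
    case 1
    have "((\<lambda>t. poly p (1 / t) * exp (- (1 / t))) has_real_derivative
        flat ([:0, 0, 1:] * (p - pderiv p)) t) (at t)"
      using 1 by (auto intro!: derivative_eq_intros simp: flat_def power2_eq_square field_simps)
    then show ?thesis
      by (rule has_field_derivative_transform_within_open[where S = "{0<..}"]) (use 1 in \<open>auto simp: flat_def\<close>)
  next
    case 2
    have "((\<lambda>t. 0) has_real_derivative flat ([:0, 0, 1:] * (p - pderiv p)) t) (at t)"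
      using 2 by (simp add: flat_def)
    then show ?thesis
      by (rule has_field_derivative_transform_within_open[where S = "{..<0}"]) (use 2 in \<open>auto simp: flat_def\<close>)
  next
    case 3
    have "((\<lambda>h. flat p h / h) \<longlongrightarrow> 0) (at 0)"
    proof (rule filterlim_split_at)
      have "((\<lambda>h. 0) \<longlongrightarrow> 0) (at_left (0::real))" by simp
      moreover have "\<forall>\<^sub>F h in at_left 0. 0 = flat p h / h"
        unfolding eventually_at_left_field by (intro exI[of _ "-1"]) (auto simp: flat_def)
      ultimately show "((\<lambda>h. flat p h / h) \<longlongrightarrow> 0) (at_left 0)"
        by (rule Lim_transform_eventually)
      have "((\<lambda>h::real. inverse h ^ 1 * poly p (inverse h) / exp (inverse h)) \<longlongrightarrow> 0) (at_right 0)"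
        by (rule filterlim_compose[OF poly_div_exp_tendsto_0 filterlim_inverse_at_top_right])
      moreover have "\<forall>\<^sub>F h in at_right 0. inverse h ^ 1 * poly p (inverse h) / exp (inverse h) = flat p h / h"
        unfolding eventually_at_right_field
        by (intro exI[of _ 1]) (auto simp: flat_def exp_minus divide_inverse)
      ultimately show "((\<lambda>h. flat p h / h) \<longlongrightarrow> 0) (at_right 0)"
        by (rule Lim_transform_eventually)
    qed
    then show ?thesis using 3 by (simp add: DERIV_def flat_def)
  qed
qed

lemma Ck_flat: "Ck k (flat p)"
proof (induction k arbitrary: p)
  case 0
  have "isCont (flat p) t" for t using flat_has_derivative by (rule DERIV_isCont)
  then show ?case by (simp add: continuous_at_imp_continuous_on)
next
  case (Suc k)
  show ?case by (rule Ck_real_SucI[OF flat_has_derivative Suc])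
qed

text \<open>\<open>flat 1 (real (Suc n) * s)\<close> tends to 1 for \<open>s > 0\<close> and is 0
  otherwise. The product of such factors, one for each face of the box, is smooth, positive exactly
  on the open box, and tends to its indicator.\<close>

lemma box_bump:
  fixes a b :: "'a::euclidean_space"
  assumes "cbox a b \<subseteq> \<Omega>"
  obtains \<beta> :: "nat \<Rightarrow> 'a \<Rightarrow> real" where "\<And>n. \<beta> n \<in> test_functions \<Omega>"
    "\<And>n x. 0 \<le> \<beta> n x" "\<And>n x. \<beta> n x \<le> 1" "\<And>n x. \<beta> n x > 0 \<longleftrightarrow> x \<in> box a b"
    "\<And>x. (\<lambda>n. \<beta> n x) \<longlonglongrightarrow> indicator (box a b) x"
proof -
  define g where "g n i x = flat 1 (real (Suc n) * (x \<bullet> i - a \<bullet> i)) * flat 1 (real (Suc n) * (b \<bullet> i - x \<bullet> i))"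
    for n :: nat and i x :: 'a
  define \<beta> where "\<beta> n x = (\<Prod>i\<in>Basis. g n i x)" for n :: nat and x :: 'a
  have f: "0 \<le> flat 1 t" "flat 1 t \<le> 1" "flat 1 t > 0 \<longleftrightarrow> t > 0" for t
    by (simp_all add: flat_def)
  have g: "0 \<le> g n i x" "g n i x \<le> 1" for n i x
    unfolding g_def by (simp add: f) (rule mult_le_one; simp add: f)
  have gpos: "g n i x > 0 \<longleftrightarrow> a \<bullet> i < x \<bullet> i \<and> x \<bullet> i < b \<bullet> i" for n i x
  proof -
    have m: "p * q > 0 \<longleftrightarrow> p > 0 \<and> q > 0" if "p \<ge> 0" "q \<ge> 0" for p q :: real
      using that by (auto simp: zero_less_mult_iff)
    show ?thesis unfolding g_def m[OF f(1) f(1)] f(3) by (simp add: zero_less_mult_iff)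
  qed
  have pos: "\<beta> n x > 0 \<longleftrightarrow> x \<in> box a b" for n x
  proof
    assume "x \<in> box a b"
    then show "\<beta> n x > 0" unfolding \<beta>_def by (intro prod_pos) (auto simp: gpos mem_box)
  next
    assume p: "\<beta> n x > 0"
    have "g n i x > 0" if "i \<in> Basis" for i
    proof (rule ccontr)
      assume "\<not> g n i x > 0"
      then have "g n i x = 0" using g(1)[of n i x] by linarith
      then have "\<beta> n x = 0" unfolding \<beta>_def using that by (auto intro!: prod_zero)
      then show False using p by simp
    qed
    then show "x \<in> box a b" by (simp add: gpos mem_box)
  qed
  have nonneg: "0 \<le> \<beta> n x" for n x unfolding \<beta>_def by (intro prod_nonneg g)
  have lim: "(\<lambda>n. \<beta> n x) \<longlonglongrightarrow> indicator (box a b) x" for x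
  proof (cases "x \<in> box a b")
    case True
    have l: "(\<lambda>n. flat 1 (real (Suc n) * s)) \<longlonglongrightarrow> 1" if "s > 0" for s
    proof -
      have "(\<lambda>n. exp (- (inverse (real (Suc n)) * inverse s))) \<longlonglongrightarrow> exp (- (0 * inverse s))"
        by (intro tendsto_intros LIMSEQ_inverse_real_of_nat)
      then show ?thesis using that by (simp add: flat_def divide_inverse)
    qed
    have "(\<lambda>n. g n i x) \<longlonglongrightarrow> 1 * 1" if "i \<in> Basis" for i
      unfolding g_def using True that by (intro tendsto_mult l) (auto simp: mem_box)
    then have "(\<lambda>n. \<beta> n x) \<longlonglongrightarrow> (\<Prod>i\<in>(Basis::'a set). 1 * 1)" unfolding \<beta>_def by (intro tendsto_prod) auto
    then show ?thesis using True by simp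
  next
    case False
    then have "\<beta> n x = 0" for n using pos[of n x] nonneg[of n x] by linarith
    then show ?thesis using False by simp
  qed
  have test: "\<beta> n \<in> test_functions \<Omega>" for n
  proof (rule test_functionsI)
    have aff: "Ck k (\<lambda>x. real (Suc n) * (x \<bullet> i - a \<bullet> i))" "Ck k (\<lambda>x. real (Suc n) * (b \<bullet> i - x \<bullet> i))"
      for k and i :: 'a
      using Ck_mult[OF Ck_const[of k "real (Suc n)"] Ck_add[OF Ck_inner[of k i] Ck_const[of k "- (a \<bullet> i)"]]]
        Ck_mult[OF Ck_const[of k "real (Suc n)"] Ck_add[OF Ck_const[of k "b \<bullet> i"] Ck_mult[OF Ck_const[of k "-1"] Ck_inner[of k i]]]]
      by simp_all
    show "Ck k (\<beta> n)" for k
      unfolding \<beta>_def g_def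
      by (rule Ck_prod) (rule Ck_mult[OF Ck_compose[OF Ck_flat aff(1)] Ck_compose[OF Ck_flat aff(2)]])
    show "compact (cbox a b)" by simp
    show "\<beta> n x = 0" if "x \<notin> cbox a b" for x
      using pos[of n x] nonneg[of n x] that box_subset_cbox[of a b] by fastforce
  qed (rule assms)
  show ?thesis
    by (rule that[OF test nonneg _ pos lim]) (unfold \<beta>_def, intro prod_le_1 conjI g)
qed

text \<open>Finitely many open boxes inside \<open>\<Omega>\<close> cover \<open>K\<close>; the sum
  of their bumps is continuous and positive on \<open>K\<close>, hence bounded below there. It is
  the cut-off for the logarithmic estimate.\<close>

lemma positive_test_function:
  fixes K :: "'a::euclidean_space set"
  assumes "open \<Omega>" "compact K" "K \<subseteq> \<Omega>"
  obtains \<eta> c where "\<eta> \<in> test_functions \<Omega>" "\<And>x. 0 \<le> \<eta> x" "c > 0" "\<And>x. x \<in> K \<Longrightarrow> c \<le> \<eta> x"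
proof -
  have "\<forall>x\<in>K. \<exists>p. x \<in> box (fst p) (snd p) \<and> cbox (fst p) (snd p) \<subseteq> \<Omega>"
  proof
    fix x assume "x \<in> K"
    then have "x \<in> \<Omega>" using assms(3) by blast
    then obtain a b where "cbox a b \<subseteq> \<Omega>" "x \<in> box a b" "\<forall>i\<in>Basis. a \<bullet> i < b \<bullet> i"
      by (rule open_contains_cbox[OF assms(1)])
    then show "\<exists>p. x \<in> box (fst p) (snd p) \<and> cbox (fst p) (snd p) \<subseteq> \<Omega>"
      by (intro exI[of _ "(a, b)"]) simp
  qed
  from bchoice[OF this] obtain p where p: "\<forall>x\<in>K. x \<in> box (fst (p x)) (snd (p x)) \<and> cbox (fst (p x)) (snd (p x)) \<subseteq> \<Omega>" ..
  define a b where "a x = fst (p x)" and "b x = snd (p x)" for x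
  have ab: "\<And>x. x \<in> K \<Longrightarrow> x \<in> box (a x) (b x)" "\<And>x. x \<in> K \<Longrightarrow> cbox (a x) (b x) \<subseteq> \<Omega>"
    using p by (auto simp: a_def b_def)
  have "K \<subseteq> (\<Union>x\<in>K. box (a x) (b x))" using ab(1) by blast
  then obtain F where F: "F \<subseteq> K" "finite F" "K \<subseteq> (\<Union>x\<in>F. box (a x) (b x))"
    by (rule compactE_image[OF assms(2) open_box])
  have "\<exists>\<beta>. \<beta> \<in> test_functions \<Omega> \<and> (\<forall>y. 0 \<le> \<beta> y) \<and> (\<forall>y\<in>box (a x) (b x). \<beta> y > 0)" if xK: "x \<in> K" for x
  proof -
    obtain \<beta> :: "nat \<Rightarrow> 'a \<Rightarrow> real" where "\<And>n. \<beta> n \<in> test_functions \<Omega>" "\<And>n x. 0 \<le> \<beta> n x" "\<And>n y. \<beta> n y > 0 \<longleftrightarrow> y \<in> box (a x) (b x)"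
      using box_bump[OF ab(2)[OF xK]] by metis
    then show ?thesis by (intro exI[of _ "\<beta> 0"]) simp
  qed
  then obtain \<beta> where \<beta>: "\<And>x. x \<in> K \<Longrightarrow> \<beta> x \<in> test_functions \<Omega>" "\<And>x y. x \<in> K \<Longrightarrow> 0 \<le> \<beta> x y"
    "\<And>x y. x \<in> K \<Longrightarrow> y \<in> box (a x) (b x) \<Longrightarrow> \<beta> x y > 0" by metis
  define \<eta> where "\<eta> y = (\<Sum>x\<in>F. \<beta> x y)" for y
  have t: "\<eta> \<in> test_functions \<Omega>"
    unfolding \<eta>_def using F(2,1) \<beta>(1)
    by (induction F rule: finite_induct) (auto intro: test_functions_zero test_functions_add)
  have n: "0 \<le> \<eta> y" for y unfolding \<eta>_def using F(1) \<beta>(2) by (intro sum_nonneg) auto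
  have p: "\<eta> y > 0" if y: "y \<in> K" for y
  proof -
    obtain x where "x \<in> F" "y \<in> box (a x) (b x)" using F(3) y by blast
    then show ?thesis unfolding \<eta>_def using F(1,2) \<beta>(2,3) by (intro sum_pos2[of F x]) auto
  qed
  have cont: "continuous_on K \<eta>" using test_functions_Ck[OF t, of 0] by (rule Ck_continuous)
  show ?thesis
  proof (cases "K = {}")
    case True
    then show ?thesis using that[OF t n zero_less_one] by simp
  next
    case False
    obtain y where "y \<in> K" "\<And>x. x \<in> K \<Longrightarrow> \<eta> y \<le> \<eta> x"
      using continuous_attains_inf[OF assms(2) False cont] by blast
    then show ?thesis using that[OF t n p] by blast
  qed
qed

subsection \<open>The fundamental lemma of the calculus of variations\<close>

text \<open>Bumps carry the hypothesis over to indicators of boxes. Boxes are stable under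
  intersection and generate the Borel sets, so the integral vanishes over every Borel part of a box,
  in particular over the parts where the function is positive or negative.\<close>

lemma fundamental_lemma:
  fixes \<Omega> :: "'a::euclidean_space set" and g :: "'a \<Rightarrow> real"
  assumes \<Omega>: "open \<Omega>" and g: "integrable (lebesgue_on \<Omega>) g"
    and z: "\<And>\<phi>. \<phi> \<in> test_functions \<Omega> \<Longrightarrow> (LINT x|lebesgue_on \<Omega>. g x * \<phi> x) = 0"
  shows "AE x in lebesgue_on \<Omega>. g x = 0"
proof -
  have \<Omega>l: "\<Omega> \<in> sets lebesgue" using \<Omega> by (simp add: lborelD)
  have gi: "integrable lebesgue (\<lambda>x. indicator \<Omega> x *\<^sub>R g x)"
    using g \<Omega>l by (simp add: integrable_restrict_space)
  \<comment> \<open>A Borel representative is needed: the sign sets of the Lebesgue measurable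
    \<open>g\<close> need not lie in the sigma-algebra generated by boxes.\<close>
  obtain g' where g': "g' \<in> borel_measurable lborel" "AE x in lborel. indicator \<Omega> x *\<^sub>R g x = g' x"
    using completion_ex_borel_measurable_real[OF borel_measurable_integrable[OF gi]] by blast
  have ae: "AE x in lebesgue. indicator \<Omega> x *\<^sub>R g x = g' x" using g'(2) by (rule AE_completion)
  have g'i: "integrable lborel g'"
  proof -
    have "integrable lebesgue g'"
      by (rule integrable_cong_AE_imp[OF gi measurable_completion[OF g'(1)] ae])
    then show ?thesis by (simp add: integrable_completion[OF g'(1)])
  qed
  have zero': "(LINT x|lborel. g' x * \<phi> x) = 0" if \<phi>: "\<phi> \<in> test_functions \<Omega>" for \<phi>
  proof -
    have \<phi>m: "\<phi> \<in> borel_measurable lborel" using Ck_continuous[OF test_functions_Ck[OF \<phi>, of 0]] by (simp add: borel_measurable_continuous_onI)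
    have "(LINT x|lborel. g' x * \<phi> x) = (LINT x|lebesgue. g' x * \<phi> x)"
      using g'(1) \<phi>m by (intro integral_completion[symmetric]) simp
    also have "\<dots> = (LINT x|lebesgue. indicator \<Omega> x *\<^sub>R (g x * \<phi> x))"
    proof (rule integral_cong_AE)
      show "(\<lambda>x. g' x * \<phi> x) \<in> borel_measurable lebesgue"
        by (intro borel_measurable_times measurable_completion g'(1) \<phi>m)
      have "(\<lambda>x. (indicator \<Omega> x *\<^sub>R g x) * \<phi> x) \<in> borel_measurable lebesgue"
        by (intro borel_measurable_times measurable_completion \<phi>m borel_measurable_integrable[OF gi])
      then show "(\<lambda>x. indicator \<Omega> x *\<^sub>R (g x * \<phi> x)) \<in> borel_measurable lebesgue"
        by (simp add: mult.assoc)
      show "AE x in lebesgue. g' x * \<phi> x = indicator \<Omega> x *\<^sub>R (g x * \<phi> x)"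
        using ae by eventually_elim (simp add: mult.assoc[symmetric])
    qed
    also have "\<dots> = 0" using z[OF \<phi>] \<Omega>l by (simp add: integral_restrict_space)
    finally show ?thesis .
  qed
  have box0: "(LINT x|lborel. g' x * indicator (box a b) x) = 0" if ab: "cbox a b \<subseteq> \<Omega>" for a b
  proof -
    obtain \<beta> :: "nat \<Rightarrow> 'a \<Rightarrow> real" where \<beta>: "\<And>n. \<beta> n \<in> test_functions \<Omega>"
      "\<And>n x. 0 \<le> \<beta> n x" "\<And>n x. \<beta> n x \<le> 1" "\<And>x. (\<lambda>n. \<beta> n x) \<longlonglongrightarrow> indicator (box a b) x"
      using box_bump[OF ab] by metis
    have \<beta>m: "\<beta> n \<in> borel_measurable lborel" for n
      using Ck_continuous[OF test_functions_Ck[OF \<beta>(1), of 0]] by (simp add: borel_measurable_continuous_onI)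
    have "(\<lambda>n. LINT x|lborel. g' x * \<beta> n x) \<longlonglongrightarrow> (LINT x|lborel. g' x * indicator (box a b) x)"
    proof (rule integral_dominated_convergence[where w = "\<lambda>x. \<bar>g' x\<bar>"])
      show "AE x in lborel. (\<lambda>n. g' x * \<beta> n x) \<longlonglongrightarrow> g' x * indicator (box a b) x"
        by (intro AE_I2 tendsto_mult tendsto_const \<beta>(4))
      show "AE x in lborel. norm (g' x * \<beta> n x) \<le> \<bar>g' x\<bar>" for n
        using \<beta>(2,3) by (intro AE_I2) (simp add: abs_mult mult_left_le)
    qed (use g'(1) \<beta>m g'i in auto)
    then show ?thesis using zero'[OF \<beta>(1)] LIMSEQ_unique[OF _ tendsto_const] by simp
  qed
  have main: "AE x in lborel. x \<in> box a b \<longrightarrow> g' x = 0" if ab: "cbox a b \<subseteq> \<Omega>" for a b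
  proof -
    have gI: "integrable lborel (\<lambda>x. g' x * indicator A x)" if "A \<in> sets borel" for A
      using integrable_mult_indicator[of A lborel g'] g'i that by (simp add: mult.commute)
    have all: "(LINT x|lborel. g' x * indicator (A \<inter> box a b) x) = 0" if "A \<in> sets borel" for A
    proof -
      have st: "Int_stable (range (\<lambda>(a, b). box a b :: 'a set))"
        by (auto simp: Int_stable_def box_Int_box)
      have As: "A \<in> sigma_sets UNIV (range (\<lambda>(a, b). box a b :: 'a set))"
        using that unfolding borel_eq_box by simp
      have "range (\<lambda>(a, b). box a b :: 'a set) \<subseteq> Pow UNIV" by simp
      from st this As show ?thesis
      proof (induction rule: sigma_sets_induct_disjoint)
        case (basic A)
        then obtain c d where A: "A = box c d" by auto
        have "A \<inter> box a b = box (\<Sum>i\<in>Basis. max (c \<bullet> i) (a \<bullet> i) *\<^sub>R i) (\<Sum>i\<in>Basis. min (d \<bullet> i) (b \<bullet> i) *\<^sub>R i)"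
          (is "_ = box ?p ?q") unfolding A by (rule box_Int_box)
        moreover have "cbox ?p ?q \<subseteq> cbox a b" by (auto simp: mem_box)
        ultimately show ?case using box0[of ?p ?q] ab by auto
      next
        case empty
        show ?case by simp
      next
        case (compl A)
        then have "A \<in> sets borel" unfolding borel_eq_box by simp
        have "(\<lambda>x. g' x * indicator ((UNIV - A) \<inter> box a b) x) = (\<lambda>x. g' x * indicator (box a b) x - g' x * indicator (A \<inter> box a b) x)"
          by (auto simp: fun_eq_iff indicator_def)
        then show ?case using compl box0[OF ab] gI[of "box a b"] gI[of "A \<inter> box a b"] \<open>A \<in> sets borel\<close>
          by (simp add: Bochner_Integration.integral_diff)
      next
        case (union A)
        have A: "A i \<in> sets borel" for i using union(2) unfolding borel_eq_box by (simp add: image_subset_iff)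
        have "(LINT x:(\<Union>i. A i \<inter> box a b)|lborel. g' x) = (\<Sum>i. LINT x:(A i \<inter> box a b)|lborel. g' x)"
        proof (rule lebesgue_integral_countable_add)
          show "A i \<inter> box a b \<in> sets lborel" for i using A by simp
          show "(A i \<inter> box a b) \<inter> (A j \<inter> box a b) = {}" if "i \<noteq> j" for i j
            using union(1) that by (auto simp: disjoint_family_on_def)
          have "(\<Union>i. A i \<inter> box a b) \<in> sets borel" using A by auto
          then show "set_integrable lborel (\<Union>i. A i \<inter> box a b) g'"
            unfolding set_integrable_def using gI by (simp add: mult.commute)
        qed
        also have "\<dots> = 0" using union(3) by (simp add: set_lebesgue_integral_def mult.commute)
        finally show ?case by (simp add: set_lebesgue_integral_def mult.commute)
      qed
    qed
    have half: "AE x in lborel. s * g' x * indicator (box a b) x \<le> 0" if s: "s = 1 \<or> s = - 1" for s :: real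
    proof -
      define A where "A = {x. s * g' x > 0}"
      have A: "A \<in> sets borel" unfolding A_def using g'(1) by simp
      have "integrable lborel (\<lambda>x. s * (g' x * indicator (A \<inter> box a b) x))" using A by (intro integrable_mult_right gI) auto
      moreover have "(LINT x|lborel. s * (g' x * indicator (A \<inter> box a b) x)) = 0" using all[OF A] by simp
      moreover have "AE x in lborel. 0 \<le> s * (g' x * indicator (A \<inter> box a b) x)"
        by (auto simp: A_def indicator_def mult.assoc[symmetric])
      ultimately have "AE x in lborel. s * (g' x * indicator (A \<inter> box a b) x) = 0"
        using integral_nonneg_eq_0_iff_AE by blast
      then show ?thesis by eventually_elim (auto simp: A_def indicator_def not_less split: if_splits)
    qed
    show ?thesis using half[OF disjI1[OF refl]] half[OF disjI2[OF refl]]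
      by eventually_elim (auto simp: indicator_def split: if_splits)
  qed
  obtain \<D> where D: "countable \<D>" "\<D> \<subseteq> Pow \<Omega>" "\<And>X. X \<in> \<D> \<Longrightarrow> \<exists>a b. X = cbox a b \<and> cbox a b \<subseteq> \<Omega> \<and> (AE x in lborel. x \<in> box a b \<longrightarrow> g' x = 0)" "\<Union>\<D> = \<Omega>"
  proof -
    obtain \<D> where D: "countable \<D>" "\<D> \<subseteq> Pow \<Omega>" "\<And>X. X \<in> \<D> \<Longrightarrow> \<exists>a b. X = cbox a b" "\<Union>\<D> = \<Omega>"
      using open_countable_Union_open_cbox[OF \<Omega>] by metis
    show ?thesis
    proof (rule that[OF D(1,2) _ D(4)])
      fix X assume X: "X \<in> \<D>"
      then obtain a b where "X = cbox a b" using D(3) by blast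
      moreover from this have "cbox a b \<subseteq> \<Omega>" using X D(2) by auto
      ultimately show "\<exists>a b. X = cbox a b \<and> cbox a b \<subseteq> \<Omega> \<and> (AE x in lborel. x \<in> box a b \<longrightarrow> g' x = 0)"
        using main by blast
    qed
  qed
  have "AE x in lborel. x \<in> X \<longrightarrow> g' x = 0" if X: "X \<in> \<D>" for X
  proof -
    obtain a b where X: "X = cbox a b" "AE x in lborel. x \<in> box a b \<longrightarrow> g' x = 0" using D(3)[OF X] by blast
    \<comment> \<open>The countable cover consists of closed boxes, whereas \<open>main\<close>
      speaks of open ones; the frontiers are null sets.\<close>
    have "negligible (cbox a b - box a b)" by (rule negligible_frontier_interval)
    then have "AE x in lebesgue. x \<notin> cbox a b - box a b"
      by (intro AE_not_in) (simp only: negligible_iff_null_sets)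
    then have "AE x in lborel. x \<notin> cbox a b - box a b" by (simp add: AE_completion_iff)
    then show ?thesis using X(2) unfolding X(1) by eventually_elim auto
  qed
  then have "AE x in lborel. \<forall>X\<in>\<D>. x \<in> X \<longrightarrow> g' x = 0" by (subst AE_ball_countable[OF D(1)]) blast
  then have "AE x in lborel. x \<in> \<Omega> \<longrightarrow> g' x = 0" by eventually_elim (use D(4) in auto)
  then have "AE x in lebesgue. x \<in> \<Omega> \<longrightarrow> g' x = 0" by (rule AE_completion)
  then have "AE x in lebesgue. x \<in> \<Omega> \<longrightarrow> g x = 0" using ae by eventually_elim auto
  then show ?thesis using \<Omega>l by (simp add: AE_restrict_space_iff)
qed

subsection \<open>Sobolev spaces on bounded open sets\<close>

lemma lc_diff: "lc 1 f (-1) g = (\<lambda>x. f x - g x)"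
  by (simp add: lc_def)

lemma L2_diff: "f \<in> L2 \<Omega> \<Longrightarrow> g \<in> L2 \<Omega> \<Longrightarrow> (\<lambda>x. f x - g x) \<in> L2 \<Omega>"
  using L2_lc[of f \<Omega> g 1 "-1"] by (simp add: lc_diff)

lemma l2_norm_triangle:
  assumes "f \<in> L2 \<Omega>" "g \<in> L2 \<Omega>" "k \<in> L2 \<Omega>"
  shows "l2_norm \<Omega> (\<lambda>x. f x - k x) \<le> l2_norm \<Omega> (\<lambda>x. f x - g x) + l2_norm \<Omega> (\<lambda>x. g x - k x)"
  using L2.ip_self_dif_triangle[OF assms] by (simp add: lc_diff l2_norm_nrm)

lemma l2_inner_diff:
  assumes "f \<in> L2 \<Omega>" "g \<in> L2 \<Omega>" "k \<in> L2 \<Omega>"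
  shows "l2_inner \<Omega> (\<lambda>x. f x - g x) k = l2_inner \<Omega> f k - l2_inner \<Omega> g k"
  using l2_inner_lc[OF assms, of 1 "-1"] by (simp add: lc_diff)

lemma l2_inner_tendsto:
  assumes f: "\<And>n. f n \<in> L2 \<Omega>" "l \<in> L2 \<Omega>" and k: "k \<in> L2 \<Omega>"
    and lim: "(\<lambda>n. l2_norm \<Omega> (\<lambda>x. f n x - l x)) \<longlonglongrightarrow> 0"
  shows "(\<lambda>n. l2_inner \<Omega> (f n) k) \<longlonglongrightarrow> l2_inner \<Omega> l k"
proof -
  have "(\<lambda>n. l2_inner \<Omega> (f n) k - l2_inner \<Omega> l k) \<longlonglongrightarrow> 0"
  proof (rule Lim_null_comparison)
    show "\<forall>\<^sub>F n in sequentially. norm (l2_inner \<Omega> (f n) k - l2_inner \<Omega> l k) \<le> l2_norm \<Omega> (\<lambda>x. f n x - l x) * l2_norm \<Omega> k"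
      using l2_cs[OF L2_diff[OF f] k] by (intro always_eventually allI) (simp add: l2_inner_diff f k)
    show "(\<lambda>n. l2_norm \<Omega> (\<lambda>x. f n x - l x) * l2_norm \<Omega> k) \<longlonglongrightarrow> 0"
      using tendsto_mult_left_zero[OF lim] .
  qed
  then show ?thesis by (rule LIM_zero_cancel)
qed

lemma l2_norm_tendsto:
  assumes f: "\<And>n. f n \<in> L2 \<Omega>" "l \<in> L2 \<Omega>"
    and lim: "(\<lambda>n. l2_norm \<Omega> (\<lambda>x. f n x - l x)) \<longlonglongrightarrow> 0"
  shows "(\<lambda>n. l2_norm \<Omega> (f n)) \<longlonglongrightarrow> l2_norm \<Omega> l"
proof -
  have "(\<lambda>n. l2_norm \<Omega> (f n) - l2_norm \<Omega> l) \<longlonglongrightarrow> 0"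
    using L2.nrm_le_dif[OF f]
    by (intro Lim_null_comparison[OF _ lim] always_eventually allI) (simp add: l2_norm_nrm lc_diff)
  then show ?thesis by (rule LIM_zero_cancel)
qed

lemma L2_inner_const:
  assumes "g \<in> L2 \<Omega>"
  shows "(\<lambda>x. g x \<bullet> b) \<in> L2 \<Omega>"
proof (rule L2I_dominated[OF _ L2_lc[OF assms assms, of "norm b" 0]])
  show "(\<lambda>x. g x \<bullet> b) \<in> borel_measurable (lebesgue_on \<Omega>)"
    by (intro borel_measurable_inner L2_measurable assms borel_measurable_const)
  show "AE x in lebesgue_on \<Omega>. norm (g x \<bullet> b) \<le> norm (lc (norm b) g 0 g x)"
    using Cauchy_Schwarz_ineq2[of "g _" b] by (intro AE_I2) (simp add: lc_def mult.commute)
qed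

lemma l2_norm_inner_const_le:
  assumes "g \<in> L2 \<Omega>"
  shows "l2_norm \<Omega> (\<lambda>x. g x \<bullet> b) \<le> norm b * l2_norm \<Omega> g"
proof (rule power2_le_imp_le)
  have "(l2_norm \<Omega> (\<lambda>x. g x \<bullet> b))\<^sup>2 \<le> (LINT x|lebesgue_on \<Omega>. (norm b)\<^sup>2 * (norm (g x))\<^sup>2)"
    unfolding l2_norm_sq_int
  proof (intro integral_mono L2_sq_integrable L2_inner_const integrable_mult_right assms)
    fix x
    have "norm (g x \<bullet> b) \<le> norm b * norm (g x)" using Cauchy_Schwarz_ineq2[of "g x" b] by (simp add: mult.commute)
    from power_mono[OF this, of 2] show "(norm (g x \<bullet> b))\<^sup>2 \<le> (norm b)\<^sup>2 * (norm (g x))\<^sup>2" by (simp add: power_mult_distrib)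
  qed
  then show "(l2_norm \<Omega> (\<lambda>x. g x \<bullet> b))\<^sup>2 \<le> (norm b * l2_norm \<Omega> g)\<^sup>2"
    by (simp add: l2_norm_sq_int power_mult_distrib)
qed simp

locale open_bounded =
  fixes \<Omega> :: "'a::euclidean_space set"
  assumes open_dom: "open \<Omega>" and bounded_dom: "bounded \<Omega>"
begin

lemma dom_lebesgue [simp]: "\<Omega> \<in> sets lebesgue"
  using open_dom by (simp add: lborelD)

lemma finite_dom: "finite_measure (lebesgue_on \<Omega>)"
  by (rule finite_measure_lebesgue_on_bounded[OF bounded_dom dom_lebesgue])

lemma bounded_L2:
  fixes f :: "'a \<Rightarrow> 'b::euclidean_space"
  assumes "f \<in> borel_measurable (lebesgue_on \<Omega>)" "AE x in lebesgue_on \<Omega>. norm (f x) \<le> B"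
  shows "f \<in> L2 \<Omega>"
proof -
  interpret finite_measure "lebesgue_on \<Omega>" by (rule finite_dom)
  show ?thesis unfolding L2_def
  proof (safe intro!: assms(1))
    show "integrable (lebesgue_on \<Omega>) (\<lambda>x. (norm (f x))\<^sup>2)"
    proof (rule integrable_const_bound[where B = "B\<^sup>2"])
      show "AE x in lebesgue_on \<Omega>. norm ((norm (f x))\<^sup>2) \<le> B\<^sup>2"
        using assms(2) by eventually_elim (simp add: power_mono)
    qed (use assms(1) in measurable)
  qed
qed

lemma continuous_compact_support:
  fixes f :: "'a \<Rightarrow> 'b::euclidean_space"
  assumes "continuous_on UNIV f" "compact K" "\<And>x. x \<notin> K \<Longrightarrow> f x = 0"
  shows "\<exists>B. \<forall>x. norm (f x) \<le> B" "f \<in> L2 \<Omega>"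
proof -
  obtain B where B: "\<And>x. x \<in> K \<Longrightarrow> norm (f x) \<le> B"
    using compact_imp_bounded[OF compact_continuous_image[OF continuous_on_subset[OF assms(1) subset_UNIV] assms(2)]]
    unfolding bounded_iff by auto
  have B': "norm (f x) \<le> \<bar>B\<bar>" for x using B[of x] assms(3)[of x] by (cases "x \<in> K") auto
  then show "\<exists>B. \<forall>x. norm (f x) \<le> B" by blast
  have "f \<in> borel_measurable lebesgue"
    using measurable_completion[of f lborel borel] assms(1) by (simp add: borel_measurable_continuous_onI)
  then have "f \<in> borel_measurable (lebesgue_on \<Omega>)" by (rule measurable_restrict_space1)
  then show "f \<in> L2 \<Omega>" using B' by (intro bounded_L2) auto
qed

lemma test_bounded: "\<phi> \<in> test_functions \<Omega> \<Longrightarrow> \<exists>B. \<forall>x. norm (\<phi> x) \<le> B"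
  and test_L2: "\<phi> \<in> test_functions \<Omega> \<Longrightarrow> \<phi> \<in> L2 \<Omega>"
  and grad_bounded: "\<phi> \<in> test_functions \<Omega> \<Longrightarrow> \<exists>B. \<forall>x. norm (grad \<phi> x) \<le> B"
  and grad_L2: "\<phi> \<in> test_functions \<Omega> \<Longrightarrow> grad \<phi> \<in> L2 \<Omega>"
proof -
  assume \<phi>: "\<phi> \<in> test_functions \<Omega>"
  obtain K where K: "compact K" "\<And>x. x \<notin> K \<Longrightarrow> \<phi> x = 0" "\<And>x. x \<notin> K \<Longrightarrow> grad \<phi> x = 0"
    using test_functionsE[OF \<phi>] by metis
  have c: "continuous_on UNIV \<phi>" "continuous_on UNIV (grad \<phi>)"
    by (rule Ck_continuous[OF test_functions_Ck[OF \<phi>, of 0]]) (rule continuous_grad[OF test_functions_Ck[OF \<phi>]])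
  show "\<exists>B. \<forall>x. norm (\<phi> x) \<le> B" "\<phi> \<in> L2 \<Omega>" "\<exists>B. \<forall>x. norm (grad \<phi> x) \<le> B" "grad \<phi> \<in> L2 \<Omega>"
    using continuous_compact_support[OF c(1) K(1,2)] continuous_compact_support[OF c(2) K(1,3)] by blast+
qed

lemma weak_gradient_iff:
  "has_weak_gradient \<Omega> w g \<longleftrightarrow> (\<forall>\<phi>\<in>test_functions \<Omega>. \<forall>b\<in>Basis.
    l2_inner \<Omega> w (partial b \<phi>) = - l2_inner \<Omega> (\<lambda>x. g x \<bullet> b) \<phi>)"
  by (simp add: has_weak_gradient_def l2_inner_def)

text \<open>The fundamental lemma applies to each coordinate of the difference. This is what makes
  the choice in \<open>wgrad\<close> immaterial.\<close>

lemma weak_gradient_unique: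
  assumes g: "g \<in> L2 \<Omega>" "h \<in> L2 \<Omega>" and w: "has_weak_gradient \<Omega> w g" "has_weak_gradient \<Omega> w h"
  shows "AE x in lebesgue_on \<Omega>. g x = h x"
proof -
  have "AE x in lebesgue_on \<Omega>. (g x - h x) \<bullet> b = 0" if b: "b \<in> Basis" for b
  proof (rule fundamental_lemma[OF open_dom])
    have d: "(\<lambda>x. (g x - h x) \<bullet> b) \<in> L2 \<Omega>" by (intro L2_inner_const L2_diff g)
    then show "integrable (lebesgue_on \<Omega>) (\<lambda>x. (g x - h x) \<bullet> b)" by (rule L1_le_L2[OF bounded_dom dom_lebesgue])
    fix \<phi> assume \<phi>: "\<phi> \<in> test_functions \<Omega>"
    have "l2_inner \<Omega> (\<lambda>x. g x \<bullet> b) \<phi> = l2_inner \<Omega> (\<lambda>x. h x \<bullet> b) \<phi>"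
      using w \<phi> b unfolding weak_gradient_iff by (metis neg_equal_iff_equal)
    then have "l2_inner \<Omega> (\<lambda>x. g x \<bullet> b - h x \<bullet> b) \<phi> = 0"
      by (simp add: l2_inner_diff L2_inner_const g test_L2[OF \<phi>])
    then show "(LINT x|lebesgue_on \<Omega>. ((g x - h x) \<bullet> b) * \<phi> x) = 0"
      by (simp add: l2_inner_def inner_diff_left)
  qed
  then have "AE x in lebesgue_on \<Omega>. \<forall>b\<in>Basis. (g x - h x) \<bullet> b = 0" by (subst AE_ball_countable) (auto intro: countable_finite)
  then show ?thesis by eventually_elim (auto simp: euclidean_eq_iff[of "g _"] inner_diff_left)
qed

lemma H1_D:
  assumes "w \<in> H1 \<Omega>"
  shows "w \<in> L2 \<Omega>" "wgrad \<Omega> w \<in> L2 \<Omega>" "has_weak_gradient \<Omega> w (wgrad \<Omega> w)"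
proof -
  have "\<exists>g. g \<in> L2 \<Omega> \<and> has_weak_gradient \<Omega> w g" using assms by (auto simp: H1_def)
  from someI_ex[OF this] show "wgrad \<Omega> w \<in> L2 \<Omega>" "has_weak_gradient \<Omega> w (wgrad \<Omega> w)"
    by (simp_all add: wgrad_def)
  show "w \<in> L2 \<Omega>" using assms by (simp add: H1_def)
qed

lemma H1_I:
  assumes "w \<in> L2 \<Omega>" "g \<in> L2 \<Omega>" "has_weak_gradient \<Omega> w g"
  shows "w \<in> H1 \<Omega>" "AE x in lebesgue_on \<Omega>. wgrad \<Omega> w x = g x"
proof -
  show w: "w \<in> H1 \<Omega>" using assms by (auto simp: H1_def)
  show "AE x in lebesgue_on \<Omega>. wgrad \<Omega> w x = g x"
    by (rule weak_gradient_unique[OF H1_D(2)[OF w] assms(2) H1_D(3)[OF w] assms(3)])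
qed

lemma weak_gradient_lc:
  assumes "w \<in> L2 \<Omega>" "g \<in> L2 \<Omega>" "has_weak_gradient \<Omega> w g"
    "v \<in> L2 \<Omega>" "h \<in> L2 \<Omega>" "has_weak_gradient \<Omega> v h"
  shows "has_weak_gradient \<Omega> (lc a w b v) (lc a g b h)"
  unfolding weak_gradient_iff
proof (intro ballI)
  fix \<phi> and c :: 'a assume \<phi>: "\<phi> \<in> test_functions \<Omega>" and c: "c \<in> Basis"
  have "(\<lambda>x. lc a g b h x \<bullet> c) = lc a (\<lambda>x. g x \<bullet> c) b (\<lambda>x. h x \<bullet> c)"
    by (simp add: lc_def inner_add_left)
  then have "l2_inner \<Omega> (\<lambda>x. lc a g b h x \<bullet> c) \<phi> = a * l2_inner \<Omega> (\<lambda>x. g x \<bullet> c) \<phi> + b * l2_inner \<Omega> (\<lambda>x. h x \<bullet> c) \<phi>"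
    using assms by (simp add: l2_inner_lc L2_inner_const test_L2[OF \<phi>])
  moreover have "l2_inner \<Omega> (lc a w b v) (partial c \<phi>) = a * l2_inner \<Omega> w (partial c \<phi>) + b * l2_inner \<Omega> v (partial c \<phi>)"
    by (intro l2_inner_lc assms(1,4) test_L2[OF test_functions_partial[OF \<phi> c]])
  ultimately show "l2_inner \<Omega> (lc a w b v) (partial c \<phi>) = - l2_inner \<Omega> (\<lambda>x. lc a g b h x \<bullet> c) \<phi>"
    using assms(3,6) \<phi> c unfolding weak_gradient_iff by simp
qed

lemma H1_lc:
  assumes "w \<in> H1 \<Omega>" "v \<in> H1 \<Omega>"
  shows "lc a w b v \<in> H1 \<Omega>"
    "AE x in lebesgue_on \<Omega>. wgrad \<Omega> (lc a w b v) x = lc a (wgrad \<Omega> w) b (wgrad \<Omega> v) x"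
  using H1_I[OF L2_lc L2_lc weak_gradient_lc, OF H1_D(1)[OF assms(1)] H1_D(1)[OF assms(2)]
      H1_D(2)[OF assms(1)] H1_D(2)[OF assms(2)] H1_D[OF assms(1)] H1_D[OF assms(2)]]
  by blast+

lemma test_H1:
  assumes "\<phi> \<in> test_functions \<Omega>"
  shows "\<phi> \<in> H1 \<Omega>" "AE x in lebesgue_on \<Omega>. wgrad \<Omega> \<phi> x = grad \<phi> x"
  using H1_I[OF test_L2 grad_L2 weak_gradient_test] assms by auto

definition h1_inner :: "('a \<Rightarrow> real) \<Rightarrow> ('a \<Rightarrow> real) \<Rightarrow> real" where
  "h1_inner w v = l2_inner \<Omega> w v + l2_inner \<Omega> (wgrad \<Omega> w) (wgrad \<Omega> v)"

text \<open>\<open>wgrad\<close> chooses a representative and is linear only almost everywhere;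
  inside an inner product it becomes linear in the strict sense.\<close>

lemma wgrad_inner_lc:
  assumes "w \<in> H1 \<Omega>" "v \<in> H1 \<Omega>" "k \<in> L2 \<Omega>"
  shows "l2_inner \<Omega> (wgrad \<Omega> (lc a w b v)) k = a * l2_inner \<Omega> (wgrad \<Omega> w) k + b * l2_inner \<Omega> (wgrad \<Omega> v) k"
proof -
  have "l2_inner \<Omega> (wgrad \<Omega> (lc a w b v)) k = l2_inner \<Omega> (lc a (wgrad \<Omega> w) b (wgrad \<Omega> v)) k"
    by (rule l2_inner_cong_AE) (use H1_lc[OF assms(1,2)] assms in \<open>auto intro: H1_D L2_lc\<close>)
  then show ?thesis using assms by (simp add: l2_inner_lc H1_D)
qed

sublocale H1: sip "H1 \<Omega>" h1_inner
proof
  show "lc a f b g \<in> H1 \<Omega>" if "f \<in> H1 \<Omega>" "g \<in> H1 \<Omega>" for f g a b by (rule H1_lc[OF that])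
  show "(\<lambda>x. 0) \<in> H1 \<Omega>" by (rule test_H1[OF test_functions_zero])
  show "h1_inner f g = h1_inner g f" for f g by (simp add: h1_inner_def l2_inner_commute[of _ f] l2_inner_commute[of _ "wgrad \<Omega> f"])
  show "h1_inner (lc a f b g) k = a * h1_inner f k + b * h1_inner g k" if "f \<in> H1 \<Omega>" "g \<in> H1 \<Omega>" "k \<in> H1 \<Omega>" for f g k a b
    using that by (simp add: h1_inner_def wgrad_inner_lc l2_inner_lc H1_D algebra_simps)
  show "h1_inner f f \<ge> 0" for f unfolding h1_inner_def l2_norm_sq[symmetric] by simp
qed

lemma h1_norm_nrm: "h1_norm \<Omega> w = H1.nrm w"
  by (simp add: h1_norm_def H1.nrm_def h1_inner_def l2_norm_sq)

lemma h1_norm_sq: "(h1_norm \<Omega> w)\<^sup>2 = (l2_norm \<Omega> w)\<^sup>2 + (l2_norm \<Omega> (wgrad \<Omega> w))\<^sup>2"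
  by (simp add: h1_norm_def)

lemma h1_norm_nonneg [simp]: "h1_norm \<Omega> w \<ge> 0"
  by (simp add: h1_norm_def)

lemma l2_le_h1: "l2_norm \<Omega> w \<le> h1_norm \<Omega> w" "l2_norm \<Omega> (wgrad \<Omega> w) \<le> h1_norm \<Omega> w"
  by (rule power2_le_imp_le; simp add: h1_norm_sq)+

lemma h1_le_l2: "h1_norm \<Omega> w \<le> l2_norm \<Omega> w + l2_norm \<Omega> (wgrad \<Omega> w)"
  by (rule power2_le_imp_le) (simp_all add: h1_norm_sq power2_sum)

lemma wgrad_diff_norm:
  assumes "w \<in> H1 \<Omega>" "v \<in> H1 \<Omega>"
  shows "l2_norm \<Omega> (wgrad \<Omega> (\<lambda>x. w x - v x)) = l2_norm \<Omega> (\<lambda>x. wgrad \<Omega> w x - wgrad \<Omega> v x)"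
proof (rule l2_norm_cong_AE)
  show "AE x in lebesgue_on \<Omega>. wgrad \<Omega> (\<lambda>x. w x - v x) x = wgrad \<Omega> w x - wgrad \<Omega> v x"
    using H1_lc(2)[OF assms, of 1 "-1"] by (simp add: lc_diff)
  show "wgrad \<Omega> (\<lambda>x. w x - v x) \<in> L2 \<Omega>" using H1_D(2)[OF H1_lc(1)[OF assms, of 1 "-1"]] by (simp add: lc_diff)
qed (intro L2_diff H1_D assms)

lemma weak_gradient_limit:
  assumes w: "\<And>n. w n \<in> L2 \<Omega>" "\<And>n. g n \<in> L2 \<Omega>" "\<And>n. has_weak_gradient \<Omega> (w n) (g n)"
    and l: "l \<in> L2 \<Omega>" "h \<in> L2 \<Omega>"
    and lim: "(\<lambda>n. l2_norm \<Omega> (\<lambda>x. w n x - l x)) \<longlonglongrightarrow> 0" "(\<lambda>n. l2_norm \<Omega> (\<lambda>x. g n x - h x)) \<longlonglongrightarrow> 0"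
  shows "has_weak_gradient \<Omega> l h"
  unfolding weak_gradient_iff
proof (intro ballI)
  fix \<phi> and c :: 'a assume \<phi>: "\<phi> \<in> test_functions \<Omega>" and c: "c \<in> Basis"
  have 1: "(\<lambda>n. l2_inner \<Omega> (w n) (partial c \<phi>)) \<longlonglongrightarrow> l2_inner \<Omega> l (partial c \<phi>)"
    by (intro l2_inner_tendsto w l lim test_L2 test_functions_partial \<phi> c)
  have "(\<lambda>n. l2_inner \<Omega> (\<lambda>x. g n x \<bullet> c) \<phi>) \<longlonglongrightarrow> l2_inner \<Omega> (\<lambda>x. h x \<bullet> c) \<phi>"
  proof (intro l2_inner_tendsto L2_inner_const w l test_L2 \<phi>)
    show "(\<lambda>n. l2_norm \<Omega> (\<lambda>x. g n x \<bullet> c - h x \<bullet> c)) \<longlonglongrightarrow> 0"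
    proof (rule Lim_null_comparison[OF _ lim(2)], intro always_eventually allI)
      fix n show "norm (l2_norm \<Omega> (\<lambda>x. g n x \<bullet> c - h x \<bullet> c)) \<le> l2_norm \<Omega> (\<lambda>x. g n x - h x)"
        using l2_norm_inner_const_le[OF L2_diff[OF w(2) l(2)], of n c] c by (simp add: inner_diff_left)
    qed
  qed
  then have "(\<lambda>n. - l2_inner \<Omega> (\<lambda>x. g n x \<bullet> c) \<phi>) \<longlonglongrightarrow> - l2_inner \<Omega> (\<lambda>x. h x \<bullet> c) \<phi>" by (rule tendsto_minus)
  moreover have "- l2_inner \<Omega> (\<lambda>x. g n x \<bullet> c) \<phi> = l2_inner \<Omega> (w n) (partial c \<phi>)" for n
    using w(3) \<phi> c unfolding weak_gradient_iff by simp
  ultimately show "l2_inner \<Omega> l (partial c \<phi>) = - l2_inner \<Omega> (\<lambda>x. h x \<bullet> c) \<phi>"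
    using LIMSEQ_unique[OF 1] by simp
qed

lemma H10_H1: "w \<in> H10 \<Omega> \<Longrightarrow> w \<in> H1 \<Omega>"
  by (simp add: H10_def)

lemma H10_L2: "w \<in> H10 \<Omega> \<Longrightarrow> w \<in> L2 \<Omega>"
  using H10_H1 H1_D(1) by blast

lemma wgrad_L2: "w \<in> H10 \<Omega> \<Longrightarrow> wgrad \<Omega> w \<in> L2 \<Omega>"
  using H10_H1 H1_D(2) by blast

lemma H10_closed:
  assumes w: "w \<in> H1 \<Omega>" and v: "\<And>e. e > 0 \<Longrightarrow> \<exists>v\<in>H10 \<Omega>. h1_norm \<Omega> (\<lambda>x. w x - v x) < e"
  shows "w \<in> H10 \<Omega>"
  unfolding H10_def
proof (safe intro!: w)
  fix e :: real assume "e > 0"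
  then obtain v where v: "v \<in> H10 \<Omega>" "h1_norm \<Omega> (\<lambda>x. w x - v x) < e/2" using v[of "e/2"] by auto
  then obtain \<phi> where \<phi>: "\<phi> \<in> test_functions \<Omega>" "h1_norm \<Omega> (\<lambda>x. v x - \<phi> x) < e/2"
    using \<open>e > 0\<close> by (auto simp: H10_def dest!: spec[of _ "e/2"])
  have "h1_norm \<Omega> (\<lambda>x. w x - \<phi> x) \<le> h1_norm \<Omega> (\<lambda>x. w x - v x) + h1_norm \<Omega> (\<lambda>x. v x - \<phi> x)"
    using H1.ip_self_dif_triangle[OF w H10_H1[OF v(1)] test_H1(1)[OF \<phi>(1)]] by (simp add: lc_diff h1_norm_nrm)
  then show "\<exists>\<phi>\<in>test_functions \<Omega>. h1_norm \<Omega> (\<lambda>x. w x - \<phi> x) < e" using v \<phi> by (intro bexI[of _ \<phi>]) auto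
qed

lemma test_H10: "\<phi> \<in> test_functions \<Omega> \<Longrightarrow> \<phi> \<in> H10 \<Omega>"
  unfolding H10_def
proof safe
  assume \<phi>: "\<phi> \<in> test_functions \<Omega>"
  then show H: "\<phi> \<in> H1 \<Omega>" by (rule test_H1)
  fix e :: real assume "e > 0"
  moreover have "h1_norm \<Omega> (\<lambda>x. \<phi> x - \<phi> x) = 0"
    using H1.ip_lc_self[OF H H, of 1 "-1"] by (simp add: h1_norm_nrm H1.nrm_def lc_diff)
  ultimately show "\<exists>\<psi>\<in>test_functions \<Omega>. h1_norm \<Omega> (\<lambda>x. \<phi> x - \<psi> x) < e" using \<phi> by (intro bexI[of _ \<phi>]) simp_all
qed

lemma H10_lc:
  assumes "w \<in> H10 \<Omega>" "v \<in> H10 \<Omega>"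
  shows "lc a w b v \<in> H10 \<Omega>"
proof (rule H10_closed)
  show "lc a w b v \<in> H1 \<Omega>" using assms by (intro H1_lc H10_H1)
  fix e :: real assume e: "e > 0"
  define d where "d = e / (\<bar>a\<bar> + \<bar>b\<bar> + 1)"
  have d: "d > 0" using e by (simp add: d_def add_nonneg_pos)
  obtain \<phi> where \<phi>: "\<phi> \<in> test_functions \<Omega>" "h1_norm \<Omega> (\<lambda>x. w x - \<phi> x) < d" using assms(1) d by (auto simp: H10_def)
  obtain \<psi> where \<psi>: "\<psi> \<in> test_functions \<Omega>" "h1_norm \<Omega> (\<lambda>x. v x - \<psi> x) < d" using assms(2) d by (auto simp: H10_def)
  have H: "lc 1 w (-1) \<phi> \<in> H1 \<Omega>" "lc 1 v (-1) \<psi> \<in> H1 \<Omega>" 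
    by (intro H1_lc H10_H1[OF assms(1)] H10_H1[OF assms(2)] test_H1(1)[OF \<phi>(1)] test_H1(1)[OF \<psi>(1)])+
  have "(\<lambda>x. lc a w b v x - lc a \<phi> b \<psi> x) = lc a (lc 1 w (-1) \<phi>) b (lc 1 v (-1) \<psi>)"
    by (simp add: lc_def algebra_simps)
  then have "h1_norm \<Omega> (\<lambda>x. lc a w b v x - lc a \<phi> b \<psi> x) \<le> \<bar>a\<bar> * h1_norm \<Omega> (\<lambda>x. w x - \<phi> x) + \<bar>b\<bar> * h1_norm \<Omega> (\<lambda>x. v x - \<psi> x)"
    using H1.nrm_lc_le[OF H, of a b] by (simp add: h1_norm_nrm lc_diff)
  also have "\<dots> \<le> \<bar>a\<bar> * d + \<bar>b\<bar> * d" using \<phi> \<psi> by (intro add_mono mult_left_mono) auto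
  also have "\<dots> < (\<bar>a\<bar> + \<bar>b\<bar> + 1) * d" using d by (simp add: algebra_simps)
  also have "\<dots> = e" unfolding d_def by simp
  finally show "\<exists>v'\<in>H10 \<Omega>. h1_norm \<Omega> (\<lambda>x. lc a w b v x - v' x) < e"
    using test_H10[OF test_functions_lc[OF \<phi>(1) \<psi>(1)]] by blast
qed

text \<open>The weak gradient is a closed operator and \<open>H10 \<Omega>\<close> is closed in
  \<open>H1 \<Omega>\<close>. Completeness, compositions and truncations are all obtained by passing
  to the limit with this rule.\<close>

lemma H10_limit:
  assumes w: "\<And>n. w n \<in> H10 \<Omega>" and l: "l \<in> L2 \<Omega>" "h \<in> L2 \<Omega>"
    and lim: "(\<lambda>n. l2_norm \<Omega> (\<lambda>x. w n x - l x)) \<longlonglongrightarrow> 0" "(\<lambda>n. l2_norm \<Omega> (\<lambda>x. wgrad \<Omega> (w n) x - h x)) \<longlonglongrightarrow> 0"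
  shows "l \<in> H10 \<Omega>" "AE x in lebesgue_on \<Omega>. wgrad \<Omega> l x = h x"
    "(\<lambda>n. h1_norm \<Omega> (\<lambda>x. w n x - l x)) \<longlonglongrightarrow> 0"
proof -
  have g: "has_weak_gradient \<Omega> l h"
    by (rule weak_gradient_limit[OF H10_L2[OF w] wgrad_L2[OF w] H1_D(3)[OF H10_H1[OF w]] l lim])
  show 1: "AE x in lebesgue_on \<Omega>. wgrad \<Omega> l x = h x" by (rule H1_I[OF l g])
  have lH: "l \<in> H1 \<Omega>" by (rule H1_I[OF l g])
  have "h1_norm \<Omega> (\<lambda>x. w n x - l x) \<le> l2_norm \<Omega> (\<lambda>x. w n x - l x) + l2_norm \<Omega> (\<lambda>x. wgrad \<Omega> (w n) x - h x)" for n
  proof -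
    have "l2_norm \<Omega> (\<lambda>x. wgrad \<Omega> (w n) x - wgrad \<Omega> l x) = l2_norm \<Omega> (\<lambda>x. wgrad \<Omega> (w n) x - h x)"
      by (rule l2_norm_cong_AE) (use 1 in \<open>auto intro: L2_diff wgrad_L2 w H1_D lH l\<close>)
    then show ?thesis using h1_le_l2[of "\<lambda>x. w n x - l x"] wgrad_diff_norm[OF H10_H1[OF w] lH, of n] by simp
  qed
  moreover have "(\<lambda>n. l2_norm \<Omega> (\<lambda>x. w n x - l x) + l2_norm \<Omega> (\<lambda>x. wgrad \<Omega> (w n) x - h x)) \<longlonglongrightarrow> 0"
    using tendsto_add[OF lim] by simp
  ultimately show 2: "(\<lambda>n. h1_norm \<Omega> (\<lambda>x. w n x - l x)) \<longlonglongrightarrow> 0"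
    by (intro Lim_null_comparison[of "\<lambda>n. h1_norm \<Omega> (\<lambda>x. w n x - l x)"]) auto
  show "l \<in> H10 \<Omega>"
  proof (rule H10_closed[OF lH])
    fix e :: real assume "e > 0"
    with 2 obtain n where "h1_norm \<Omega> (\<lambda>x. w n x - l x) < e"
      by (metis (mono_tags, lifting) LIMSEQ_D abs_of_nonneg diff_zero h1_norm_nonneg order_refl real_norm_def)
    moreover have "h1_norm \<Omega> (\<lambda>x. l x - w n x) = h1_norm \<Omega> (\<lambda>x. w n x - l x)"
      using H1.nrm_dif_sym[OF lH H10_H1[OF w]] by (simp add: lc_diff h1_norm_nrm)
    ultimately show "\<exists>v\<in>H10 \<Omega>. h1_norm \<Omega> (\<lambda>x. l x - v x) < e" using w by metis
  qed
qed

text \<open>The almost everywhere convergence, gained on a subsequence, is what Fatou's lemma and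
  dominated convergence need later.\<close>

lemma H10_approx:
  assumes w: "w \<in> H10 \<Omega>"
  obtains \<phi> :: "nat \<Rightarrow> 'a \<Rightarrow> real" where "\<And>n. \<phi> n \<in> test_functions \<Omega>"
    "(\<lambda>n. l2_norm \<Omega> (\<lambda>x. \<phi> n x - w x)) \<longlonglongrightarrow> 0"
    "(\<lambda>n. l2_norm \<Omega> (\<lambda>x. grad (\<phi> n) x - wgrad \<Omega> w x)) \<longlonglongrightarrow> 0"
    "AE x in lebesgue_on \<Omega>. (\<lambda>n. \<phi> n x) \<longlonglongrightarrow> w x"
proof -
  have "\<exists>\<phi>\<in>test_functions \<Omega>. h1_norm \<Omega> (\<lambda>x. w x - \<phi> x) < inverse (real (Suc n))" for n
    using w by (simp add: H10_def)
  then obtain \<phi> where \<phi>: "\<And>n. \<phi> n \<in> test_functions \<Omega>" "\<And>n. h1_norm \<Omega> (\<lambda>x. w x - \<phi> n x) < inverse (real (Suc n))" by metis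
  have h: "h1_norm \<Omega> (\<lambda>x. \<phi> n x - w x) < inverse (real (Suc n))" for n
    using \<phi>(2)[of n] H1.nrm_dif_sym[OF H10_H1[OF w] test_H1(1)[OF \<phi>(1)]] by (simp add: lc_diff h1_norm_nrm)
  have l: "(\<lambda>n. l2_norm \<Omega> (\<lambda>x. \<phi> n x - w x)) \<longlonglongrightarrow> 0"
    using order_trans[OF l2_le_h1(1) less_imp_le[OF h]]
    by (intro Lim_null_comparison[OF _ LIMSEQ_inverse_real_of_nat]) auto
  have g: "(\<lambda>n. l2_norm \<Omega> (\<lambda>x. grad (\<phi> n) x - wgrad \<Omega> w x)) \<longlonglongrightarrow> 0"
  proof (rule Lim_null_comparison[OF _ LIMSEQ_inverse_real_of_nat], intro always_eventually allI)
    fix n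
    have "l2_norm \<Omega> (\<lambda>x. grad (\<phi> n) x - wgrad \<Omega> w x) = l2_norm \<Omega> (\<lambda>x. wgrad \<Omega> (\<phi> n) x - wgrad \<Omega> w x)"
      by (rule l2_norm_cong_AE) (use test_H1[OF \<phi>(1), of n] in \<open>auto intro: L2_diff wgrad_L2 w H1_D grad_L2 \<phi>\<close>)
    also have "\<dots> \<le> h1_norm \<Omega> (\<lambda>x. \<phi> n x - w x)"
      using l2_le_h1(2)[of "\<lambda>x. \<phi> n x - w x"] wgrad_diff_norm[OF test_H1(1)[OF \<phi>(1)] H10_H1[OF w], of n] by simp
    finally show "norm (l2_norm \<Omega> (\<lambda>x. grad (\<phi> n) x - wgrad \<Omega> w x)) \<le> inverse (real (Suc n))"
      using h[of n] by simp
  qed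
  obtain r where r: "strict_mono (r :: nat \<Rightarrow> nat)" "AE x in lebesgue_on \<Omega>. (\<lambda>n. \<phi> (r n) x) \<longlonglongrightarrow> w x"
    using L2_tendsto_AE_subseq[OF bounded_dom dom_lebesgue test_L2[OF \<phi>(1)] H10_L2[OF w] l] by blast
  show ?thesis
    by (rule that[of "\<phi> \<circ> r"])
      (use \<phi>(1) r LIMSEQ_subseq_LIMSEQ[OF l r(1)] LIMSEQ_subseq_LIMSEQ[OF g r(1)] in \<open>simp_all add: o_def\<close>)
qed

lemma H10_complete:
  assumes h: "\<And>n::nat. h n \<in> H10 \<Omega>"
    and cauchy: "\<And>e. e > 0 \<Longrightarrow> \<exists>N. \<forall>m\<ge>N. \<forall>n\<ge>N. h1_norm \<Omega> (\<lambda>x. h m x - h n x) < e"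
  obtains l where "l \<in> H10 \<Omega>" "(\<lambda>n. h1_norm \<Omega> (\<lambda>x. h n x - l x)) \<longlonglongrightarrow> 0"
proof -
  have c1: "\<exists>N. \<forall>m\<ge>N. \<forall>n\<ge>N. l2_norm \<Omega> (\<lambda>x. h m x - h n x) < e" if e: "e > 0" for e
    using cauchy[OF e] l2_le_h1(1) by (meson le_less_trans)
  have c2: "\<exists>N. \<forall>m\<ge>N. \<forall>n\<ge>N. l2_norm \<Omega> (\<lambda>x. wgrad \<Omega> (h m) x - wgrad \<Omega> (h n) x) < e" if e: "e > 0" for e
  proof -
    obtain N where N: "\<forall>m\<ge>N. \<forall>n\<ge>N. h1_norm \<Omega> (\<lambda>x. h m x - h n x) < e" using cauchy[OF e] by blast
    have "l2_norm \<Omega> (\<lambda>x. wgrad \<Omega> (h m) x - wgrad \<Omega> (h n) x) \<le> h1_norm \<Omega> (\<lambda>x. h m x - h n x)" for m n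
      using l2_le_h1(2)[of "\<lambda>x. h m x - h n x"] by (simp add: wgrad_diff_norm H10_H1 h)
    then show ?thesis using N by (meson le_less_trans)
  qed
  obtain l where l: "l \<in> L2 \<Omega>" "(\<lambda>n. l2_norm \<Omega> (\<lambda>x. h n x - l x)) \<longlonglongrightarrow> 0"
    by (rule L2_complete[OF bounded_dom dom_lebesgue H10_L2[OF h] c1]) blast+
  obtain g where g: "g \<in> L2 \<Omega>" "(\<lambda>n. l2_norm \<Omega> (\<lambda>x. wgrad \<Omega> (h n) x - g x)) \<longlonglongrightarrow> 0"
    by (rule L2_complete[OF bounded_dom dom_lebesgue wgrad_L2[OF h] c2]) blast+
  show ?thesis by (rule that[OF H10_limit(1,3)[OF h l(1) g(1) l(2) g(2)]])
qed

end

subsection \<open>Translations and averages\<close>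

lemma nn_integral_translate:
  fixes f :: "'a::euclidean_space \<Rightarrow> ennreal"
  assumes [measurable]: "f \<in> borel_measurable borel"
  shows "(\<integral>\<^sup>+x. f (h + x) \<partial>lborel) = (\<integral>\<^sup>+x. f x \<partial>lborel)"
proof -
  have "(\<integral>\<^sup>+x. f x \<partial>lborel) = (\<integral>\<^sup>+x. f x \<partial>distr lborel borel ((+) h))" by (simp add: lborel_distr_plus)
  also have "\<dots> = (\<integral>\<^sup>+x. f (h + x) \<partial>lborel)" by (rule nn_integral_distr) auto
  finally show ?thesis by simp
qed

text \<open>The integral of \<open>(f - s)^2\<close> over \<open>K\<close> is nonnegative for every
  \<open>s\<close>; take \<open>s\<close> to be the mean. On a null set it is affine in
  \<open>s\<close>, so the integral of \<open>f\<close> must vanish.\<close>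

lemma cs_compact:
  fixes f :: "'a::euclidean_space \<Rightarrow> real"
  assumes f: "continuous_on K f" and K: "compact K"
  shows "(LINT y|lborel. indicator K y * f y)\<^sup>2 \<le> measure lborel K * (LINT y|lborel. indicator K y * (f y)\<^sup>2)"
proof -
  define m where "m = measure lborel K"
  define I where "I = (LINT y|lborel. indicator K y * f y)"
  define J where "J = (LINT y|lborel. indicator K y * (f y)\<^sup>2)"
  have i1: "integrable lborel (\<lambda>y. indicator K y * f y)"
    using borel_integrable_compact[OF K f] by simp
  have i2: "integrable lborel (\<lambda>y. indicator K y * (f y)\<^sup>2)"
    using borel_integrable_compact[OF K continuous_on_power[OF f]] by simp
  have i0: "integrable lborel (indicator K :: 'a \<Rightarrow> real)"
    using borel_integrable_compact[OF K continuous_on_const[of _ "1::real"]] by simp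
  have q: "0 \<le> m * s\<^sup>2 - 2 * s * I + J" for s
  proof -
    have "0 \<le> (LINT y|lborel. indicator K y * (f y - s)\<^sup>2)" by (intro integral_nonneg_AE) auto
    also have "(\<lambda>y. indicator K y * (f y - s)\<^sup>2) =
        (\<lambda>y. s\<^sup>2 * indicator K y - (2 * s) * (indicator K y * f y) + indicator K y * (f y)\<^sup>2)"
      by (auto simp: fun_eq_iff power2_eq_square algebra_simps)
    also have "(LINT y|lborel. \<dots> y) = s\<^sup>2 * m - (2 * s) * I + J"
      using i0 i1 i2 by (simp add: m_def I_def J_def)
    finally show ?thesis by (simp add: mult.commute)
  qed
  have "I\<^sup>2 \<le> m * J"
  proof (cases "m = 0")
    case True
    have "I = 0"
    proof (rule ccontr)
      assume "I \<noteq> 0"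
      then show False using q[of "(J + 1) / (2 * I)"] True by simp
    qed
    then show ?thesis using True by simp
  next
    case False
    then have m: "m > 0" using measure_nonneg[of lborel K] unfolding m_def by linarith
    have "m * (I / m)\<^sup>2 - 2 * (I / m) * I = - (I\<^sup>2 / m)" using m by (simp add: power2_eq_square)
    then have "I\<^sup>2 / m \<le> J" using q[of "I / m"] by linarith
    then show ?thesis using m by (simp add: pos_divide_le_eq mult.commute)
  qed
  then show ?thesis by (simp add: m_def I_def J_def)
qed

lemma nn_integral_compact:
  fixes f :: "'a::euclidean_space \<Rightarrow> real"
  assumes f: "continuous_on K f" and K: "compact K" and nn: "\<And>x. 0 \<le> f x"
  shows "(\<integral>\<^sup>+y. indicator K y * ennreal (f y) \<partial>lborel) = ennreal (LINT y|lborel. indicator K y * f y)"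
proof -
  have "(\<integral>\<^sup>+y. indicator K y * ennreal (f y) \<partial>lborel) = (\<integral>\<^sup>+y. ennreal (indicator K y * f y) \<partial>lborel)"
    by (intro nn_integral_cong) (auto simp: indicator_def)
  also have "\<dots> = ennreal (LINT y|lborel. indicator K y * f y)"
    using borel_integrable_compact[OF K f] nn by (intro nn_integral_eq_integral) auto
  finally show ?thesis .
qed

text \<open>The fundamental theorem of calculus along the segment from \<open>x\<close> to
  \<open>h + x\<close>, followed by Cauchy-Schwarz in \<open>t\<close>. Nonnegative integrals are
  used so that the order of integration can be exchanged without integrability conditions.\<close>

lemma segment_estimate:
  fixes f :: "'a::euclidean_space \<Rightarrow> real"
  assumes f: "Ck 1 f"
  shows "ennreal ((f (h + x) - f x)\<^sup>2) \<le>
    ennreal ((norm h)\<^sup>2) * (\<integral>\<^sup>+t. indicator {0..1} t * ennreal ((norm (grad f (t *\<^sub>R h + x)))\<^sup>2) \<partial>lborel)"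
proof -
  define g where "g t = grad f (t *\<^sub>R h + x) \<bullet> h" for t
  have cg: "continuous_on {0..1} (\<lambda>t. grad f (t *\<^sub>R h + x))"
    by (rule continuous_on_compose2[OF continuous_grad[OF f, of UNIV]]) (auto intro!: continuous_intros)
  have cg': "continuous_on {0..1} g" unfolding g_def by (intro continuous_intros cg)
  have d: "((\<lambda>t. f (t *\<^sub>R h + x)) has_real_derivative g t) (at t within S)" for t S
  proof -
    have fd: "f differentiable at y" for y using f by simp
    have "((\<lambda>t. f (t *\<^sub>R h + x)) has_derivative (\<lambda>s. grad f (t *\<^sub>R h + x) \<bullet> (s *\<^sub>R h))) (at t within S)"
      by (rule has_derivative_compose[OF _ has_derivative_grad[OF fd]]) (auto intro!: derivative_eq_intros)
    then show ?thesis by (simp add: has_field_derivative_def g_def mult_commute_abs)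
  qed
  have "(LINT t|lborel. indicator {0..1} t * g t) = f (1 *\<^sub>R h + x) - f (0 *\<^sub>R h + x)"
    using integral_FTC_Icc[OF zero_le_one d[unfolded has_real_derivative_iff_has_vector_derivative] cg'] by simp
  then have "(f (h + x) - f x)\<^sup>2 = (LINT t|lborel. indicator {0..1} t * g t)\<^sup>2" by simp
  also have "\<dots> \<le> measure lborel {0..1::real} * (LINT t|lborel. indicator {0..1} t * (g t)\<^sup>2)"
    by (rule cs_compact[OF cg']) simp
  also have "\<dots> = (LINT t|lborel. indicator {0..1} t * (g t)\<^sup>2)" by simp
  also have "\<dots> \<le> (LINT t|lborel. (norm h)\<^sup>2 * (indicator {0..1} t * (norm (grad f (t *\<^sub>R h + x)))\<^sup>2))"
  proof (rule integral_mono)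
    show "integrable lborel (\<lambda>t. indicator {0..1} t * (g t)\<^sup>2)"
      using borel_integrable_compact[OF _ continuous_on_power[OF cg']] by simp
    show "integrable lborel (\<lambda>t. (norm h)\<^sup>2 * (indicator {0..1} t * (norm (grad f (t *\<^sub>R h + x)))\<^sup>2))"
      using borel_integrable_compact[OF _ continuous_on_power[OF continuous_on_norm[OF cg]], of 2]
      by (intro integrable_mult_right) simp
    fix t
    have "\<bar>g t\<bar> \<le> norm (grad f (t *\<^sub>R h + x)) * norm h" unfolding g_def by (rule Cauchy_Schwarz_ineq2)
    from power_mono[OF this, of 2] show "indicator {0..1} t * (g t)\<^sup>2 \<le> (norm h)\<^sup>2 * (indicator {0..1} t * (norm (grad f (t *\<^sub>R h + x)))\<^sup>2)"
      by (auto simp: power_mult_distrib mult.commute indicator_def)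
  qed
  also have "\<dots> = (norm h)\<^sup>2 * (LINT t|lborel. indicator {0..1} t * (norm (grad f (t *\<^sub>R h + x)))\<^sup>2)" by simp
  finally have "ennreal ((f (h + x) - f x)\<^sup>2) \<le> ennreal ((norm h)\<^sup>2) * ennreal (LINT t|lborel. indicator {0..1} t * (norm (grad f (t *\<^sub>R h + x)))\<^sup>2)"
    by (simp add: ennreal_mult'[symmetric] ennreal_leI)
  then show ?thesis
    by (subst nn_integral_compact[OF continuous_on_power[OF continuous_on_norm[OF cg]]]) auto
qed

lemma Ck_measurable:
  assumes "Ck 1 f"
  shows "f \<in> borel_measurable borel" "grad f \<in> borel_measurable borel"
  using Ck_continuous[OF assms] continuous_grad[OF assms] by (auto intro: borel_measurable_continuous_onI)

text \<open>Integrate the segment estimate over \<open>x\<close>, exchange the integrals and undo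
  the shift by \<open>t *\<^sub>R h\<close>. \<open>B\<close> has to contain every segment that
  starts in \<open>A\<close>.\<close>

lemma translation_estimate:
  fixes f :: "'a::euclidean_space \<Rightarrow> real"
  assumes f: "Ck 1 f" and [measurable]: "A \<in> sets borel" "B \<in> sets borel"
    and AB: "\<And>x t. x \<in> A \<Longrightarrow> 0 \<le> t \<Longrightarrow> t \<le> 1 \<Longrightarrow> t *\<^sub>R h + x \<in> B"
  shows "(\<integral>\<^sup>+x. indicator A x * ennreal ((f (h + x) - f x)\<^sup>2) \<partial>lborel) \<le>
    ennreal ((norm h)\<^sup>2) * (\<integral>\<^sup>+x. indicator B x * ennreal ((norm (grad f x))\<^sup>2) \<partial>lborel)"
proof -
  note [measurable] = Ck_measurable[OF f]
  let ?G = "\<lambda>x. indicator B x * ennreal ((norm (grad f x))\<^sup>2)"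
  have "(\<integral>\<^sup>+x. indicator A x * ennreal ((f (h + x) - f x)\<^sup>2) \<partial>lborel) \<le>
      (\<integral>\<^sup>+x. ennreal ((norm h)\<^sup>2) * (\<integral>\<^sup>+t. indicator {0..1} t * ?G (t *\<^sub>R h + x) \<partial>lborel) \<partial>lborel)"
  proof (intro nn_integral_mono)
    fix x :: 'a
    show "indicator A x * ennreal ((f (h + x) - f x)\<^sup>2) \<le> ennreal ((norm h)\<^sup>2) * (\<integral>\<^sup>+t. indicator {0..1} t * ?G (t *\<^sub>R h + x) \<partial>lborel)"
    proof (cases "x \<in> A")
      case True
      have "(\<integral>\<^sup>+t. indicator {0..1} t * ennreal ((norm (grad f (t *\<^sub>R h + x)))\<^sup>2) \<partial>lborel) =
        (\<integral>\<^sup>+t. indicator {0..1} t * ?G (t *\<^sub>R h + x) \<partial>lborel)"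
        using AB[OF True] by (intro nn_integral_cong) (auto simp: indicator_def)
      then show ?thesis using segment_estimate[OF f, of h x] True by simp
    qed simp
  qed
  also have "\<dots> = ennreal ((norm h)\<^sup>2) * (\<integral>\<^sup>+x. (\<integral>\<^sup>+t. indicator {0..1} t * ?G (t *\<^sub>R h + x) \<partial>lborel) \<partial>lborel)"
    by (rule nn_integral_cmult) measurable
  also have "(\<integral>\<^sup>+x. (\<integral>\<^sup>+t. indicator {0..1} t * ?G (t *\<^sub>R h + x) \<partial>lborel) \<partial>lborel) =
    (\<integral>\<^sup>+t. (\<integral>\<^sup>+x. indicator {0..1} t * ?G (t *\<^sub>R h + x) \<partial>lborel) \<partial>lborel)"
    by (rule lborel_pair.Fubini'[symmetric]) measurable
  also have "\<dots> = (\<integral>\<^sup>+t. indicator {0..1::real} t * (\<integral>\<^sup>+x. ?G x \<partial>lborel) \<partial>lborel)"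
  proof (rule nn_integral_cong)
    fix t :: real
    have "(\<integral>\<^sup>+x. indicator {0..1} t * ?G (t *\<^sub>R h + x) \<partial>lborel) = indicator {0..1} t * (\<integral>\<^sup>+x. ?G (t *\<^sub>R h + x) \<partial>lborel)"
      by (rule nn_integral_cmult) measurable
    then show "(\<integral>\<^sup>+x. indicator {0..1} t * ?G (t *\<^sub>R h + x) \<partial>lborel) = indicator {0..1} t * (\<integral>\<^sup>+x. ?G x \<partial>lborel)"
      using nn_integral_translate[of ?G "t *\<^sub>R h"] by simp
  qed
  also have "\<dots> = (\<integral>\<^sup>+x. ?G x \<partial>lborel)" by (simp add: nn_integral_multc)
  finally show ?thesis .
qed

text \<open>Substitute \<open>y = h + x\<close>. For fixed \<open>h\<close>, convexity keeps the
  segment from \<open>x\<close> to \<open>h + x\<close> in \<open>K\<close> whenever both ends are,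
  so the translation estimate applies; integrating over the differences \<open>h\<close> in
  \<open>D\<close> produces the measure of \<open>D\<close>.\<close>

lemma convex_poincare_nn:
  fixes f :: "'a::euclidean_space \<Rightarrow> real"
  assumes f: "Ck 1 f" and [measurable]: "K \<in> sets borel" "D \<in> sets borel" and K: "convex K"
    and D: "\<And>x y. x \<in> K \<Longrightarrow> y \<in> K \<Longrightarrow> y - x \<in> D" "\<And>h. h \<in> D \<Longrightarrow> norm h \<le> R"
  shows "(\<integral>\<^sup>+x. \<integral>\<^sup>+y. indicator K x * indicator K y * ennreal ((f y - f x)\<^sup>2) \<partial>lborel \<partial>lborel) \<le>
    ennreal (R\<^sup>2) * (\<integral>\<^sup>+x. indicator K x * ennreal ((norm (grad f x))\<^sup>2) \<partial>lborel) * emeasure lborel D"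
proof -
  note [measurable] = Ck_measurable[OF f]
  let ?I = "\<integral>\<^sup>+x. indicator K x * ennreal ((norm (grad f x))\<^sup>2) \<partial>lborel"
  let ?F = "\<lambda>x h. indicator K x * indicator K (h + x) * ennreal ((f (h + x) - f x)\<^sup>2) :: ennreal"
  have "(\<integral>\<^sup>+y. indicator K x * indicator K y * ennreal ((f y - f x)\<^sup>2) \<partial>lborel) = (\<integral>\<^sup>+h. ?F x h \<partial>lborel)" for x
    using nn_integral_translate[of "\<lambda>y. indicator K x * indicator K y * ennreal ((f y - f x)\<^sup>2)" x]
    by (simp add: add.commute)
  then have "(\<integral>\<^sup>+x. \<integral>\<^sup>+y. indicator K x * indicator K y * ennreal ((f y - f x)\<^sup>2) \<partial>lborel \<partial>lborel) =
    (\<integral>\<^sup>+x. \<integral>\<^sup>+h. ?F x h \<partial>lborel \<partial>lborel)" by simp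
  also have "\<dots> = (\<integral>\<^sup>+h. \<integral>\<^sup>+x. ?F x h \<partial>lborel \<partial>lborel)"
    by (rule lborel_pair.Fubini'[symmetric]) measurable
  also have "\<dots> \<le> (\<integral>\<^sup>+h. (ennreal (R\<^sup>2) * ?I) * indicator D h \<partial>lborel)"
  proof (rule nn_integral_mono)
    fix h :: 'a
    let ?A = "K \<inter> (+) h -` K"
    have A: "?A \<in> sets borel" by measurable
    have "(\<integral>\<^sup>+x. ?F x h \<partial>lborel) = (\<integral>\<^sup>+x. indicator ?A x * ennreal ((f (h + x) - f x)\<^sup>2) \<partial>lborel)"
      by (intro nn_integral_cong) (auto simp: indicator_def)
    also have "\<dots> \<le> (ennreal (R\<^sup>2) * ?I) * indicator D h"
    proof (cases "h \<in> D")
      case True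
      have "(\<integral>\<^sup>+x. indicator ?A x * ennreal ((f (h + x) - f x)\<^sup>2) \<partial>lborel) \<le> ennreal ((norm h)\<^sup>2) * ?I"
      proof (rule translation_estimate[OF f A])
        fix x t assume x: "x \<in> ?A" and t: "0 \<le> t" "t \<le> (1::real)"
        have "(1 - t) *\<^sub>R x + t *\<^sub>R (h + x) \<in> K" using x t by (intro convexD[OF K]) auto
        then show "t *\<^sub>R h + x \<in> K" by (simp add: algebra_simps)
      qed measurable
      also have "\<dots> \<le> ennreal (R\<^sup>2) * ?I"
        using D(2)[OF True] by (intro mult_right_mono ennreal_leI power_mono) auto
      finally show ?thesis using True by simp
    next
      case False
      then have "?A = {}" using D(1) by fastforce
      then show ?thesis by simp
    qed
    finally show "(\<integral>\<^sup>+x. ?F x h \<partial>lborel) \<le> (ennreal (R\<^sup>2) * ?I) * indicator D h" .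
  qed
  also have "\<dots> = ennreal (R\<^sup>2) * ?I * emeasure lborel D" by (simp add: nn_integral_cmult_indicator)
  finally show ?thesis .
qed

text \<open>The left side is the double integral of \<open>(f y - f x)^2\<close> over
  \<open>K\<close> and \<open>K\<close>, multiplied out. In this form the variance of
  \<open>f\<close> appears without a division by the measure of \<open>K\<close>, which may be
  zero.\<close>

lemma convex_poincare:
  fixes f :: "'a::euclidean_space \<Rightarrow> real"
  assumes f: "Ck 1 f" and K: "convex K" "compact K" and D: "compact D"
    "\<And>x y. x \<in> K \<Longrightarrow> y \<in> K \<Longrightarrow> y - x \<in> D" "\<And>h. h \<in> D \<Longrightarrow> norm h \<le> R"
  shows "2 * (measure lborel K * (LINT x|lborel. indicator K x * (f x)\<^sup>2) - (LINT x|lborel. indicator K x * f x)\<^sup>2)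
    \<le> R\<^sup>2 * measure lborel D * (LINT x|lborel. indicator K x * (norm (grad f x))\<^sup>2)"
proof -
  define m where "m = measure lborel K"
  define I where "I = (LINT y|lborel. indicator K y * f y)"
  define J where "J = (LINT y|lborel. indicator K y * (f y)\<^sup>2)"
  define G where "G = (LINT x|lborel. indicator K x * (norm (grad f x))\<^sup>2)"
  have cf: "continuous_on S f" for S using f by (rule Ck_continuous)
  have i1: "integrable lborel (\<lambda>y. indicator K y * f y)"
    using borel_integrable_compact[OF K(2) cf] by simp
  have i2: "integrable lborel (\<lambda>y. indicator K y * (f y)\<^sup>2)"
    using borel_integrable_compact[OF K(2) continuous_on_power[OF cf]] by simp
  have i0: "integrable lborel (indicator K :: 'a \<Rightarrow> real)"
    using borel_integrable_compact[OF K(2) continuous_on_const[of _ "1::real"]] by simp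
  have Kb: "K \<in> sets borel" "D \<in> sets borel" using K(2) D(1) by (auto intro: borel_compact)
  have fin: "emeasure lborel D = ennreal (measure lborel D)"
    using emeasure_compact_finite[OF D(1)] by (simp add: emeasure_eq_ennreal_measure)
  have inner: "(\<integral>\<^sup>+y. indicator K x * indicator K y * ennreal ((f y - f x)\<^sup>2) \<partial>lborel)
    = indicator K x * ennreal (J - 2 * f x * I + (f x)\<^sup>2 * m)" for x
  proof -
    have "(\<integral>\<^sup>+y. indicator K y * ennreal ((f y - f x)\<^sup>2) \<partial>lborel) = ennreal (LINT y|lborel. indicator K y * (f y - f x)\<^sup>2)"
      by (rule nn_integral_compact[OF _ K(2)]) (auto intro!: continuous_intros cf)
    also have "(\<lambda>y. indicator K y * (f y - f x)\<^sup>2) =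
        (\<lambda>y. (f x)\<^sup>2 * indicator K y - (2 * f x) * (indicator K y * f y) + indicator K y * (f y)\<^sup>2)"
      by (auto simp: fun_eq_iff power2_eq_square algebra_simps)
    also have "(LINT y|lborel. \<dots> y) = J - 2 * f x * I + (f x)\<^sup>2 * m"
      using i0 i1 i2 by (simp add: m_def I_def J_def)
    finally show ?thesis by (cases "x \<in> K") simp_all
  qed
  have pos: "0 \<le> J - 2 * f x * I + (f x)\<^sup>2 * m" for x
  proof -
    have "0 \<le> (LINT y|lborel. indicator K y * (f y - f x)\<^sup>2)" by (intro integral_nonneg_AE) auto
    also have "(\<lambda>y. indicator K y * (f y - f x)\<^sup>2) =
        (\<lambda>y. (f x)\<^sup>2 * indicator K y - (2 * f x) * (indicator K y * f y) + indicator K y * (f y)\<^sup>2)"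
      by (auto simp: fun_eq_iff power2_eq_square algebra_simps)
    also have "(LINT y|lborel. \<dots> y) = J - 2 * f x * I + (f x)\<^sup>2 * m"
      using i0 i1 i2 by (simp add: m_def I_def J_def)
    finally show ?thesis .
  qed
  have "(\<integral>\<^sup>+x. \<integral>\<^sup>+y. indicator K x * indicator K y * ennreal ((f y - f x)\<^sup>2) \<partial>lborel \<partial>lborel)
    = ennreal (LINT x|lborel. indicator K x * (J - 2 * f x * I + (f x)\<^sup>2 * m))"
    unfolding inner by (rule nn_integral_compact[OF _ K(2)]) (auto intro!: continuous_intros cf pos)
  also have "(\<lambda>x. indicator K x * (J - 2 * f x * I + (f x)\<^sup>2 * m)) =
      (\<lambda>x. J * indicator K x - (2 * I) * (indicator K x * f x) + m * (indicator K x * (f x)\<^sup>2))"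
    by (auto simp: fun_eq_iff algebra_simps)
  also have "(LINT x|lborel. \<dots> x) = J * m - (2 * I) * I + m * J"
    using i0 i1 i2 by (simp add: m_def I_def J_def)
  also have "\<dots> = 2 * (m * J - I\<^sup>2)" by (simp add: power2_eq_square algebra_simps)
  finally have "ennreal (2 * (m * J - I\<^sup>2)) \<le> ennreal (R\<^sup>2) * (\<integral>\<^sup>+x. indicator K x * ennreal ((norm (grad f x))\<^sup>2) \<partial>lborel) * emeasure lborel D"
    using convex_poincare_nn[OF f Kb K(1) D(2,3)] by simp
  also have "(\<integral>\<^sup>+x. indicator K x * ennreal ((norm (grad f x))\<^sup>2) \<partial>lborel) = ennreal G"
    unfolding G_def by (rule nn_integral_compact[OF _ K(2)]) (auto intro!: continuous_intros continuous_grad f)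
  finally have "ennreal (2 * (m * J - I\<^sup>2)) \<le> ennreal (R\<^sup>2 * G * measure lborel D)"
    unfolding fin by (simp add: ennreal_mult'[symmetric] ennreal_mult''[symmetric])
  moreover have "0 \<le> R\<^sup>2 * G * measure lborel D"
    unfolding G_def by (intro mult_nonneg_nonneg integral_nonneg_AE) auto
  ultimately have "2 * (m * J - I\<^sup>2) \<le> R\<^sup>2 * G * measure lborel D" by (simp add: ennreal_le_iff)
  then show ?thesis by (simp add: m_def I_def J_def G_def algebra_simps)
qed

section \<open>Averages over cubes of half-width \<open>\<delta>\<close>\<close>

definition cube :: "'a::euclidean_space \<Rightarrow> real \<Rightarrow> 'a set" where
  "cube x \<delta> = cbox (x - \<delta> *\<^sub>R One) (x + \<delta> *\<^sub>R One)"

lemma cube_translate: "h + x \<in> cube x \<delta> \<longleftrightarrow> h \<in> cube 0 \<delta>"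
  by (auto simp: cube_def mem_box algebra_simps)

lemma cube_props [simp]:
  "compact (cube x \<delta>)" "convex (cube x \<delta>)" "cube x \<delta> \<in> sets borel"
  by (simp_all add: cube_def)

lemma cube_sets [measurable]: "cube x \<delta> \<in> sets borel"
  by simp

lemma measure_cube:
  fixes x :: "'a::euclidean_space"
  assumes "\<delta> \<ge> 0"
  shows "measure lborel (cube x \<delta>) = (2 * \<delta>) ^ DIM('a)"
proof -
  have "measure lborel (cube x \<delta>) = (\<Prod>b\<in>(Basis::'a set). 2 * \<delta>)"
    unfolding cube_def using assms
    by (subst measure_lborel_cbox_eq) (auto simp: inner_simps intro!: prod.cong)
  then show ?thesis by simp
qed

lemma norm_cube:
  fixes x y :: "'a::euclidean_space"
  assumes "y \<in> cube x \<delta>"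
  shows "norm (y - x) \<le> \<delta> * DIM('a)"
proof -
  have "norm (y - x) \<le> (\<Sum>b\<in>Basis. \<bar>(y - x) \<bullet> b\<bar>)" by (rule norm_le_l1)
  also have "\<dots> \<le> (\<Sum>b\<in>(Basis::'a set). \<delta>)"
    using assms by (intro sum_mono) (auto simp: cube_def mem_box inner_simps abs_le_iff algebra_simps)
  finally show ?thesis by (simp add: mult.commute)
qed

lemma cube_mono:
  fixes x :: "'a::euclidean_space"
  assumes "\<delta> \<le> \<epsilon>" shows "cube x \<delta> \<subseteq> cube x \<epsilon>"
  unfolding cube_def using assms by (intro subset_box_imp) (auto simp: inner_simps)

lemma cube_diff:
  fixes x :: "'a::euclidean_space"
  assumes "y \<in> cube x \<delta>" "z \<in> cube x \<delta>" shows "z - y \<in> cube 0 (2 * \<delta>)"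
  using assms by (fastforce simp: cube_def mem_box inner_simps)

definition avg :: "real \<Rightarrow> ('a::euclidean_space \<Rightarrow> real) \<Rightarrow> 'a \<Rightarrow> real" where
  "avg \<delta> f x = (LINT y|lborel. indicator (cube x \<delta>) y * f y) / (2 * \<delta>) ^ DIM('a)"

text \<open>The domain of integration no longer depends on \<open>x\<close>, which gives
  measurability and a Lipschitz estimate in \<open>x\<close>.\<close>

lemma avg_alt:
  fixes f :: "'a::euclidean_space \<Rightarrow> real"
  assumes [measurable]: "f \<in> borel_measurable borel"
  shows "avg \<delta> f x = (LINT h|lborel. indicator (cube 0 \<delta>) h * f (h + x)) / (2 * \<delta>) ^ DIM('a)"
proof -
  have "indicator (cube x \<delta>) (x + h) = (indicator (cube 0 \<delta>) h :: real)" for h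
    using cube_translate[of h x \<delta>] by (simp add: indicator_def add.commute)
  then show ?thesis
    unfolding avg_def
    using translation_invariant_integral[of "\<lambda>y. indicator (cube x \<delta>) y * f y" x]
    by (simp add: add.commute)
qed

lemma avg_measurable [measurable]:
  fixes f :: "'a::euclidean_space \<Rightarrow> real"
  assumes [measurable]: "f \<in> borel_measurable borel"
  shows "avg \<delta> f \<in> borel_measurable borel"
proof -
  have "(\<lambda>x. (LINT h|lborel. indicator (cube 0 \<delta>) h * f (h + x))) \<in> borel_measurable lborel"
    by measurable
  then have "(\<lambda>x. (LINT h|lborel. indicator (cube 0 \<delta>) h * f (h + x)) / (2 * \<delta>) ^ DIM('a)) \<in> borel_measurable borel"
    by simp
  moreover have "avg \<delta> f = (\<lambda>x. (LINT h|lborel. indicator (cube 0 \<delta>) h * f (h + x)) / (2 * \<delta>) ^ DIM('a))"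
    using avg_alt[OF assms] by blast
  ultimately show ?thesis by simp
qed

lemma integral_cube_const:
  fixes x :: "'a::euclidean_space"
  assumes "\<delta> > 0" "continuous_on UNIV f"
  shows "(LINT y|lborel. indicator (cube x \<delta>) y * (f y - c)) = (LINT y|lborel. indicator (cube x \<delta>) y * f y) - c * (2 * \<delta>) ^ DIM('a)"
proof -
  have i1: "integrable lborel (\<lambda>y. indicator (cube x \<delta>) y * f y)"
    using borel_integrable_compact[OF cube_props(1) continuous_on_subset[OF assms(2) subset_UNIV]] by simp
  have i0: "integrable lborel (indicator (cube x \<delta>) :: 'a \<Rightarrow> real)"
    using borel_integrable_compact[OF cube_props(1) continuous_on_const[of _ "1::real"]] by simp
  have "(\<lambda>y. indicator (cube x \<delta>) y * (f y - c)) = (\<lambda>y. indicator (cube x \<delta>) y * f y - c * indicator (cube x \<delta>) y)"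
    by (auto simp: algebra_simps)
  then have "(LINT y|lborel. indicator (cube x \<delta>) y * (f y - c)) = (LINT y|lborel. indicator (cube x \<delta>) y * f y) - c * measure lborel (cube x \<delta>)"
    using i1 i0 by simp
  then show ?thesis using measure_cube[of \<delta> x] assms(1) by simp
qed

text \<open>Jensen's inequality for the mean over the cube, obtained from Cauchy-Schwarz.\<close>

lemma avg_minus_sq:
  fixes f :: "'a::euclidean_space \<Rightarrow> real"
  assumes "\<delta> > 0" "continuous_on UNIV f"
  shows "(avg \<delta> f x - c)\<^sup>2 \<le> (LINT y|lborel. indicator (cube x \<delta>) y * (f y - c)\<^sup>2) / (2 * \<delta>) ^ DIM('a)"
proof -
  let ?m = "(2 * \<delta>) ^ DIM('a)"
  have m: "?m > 0" using assms(1) by simp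
  have "avg \<delta> f x - c = (LINT y|lborel. indicator (cube x \<delta>) y * (f y - c)) / ?m"
  proof -
    have "c * ?m / ?m = c" by (rule nonzero_mult_div_cancel_right) (use m in linarith)
    then show ?thesis unfolding integral_cube_const[OF assms] avg_def by (simp only: diff_divide_distrib)
  qed
  then have "(avg \<delta> f x - c)\<^sup>2 = (LINT y|lborel. indicator (cube x \<delta>) y * (f y - c))\<^sup>2 / ?m\<^sup>2"
    by (simp add: power_divide)
  also have "\<dots> \<le> (?m * (LINT y|lborel. indicator (cube x \<delta>) y * (f y - c)\<^sup>2)) / ?m\<^sup>2"
  proof (intro divide_right_mono)
    have "continuous_on (cube x \<delta>) (\<lambda>y. f y - c)"
      by (intro continuous_intros continuous_on_subset[OF assms(2) subset_UNIV])
    from cs_compact[OF this cube_props(1)] show "(LINT y|lborel. indicator (cube x \<delta>) y * (f y - c))\<^sup>2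
      \<le> ?m * (LINT y|lborel. indicator (cube x \<delta>) y * (f y - c)\<^sup>2)"
      using measure_cube[of \<delta> x] assms(1) by simp
  qed simp
  also have "\<dots> = (LINT y|lborel. indicator (cube x \<delta>) y * (f y - c)\<^sup>2) / ?m"
    using m by (simp add: power2_eq_square)
  finally show ?thesis .
qed

section \<open>Averages of a continuously differentiable function with compact support\<close>

locale smooth_compact =
  fixes f :: "'a::euclidean_space \<Rightarrow> real" and K :: "'a set"
  assumes C1: "Ck 1 f" and K: "compact K" "\<And>x. x \<notin> K \<Longrightarrow> f x = 0" "\<And>x. x \<notin> K \<Longrightarrow> grad f x = 0"
begin

definition "N = (LINT x|lborel. (f x)\<^sup>2)"
definition "G = (LINT x|lborel. (norm (grad f x))\<^sup>2)"

lemma cont: "continuous_on S f" "continuous_on S (grad f)"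
  using Ck_continuous[OF C1] continuous_grad[OF C1] by auto

lemmas meas [measurable] = Ck_measurable[OF C1]

lemma int_sq: "integrable lborel (\<lambda>x. (f x)\<^sup>2)" "integrable lborel (\<lambda>x. (norm (grad f x))\<^sup>2)"
  by (rule integrable_compact_support[of _ K]; auto intro!: continuous_intros cont K simp: K)+

lemma nn_N: "(\<integral>\<^sup>+x. ennreal ((f x)\<^sup>2) \<partial>lborel) = ennreal N"
  unfolding N_def by (rule nn_integral_eq_integral) (auto intro: int_sq)

lemma nn_G: "(\<integral>\<^sup>+x. ennreal ((norm (grad f x))\<^sup>2) \<partial>lborel) = ennreal G"
  unfolding G_def by (rule nn_integral_eq_integral) (auto intro: int_sq)

lemma NG_nonneg [simp]: "0 \<le> N" "0 \<le> G"
  unfolding N_def G_def by (auto intro: integral_nonneg_AE)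

lemma translate_le: "(\<integral>\<^sup>+x. ennreal ((f (h + x) - f x)\<^sup>2) \<partial>lborel) \<le> ennreal ((norm h)\<^sup>2 * G)"
  using translation_estimate[OF C1, of UNIV UNIV h] by (simp add: nn_G ennreal_mult')

lemma avg_sq_le:
  assumes "\<delta> > 0" shows "(avg \<delta> f x)\<^sup>2 \<le> N / (2 * \<delta>) ^ DIM('a)"
proof -
  have "(avg \<delta> f x - 0)\<^sup>2 \<le> (LINT y|lborel. indicator (cube x \<delta>) y * (f y - 0)\<^sup>2) / (2 * \<delta>) ^ DIM('a)"
    by (rule avg_minus_sq[OF assms cont(1)])
  also have "\<dots> \<le> N / (2 * \<delta>) ^ DIM('a)"
  proof (intro divide_right_mono)
    show "(LINT y|lborel. indicator (cube x \<delta>) y * (f y - 0)\<^sup>2) \<le> N"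
      unfolding N_def
    proof (rule integral_mono)
      show "integrable lborel (\<lambda>y. indicator (cube x \<delta>) y * (f y - 0)\<^sup>2)"
        using borel_integrable_compact[OF cube_props(1) continuous_on_power[OF cont(1)]] by simp
    qed (auto intro: int_sq simp: indicator_def)
  qed (use assms in simp)
  finally show ?thesis by simp
qed

text \<open>Jensen's inequality at each point, then the translation estimate for each shift in the
  cube, whose length is at most \<open>\<delta> * DIM('a)\<close>. The first-order rate in
  \<open>\<delta>\<close> serves both the \<open>L^4\<close> bound and compactness.\<close>

lemma avg_diff_L2:
  assumes \<delta>: "\<delta> > 0"
  shows "(\<integral>\<^sup>+x. ennreal ((avg \<delta> f x - f x)\<^sup>2) \<partial>lborel) \<le> ennreal ((\<delta> * DIM('a))\<^sup>2 * G)"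
proof -
  let ?m = "(2 * \<delta>) ^ DIM('a)"
  have m: "?m > 0" using \<delta> by simp
  have "ennreal ((avg \<delta> f x - f x)\<^sup>2) \<le> ennreal (1 / ?m) * (\<integral>\<^sup>+h. indicator (cube 0 \<delta>) h * ennreal ((f (h + x) - f x)\<^sup>2) \<partial>lborel)" for x
  proof -
    have "ennreal ((avg \<delta> f x - f x)\<^sup>2) \<le> ennreal ((1 / ?m) * (LINT y|lborel. indicator (cube x \<delta>) y * (f y - f x)\<^sup>2))"
      using avg_minus_sq[OF \<delta> cont(1), of x "f x"] by (simp add: ennreal_leI)
    also have "\<dots> = ennreal (1 / ?m) * ennreal (LINT y|lborel. indicator (cube x \<delta>) y * (f y - f x)\<^sup>2)"
      using m by (intro ennreal_mult') simp
    also have "ennreal (LINT y|lborel. indicator (cube x \<delta>) y * (f y - f x)\<^sup>2) =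
        (\<integral>\<^sup>+y. indicator (cube x \<delta>) y * ennreal ((f y - f x)\<^sup>2) \<partial>lborel)"
      by (rule nn_integral_compact[symmetric]) (auto intro!: continuous_intros cont)
    also have "\<dots> = (\<integral>\<^sup>+h. indicator (cube 0 \<delta>) h * ennreal ((f (h + x) - f x)\<^sup>2) \<partial>lborel)"
    proof -
      have "indicator (cube x \<delta>) (x + h) = (indicator (cube 0 \<delta>) h :: ennreal)" for h
        using cube_translate[of h x \<delta>] by (simp add: indicator_def add.commute)
      then show ?thesis
        using nn_integral_translate[of "\<lambda>y. indicator (cube x \<delta>) y * ennreal ((f y - f x)\<^sup>2)" x]
        by (simp add: add.commute)
    qed
    finally show ?thesis .
  qed
  then have "(\<integral>\<^sup>+x. ennreal ((avg \<delta> f x - f x)\<^sup>2) \<partial>lborel) \<le>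
      (\<integral>\<^sup>+x. ennreal (1 / ?m) * (\<integral>\<^sup>+h. indicator (cube 0 \<delta>) h * ennreal ((f (h + x) - f x)\<^sup>2) \<partial>lborel) \<partial>lborel)"
    by (intro nn_integral_mono)
  also have "\<dots> = ennreal (1 / ?m) * (\<integral>\<^sup>+x. \<integral>\<^sup>+h. indicator (cube 0 \<delta>) h * ennreal ((f (h + x) - f x)\<^sup>2) \<partial>lborel \<partial>lborel)"
    by (rule nn_integral_cmult) measurable
  also have "(\<integral>\<^sup>+x. \<integral>\<^sup>+h. indicator (cube 0 \<delta>) h * ennreal ((f (h + x) - f x)\<^sup>2) \<partial>lborel \<partial>lborel)
      = (\<integral>\<^sup>+h. \<integral>\<^sup>+x. indicator (cube 0 \<delta>) h * ennreal ((f (h + x) - f x)\<^sup>2) \<partial>lborel \<partial>lborel)"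
    by (rule lborel_pair.Fubini'[symmetric]) measurable
  also have "\<dots> \<le> (\<integral>\<^sup>+h. ennreal ((\<delta> * DIM('a))\<^sup>2 * G) * indicator (cube (0::'a) \<delta>) h \<partial>lborel)"
  proof (rule nn_integral_mono)
    fix h :: 'a
    have "(\<integral>\<^sup>+x. indicator (cube 0 \<delta>) h * ennreal ((f (h + x) - f x)\<^sup>2) \<partial>lborel) = indicator (cube 0 \<delta>) h * (\<integral>\<^sup>+x. ennreal ((f (h + x) - f x)\<^sup>2) \<partial>lborel)"
      by (rule nn_integral_cmult) measurable
    also have "\<dots> \<le> ennreal ((\<delta> * DIM('a))\<^sup>2 * G) * indicator (cube 0 \<delta>) h"
    proof (cases "h \<in> cube 0 \<delta>")
      case True
      have "ennreal ((norm h)\<^sup>2 * G) \<le> ennreal ((\<delta> * DIM('a))\<^sup>2 * G)"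
        using norm_cube[OF True] by (intro ennreal_leI mult_right_mono power_mono) auto
      then show ?thesis using order_trans[OF translate_le[of h]] True by simp
    qed simp
    finally show "(\<integral>\<^sup>+x. indicator (cube 0 \<delta>) h * ennreal ((f (h + x) - f x)\<^sup>2) \<partial>lborel) \<le> ennreal ((\<delta> * DIM('a))\<^sup>2 * G) * indicator (cube 0 \<delta>) h" .
  qed
  also have "\<dots> = ennreal ((\<delta> * DIM('a))\<^sup>2 * G) * emeasure lborel (cube (0::'a) \<delta>)" by (simp add: nn_integral_cmult_indicator)
  also have "emeasure lborel (cube (0::'a) \<delta>) = ennreal ?m"
    using emeasure_compact_finite[OF cube_props(1), of "0::'a" \<delta>] measure_cube[of \<delta> "0::'a"] \<delta>
    by (simp add: emeasure_eq_ennreal_measure)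
  finally have "(\<integral>\<^sup>+x. ennreal ((avg \<delta> f x - f x)\<^sup>2) \<partial>lborel) \<le> ennreal (1 / ?m) * (ennreal ((\<delta> * DIM('a))\<^sup>2 * G) * ennreal ?m)"
    by (simp add: mult_left_mono)
  also have "\<dots> = ennreal ((1 / ?m) * (((\<delta> * DIM('a))\<^sup>2 * G) * ?m))"
    using m \<delta> by (simp only: ennreal_mult' NG_nonneg mult_nonneg_nonneg zero_le_power2 less_imp_le zero_le_divide_1_iff)
  also have "(1 / ?m) * (((\<delta> * DIM('a))\<^sup>2 * G) * ?m) = (\<delta> * DIM('a))\<^sup>2 * G" using m by simp
  finally show ?thesis .
qed

text \<open>The constant depends on \<open>f\<close> only through its gradient norm, so a family
  bounded in \<open>H^1\<close> has equicontinuous averages.\<close>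

lemma avg_lipschitz:
  assumes \<delta>: "\<delta> > 0"
  shows "(avg \<delta> f x - avg \<delta> f x')\<^sup>2 \<le> (norm (x - x'))\<^sup>2 * G / (2 * \<delta>) ^ DIM('a)"
proof -
  let ?m = "(2 * \<delta>) ^ DIM('a)" and ?Q = "cube (0::'a) \<delta>"
  have m: "?m > 0" using \<delta> by simp
  define g where "g h = f (h + x) - f (h + x')" for h
  have cg: "continuous_on S g" for S
    unfolding g_def by (intro continuous_intros continuous_on_compose2[OF cont(1)[of UNIV]]) auto
  have i: "integrable lborel (\<lambda>h. indicator ?Q h * f (h + z))" for z
  proof -
    have "continuous_on ?Q (\<lambda>h. f (h + z))"
      by (rule continuous_on_compose2[OF cont(1)[of UNIV]]) (auto intro!: continuous_intros)
    then show ?thesis using borel_integrable_compact[OF cube_props(1)] by fastforce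
  qed
  have "avg \<delta> f x - avg \<delta> f x' = (LINT h|lborel. indicator ?Q h * g h) / ?m"
    unfolding avg_alt[OF meas(1)] g_def using i by (simp add: diff_divide_distrib[symmetric] right_diff_distrib)
  then have "(avg \<delta> f x - avg \<delta> f x')\<^sup>2 = (LINT h|lborel. indicator ?Q h * g h)\<^sup>2 / ?m\<^sup>2" by (simp add: power_divide)
  also have "\<dots> \<le> (?m * (LINT h|lborel. indicator ?Q h * (g h)\<^sup>2)) / ?m\<^sup>2"
    using cs_compact[OF cg cube_props(1), of 0 \<delta>] measure_cube[of \<delta> "0::'a"] \<delta>
    by (intro divide_right_mono) auto
  also have "\<dots> = (LINT h|lborel. indicator ?Q h * (g h)\<^sup>2) / ?m"
    using m by (simp add: power2_eq_square)
  also have "\<dots> \<le> ((norm (x - x'))\<^sup>2 * G) / ?m"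
  proof (intro divide_right_mono)
    have "ennreal (LINT h|lborel. indicator ?Q h * (g h)\<^sup>2) = (\<integral>\<^sup>+h. indicator ?Q h * ennreal ((g h)\<^sup>2) \<partial>lborel)"
      by (rule nn_integral_compact[symmetric]) (auto intro!: continuous_intros cg)
    also have "\<dots> \<le> (\<integral>\<^sup>+h. ennreal ((g h)\<^sup>2) \<partial>lborel)" by (intro nn_integral_mono) (auto simp: indicator_def)
    also have "\<dots> = (\<integral>\<^sup>+h. ennreal ((f ((x - x') + h) - f h)\<^sup>2) \<partial>lborel)"
      using nn_integral_translate[of "\<lambda>h. ennreal ((f ((x - x') + h) - f h)\<^sup>2)" x'] by (simp add: g_def add.commute)
    also have "\<dots> \<le> ennreal ((norm (x - x'))\<^sup>2 * G)" by (rule translate_le)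
    finally show "(LINT h|lborel. indicator ?Q h * (g h)\<^sup>2) \<le> (norm (x - x'))\<^sup>2 * G"
      by (subst (asm) ennreal_le_iff) auto
  qed (use m in simp)
  finally show ?thesis by simp
qed

text \<open>The mean over the half cube differs from the mean over the full cube, in square, by at
  most the squared deviation integrated over the full cube and divided by the volume of the half
  cube. Poincare's inequality on the full cube then gives the order \<open>\<delta>^(2 - d)\<close>
  in dimension \<open>d\<close>.\<close>

lemma avg_half_step:
  assumes \<delta>: "\<delta> > 0"
  shows "(avg (\<delta> / 2) f x - avg \<delta> f x)\<^sup>2 \<le> 2 * (real DIM('a))\<^sup>2 * 2 ^ DIM('a) * (\<delta>\<^sup>2 / \<delta> ^ DIM('a)) * G"
proof -
  let ?d = "DIM('a)"
  define m where "m = (2 * \<delta>) ^ ?d"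
  define m' where "m' = \<delta> ^ ?d"
  have m: "m > 0" "m' > 0" using \<delta> by (simp_all add: m_def m'_def)
  let ?c = "avg \<delta> f x"
  define I where "I = (LINT y|lborel. indicator (cube x \<delta>) y * f y)"
  define J where "J = (LINT y|lborel. indicator (cube x \<delta>) y * (f y)\<^sup>2)"
  have c: "?c = I / m" by (simp add: avg_def I_def m_def)
  have i1: "integrable lborel (\<lambda>y. indicator (cube x \<delta>) y * f y)"
    using borel_integrable_compact[OF cube_props(1) cont(1)] by simp
  have i2: "integrable lborel (\<lambda>y. indicator (cube x \<delta>) y * (f y)\<^sup>2)"
    using borel_integrable_compact[OF cube_props(1) continuous_on_power[OF cont(1)]] by simp
  have i0: "integrable lborel (indicator (cube x \<delta>) :: 'a \<Rightarrow> real)"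
    using borel_integrable_compact[OF cube_props(1) continuous_on_const[of _ "1::real"]] by simp
  have i3: "integrable lborel (\<lambda>y. indicator (cube x s) y * (f y - ?c)\<^sup>2)" for s
    using borel_integrable_compact[OF cube_props(1), of x s "\<lambda>y. (f y - ?c)\<^sup>2"] by (simp add: cont continuous_intros)
  have "(avg (\<delta> / 2) f x - ?c)\<^sup>2 \<le> (LINT y|lborel. indicator (cube x (\<delta> / 2)) y * (f y - ?c)\<^sup>2) / m'"
    using avg_minus_sq[of "\<delta> / 2" f x ?c] \<delta> cont by (simp add: m'_def)
  also have "\<dots> \<le> (LINT y|lborel. indicator (cube x \<delta>) y * (f y - ?c)\<^sup>2) / m'"
    using m cube_mono[of "\<delta> / 2" \<delta> x] \<delta>
    by (intro divide_right_mono integral_mono i3) (auto simp: indicator_def)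
  also have "(\<lambda>y. indicator (cube x \<delta>) y * (f y - ?c)\<^sup>2) =
      (\<lambda>y. ?c\<^sup>2 * indicator (cube x \<delta>) y - (2 * ?c) * (indicator (cube x \<delta>) y * f y) + indicator (cube x \<delta>) y * (f y)\<^sup>2)"
    by (auto simp: fun_eq_iff power2_eq_square algebra_simps)
  also have "(LINT y|lborel. \<dots> y) = ?c\<^sup>2 * m - (2 * ?c) * I + J"
    using i0 i1 i2 measure_cube[of \<delta> x] \<delta> by (simp add: m_def I_def J_def)
  also have "\<dots> = (m * J - I\<^sup>2) / m" unfolding c using m by (simp add: power2_eq_square field_simps)
  also have "(m * J - I\<^sup>2) / m / m' \<le> (1/2 * ((2 * \<delta> * ?d)\<^sup>2 * (4 * \<delta>) ^ ?d * G)) / m / m'"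
  proof (intro divide_right_mono)
    have "2 * (measure lborel (cube x \<delta>) * J - I\<^sup>2)
      \<le> (2 * \<delta> * ?d)\<^sup>2 * measure lborel (cube (0::'a) (2 * \<delta>)) * (LINT y|lborel. indicator (cube x \<delta>) y * (norm (grad f y))\<^sup>2)"
      unfolding J_def I_def
    proof (rule convex_poincare[OF C1 cube_props(2,1) cube_props(1)])
      show "norm h \<le> 2 * \<delta> * ?d" if "h \<in> cube (0::'a) (2 * \<delta>)" for h using norm_cube[OF that] by simp
    qed (auto intro: cube_diff)
    also have "\<dots> \<le> (2 * \<delta> * ?d)\<^sup>2 * measure lborel (cube (0::'a) (2 * \<delta>)) * G"
    proof (intro mult_left_mono)
      show "(LINT y|lborel. indicator (cube x \<delta>) y * (norm (grad f y))\<^sup>2) \<le> G"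
        unfolding G_def
      proof (rule integral_mono)
        show "integrable lborel (\<lambda>y. indicator (cube x \<delta>) y * (norm (grad f y))\<^sup>2)"
          using borel_integrable_compact[OF cube_props(1) continuous_on_power[OF continuous_on_norm[OF cont(2)]]] by simp
      qed (auto intro: int_sq simp: indicator_def)
    qed auto
    finally show "m * J - I\<^sup>2 \<le> 1/2 * ((2 * \<delta> * ?d)\<^sup>2 * (4 * \<delta>) ^ ?d * G)"
      using \<delta> by (simp add: measure_cube m_def)
  qed (use m in auto)
  also have "\<dots> = 2 * (real ?d)\<^sup>2 * 2 ^ ?d * (\<delta>\<^sup>2 / \<delta> ^ ?d) * G"
  proof -
    have "(4 * \<delta>) ^ ?d = 2 ^ ?d * m"
      using power_mult_distrib[of 2 "2 * \<delta>" ?d] by (simp add: m_def)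
    then have "1/2 * ((2 * \<delta> * ?d)\<^sup>2 * (4 * \<delta>) ^ ?d * G) / m / m' = 1/2 * ((2 * \<delta> * ?d)\<^sup>2 * 2 ^ ?d * G) / m'"
      using m by simp
    then show ?thesis by (simp add: m'_def power_mult_distrib)
  qed
  finally show ?thesis .
qed

lemma avg_tendsto:
  assumes "\<And>n. \<delta> n > 0" "\<delta> \<longlonglongrightarrow> 0"
  shows "(\<lambda>n. avg (\<delta> n) f x) \<longlonglongrightarrow> f x"
proof (rule LIMSEQ_I)
  fix e :: real assume e: "e > 0"
  have "isCont f x" using cont(1)[of UNIV] by (simp add: continuous_on_eq_continuous_at)
  then obtain s where s: "s > 0" "\<And>y. norm (y - x) < s \<Longrightarrow> \<bar>f y - f x\<bar> < e / 2"
    unfolding continuous_at_eps_delta using e by (metis dist_norm dist_real_def half_gt_zero)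
  have "(\<lambda>n. \<delta> n * DIM('a)) \<longlonglongrightarrow> (0::real) * real DIM('a)" by (intro tendsto_intros assms)
  then obtain n0 where n0: "\<And>n. n \<ge> n0 \<Longrightarrow> \<delta> n * DIM('a) < s"
    using s(1) order_tendstoD(2)[of "\<lambda>n. \<delta> n * DIM('a)" 0 sequentially s] by (auto simp: eventually_sequentially)
  have "\<bar>avg (\<delta> n) f x - f x\<bar> \<le> e / 2" if n: "n \<ge> n0" for n
  proof -
    let ?Q = "cube x (\<delta> n)" and ?m = "(2 * \<delta> n) ^ DIM('a)"
    have m: "?m > 0" using assms(1)[of n] by simp
    have "(LINT y|lborel. indicator ?Q y * (f y - f x)\<^sup>2) \<le> (LINT y|lborel. (e / 2)\<^sup>2 * indicator ?Q y)"
    proof (rule integral_mono)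
      show "integrable lborel (\<lambda>y. indicator ?Q y * (f y - f x)\<^sup>2)"
        using borel_integrable_compact[OF cube_props(1), of x "\<delta> n" "\<lambda>y. (f y - f x)\<^sup>2"] by (simp add: cont continuous_intros)
      show "integrable lborel (\<lambda>y. (e / 2)\<^sup>2 * indicator ?Q y)"
        using borel_integrable_compact[OF cube_props(1) continuous_on_const[of _ "1::real"], of x "\<delta> n"] by simp
      fix y
      show "indicator ?Q y * (f y - f x)\<^sup>2 \<le> (e / 2)\<^sup>2 * indicator ?Q y"
      proof (cases "y \<in> ?Q")
        case True
        then have "\<bar>f y - f x\<bar> < e / 2" using norm_cube[OF True] n0[OF n] by (intro s(2)) simp
        then have "(f y - f x)\<^sup>2 \<le> (e / 2)\<^sup>2" using e by (metis abs_le_square_iff abs_of_pos half_gt_zero less_imp_le)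
        then show ?thesis using True by simp
      qed simp
    qed
    also have "\<dots> = (e / 2)\<^sup>2 * ?m" using measure_cube[of "\<delta> n" x] assms(1)[of n] by simp
    finally have "(avg (\<delta> n) f x - f x)\<^sup>2 \<le> (e / 2)\<^sup>2"
      using order_trans[OF avg_minus_sq[OF assms(1) cont(1), of n x "f x"], of "(e / 2)\<^sup>2"] m
      by (simp only: pos_divide_le_eq)
    then show ?thesis using e by (metis abs_le_square_iff abs_of_pos half_gt_zero)
  qed
  then show "\<exists>no. \<forall>n\<ge>no. norm (avg (\<delta> n) f x - f x) < e" using e by (intro exI[of _ n0]) fastforce
qed

end

text \<open>Two applications of Cauchy-Schwarz with weights \<open>p ^ j\<close>,
  \<open>p = 19/20\<close>. The sum of \<open>p ^ (2 j)\<close> is at most 11, it enters three times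
  (\<open>1331 = 11^3\<close>), and \<open>p ^ (-6)\<close> is at most \<open>10/7\<close>. Any
  growth rate below 2 would do, since it has to be beaten by a decay like
  \<open>2^(-j)\<close>.\<close>

lemma fourth_power_sum_le:
  fixes b :: "nat \<Rightarrow> real"
  shows "(\<Sum>j<n. b j) ^ 4 \<le> 1331 * (\<Sum>j<n. (10 / 7) ^ j * b j ^ 4)"
proof -
  define p :: real where "p = 19 / 20"
  have p: "p > 0" by (simp add: p_def)
  define S where "S = (\<Sum>j<n. (p ^ j)\<^sup>2)"
  have S: "0 \<le> S" "S \<le> 11"
  proof -
    show "0 \<le> S" unfolding S_def by (intro sum_nonneg) simp
    have "S = (\<Sum>j<n. (p\<^sup>2) ^ j)" unfolding S_def by (simp add: power_mult[symmetric] mult.commute)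
    also have "\<dots> = (1 - (p\<^sup>2) ^ n) / (1 - p\<^sup>2)"
      by (subst sum_gp_strict) (auto simp: p_def power2_eq_square)
    also have "\<dots> \<le> 1 / (1 - p\<^sup>2)" by (intro divide_right_mono) (auto simp: p_def power2_eq_square)
    also have "\<dots> \<le> 11" by (simp add: p_def power2_eq_square)
    finally show "S \<le> 11" .
  qed
  define T where "T = (\<Sum>j<n. (b j / p ^ j)\<^sup>2)"
  define U where "U = (\<Sum>j<n. ((b j / p ^ j)\<^sup>2 / p ^ j)\<^sup>2)"
  have "(\<Sum>j<n. b j) = (\<Sum>j<n. p ^ j * (b j / p ^ j))" using p by simp
  then have 1: "(\<Sum>j<n. b j)\<^sup>2 \<le> S * T"
    using Cauchy_Schwarz_ineq_sum[of "\<lambda>j. p ^ j" "\<lambda>j. b j / p ^ j" "{..<n}"] by (simp add: S_def T_def)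
  have "T = (\<Sum>j<n. p ^ j * ((b j / p ^ j)\<^sup>2 / p ^ j))" unfolding T_def using p by simp
  then have 2: "T\<^sup>2 \<le> S * U"
    using Cauchy_Schwarz_ineq_sum[of "\<lambda>j. p ^ j" "\<lambda>j. (b j / p ^ j)\<^sup>2 / p ^ j" "{..<n}"] by (simp add: S_def U_def)
  have U: "U \<le> (\<Sum>j<n. (10 / 7) ^ j * b j ^ 4)"
    unfolding U_def
  proof (rule sum_mono)
    fix j
    have "((b j / p ^ j)\<^sup>2 / p ^ j)\<^sup>2 = (1 / p ^ 6) ^ j * b j ^ 4"
      by (simp add: power_divide power_mult[symmetric] mult.commute power_add[symmetric] power_mult_distrib)
    also have "\<dots> \<le> (10 / 7) ^ j * b j ^ 4"
      by (rule mult_right_mono[OF power_mono]) (simp_all add: p_def power_divide)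
    finally show "((b j / p ^ j)\<^sup>2 / p ^ j)\<^sup>2 \<le> (10 / 7) ^ j * b j ^ 4" .
  qed
  have U0: "0 \<le> U" "0 \<le> T" unfolding U_def T_def by (intro sum_nonneg; simp)+
  have "(\<Sum>j<n. b j) ^ 4 = ((\<Sum>j<n. b j)\<^sup>2)\<^sup>2" by simp
  also have "\<dots> \<le> (S * T)\<^sup>2" by (rule power_mono[OF 1]) simp
  also have "\<dots> \<le> S\<^sup>2 * (S * U)" using 2 by (simp add: power_mult_distrib mult_left_mono)
  also have "\<dots> \<le> 11\<^sup>2 * (11 * U)" using S U0 by (intro mult_mono power_mono) auto
  also have "\<dots> \<le> 1331 * (\<Sum>j<n. (10 / 7) ^ j * b j ^ 4)" using U by simp
  finally show ?thesis .
qed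

lemma fourth_power_add_le: "(a + b :: real) ^ 4 \<le> 8 * a ^ 4 + 8 * b ^ 4"
proof -
  have *: "(s + t)\<^sup>2 \<le> 2 * s\<^sup>2 + 2 * t\<^sup>2" for s t :: real
    using zero_le_power2[of "s - t"] by (simp add: power2_eq_square algebra_simps)
  have "(a + b) ^ 4 = ((a + b)\<^sup>2)\<^sup>2" by simp
  also have "\<dots> \<le> (2 * a\<^sup>2 + 2 * b\<^sup>2)\<^sup>2" by (rule power_mono[OF *]) simp
  also have "\<dots> \<le> 2 * (2 * a\<^sup>2)\<^sup>2 + 2 * (2 * b\<^sup>2)\<^sup>2" by (rule *)
  finally show ?thesis by (simp add: power_mult_distrib)
qed

text \<open>Interpolation of \<open>L^4\<close> between the supremum and \<open>L^2\<close>.\<close>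

lemma nn_integral_fourth_power:
  fixes g :: "'a \<Rightarrow> real"
  assumes [measurable]: "g \<in> borel_measurable M" and A: "\<And>x. (g x)\<^sup>2 \<le> A" "0 \<le> A"
    and B: "(\<integral>\<^sup>+x. ennreal ((g x)\<^sup>2) \<partial>M) \<le> ennreal B" "0 \<le> B"
  shows "(\<integral>\<^sup>+x. ennreal (g x ^ 4) \<partial>M) \<le> ennreal (A * B)"
proof -
  have "(\<integral>\<^sup>+x. ennreal (g x ^ 4) \<partial>M) \<le> (\<integral>\<^sup>+x. ennreal A * ennreal ((g x)\<^sup>2) \<partial>M)"
  proof (rule nn_integral_mono)
    fix x
    have "g x ^ 4 = (g x)\<^sup>2 * (g x)\<^sup>2" by (simp add: power_add[symmetric])
    also have "\<dots> \<le> A * (g x)\<^sup>2" by (intro mult_right_mono A) simp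
    finally show "ennreal (g x ^ 4) \<le> ennreal A * ennreal ((g x)\<^sup>2)"
      using A(2) by (simp add: ennreal_mult'[symmetric] ennreal_leI)
  qed
  also have "\<dots> = ennreal A * (\<integral>\<^sup>+x. ennreal ((g x)\<^sup>2) \<partial>M)" by (rule nn_integral_cmult) measurable
  also have "\<dots> \<le> ennreal A * ennreal B" by (intro mult_left_mono B) simp
  finally show ?thesis using A(2) by (simp add: ennreal_mult')
qed

lemma nn_integral_sq_add_le:
  fixes g h :: "'a \<Rightarrow> real"
  assumes [measurable]: "g \<in> borel_measurable M" "h \<in> borel_measurable M"
    and "(\<integral>\<^sup>+x. ennreal ((g x)\<^sup>2) \<partial>M) \<le> ennreal A" "(\<integral>\<^sup>+x. ennreal ((h x)\<^sup>2) \<partial>M) \<le> ennreal B" "0 \<le> A" "0 \<le> B"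
  shows "(\<integral>\<^sup>+x. ennreal ((g x - h x)\<^sup>2) \<partial>M) \<le> ennreal (2 * A + 2 * B)"
proof -
  have "(\<integral>\<^sup>+x. ennreal ((g x - h x)\<^sup>2) \<partial>M) \<le> (\<integral>\<^sup>+x. 2 * ennreal ((g x)\<^sup>2) + 2 * ennreal ((h x)\<^sup>2) \<partial>M)"
  proof (rule nn_integral_mono)
    fix x
    have "(g x - h x)\<^sup>2 \<le> 2 * (g x)\<^sup>2 + 2 * (h x)\<^sup>2"
      using zero_le_power2[of "g x + h x"] by (simp add: power2_eq_square algebra_simps)
    then have "ennreal ((g x - h x)\<^sup>2) \<le> ennreal (2 * (g x)\<^sup>2 + 2 * (h x)\<^sup>2)" by (rule ennreal_leI)
    also have "\<dots> = 2 * ennreal ((g x)\<^sup>2) + 2 * ennreal ((h x)\<^sup>2)"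
      by (simp add: ennreal_mult')
    finally show "ennreal ((g x - h x)\<^sup>2) \<le> 2 * ennreal ((g x)\<^sup>2) + 2 * ennreal ((h x)\<^sup>2)" .
  qed
  also have "\<dots> = 2 * (\<integral>\<^sup>+x. ennreal ((g x)\<^sup>2) \<partial>M) + 2 * (\<integral>\<^sup>+x. ennreal ((h x)\<^sup>2) \<partial>M)"
    by (simp add: nn_integral_add nn_integral_cmult)
  also have "\<dots> \<le> 2 * ennreal A + 2 * ennreal B" by (intro add_mono mult_left_mono assms) auto
  also have "\<dots> = ennreal (2 * A + 2 * B)" using assms by (simp add: ennreal_mult')
  finally show ?thesis .
qed

section \<open>The fourth power integral in dimension at most three\<close>

context smooth_compact
begin

text \<open>With \<open>a j\<close> the average of \<open>f\<close> over cubes of half-width \<open>2\<^sup>-\<^sup>j\<close>, the increment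
  \<open>a (j + 1) - a j\<close> is \<open>O(2\<^sup>-\<^sup>j)\<close> in the mean square and, in dimension at most three,
  \<open>O(2\<^sup>j\<^sup>/\<^sup>2)\<close> uniformly; so its fourth power has integral \<open>O(2\<^sup>-\<^sup>j)\<close>, and the increments can be summed.\<close>

lemma fourth_power_le:
  assumes dim: "DIM('a) \<le> 3"
  shows "(\<integral>\<^sup>+x. ennreal (f x ^ 4) \<partial>lborel) \<le> ennreal (3 * 10^8 * (N + G)\<^sup>2)"
proof -
  let ?d = "real DIM('a)"
  define E where "E = N + G"
  have E: "N \<le> E" "G \<le> E" "0 \<le> E" by (simp_all add: E_def)
  have d: "1 \<le> ?d" "?d \<le> 3" using dim DIM_positive[where 'a='a] by linarith+
  have d2: "?d\<^sup>2 \<le> 9" using power_mono[OF d(2), of 2] d by simp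
  define \<delta> :: "nat \<Rightarrow> real" where "\<delta> j = (1 / 2) ^ j" for j
  have \<delta>: "\<delta> j > 0" "\<delta> j \<le> 1" "\<delta> (Suc j) = \<delta> j / 2" for j by (simp_all add: \<delta>_def power_le_one)
  define a where "a j = avg (\<delta> j) f" for j
  have am [measurable]: "a j \<in> borel_measurable borel" for j unfolding a_def by (rule avg_measurable) (rule meas)
  define D where "D j x = a (Suc j) x - a j x" for j x
  have Dm [measurable]: "D j \<in> borel_measurable borel" for j unfolding D_def by measurable
  have aL2: "(\<integral>\<^sup>+x. ennreal ((a j x - f x)\<^sup>2) \<partial>lborel) \<le> ennreal (9 * (\<delta> j)\<^sup>2 * E)" for j
  proof -
    have "(\<delta> j * ?d)\<^sup>2 * G \<le> 9 * (\<delta> j)\<^sup>2 * E"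
      unfolding power_mult_distrib using d2 E by (subst mult.commute[of "(\<delta> j)\<^sup>2"]) (intro mult_mono; simp)
    then show ?thesis using order_trans[OF avg_diff_L2[OF \<delta>(1)[of j]] ennreal_leI] by (simp add: a_def)
  qed
  have DL2: "(\<integral>\<^sup>+x. ennreal ((D j x)\<^sup>2) \<partial>lborel) \<le> ennreal (36 * (\<delta> j)\<^sup>2 * E)" for j
  proof -
    have "(\<integral>\<^sup>+x. ennreal (((a (Suc j) x - f x) - (a j x - f x))\<^sup>2) \<partial>lborel) \<le> ennreal (2 * (9 * (\<delta> (Suc j))\<^sup>2 * E) + 2 * (9 * (\<delta> j)\<^sup>2 * E))"
      by (rule nn_integral_sq_add_le[OF _ _ aL2 aL2]) (use E in auto)
    also have "\<dots> \<le> ennreal (36 * (\<delta> j)\<^sup>2 * E)" using E by (intro ennreal_leI) (simp add: \<delta>(3) power_divide)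
    finally show ?thesis by (simp add: D_def)
  qed
  \<comment> \<open>The dimension enters here: for \<open>\<delta> \<le> 1\<close> and
    \<open>d \<le> 3\<close> the factor \<open>\<delta>^2 / \<delta>^d\<close> is at most
    \<open>1 / \<delta>\<close>. The constant is \<open>144 = 2 * 9 * 8\<close>.\<close>
  have Dsup: "(D j x)\<^sup>2 \<le> 144 / \<delta> j * E" for j x
  proof -
    have "(\<delta> j)\<^sup>2 / \<delta> j ^ DIM('a) \<le> 1 / \<delta> j"
    proof -
      have "\<delta> j ^ 3 \<le> \<delta> j ^ DIM('a)" using \<delta>[of j] dim by (intro power_decreasing) auto
      then have "(\<delta> j)\<^sup>2 / \<delta> j ^ DIM('a) \<le> (\<delta> j)\<^sup>2 / \<delta> j ^ 3" using \<delta>(1)[of j] by (intro divide_left_mono) auto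
      also have "\<dots> = 1 / \<delta> j" using \<delta>(1)[of j] by (simp add: power3_eq_cube power2_eq_square)
      finally show ?thesis .
    qed
    moreover have "(2::real) ^ DIM('a) \<le> 2 ^ 3" using dim by (intro power_increasing) auto
    ultimately have "2 * ?d\<^sup>2 * 2 ^ DIM('a) * ((\<delta> j)\<^sup>2 / \<delta> j ^ DIM('a)) * G \<le> 2 * 9 * 2 ^ 3 * (1 / \<delta> j) * E"
      using d2 E \<delta>(1)[of j] by (intro mult_mono) auto
    then show ?thesis using avg_half_step[OF \<delta>(1)[of j], of x] by (simp add: D_def a_def \<delta>(3))
  qed
  have D4: "(\<integral>\<^sup>+x. ennreal (D j x ^ 4) \<partial>lborel) \<le> ennreal (5184 * (1/2) ^ j * E\<^sup>2)" for j
  proof -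
    have "(\<integral>\<^sup>+x. ennreal (D j x ^ 4) \<partial>lborel) \<le> ennreal ((144 / \<delta> j * E) * (36 * (\<delta> j)\<^sup>2 * E))"
      by (rule nn_integral_fourth_power[OF _ Dsup _ DL2]) (use E \<delta>(1)[of j] in auto)
    also have "(144 / \<delta> j * E) * (36 * (\<delta> j)\<^sup>2 * E) = 5184 * \<delta> j * E\<^sup>2" using \<delta>(1)[of j] by (simp add: power2_eq_square)
    finally show ?thesis by (simp add: \<delta>_def)
  qed
  \<comment> \<open>The start of the telescoping sum, at half-width 1, is controlled by the norm of
    \<open>f\<close> alone in the supremum; \<open>20 = 2 * 9 + 2\<close> comes from comparing it
    with \<open>f\<close> in the mean square.\<close>
  have a04: "(\<integral>\<^sup>+x. ennreal (a 0 x ^ 4) \<partial>lborel) \<le> ennreal (20 * E\<^sup>2)"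
  proof -
    have "(a 0 x)\<^sup>2 \<le> E" for x
    proof -
      have "(a 0 x)\<^sup>2 \<le> N / 2 ^ DIM('a)" using avg_sq_le[of 1 x] by (simp add: a_def \<delta>_def)
      also have "\<dots> \<le> N / 1" by (intro divide_left_mono) auto
      finally show ?thesis using E by simp
    qed
    moreover have "(\<integral>\<^sup>+x. ennreal ((a 0 x)\<^sup>2) \<partial>lborel) \<le> ennreal (20 * E)"
    proof -
      have "(\<integral>\<^sup>+x. ennreal (((a 0 x - f x) - (- f x))\<^sup>2) \<partial>lborel) \<le> ennreal (2 * (9 * (\<delta> 0)\<^sup>2 * E) + 2 * E)"
        by (rule nn_integral_sq_add_le[OF _ _ aL2]) (use E in \<open>auto simp: nn_N ennreal_leI\<close>)
      then show ?thesis by (simp add: \<delta>_def)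
    qed
    ultimately have "(\<integral>\<^sup>+x. ennreal (a 0 x ^ 4) \<partial>lborel) \<le> ennreal (E * (20 * E))"
      by (intro nn_integral_fourth_power) (use E in auto)
    then show ?thesis by (simp add: power2_eq_square mult.left_commute)
  qed
  \<comment> \<open>The weights \<open>(10/7)^j\<close> meet the decay \<open>(1/2)^j\<close> in a
    geometric series of ratio \<open>5/7\<close> and sum at most \<open>7/2\<close>; the product
    \<open>8 * 1331 * 5184 * 7/2\<close> stays below \<open>2 * 10^8\<close>.\<close>
  have an4: "(\<integral>\<^sup>+x. ennreal (a n x ^ 4) \<partial>lborel) \<le> ennreal (10^8 * E\<^sup>2 + 2 * 10^8 * E\<^sup>2)" for n
  proof -
    have "(\<integral>\<^sup>+x. ennreal (a n x ^ 4) \<partial>lborel) \<le> (\<integral>\<^sup>+x. 8 * ennreal (a 0 x ^ 4) + (\<Sum>j<n. ennreal (8 * 1331 * (10/7) ^ j) * ennreal (D j x ^ 4)) \<partial>lborel)"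
    proof (rule nn_integral_mono)
      fix x
      have "(\<Sum>j<n. D j x) = a n x - a 0 x" unfolding D_def by (rule sum_lessThan_telescope)
      then have "a n x = a 0 x + (\<Sum>j<n. D j x)" by simp
      then have "a n x ^ 4 \<le> 8 * a 0 x ^ 4 + 8 * (\<Sum>j<n. D j x) ^ 4" using fourth_power_add_le by metis
      also have "\<dots> \<le> 8 * a 0 x ^ 4 + 8 * (1331 * (\<Sum>j<n. (10/7) ^ j * D j x ^ 4))"
        by (intro add_left_mono mult_left_mono fourth_power_sum_le) simp
      finally have "ennreal (a n x ^ 4) \<le> ennreal (8 * a 0 x ^ 4 + (\<Sum>j<n. (8 * 1331 * (10/7) ^ j) * D j x ^ 4))"
        by (intro ennreal_leI) (simp add: sum_distrib_left mult.assoc)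
      also have "\<dots> = 8 * ennreal (a 0 x ^ 4) + (\<Sum>j<n. ennreal (8 * 1331 * (10/7) ^ j) * ennreal (D j x ^ 4))"
        by (simp add: ennreal_mult'[symmetric] sum_nonneg ennreal_plus sum_ennreal[symmetric] del: sum_ennreal)
          (simp add: ennreal_mult')
      finally show "ennreal (a n x ^ 4) \<le> 8 * ennreal (a 0 x ^ 4) + (\<Sum>j<n. ennreal (8 * 1331 * (10/7) ^ j) * ennreal (D j x ^ 4))" .
    qed
    also have "\<dots> = 8 * (\<integral>\<^sup>+x. ennreal (a 0 x ^ 4) \<partial>lborel) + (\<Sum>j<n. ennreal (8 * 1331 * (10/7) ^ j) * (\<integral>\<^sup>+x. ennreal (D j x ^ 4) \<partial>lborel))"
      by (simp add: nn_integral_add nn_integral_cmult nn_integral_sum)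
    also have "\<dots> \<le> 8 * ennreal (20 * E\<^sup>2) + (\<Sum>j<n. ennreal (8 * 1331 * (10/7) ^ j) * ennreal (5184 * (1/2) ^ j * E\<^sup>2))"
      by (intro add_mono mult_left_mono sum_mono a04 D4) auto
    also have "\<dots> = 8 * ennreal (20 * E\<^sup>2) + (\<Sum>j<n. ennreal ((8 * 1331 * (10/7) ^ j) * (5184 * (1/2) ^ j * E\<^sup>2)))"
      by (simp add: ennreal_mult'[symmetric])
    also have "\<dots> = ennreal (8 * (20 * E\<^sup>2) + (\<Sum>j<n. (8 * 1331 * (10/7) ^ j) * (5184 * (1/2) ^ j * E\<^sup>2)))"
    proof -
      have s: "(\<Sum>j<n. ennreal ((8 * 1331 * (10/7) ^ j) * (5184 * (1/2) ^ j * E\<^sup>2))) = ennreal (\<Sum>j<n. (8 * 1331 * (10/7) ^ j) * (5184 * (1/2) ^ j * E\<^sup>2))"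
        by (rule sum_ennreal) simp
      show ?thesis unfolding s by (subst ennreal_plus) (auto intro!: sum_nonneg simp: ennreal_mult')
    qed
    also have "\<dots> \<le> ennreal (10^8 * E\<^sup>2 + 2 * 10^8 * E\<^sup>2)"
    proof (rule ennreal_leI)
      have "(\<Sum>j<n. (8 * 1331 * (10/7) ^ j) * (5184 * (1/2) ^ j * E\<^sup>2)) = (8 * 1331 * 5184 * E\<^sup>2) * (\<Sum>j<n. (5/7) ^ j)"
      proof (subst sum_distrib_left, rule sum.cong)
        fix j
        have "((5::real)/7) ^ j = (10/7 * (1/2)) ^ j" by simp
        then have "((5::real)/7) ^ j = (10/7) ^ j * (1/2) ^ j" unfolding power_mult_distrib .
        then show "(8 * 1331 * (10/7) ^ j) * (5184 * (1/2) ^ j * E\<^sup>2) = (8 * 1331 * 5184 * E\<^sup>2) * (5/7) ^ j" by simp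
      qed simp
      also have "\<dots> \<le> (8 * 1331 * 5184 * E\<^sup>2) * (7/2)"
      proof (intro mult_left_mono)
        have "(\<Sum>j<n. ((5::real)/7) ^ j) = (1 - (5/7) ^ n) / (1 - 5/7)" by (subst sum_gp_strict) auto
        also have "\<dots> \<le> 1 / (1 - 5/7)" by (intro divide_right_mono) auto
        finally show "(\<Sum>j<n. ((5::real)/7) ^ j) \<le> 7/2" by simp
      qed simp
      finally show "8 * (20 * E\<^sup>2) + (\<Sum>j<n. (8 * 1331 * (10/7) ^ j) * (5184 * (1/2) ^ j * E\<^sup>2)) \<le> 10^8 * E\<^sup>2 + 2 * 10^8 * E\<^sup>2"
        by (intro add_mono) (simp, erule order_trans, simp)
    qed
    finally show ?thesis .
  qed
  have "(\<integral>\<^sup>+x. ennreal (f x ^ 4) \<partial>lborel) = (\<integral>\<^sup>+x. liminf (\<lambda>n. ennreal (a n x ^ 4)) \<partial>lborel)"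
  proof (rule nn_integral_cong)
    fix x
    have "(\<lambda>n. a n x) \<longlonglongrightarrow> f x" unfolding a_def
      by (rule avg_tendsto) (auto simp: \<delta> intro!: LIMSEQ_realpow_zero simp: \<delta>_def[abs_def])
    then have "(\<lambda>n. ennreal (a n x ^ 4)) \<longlonglongrightarrow> ennreal (f x ^ 4)" by (intro tendsto_ennrealI tendsto_power)
    then show "ennreal (f x ^ 4) = liminf (\<lambda>n. ennreal (a n x ^ 4))"
      by (rule lim_imp_Liminf[OF sequentially_bot, symmetric])
  qed
  also have "\<dots> \<le> liminf (\<lambda>n. \<integral>\<^sup>+x. ennreal (a n x ^ 4) \<partial>lborel)" by (rule nn_integral_liminf) measurable
  also have "\<dots> \<le> ennreal (3 * 10^8 * E\<^sup>2)"
    using an4 by (intro order_trans[OF Liminf_le_Limsup Limsup_bounded]) (auto simp: algebra_simps)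
  finally show ?thesis by (simp add: E_def)
qed

end

subsection \<open>Poincare inequality, Sobolev embedding and Rellich compactness\<close>

context open_bounded
begin

lemma test_smooth_compact:
  assumes "f \<in> test_functions \<Omega>"
  obtains K where "smooth_compact f K" "K \<subseteq> \<Omega>"
proof -
  obtain K where "compact K" "K \<subseteq> \<Omega>" "\<And>x. x \<notin> K \<Longrightarrow> f x = 0" "\<And>x. x \<notin> K \<Longrightarrow> grad f x = 0"
    using test_functionsE[OF assms] by metis
  then show ?thesis by (intro that[of K] smooth_compact.intro test_functions_Ck[OF assms])
qed

lemma test_N_G:
  assumes f: "f \<in> test_functions \<Omega>"
  shows "smooth_compact.N f = (l2_norm \<Omega> f)\<^sup>2" "smooth_compact.G f = (l2_norm \<Omega> (grad f))\<^sup>2"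
proof -
  obtain K where SC: "smooth_compact f K" "K \<subseteq> \<Omega>" using test_smooth_compact[OF f] .
  interpret smooth_compact f K by fact
  have z: "x \<notin> \<Omega> \<Longrightarrow> f x = 0" "x \<notin> \<Omega> \<Longrightarrow> grad f x = 0" for x
    using K SC(2) by auto
  show "smooth_compact.N f = (l2_norm \<Omega> f)\<^sup>2"
    unfolding N_def l2_norm_sq_int by (subst lebesgue_on_eq_lborel) (auto simp: z)
  show "smooth_compact.G f = (l2_norm \<Omega> (grad f))\<^sup>2"
    unfolding G_def l2_norm_sq_int by (subst lebesgue_on_eq_lborel) (auto simp: z)
qed

lemma nn_integral_dom_le:
  fixes g :: "'a \<Rightarrow> ennreal"
  assumes [measurable]: "g \<in> borel_measurable borel"
  shows "(\<integral>\<^sup>+x. g x \<partial>lebesgue_on \<Omega>) \<le> (\<integral>\<^sup>+x. g x \<partial>lborel)"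
proof -
  have "(\<integral>\<^sup>+x. g x \<partial>lebesgue_on \<Omega>) = (\<integral>\<^sup>+x. g x * indicator \<Omega> x \<partial>lebesgue)"
    by (rule nn_integral_restrict_space) simp
  also have "\<dots> \<le> (\<integral>\<^sup>+x. g x \<partial>lebesgue)" by (intro nn_integral_mono) (auto simp: indicator_def)
  also have "\<dots> = (\<integral>\<^sup>+x. g x \<partial>lborel)" by (rule nn_integral_completion)
  finally show ?thesis .
qed

lemma borel_measurable_dom:
  fixes g :: "'a \<Rightarrow> 'b::topological_space"
  shows "g \<in> borel_measurable borel \<Longrightarrow> g \<in> borel_measurable (lebesgue_on \<Omega>)"
  by (rule measurable_restrict_space1, rule measurable_completion) simp

lemma test_h1_norm:
  assumes f: "f \<in> test_functions \<Omega>"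
  shows "(h1_norm \<Omega> f)\<^sup>2 = (l2_norm \<Omega> f)\<^sup>2 + (l2_norm \<Omega> (grad f))\<^sup>2" "l2_norm \<Omega> (wgrad \<Omega> f) = l2_norm \<Omega> (grad f)"
proof -
  show "l2_norm \<Omega> (wgrad \<Omega> f) = l2_norm \<Omega> (grad f)"
    by (rule l2_norm_cong_AE) (use test_H1[OF f] f in \<open>auto intro: H1_D grad_L2\<close>)
  then show "(h1_norm \<Omega> f)\<^sup>2 = (l2_norm \<Omega> f)\<^sup>2 + (l2_norm \<Omega> (grad f))\<^sup>2" by (simp add: h1_norm_sq)
qed

text \<open>Integrate \<open>\<partial>\<^sub>b ((x \<bullet> b) f\<^sup>2) = f\<^sup>2 + 2 (x \<bullet> b) f \<partial>\<^sub>b f\<close>.\<close>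

lemma poincare_test:
  assumes R: "\<And>x. x \<in> \<Omega> \<Longrightarrow> norm x \<le> R" "0 \<le> R" and f: "f \<in> test_functions \<Omega>"
  shows "l2_norm \<Omega> f \<le> 2 * R * l2_norm \<Omega> (grad f)"
proof -
  obtain b :: 'a where b: "b \<in> Basis" using nonempty_Basis by blast
  define g where "g x = (x \<bullet> b) * f x" for x
  have g: "g \<in> test_functions \<Omega>" unfolding g_def by (rule test_functions_mult[OF Ck_inner f])
  have pb: "partial b f \<in> test_functions \<Omega>" by (rule test_functions_partial[OF f b])
  have w: "l2_inner \<Omega> f (partial b g) = - l2_inner \<Omega> (\<lambda>x. grad f x \<bullet> b) g"
    using weak_gradient_test[OF dom_lebesgue f] g b unfolding weak_gradient_iff by blast
  have pg: "partial b g x = f x + (x \<bullet> b) * partial b f x" for x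
  proof -
    have "(g has_derivative (\<lambda>h. (x \<bullet> b) * (grad f x \<bullet> h) + (h \<bullet> b) * f x)) (at x)"
      unfolding g_def
      by (rule has_derivative_mult[OF _ has_derivative_grad[OF test_functions_differentiable[OF f]]])
        (auto intro!: derivative_eq_intros)
    from partial_eqI[OF this, of b] show ?thesis using b by (simp add: grad_inner_Basis)
  qed
  define k where "k x = (x \<bullet> b) * partial b f x" for x
  have k: "k \<in> test_functions \<Omega>" unfolding k_def by (rule test_functions_mult[OF Ck_inner pb])
  have "l2_inner \<Omega> (partial b g) f = l2_inner \<Omega> f f + l2_inner \<Omega> k f"
  proof -
    have "partial b g = lc 1 f 1 k" by (auto simp: lc_def pg k_def)
    then show ?thesis using test_L2 f k by (simp add: l2_inner_lc)
  qed
  moreover have "l2_inner \<Omega> (\<lambda>x. grad f x \<bullet> b) g = l2_inner \<Omega> k f"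
    using b by (simp add: l2_inner_def g_def k_def grad_inner_Basis mult.commute mult.left_commute)
  ultimately have "(l2_norm \<Omega> f)\<^sup>2 = - 2 * l2_inner \<Omega> k f"
    using w by (simp add: l2_norm_sq l2_inner_commute[of \<Omega> f "partial b g"])
  also have "\<dots> \<le> 2 * (l2_norm \<Omega> k * l2_norm \<Omega> f)"
    using l2_cs[OF test_L2[OF k] test_L2[OF f]] by linarith
  also have "l2_norm \<Omega> k \<le> R * l2_norm \<Omega> (grad f)"
  proof (rule power2_le_imp_le)
    have "(l2_norm \<Omega> k)\<^sup>2 \<le> (LINT x|lebesgue_on \<Omega>. R\<^sup>2 * (norm (grad f x))\<^sup>2)"
      unfolding l2_norm_sq_int
    proof (rule integral_mono[OF L2_sq_integrable[OF test_L2[OF k]]])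
      show "integrable (lebesgue_on \<Omega>) (\<lambda>x. R\<^sup>2 * (norm (grad f x))\<^sup>2)"
        by (intro integrable_mult_right L2_sq_integrable grad_L2 f)
      fix x assume "x \<in> space (lebesgue_on \<Omega>)"
      then have x: "x \<in> \<Omega>" by simp
      have "\<bar>x \<bullet> b\<bar> \<le> R" using R(1)[OF x] Cauchy_Schwarz_ineq2[of x b] b by simp
      moreover have "\<bar>partial b f x\<bar> \<le> norm (grad f x)"
        using Cauchy_Schwarz_ineq2[of "grad f x" b] b by (simp add: grad_inner_Basis)
      ultimately have "norm (k x) \<le> R * norm (grad f x)" unfolding k_def by (auto simp: abs_mult intro!: mult_mono R)
      from power_mono[OF this, of 2] show "(norm (k x))\<^sup>2 \<le> R\<^sup>2 * (norm (grad f x))\<^sup>2" by (simp add: power_mult_distrib)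
    qed
    then show "(l2_norm \<Omega> k)\<^sup>2 \<le> (R * l2_norm \<Omega> (grad f))\<^sup>2" by (simp add: l2_norm_sq_int power_mult_distrib)
  qed (use R in simp)
  finally have "l2_norm \<Omega> f * l2_norm \<Omega> f \<le> (2 * R * l2_norm \<Omega> (grad f)) * l2_norm \<Omega> f"
    by (simp add: power2_eq_square mult_right_mono algebra_simps)
  then show ?thesis using R(2) l2_norm_nonneg[of \<Omega> f] l2_norm_nonneg[of \<Omega> "grad f"]
    by (cases "l2_norm \<Omega> f = 0") (auto simp: mult_le_cancel_right)
qed

lemma poincare: "\<exists>P>0. \<forall>w\<in>H10 \<Omega>. l2_norm \<Omega> w \<le> P * l2_norm \<Omega> (wgrad \<Omega> w)"
proof -
  obtain R where R: "R > 0" "\<And>x. x \<in> \<Omega> \<Longrightarrow> norm x \<le> R" using bounded_dom by (auto simp: bounded_pos)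
  have "l2_norm \<Omega> w \<le> 2 * R * l2_norm \<Omega> (wgrad \<Omega> w)" if w: "w \<in> H10 \<Omega>" for w
  proof -
    obtain \<phi> where \<phi>: "\<And>n. \<phi> n \<in> test_functions \<Omega>"
      "(\<lambda>n. l2_norm \<Omega> (\<lambda>x. \<phi> n x - w x)) \<longlonglongrightarrow> 0" "(\<lambda>n. l2_norm \<Omega> (\<lambda>x. grad (\<phi> n) x - wgrad \<Omega> w x)) \<longlonglongrightarrow> 0"
      by (rule H10_approx[OF w]) blast
    have "(\<lambda>n. l2_norm \<Omega> (\<phi> n)) \<longlonglongrightarrow> l2_norm \<Omega> w"
      by (rule l2_norm_tendsto[OF test_L2[OF \<phi>(1)] H10_L2[OF w] \<phi>(2)])
    moreover have "(\<lambda>n. 2 * R * l2_norm \<Omega> (grad (\<phi> n))) \<longlonglongrightarrow> 2 * R * l2_norm \<Omega> (wgrad \<Omega> w)"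
      by (intro tendsto_intros l2_norm_tendsto[OF grad_L2[OF \<phi>(1)] wgrad_L2[OF w] \<phi>(3)])
    ultimately show ?thesis
      using poincare_test[OF R(2) less_imp_le[OF R(1)] \<phi>(1)] by (intro LIMSEQ_le) auto
  qed
  then show ?thesis using R(1) by (intro exI[of _ "2 * R"]) auto
qed

text \<open>The inequality for test functions survives the limit by Fatou's lemma, since the
  approximants converge almost everywhere and their norms converge.\<close>

lemma H10_fourth_power:
  assumes dim: "DIM('a) \<le> 3" and w: "w \<in> H10 \<Omega>"
  shows "integrable (lebesgue_on \<Omega>) (\<lambda>x. w x ^ 4)"
    "(LINT x|lebesgue_on \<Omega>. w x ^ 4) \<le> 3 * 10^8 * h1_norm \<Omega> w ^ 4"
proof -
  let ?M = "lebesgue_on \<Omega>" and ?B = "3 * 10^8 * h1_norm \<Omega> w ^ 4"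
  obtain \<phi> where \<phi>: "\<And>n. \<phi> n \<in> test_functions \<Omega>"
    "(\<lambda>n. l2_norm \<Omega> (\<lambda>x. \<phi> n x - w x)) \<longlonglongrightarrow> 0" "(\<lambda>n. l2_norm \<Omega> (\<lambda>x. grad (\<phi> n) x - wgrad \<Omega> w x)) \<longlonglongrightarrow> 0"
    "AE x in ?M. (\<lambda>n. \<phi> n x) \<longlonglongrightarrow> w x"
    by (fact H10_approx[OF w])
  have wm: "w \<in> borel_measurable ?M" using H10_L2[OF w] by (rule L2_measurable)
  have \<phi>m: "\<phi> n \<in> borel_measurable ?M" for n using test_L2[OF \<phi>(1)] by (rule L2_measurable)
  have le: "(\<integral>\<^sup>+x. ennreal (\<phi> n x ^ 4) \<partial>?M) \<le> ennreal (3 * 10^8 * ((l2_norm \<Omega> (\<phi> n))\<^sup>2 + (l2_norm \<Omega> (grad (\<phi> n)))\<^sup>2)\<^sup>2)" for n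
  proof -
    obtain K where K: "smooth_compact (\<phi> n) K" using test_smooth_compact[OF \<phi>(1)] by metis
    note [measurable] = smooth_compact.meas[OF K]
    have "(\<integral>\<^sup>+x. ennreal (\<phi> n x ^ 4) \<partial>?M) \<le> (\<integral>\<^sup>+x. ennreal (\<phi> n x ^ 4) \<partial>lborel)" by (rule nn_integral_dom_le) measurable
    from order_trans[OF this smooth_compact.fourth_power_le[OF K dim]] show ?thesis unfolding test_N_G[OF \<phi>(1)] .
  qed
  have lim: "(\<lambda>n. 3 * 10^8 * ((l2_norm \<Omega> (\<phi> n))\<^sup>2 + (l2_norm \<Omega> (grad (\<phi> n)))\<^sup>2)\<^sup>2) \<longlonglongrightarrow> ?B"
  proof -
    have "(\<lambda>n. 3 * 10^8 * ((l2_norm \<Omega> (\<phi> n))\<^sup>2 + (l2_norm \<Omega> (grad (\<phi> n)))\<^sup>2)\<^sup>2) \<longlonglongrightarrow>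
      3 * 10^8 * ((l2_norm \<Omega> w)\<^sup>2 + (l2_norm \<Omega> (wgrad \<Omega> w))\<^sup>2)\<^sup>2"
      by (intro tendsto_intros l2_norm_tendsto[OF grad_L2[OF \<phi>(1)] wgrad_L2[OF w] \<phi>(3)]
          l2_norm_tendsto[OF test_L2[OF \<phi>(1)] H10_L2[OF w] \<phi>(2)])
    moreover have "((l2_norm \<Omega> w)\<^sup>2 + (l2_norm \<Omega> (wgrad \<Omega> w))\<^sup>2)\<^sup>2 = h1_norm \<Omega> w ^ 4"
      unfolding h1_norm_sq[symmetric] by (simp add: power_mult[symmetric])
    ultimately show ?thesis by simp
  qed
  have "(\<integral>\<^sup>+x. ennreal (w x ^ 4) \<partial>?M) = (\<integral>\<^sup>+x. liminf (\<lambda>n. ennreal (\<phi> n x ^ 4)) \<partial>?M)"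
  proof (rule nn_integral_cong_AE)
    show "AE x in ?M. ennreal (w x ^ 4) = liminf (\<lambda>n. ennreal (\<phi> n x ^ 4))"
      using \<phi>(4)
    proof eventually_elim
      case (elim x)
      then have "(\<lambda>n. ennreal (\<phi> n x ^ 4)) \<longlonglongrightarrow> ennreal (w x ^ 4)" by (intro tendsto_ennrealI tendsto_power)
      then show ?case by (rule lim_imp_Liminf[OF sequentially_bot, symmetric])
    qed
  qed
  also have "\<dots> \<le> liminf (\<lambda>n. \<integral>\<^sup>+x. ennreal (\<phi> n x ^ 4) \<partial>?M)"
    using \<phi>m by (intro nn_integral_liminf) measurable
  also have "\<dots> \<le> liminf (\<lambda>n. ennreal (3 * 10^8 * ((l2_norm \<Omega> (\<phi> n))\<^sup>2 + (l2_norm \<Omega> (grad (\<phi> n)))\<^sup>2)\<^sup>2))"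
    by (intro Liminf_mono always_eventually allI le)
  also have "\<dots> = ennreal ?B" by (intro lim_imp_Liminf[OF sequentially_bot] tendsto_ennrealI lim)
  finally have main: "(\<integral>\<^sup>+x. ennreal (w x ^ 4) \<partial>?M) \<le> ennreal ?B" .
  show i: "integrable ?M (\<lambda>x. w x ^ 4)"
  proof (rule integrableI_bounded)
    show "(\<integral>\<^sup>+x. ennreal (norm (w x ^ 4)) \<partial>?M) < \<infinity>" using main by (simp add: order_le_less_trans)
  qed (use wm in measurable)
  have "ennreal (LINT x|?M. w x ^ 4) \<le> ennreal ?B"
    using main by (subst nn_integral_eq_integral[symmetric]) (auto intro: i)
  then show "(LINT x|?M. w x ^ 4) \<le> ?B" by (subst (asm) ennreal_le_iff) auto
qed

lemma l2_norm_le_sup: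
  assumes g: "g \<in> L2 \<Omega>" and le: "\<And>x. x \<in> \<Omega> \<Longrightarrow> \<bar>g x\<bar> \<le> c"
  shows "l2_norm \<Omega> g \<le> \<bar>c\<bar> * l2_norm \<Omega> (\<lambda>x. 1 :: real)"
proof -
  interpret finite_measure "lebesgue_on \<Omega>" by (rule finite_dom)
  have one: "(\<lambda>x. 1 :: real) \<in> L2 \<Omega>" by (rule bounded_L2[of _ 1]) auto
  have gm: "g \<in> borel_measurable (lebesgue_on \<Omega>)" using g by (rule L2_measurable)
  have "AE x in lebesgue_on \<Omega>. \<bar>g x\<bar> \<le> c" using le by (intro AE_I2) simp
  from L2_mult_bounded(2)[OF one gm this] show ?thesis by simp
qed

text \<open>For a fixed half-width the averages of the \<open>f n\<close> are uniformly bounded and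
  equi-Lipschitz, so Arzela-Ascoli provides a uniformly convergent subsequence; the averages are
  close to the \<open>f n\<close> in \<open>L^2\<close>, uniformly in \<open>n\<close>. Each
  tolerance \<open>inverse (Suc k)\<close> is thus reached by a further extraction, and a diagonal
  sequence serves all of them.\<close>

lemma rellich_test:
  fixes f :: "nat \<Rightarrow> 'a \<Rightarrow> real"
  assumes f: "\<And>n. f n \<in> test_functions \<Omega>" and M: "\<And>n. h1_norm \<Omega> (f n) \<le> M"
  obtains r where "strict_mono (r :: nat \<Rightarrow> nat)"
    "\<And>e. e > 0 \<Longrightarrow> \<exists>N. \<forall>m\<ge>N. \<forall>n\<ge>N. l2_norm \<Omega> (\<lambda>x. f (r m) x - f (r n) x) < e"
proof -
  have M0: "0 \<le> M" using M[of 0] h1_norm_nonneg[of "f 0"] by linarith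
  define P where "P k s \<longleftrightarrow> (\<exists>N. \<forall>m\<ge>N. \<forall>n\<ge>N. l2_norm \<Omega> (\<lambda>x. f (s m) x - f (s n) x) < inverse (Suc k))"
    for k :: nat and s :: "nat \<Rightarrow> nat"
  let ?c = "l2_norm \<Omega> (\<lambda>x. 1 :: real)"
  have NG: "smooth_compact.N (f n) \<le> M\<^sup>2" "smooth_compact.G (f n) \<le> M\<^sup>2" for n
    using power_mono[OF M[of n], of 2] h1_norm_nonneg[of "f n"] zero_le_power2[of "l2_norm \<Omega> (f n)"] zero_le_power2[of "l2_norm \<Omega> (grad (f n))"]
    unfolding test_N_G[OF f] test_h1_norm(1)[OF f] by linarith+
  have ex: "\<exists>r. strict_mono r \<and> P k (s \<circ> r)" if s: "strict_mono s" for k and s :: "nat \<Rightarrow> nat"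
  proof -
    define e where "e = inverse (real (Suc k))"
    have e: "e > 0" by (simp add: e_def)
    \<comment> \<open>Makes every function differ from its average by at most \<open>e / 4\<close>;
      two such errors and \<open>e / 4\<close> for the distance of two averages stay below
      \<open>e\<close>. The summand 1 excludes a zero denominator.\<close>
    define \<delta> where "\<delta> = e / (4 * (real DIM('a) * M + 1))"
    have \<delta>: "\<delta> > 0" using e M0 by (simp add: \<delta>_def add_nonneg_pos)
    have \<delta>M: "\<delta> * real DIM('a) * M \<le> e / 4"
    proof -
      have "\<delta> * (real DIM('a) * M) \<le> \<delta> * (real DIM('a) * M + 1)" using \<delta> by (intro mult_left_mono) auto
      also have "\<dots> = e / 4"
      proof -
        define y where "y = real DIM('a) * M + 1"
        have "0 \<le> real DIM('a) * M" using M0 by simp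
        then have "y \<noteq> 0" unfolding y_def by linarith
        then have "e / (4 * y) * y = e / 4" by simp
        then show ?thesis unfolding \<delta>_def y_def .
      qed
      finally show ?thesis by (simp add: mult.assoc)
    qed
    define F where "F n = avg \<delta> (f (s n))" for n
    let ?m = "(2 * \<delta>) ^ DIM('a)"
    have m: "?m > 0" using \<delta> by simp
    have Fm: "F n \<in> borel_measurable borel" for n
      unfolding F_def using Ck_measurable(1)[OF test_functions_Ck[OF f]] by measurable
    have F_le: "norm (F n x) \<le> sqrt (M\<^sup>2 / ?m)" for n x
    proof -
      obtain K where K: "smooth_compact (f (s n)) K" using test_smooth_compact[OF f] by metis
      have "(F n x)\<^sup>2 \<le> M\<^sup>2 / ?m"
        using smooth_compact.avg_sq_le[OF K \<delta>, of x] divide_right_mono[OF NG(1)[of "s n"], of ?m] m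
        unfolding F_def by linarith
      then show ?thesis by (simp add: real_le_rsqrt abs_le_square_iff real_sqrt_le_iff)
    qed
    have F_lip: "norm (F n x - F n y) \<le> norm (x - y) * sqrt (M\<^sup>2 / ?m)" for n x y
    proof -
      obtain K where K: "smooth_compact (f (s n)) K" using test_smooth_compact[OF f] by metis
      have "(F n x - F n y)\<^sup>2 \<le> (norm (x - y))\<^sup>2 * smooth_compact.G (f (s n)) / ?m"
        using smooth_compact.avg_lipschitz[OF K \<delta>] unfolding F_def .
      also have "\<dots> \<le> (norm (x - y))\<^sup>2 * M\<^sup>2 / ?m"
        using m by (intro divide_right_mono mult_left_mono NG) auto
      also have "\<dots> = (norm (x - y) * sqrt (M\<^sup>2 / ?m))\<^sup>2" using m by (simp add: power_mult_distrib)
      finally show ?thesis using m by (simp add: abs_le_square_iff[symmetric] abs_mult)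
    qed
    have F_L2: "F n \<in> L2 \<Omega>" for n
      by (rule bounded_L2[OF borel_measurable_dom[OF Fm]]) (use F_le in auto)
    have F_near: "l2_norm \<Omega> (\<lambda>x. F n x - f (s n) x) \<le> e / 4" for n
    proof -
      obtain K where K: "smooth_compact (f (s n)) K" using test_smooth_compact[OF f] by metis
      note [measurable] = Fm smooth_compact.meas[OF K]
      have "ennreal ((l2_norm \<Omega> (\<lambda>x. F n x - f (s n) x))\<^sup>2) = (\<integral>\<^sup>+x. ennreal ((F n x - f (s n) x)\<^sup>2) \<partial>lebesgue_on \<Omega>)"
        using L2_sq_integrable[OF L2_diff[OF F_L2 test_L2[OF f]], of n "s n"] unfolding l2_norm_sq_int
        by (subst nn_integral_eq_integral) auto
      also have "\<dots> \<le> (\<integral>\<^sup>+x. ennreal ((F n x - f (s n) x)\<^sup>2) \<partial>lborel)" by (rule nn_integral_dom_le) measurable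
      also have "\<dots> \<le> ennreal ((\<delta> * DIM('a))\<^sup>2 * smooth_compact.G (f (s n)))"
        unfolding F_def by (rule smooth_compact.avg_diff_L2[OF K \<delta>])
      also have "\<dots> \<le> ennreal ((\<delta> * DIM('a))\<^sup>2 * M\<^sup>2)" by (intro ennreal_leI mult_left_mono NG) auto
      finally have "(l2_norm \<Omega> (\<lambda>x. F n x - f (s n) x))\<^sup>2 \<le> (\<delta> * DIM('a) * M)\<^sup>2"
        by (subst (asm) ennreal_le_iff) (auto simp: power_mult_distrib)
      then have "l2_norm \<Omega> (\<lambda>x. F n x - f (s n) x) \<le> \<delta> * DIM('a) * M"
        by (rule power2_le_imp_le) (use \<delta> M0 in simp)
      then show ?thesis using \<delta>M by simp
    qed
    have cl: "compact (closure \<Omega>)" using bounded_dom by (simp add: compact_closure)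
    have eq: "\<exists>d>0. \<forall>n y. y \<in> closure \<Omega> \<and> norm (x - y) < d \<longrightarrow> norm (F n x - F n y) < e'" if "e' > 0" for x e'
    proof -
      define L where "L = sqrt (M\<^sup>2 / ?m)"
      have L: "L \<ge> 0" using m by (simp add: L_def)
      have "norm (F n x - F n y) < e'" if "norm (x - y) < e' / (L + 1)" for n y
      proof -
        have "norm (F n x - F n y) \<le> norm (x - y) * L" using F_lip unfolding L_def .
        also have "\<dots> \<le> e' / (L + 1) * L" using that L by (intro mult_right_mono) auto
        also have "\<dots> < e'" using L \<open>e' > 0\<close> by (simp add: pos_divide_less_eq add_nonneg_pos algebra_simps)
        finally show ?thesis .
      qed
      then show ?thesis using L \<open>e' > 0\<close> by (intro exI[of _ "e' / (L + 1)"]) auto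
    qed
    obtain g r where r: "strict_mono (r :: nat \<Rightarrow> nat)"
      "\<And>e. 0 < e \<Longrightarrow> \<exists>N. \<forall>n x. n \<ge> N \<and> x \<in> closure \<Omega> \<longrightarrow> norm (F (r n) x - g x) < e"
      by (rule Arzela_Ascoli[of "closure \<Omega>" F, OF cl F_le eq]) blast+
    define \<eta> where "\<eta> = e / (8 * (?c + 1))"
    have c0: "0 \<le> ?c" by simp
    have \<eta>: "\<eta> > 0" using e c0 by (simp add: \<eta>_def add_nonneg_pos)
    have \<eta>c: "2 * \<eta> * ?c \<le> e / 4"
    proof -
      have "2 * \<eta> * ?c \<le> 2 * \<eta> * (?c + 1)" using \<eta> by (intro mult_left_mono) auto
      also have "\<dots> = e / 4"
      proof -
        define y where "y = ?c + 1"
        have "y \<noteq> 0" using c0 unfolding y_def by linarith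
        then have "2 * (e / (8 * y)) * y = e / 4" by simp
        then show ?thesis unfolding \<eta>_def y_def .
      qed
      finally show ?thesis .
    qed
    obtain N where N: "\<And>n x. n \<ge> N \<Longrightarrow> x \<in> closure \<Omega> \<Longrightarrow> norm (F (r n) x - g x) < \<eta>" using r(2)[OF \<eta>] by blast
    have "l2_norm \<Omega> (\<lambda>x. f (s (r i)) x - f (s (r j)) x) < e" if ij: "i \<ge> N" "j \<ge> N" for i j
    proof -
      have "l2_norm \<Omega> (\<lambda>x. F (r i) x - F (r j) x) \<le> \<bar>2 * \<eta>\<bar> * ?c"
      proof (rule l2_norm_le_sup[OF L2_diff[OF F_L2 F_L2]])
        fix x assume "x \<in> \<Omega>"
        then have "x \<in> closure \<Omega>" using closure_subset by blast
        then show "\<bar>F (r i) x - F (r j) x\<bar> \<le> 2 * \<eta>" using N[OF ij(1)] N[OF ij(2)] by (fastforce simp: abs_less_iff abs_le_iff)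
      qed
      then have 1: "l2_norm \<Omega> (\<lambda>x. F (r i) x - F (r j) x) \<le> e / 4" using \<eta>c \<eta> by simp
      have 2: "l2_norm \<Omega> (\<lambda>x. f (s (r i)) x - F (r i) x) \<le> e / 4"
        using F_near[of "r i"] L2.nrm_dif_sym[OF F_L2 test_L2[OF f], of "r i" "s (r i)"] by (simp add: lc_diff l2_norm_nrm)
      have "l2_norm \<Omega> (\<lambda>x. f (s (r i)) x - f (s (r j)) x) \<le> l2_norm \<Omega> (\<lambda>x. f (s (r i)) x - F (r i) x) + l2_norm \<Omega> (\<lambda>x. F (r i) x - f (s (r j)) x)"
        by (rule l2_norm_triangle[OF test_L2[OF f] F_L2 test_L2[OF f]])
      moreover have "l2_norm \<Omega> (\<lambda>x. F (r i) x - f (s (r j)) x) \<le> l2_norm \<Omega> (\<lambda>x. F (r i) x - F (r j) x) + l2_norm \<Omega> (\<lambda>x. F (r j) x - f (s (r j)) x)"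
        by (rule l2_norm_triangle[OF F_L2 F_L2 test_L2[OF f]])
      ultimately show ?thesis using 1 2 F_near[of "r j"] e by linarith
    qed
    then show ?thesis using r(1) unfolding P_def e_def by (intro exI[of _ r]) (auto simp: o_def)
  qed
  interpret subseqs P by unfold_locales (rule ex)
  \<comment> \<open>\<open>P k\<close> concerns large indices only and is inherited by subsequences,
    so it holds for the tail of the diagonal sequence beyond index \<open>k\<close>.\<close>
  have hold: "P k (diagseq \<circ> (+) (Suc k))" for k
  proof (rule diagseq_holds)
    fix r s :: "nat \<Rightarrow> nat" and n assume r: "strict_mono r" and "P n s"
    then obtain N where N: "\<forall>i\<ge>N. \<forall>j\<ge>N. l2_norm \<Omega> (\<lambda>x. f (s i) x - f (s j) x) < inverse (Suc n)" unfolding P_def by blast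
    have "r i \<ge> N" if "i \<ge> N" for i using seq_suble[OF r, of i] that by simp
    then show "P n (s \<circ> r)" unfolding P_def using N by (intro exI[of _ N]) auto
  qed
  show ?thesis
  proof (rule that[OF subseq_diagseq])
    fix e :: real assume "e > 0"
    then obtain k where k: "inverse (real (Suc k)) < e" using reals_Archimedean by blast
    obtain N where N: "\<And>i j. i \<ge> N \<Longrightarrow> j \<ge> N \<Longrightarrow> l2_norm \<Omega> (\<lambda>x. f (diagseq (Suc k + i)) x - f (diagseq (Suc k + j)) x) < inverse (Suc k)"
      using hold[of k] unfolding P_def by auto
    have "l2_norm \<Omega> (\<lambda>x. f (diagseq m) x - f (diagseq n) x) < e" if "m \<ge> Suc k + N" "n \<ge> Suc k + N" for m n
    proof -
      have "m - Suc k \<ge> N" "n - Suc k \<ge> N" using that by simp_all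
      from N[OF this] that have "l2_norm \<Omega> (\<lambda>x. f (diagseq m) x - f (diagseq n) x) < inverse (Suc k)" by simp
      then show ?thesis using k by linarith
    qed
    then show "\<exists>N. \<forall>m\<ge>N. \<forall>n\<ge>N. l2_norm \<Omega> (\<lambda>x. f (diagseq m) x - f (diagseq n) x) < e" by blast
  qed
qed

text \<open>Replace \<open>w n\<close> by a test function at \<open>H^1\<close> distance below
  \<open>inverse (Suc n)\<close>: these stay bounded, and the replacement error disappears along any
  subsequence.\<close>

lemma rellich:
  fixes w :: "nat \<Rightarrow> 'a \<Rightarrow> real"
  assumes w: "\<And>n. w n \<in> H10 \<Omega>" and M: "\<And>n. h1_norm \<Omega> (w n) \<le> M"
  obtains r where "strict_mono (r :: nat \<Rightarrow> nat)"
    "\<And>e. e > 0 \<Longrightarrow> \<exists>N. \<forall>m\<ge>N. \<forall>n\<ge>N. l2_norm \<Omega> (\<lambda>x. w (r m) x - w (r n) x) < e"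
proof -
  have "\<exists>\<phi>\<in>test_functions \<Omega>. h1_norm \<Omega> (\<lambda>x. w n x - \<phi> x) < inverse (real (Suc n))" for n
    using w[of n] by (simp add: H10_def)
  then obtain \<phi> where \<phi>: "\<And>n. \<phi> n \<in> test_functions \<Omega>" "\<And>n. h1_norm \<Omega> (\<lambda>x. w n x - \<phi> n x) < inverse (real (Suc n))" by metis
  have bd: "h1_norm \<Omega> (\<phi> n) \<le> M + 1" for n
  proof -
    have "h1_norm \<Omega> (\<phi> n) \<le> h1_norm \<Omega> (w n) + h1_norm \<Omega> (\<lambda>x. w n x - \<phi> n x)"
      using H1.nrm_le_dif[OF H10_H1[OF w] test_H1(1)[OF \<phi>(1)], of n n] unfolding h1_norm_nrm lc_diff by linarith
    moreover have "inverse (real (Suc n)) \<le> 1" by (simp add: divide_simps)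
    ultimately show ?thesis using M[of n] \<phi>(2)[of n] by linarith
  qed
  obtain r where r: "strict_mono (r :: nat \<Rightarrow> nat)"
    "\<And>e. e > 0 \<Longrightarrow> \<exists>N. \<forall>m\<ge>N. \<forall>n\<ge>N. l2_norm \<Omega> (\<lambda>x. \<phi> (r m) x - \<phi> (r n) x) < e"
    by (fact rellich_test[of \<phi> "M + 1", OF \<phi>(1) bd])
  show ?thesis
  proof (rule that[OF r(1)])
    fix e :: real assume e: "e > 0"
    obtain N1 where N1: "\<forall>m\<ge>N1. \<forall>n\<ge>N1. l2_norm \<Omega> (\<lambda>x. \<phi> (r m) x - \<phi> (r n) x) < e / 3" using r(2)[of "e / 3"] e by auto
    obtain N2 where N2: "inverse (real (Suc N2)) < e / 3" using reals_Archimedean[of "e / 3"] e by auto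
    have near: "l2_norm \<Omega> (\<lambda>x. w (r n) x - \<phi> (r n) x) < e / 3" if "n \<ge> N2" for n
    proof -
      have "r n \<ge> N2" using seq_suble[OF r(1), of n] that by simp
      then have "inverse (real (Suc (r n))) \<le> inverse (real (Suc N2))" by (intro le_imp_inverse_le) auto
      then show ?thesis using l2_le_h1(1)[of "\<lambda>x. w (r n) x - \<phi> (r n) x"] \<phi>(2)[of "r n"] N2 by linarith
    qed
    have "l2_norm \<Omega> (\<lambda>x. w (r m) x - w (r n) x) < e" if mn: "m \<ge> max N1 N2" "n \<ge> max N1 N2" for m n
    proof -
      have "l2_norm \<Omega> (\<lambda>x. w (r m) x - w (r n) x) \<le> l2_norm \<Omega> (\<lambda>x. w (r m) x - \<phi> (r m) x) + l2_norm \<Omega> (\<lambda>x. \<phi> (r m) x - w (r n) x)"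
        by (rule l2_norm_triangle[OF H10_L2[OF w] test_L2[OF \<phi>(1)] H10_L2[OF w]])
      moreover have "l2_norm \<Omega> (\<lambda>x. \<phi> (r m) x - w (r n) x) \<le> l2_norm \<Omega> (\<lambda>x. \<phi> (r m) x - \<phi> (r n) x) + l2_norm \<Omega> (\<lambda>x. \<phi> (r n) x - w (r n) x)"
        by (rule l2_norm_triangle[OF test_L2[OF \<phi>(1)] test_L2[OF \<phi>(1)] H10_L2[OF w]])
      moreover have "l2_norm \<Omega> (\<lambda>x. \<phi> (r n) x - w (r n) x) < e / 3"
        using near[of n] mn L2.nrm_dif_sym[OF H10_L2[OF w] test_L2[OF \<phi>(1)], of "r n" "r n"] by (simp add: lc_diff l2_norm_nrm)
      moreover have "l2_norm \<Omega> (\<lambda>x. w (r m) x - \<phi> (r m) x) < e / 3" using near[of m] mn by simp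
      moreover have "l2_norm \<Omega> (\<lambda>x. \<phi> (r m) x - \<phi> (r n) x) < e / 3" using N1 mn by simp
      ultimately show ?thesis by linarith
    qed
    then show "\<exists>N. \<forall>m\<ge>N. \<forall>n\<ge>N. l2_norm \<Omega> (\<lambda>x. w (r m) x - w (r n) x) < e" by blast
  qed
qed

end

subsection \<open>Chain rule and truncation\<close>

lemma Ck_ident: "Ck k (\<lambda>t::real. t)"
  using Ck_inner[of k "1::real"] by simp

text \<open>With \<open>r\<close> for this function, \<open>r' = - (t - c) r^3\<close> is again a
  polynomial expression in \<open>t\<close> and \<open>r\<close>, so the induction closes. The
  square root itself has derivative \<open>(t - c) r\<close> and is handled through
  \<open>r\<close>.\<close>

lemma Ck_inverse_sqrt:
  fixes c e :: real
  assumes e: "e > 0"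
  shows "Ck k (\<lambda>t. 1 / sqrt ((t - c)\<^sup>2 + e\<^sup>2))"
proof (induction k)
  case 0
  have "(t - c)\<^sup>2 + e\<^sup>2 \<noteq> 0" for t using e by (simp add: sum_power2_eq_zero_iff)
  then show ?case by (auto intro!: continuous_intros)
next
  case (Suc k)
  let ?r = "\<lambda>t. 1 / sqrt ((t - c)\<^sup>2 + e\<^sup>2)"
  show ?case
  proof (rule Ck_real_SucI)
    fix t
    have p: "(t - c)\<^sup>2 + e\<^sup>2 > 0" using e by (simp add: add_nonneg_pos)
    define s where "s = sqrt ((t - c)\<^sup>2 + e\<^sup>2)"
    have s: "s > 0" using p by (simp add: s_def)
    have "((\<lambda>t. sqrt ((t - c)\<^sup>2 + e\<^sup>2)) has_real_derivative (t - c) / s) (at t)"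
      unfolding s_def using p by (auto intro!: derivative_eq_intros simp: divide_simps)
    moreover have "sqrt ((t - c)\<^sup>2 + e\<^sup>2) \<noteq> 0" using s unfolding s_def by linarith
    ultimately have "((\<lambda>t. inverse (sqrt ((t - c)\<^sup>2 + e\<^sup>2))) has_real_derivative - (inverse s * ((t - c) / s) * inverse s)) (at t)"
      unfolding s_def by (rule DERIV_inverse')
    then show "(?r has_real_derivative (-1 * (t + (- c))) * (?r t * (?r t * ?r t))) (at t)"
      unfolding s_def by (simp add: divide_inverse algebra_simps)
  next
    have "Ck k (\<lambda>t. (-1 * (t + (- c))))"
      by (rule Ck_mult[OF Ck_const Ck_add[OF Ck_ident Ck_const]])
    then show "Ck k (\<lambda>t. (-1 * (t + (- c))) * (?r t * (?r t * ?r t)))"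
      by (rule Ck_mult[OF _ Ck_mult[OF Suc Ck_mult[OF Suc Suc]]])
  qed
qed

lemma sqrt_shift_derivative:
  fixes c e :: real
  assumes e: "e > 0"
  shows "((\<lambda>t. sqrt ((t - c)\<^sup>2 + e\<^sup>2)) has_real_derivative (t - c) * (1 / sqrt ((t - c)\<^sup>2 + e\<^sup>2))) (at t)"
proof -
  have p: "(t - c)\<^sup>2 + e\<^sup>2 > 0" using e by (simp add: add_nonneg_pos)
  then show ?thesis by (auto intro!: derivative_eq_intros simp: divide_simps)
qed

lemma Ck_diff_const: "Ck k (\<lambda>t::real. t - c)"
  using Ck_add[OF Ck_ident[of k] Ck_const[of k "-c"]] by simp

lemma Ck_sqrt_shift:
  fixes c e :: real
  assumes e: "e > 0"
  shows "Ck k (\<lambda>t. sqrt ((t - c)\<^sup>2 + e\<^sup>2))"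
  by (rule Ck_SucD, rule Ck_real_SucI[OF sqrt_shift_derivative[OF e]])
    (rule Ck_mult[OF Ck_diff_const Ck_inverse_sqrt[OF e]])

lemma sqrt_shift_bounds:
  fixes s e :: real
  assumes e: "e > 0"
  shows "\<bar>s\<bar> \<le> sqrt (s\<^sup>2 + e\<^sup>2)" "sqrt (s\<^sup>2 + e\<^sup>2) \<le> \<bar>s\<bar> + e" "\<bar>s * (1 / sqrt (s\<^sup>2 + e\<^sup>2))\<bar> \<le> 1"
    "sqrt (s\<^sup>2 + e\<^sup>2) > 0" "e \<le> sqrt (s\<^sup>2 + e\<^sup>2)"
proof -
  show 1: "\<bar>s\<bar> \<le> sqrt (s\<^sup>2 + e\<^sup>2)" by (rule real_le_rsqrt) simp
  show "sqrt (s\<^sup>2 + e\<^sup>2) \<le> \<bar>s\<bar> + e"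
    using e by (intro real_le_lsqrt) (auto simp: power2_sum)
  show p: "sqrt (s\<^sup>2 + e\<^sup>2) > 0" using e by (simp add: add_nonneg_pos)
  show "\<bar>s * (1 / sqrt (s\<^sup>2 + e\<^sup>2))\<bar> \<le> 1" using 1 p by (simp add: abs_mult divide_simps)
  show "e \<le> sqrt (s\<^sup>2 + e\<^sup>2)" by (rule real_le_rsqrt) simp
qed

lemma lipschitz_of_derivative:
  fixes F :: "real \<Rightarrow> real"
  assumes "\<And>t. (F has_real_derivative F' t) (at t)" "\<And>t. \<bar>F' t\<bar> \<le> L"
  shows "\<bar>F s - F t\<bar> \<le> L * \<bar>s - t\<bar>"
  using field_differentiable_bound[of UNIV F F' L s t] assms by simp

section \<open>Nonlinear functions of elements of \<open>H^1_0\<close>\<close>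

context open_bounded
begin

lemma l2_norm_tendsto_0_dominated:
  fixes g :: "nat \<Rightarrow> 'a \<Rightarrow> 'b::euclidean_space"
  assumes g: "\<And>n. g n \<in> borel_measurable (lebesgue_on \<Omega>)" and k: "k \<in> L2 \<Omega>"
    and le: "\<And>n. AE x in lebesgue_on \<Omega>. norm (g n x) \<le> norm (k x)"
    and lim: "AE x in lebesgue_on \<Omega>. (\<lambda>n. g n x) \<longlonglongrightarrow> 0"
  shows "(\<lambda>n. l2_norm \<Omega> (g n)) \<longlonglongrightarrow> 0"
proof -
  have "(\<lambda>n. LINT x|lebesgue_on \<Omega>. (norm (g n x))\<^sup>2) \<longlonglongrightarrow> (LINT x|lebesgue_on \<Omega>. 0)"
  proof (rule integral_dominated_convergence[OF _ _ L2_sq_integrable[OF k]])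
    show "(\<lambda>x. (norm (g n x))\<^sup>2) \<in> borel_measurable (lebesgue_on \<Omega>)" for n
      by (intro borel_measurable_power measurable_compose[OF g borel_measurable_norm])
    show "AE x in lebesgue_on \<Omega>. (\<lambda>n. (norm (g n x))\<^sup>2) \<longlonglongrightarrow> 0"
      using lim
    proof eventually_elim
      case (elim x)
      then have "(\<lambda>n. (norm (g n x))\<^sup>2) \<longlonglongrightarrow> (norm (0::'b))\<^sup>2" by (intro tendsto_intros)
      then show ?case by simp
    qed
    show "AE x in lebesgue_on \<Omega>. norm ((norm (g n x))\<^sup>2) \<le> (norm (k x))\<^sup>2" for n
      using le[of n] by eventually_elim (simp add: power_mono)
  qed simp
  then have "(\<lambda>n. (l2_norm \<Omega> (g n))\<^sup>2) \<longlonglongrightarrow> 0" by (simp add: l2_norm_sq_int)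
  then have "(\<lambda>n. sqrt ((l2_norm \<Omega> (g n))\<^sup>2)) \<longlonglongrightarrow> sqrt 0" by (rule tendsto_real_sqrt)
  then show ?thesis by simp
qed

lemma l2_norm_mono:
  fixes g :: "'a \<Rightarrow> 'b::euclidean_space" and k :: "'a \<Rightarrow> 'c::euclidean_space"
  assumes "g \<in> borel_measurable (lebesgue_on \<Omega>)" "k \<in> L2 \<Omega>" "0 \<le> c"
    and "AE x in lebesgue_on \<Omega>. norm (g x) \<le> c * norm (k x)"
  shows "g \<in> L2 \<Omega>" "l2_norm \<Omega> g \<le> c * l2_norm \<Omega> k"
proof -
  have ae: "AE x in lebesgue_on \<Omega>. (norm (g x))\<^sup>2 \<le> c\<^sup>2 * (norm (k x))\<^sup>2"
    using assms(4) by eventually_elim (metis norm_ge_zero power_mono power_mult_distrib)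
  have i: "integrable (lebesgue_on \<Omega>) (\<lambda>x. c\<^sup>2 * (norm (k x))\<^sup>2)"
    by (intro integrable_mult_right L2_sq_integrable assms)
  have "integrable (lebesgue_on \<Omega>) (\<lambda>x. (norm (g x))\<^sup>2)"
  proof (rule Bochner_Integration.integrable_bound[OF i])
    show "(\<lambda>x. (norm (g x))\<^sup>2) \<in> borel_measurable (lebesgue_on \<Omega>)"
      by (intro borel_measurable_power measurable_compose[OF assms(1) borel_measurable_norm])
  qed (use ae in \<open>auto elim: eventually_mono\<close>)
  then show g: "g \<in> L2 \<Omega>" using assms(1) by (simp add: L2_def)
  have "(l2_norm \<Omega> g)\<^sup>2 \<le> (LINT x|lebesgue_on \<Omega>. c\<^sup>2 * (norm (k x))\<^sup>2)"
    unfolding l2_norm_sq_int by (rule integral_mono_AE[OF L2_sq_integrable[OF g] i ae])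
  then have "(l2_norm \<Omega> g)\<^sup>2 \<le> (c * l2_norm \<Omega> k)\<^sup>2" by (simp add: l2_norm_sq_int power_mult_distrib)
  then show "l2_norm \<Omega> g \<le> c * l2_norm \<Omega> k" by (rule power2_le_imp_le) (simp add: assms)
qed

lemma L2_add: "f \<in> L2 \<Omega> \<Longrightarrow> g \<in> L2 \<Omega> \<Longrightarrow> (\<lambda>x. f x + g x) \<in> L2 \<Omega>"
  and l2_norm_add_le: "f \<in> L2 \<Omega> \<Longrightarrow> g \<in> L2 \<Omega> \<Longrightarrow> l2_norm \<Omega> (\<lambda>x. f x + g x) \<le> l2_norm \<Omega> f + l2_norm \<Omega> g"
  for f g :: "'a \<Rightarrow> 'b::euclidean_space"
  using L2_lc[of f \<Omega> g 1 1] l2_norm_lc_le[of f \<Omega> g 1 1] by (simp_all add: lc_def)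

text \<open>The factor \<open>p\<close> is included so that one statement covers the plain chain
  rule (\<open>p = 1\<close>) and the localised test function of the logarithmic estimate.
  Hypothesis \<open>T\<close> keeps the images of the approximating test functions inside that
  class.\<close>

lemma H10_nonlinear:
  fixes F F' :: "real \<Rightarrow> real" and p :: "'a \<Rightarrow> real"
  assumes w: "w \<in> H10 \<Omega>"
    and p: "Ck 1 p" "\<And>x. \<bar>p x\<bar> \<le> B" "\<And>x. norm (grad p x) \<le> B"
    and F: "\<And>t. (F has_real_derivative F' t) (at t)" "continuous_on UNIV F'" "\<And>t. \<bar>F' t\<bar> \<le> L"
    and T: "\<And>\<phi>. \<phi> \<in> test_functions \<Omega> \<Longrightarrow> (\<lambda>x. p x * F (\<phi> x)) \<in> test_functions \<Omega>"
  shows "(\<lambda>x. p x * F (w x)) \<in> H10 \<Omega>"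
    "AE x in lebesgue_on \<Omega>. wgrad \<Omega> (\<lambda>x. p x * F (w x)) x = F (w x) *\<^sub>R grad p x + (p x * F' (w x)) *\<^sub>R wgrad \<Omega> w x"
proof -
  let ?M = "lebesgue_on \<Omega>"
  obtain \<phi> where \<phi>: "\<And>n. \<phi> n \<in> test_functions \<Omega>"
    "(\<lambda>n. l2_norm \<Omega> (\<lambda>x. \<phi> n x - w x)) \<longlonglongrightarrow> 0" "(\<lambda>n. l2_norm \<Omega> (\<lambda>x. grad (\<phi> n) x - wgrad \<Omega> w x)) \<longlonglongrightarrow> 0"
    "AE x in ?M. (\<lambda>n. \<phi> n x) \<longlonglongrightarrow> w x"
    by (fact H10_approx[OF w])
  have B: "0 \<le> B" using p(2)[of 0] by linarith
  have L: "0 \<le> L" using F(3)[of 0] by linarith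
  have Flip: "\<bar>F s - F t\<bar> \<le> L * \<bar>s - t\<bar>" for s t by (rule lipschitz_of_derivative[OF F(1,3)])
  have Fm: "F \<in> borel_measurable borel"
    by (intro borel_measurable_continuous_onI) (meson F(1) DERIV_isCont continuous_at_imp_continuous_on)
  have F'm: "F' \<in> borel_measurable borel" by (rule borel_measurable_continuous_onI[OF F(2)])
  have pm: "p \<in> borel_measurable ?M" "grad p \<in> borel_measurable ?M"
    using Ck_measurable[OF p(1)] by (auto intro: borel_measurable_dom)
  have wm: "w \<in> borel_measurable ?M" "wgrad \<Omega> w \<in> borel_measurable ?M"
    using H10_L2[OF w] wgrad_L2[OF w] by (auto intro: L2_measurable)
  have \<phi>m: "\<phi> n \<in> borel_measurable ?M" "grad (\<phi> n) \<in> borel_measurable ?M" for n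
    using test_L2[OF \<phi>(1)] grad_L2[OF \<phi>(1)] by (auto intro: L2_measurable)
  have FM: "(\<lambda>x. F (v x)) \<in> borel_measurable ?M" "(\<lambda>x. F' (v x)) \<in> borel_measurable ?M" if "v \<in> borel_measurable ?M" for v
    using measurable_compose[OF that Fm] measurable_compose[OF that F'm] by simp_all
  define g where "g n x = p x * F (\<phi> n x)" for n x
  define l where "l x = p x * F (w x)" for x
  define h where "h x = F (w x) *\<^sub>R grad p x + (p x * F' (w x)) *\<^sub>R wgrad \<Omega> w x" for x
  have gt: "g n \<in> test_functions \<Omega>" for n unfolding g_def by (rule T[OF \<phi>(1)])
  have grad_g: "grad (g n) x = F (\<phi> n x) *\<^sub>R grad p x + (p x * F' (\<phi> n x)) *\<^sub>R grad (\<phi> n) x" for n x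
  proof (rule grad_eqI)
    have pd: "p differentiable at x" using p(1) by simp
    have "((\<lambda>x. F (\<phi> n x)) has_derivative (\<lambda>h. F' (\<phi> n x) * (grad (\<phi> n) x \<bullet> h))) (at x)"
      by (rule has_derivative_compose[OF has_derivative_grad[OF test_functions_differentiable[OF \<phi>(1)]]
          F(1)[unfolded has_field_derivative_def]])
    from has_derivative_mult[OF has_derivative_grad[OF pd] this]
    show "(g n has_derivative (\<lambda>h. (F (\<phi> n x) *\<^sub>R grad p x + (p x * F' (\<phi> n x)) *\<^sub>R grad (\<phi> n) x) \<bullet> h)) (at x)"
      unfolding g_def by (simp add: inner_add_left algebra_simps)
  qed
  have lm: "l \<in> borel_measurable ?M" unfolding l_def by (intro borel_measurable_times pm FM wm)
  have hm: "h \<in> borel_measurable ?M"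
    unfolding h_def by (intro borel_measurable_add borel_measurable_scaleR borel_measurable_times pm FM wm)
  have dw: "(\<lambda>x. \<phi> n x - w x) \<in> L2 \<Omega>" for n by (intro L2_diff test_L2 \<phi> H10_L2 w)
  have dg: "(\<lambda>x. grad (\<phi> n) x - wgrad \<Omega> w x) \<in> L2 \<Omega>" for n by (intro L2_diff grad_L2 \<phi> wgrad_L2 w)
  have d1: "(\<lambda>x. g n x - l x) \<in> L2 \<Omega> \<and> l2_norm \<Omega> (\<lambda>x. g n x - l x) \<le> (B * L) * l2_norm \<Omega> (\<lambda>x. \<phi> n x - w x)" for n
  proof (intro conjI l2_norm_mono[OF _ dw])
    show "AE x in ?M. norm (g n x - l x) \<le> B * L * norm (\<phi> n x - w x)"
    proof (rule AE_I2)
      fix x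
      have "g n x - l x = p x * (F (\<phi> n x) - F (w x))" by (simp add: g_def l_def algebra_simps)
      then show "norm (g n x - l x) \<le> B * L * norm (\<phi> n x - w x)"
        using mult_mono[OF p(2)[of x] Flip[of "\<phi> n x" "w x"] B] by (simp add: abs_mult mult.assoc)
    qed
    then show "AE x in ?M. norm (g n x - l x) \<le> B * L * norm (\<phi> n x - w x)" .
  qed (use B L lm test_L2[OF gt] in \<open>auto intro!: borel_measurable_diff dest: L2_measurable\<close>)
  have lL2: "l \<in> L2 \<Omega>" using L2_diff[OF test_L2[OF gt] conjunct1[OF d1], of 0 0] by simp
  have lim1: "(\<lambda>n. l2_norm \<Omega> (\<lambda>x. g n x - l x)) \<longlonglongrightarrow> 0"
    using d1 by (intro Lim_null_comparison[OF _ tendsto_mult_right_zero[OF \<phi>(2), of "B * L"]]) auto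
  \<comment> \<open>The gradient error is split so that \<open>q1\<close> and \<open>q2\<close> are
    controlled by Lipschitz bounds and the convergence of \<open>\<phi> n\<close>. In
    \<open>q3\<close> the factor \<open>F' (\<phi> n x) - F' (w x)\<close> is merely bounded and
    tends to zero almost everywhere, so dominated convergence is used.\<close>
  define q1 where "q1 n x = (F (\<phi> n x) - F (w x)) *\<^sub>R grad p x" for n x
  define q2 where "q2 n x = (p x * F' (\<phi> n x)) *\<^sub>R (grad (\<phi> n) x - wgrad \<Omega> w x)" for n x
  define q3 where "q3 n x = (p x * (F' (\<phi> n x) - F' (w x))) *\<^sub>R wgrad \<Omega> w x" for n x
  have qm: "q1 n \<in> borel_measurable ?M" "q2 n \<in> borel_measurable ?M" "q3 n \<in> borel_measurable ?M" for n
    unfolding q1_def q2_def q3_def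
    by (intro borel_measurable_scaleR borel_measurable_diff borel_measurable_times pm FM wm \<phi>m)+
  have q1: "q1 n \<in> L2 \<Omega> \<and> l2_norm \<Omega> (q1 n) \<le> (B * L) * l2_norm \<Omega> (\<lambda>x. \<phi> n x - w x)" for n
  proof -
    have "AE x in ?M. norm (q1 n x) \<le> B * L * norm (\<phi> n x - w x)"
    proof (rule AE_I2)
      fix x
      show "norm (q1 n x) \<le> B * L * norm (\<phi> n x - w x)"
        using mult_mono[OF p(3)[of x] Flip[of "\<phi> n x" "w x"] B] by (simp add: q1_def mult.assoc mult.commute)
    qed
    then show ?thesis using l2_norm_mono[OF qm(1) dw, of "B * L"] B L by simp
  qed
  have q2: "q2 n \<in> L2 \<Omega> \<and> l2_norm \<Omega> (q2 n) \<le> (B * L) * l2_norm \<Omega> (\<lambda>x. grad (\<phi> n) x - wgrad \<Omega> w x)" for n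
  proof -
    have "AE x in ?M. norm (q2 n x) \<le> B * L * norm (grad (\<phi> n) x - wgrad \<Omega> w x)"
    proof (rule AE_I2)
      fix x
      show "norm (q2 n x) \<le> B * L * norm (grad (\<phi> n) x - wgrad \<Omega> w x)"
        unfolding q2_def norm_scaleR abs_mult using B
        by (intro mult_right_mono mult_mono p F) auto
    qed
    then show ?thesis using l2_norm_mono[OF qm(2) dg, of "B * L"] B L by simp
  qed
  let ?k = "lc (B * (2 * L)) (wgrad \<Omega> w) 0 (wgrad \<Omega> w)"
  have k: "?k \<in> L2 \<Omega>" by (intro L2_lc wgrad_L2 w)
  have q3le: "AE x in ?M. norm (q3 n x) \<le> norm (?k x)" for n
  proof (rule AE_I2)
    fix x
    have "\<bar>F' (\<phi> n x) - F' (w x)\<bar> \<le> 2 * L" using F(3)[of "\<phi> n x"] F(3)[of "w x"] by linarith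
    then have "norm (q3 n x) \<le> (B * (2 * L)) * norm (wgrad \<Omega> w x)"
      unfolding q3_def norm_scaleR abs_mult using B by (intro mult_right_mono mult_mono p) auto
    then show "norm (q3 n x) \<le> norm (?k x)" using B L by (simp add: lc_def)
  qed
  have q3: "(\<lambda>n. l2_norm \<Omega> (q3 n)) \<longlonglongrightarrow> 0"
  proof (rule l2_norm_tendsto_0_dominated[OF qm(3) k q3le])
    show "AE x in ?M. (\<lambda>n. q3 n x) \<longlonglongrightarrow> 0"
      using \<phi>(4)
    proof eventually_elim
      case (elim x)
      have "isCont F' (w x)" using F(2) by (simp add: continuous_on_eq_continuous_at)
      then have "(\<lambda>n. F' (\<phi> n x)) \<longlonglongrightarrow> F' (w x)" using elim by (rule isCont_tendsto_compose)
      then have "(\<lambda>n. q3 n x) \<longlonglongrightarrow> (p x * (F' (w x) - F' (w x))) *\<^sub>R wgrad \<Omega> w x"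
        unfolding q3_def by (intro tendsto_intros)
      then show ?case by simp
    qed
  qed
  have q3L2: "q3 n \<in> L2 \<Omega>" for n by (rule L2I_dominated[OF qm(3) k q3le])
  have sum: "grad (g n) x - h x = q1 n x + q2 n x + q3 n x" for n x
    unfolding grad_g h_def q1_def q2_def q3_def by (simp add: algebra_simps)
  have d2: "(\<lambda>x. grad (g n) x - h x) \<in> L2 \<Omega>" for n
    unfolding sum using q1 q2 q3L2 by (intro L2_add) auto
  have hL2: "h \<in> L2 \<Omega>" using L2_diff[OF grad_L2[OF gt] d2, of 0 0] by simp
  have lim2: "(\<lambda>n. l2_norm \<Omega> (\<lambda>x. grad (g n) x - h x)) \<longlonglongrightarrow> 0"
  proof (rule Lim_null_comparison)
    show "\<forall>\<^sub>F n in sequentially. norm (l2_norm \<Omega> (\<lambda>x. grad (g n) x - h x)) \<le>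
      (B * L) * l2_norm \<Omega> (\<lambda>x. \<phi> n x - w x) + (B * L) * l2_norm \<Omega> (\<lambda>x. grad (\<phi> n) x - wgrad \<Omega> w x) + l2_norm \<Omega> (q3 n)"
    proof (intro always_eventually allI)
      fix n
      have "l2_norm \<Omega> (\<lambda>x. grad (g n) x - h x) \<le> l2_norm \<Omega> (\<lambda>x. q1 n x + q2 n x) + l2_norm \<Omega> (q3 n)"
        unfolding sum using q1 q2 q3L2 by (intro l2_norm_add_le L2_add) auto
      also have "l2_norm \<Omega> (\<lambda>x. q1 n x + q2 n x) \<le> l2_norm \<Omega> (q1 n) + l2_norm \<Omega> (q2 n)"
        using q1 q2 by (intro l2_norm_add_le) auto
      finally show "norm (l2_norm \<Omega> (\<lambda>x. grad (g n) x - h x)) \<le>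
        (B * L) * l2_norm \<Omega> (\<lambda>x. \<phi> n x - w x) + (B * L) * l2_norm \<Omega> (\<lambda>x. grad (\<phi> n) x - wgrad \<Omega> w x) + l2_norm \<Omega> (q3 n)"
        using conjunct2[OF q1[of n]] conjunct2[OF q2[of n]] by simp
    qed
    show "(\<lambda>n. (B * L) * l2_norm \<Omega> (\<lambda>x. \<phi> n x - w x) + (B * L) * l2_norm \<Omega> (\<lambda>x. grad (\<phi> n) x - wgrad \<Omega> w x) + l2_norm \<Omega> (q3 n)) \<longlonglongrightarrow> 0"
      using tendsto_add[OF tendsto_add[OF tendsto_mult_right_zero[OF \<phi>(2), of "B * L"] tendsto_mult_right_zero[OF \<phi>(3), of "B * L"]] q3] by simp
  qed
  have eq: "l2_norm \<Omega> (\<lambda>x. wgrad \<Omega> (g n) x - h x) = l2_norm \<Omega> (\<lambda>x. grad (g n) x - h x)" for n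
    by (rule l2_norm_cong_AE) (use test_H1(2)[OF gt, of n] d2 in \<open>auto intro: L2_diff wgrad_L2 test_H10 gt hL2\<close>)
  have lim2': "(\<lambda>n. l2_norm \<Omega> (\<lambda>x. wgrad \<Omega> (g n) x - h x)) \<longlonglongrightarrow> 0" unfolding eq by (rule lim2)
  note R = H10_limit[OF test_H10[OF gt] lL2 hL2 lim1 lim2']
  show "(\<lambda>x. p x * F (w x)) \<in> H10 \<Omega>" using R(1) unfolding l_def[abs_def] .
  show "AE x in ?M. wgrad \<Omega> (\<lambda>x. p x * F (w x)) x = F (w x) *\<^sub>R grad p x + (p x * F' (w x)) *\<^sub>R wgrad \<Omega> w x"
    using R(2) unfolding l_def[abs_def] h_def .
qed

lemma grad_const: "grad (\<lambda>x. c) x = 0"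
  by (rule grad_eqI) simp

lemma H10_chain:
  fixes F F' :: "real \<Rightarrow> real"
  assumes w: "w \<in> H10 \<Omega>" and F: "\<And>k. Ck k F" "F 0 = 0" "\<And>t. (F has_real_derivative F' t) (at t)" "continuous_on UNIV F'" "\<And>t. \<bar>F' t\<bar> \<le> L"
  shows "(\<lambda>x. F (w x)) \<in> H10 \<Omega>" "AE x in lebesgue_on \<Omega>. wgrad \<Omega> (\<lambda>x. F (w x)) x = F' (w x) *\<^sub>R wgrad \<Omega> w x"
proof -
  have T: "(\<lambda>x. 1 * F (\<phi> x)) \<in> test_functions \<Omega>" if "\<phi> \<in> test_functions \<Omega>" for \<phi>
    using test_functions_compose[OF F(1,2) that] by simp
  show "(\<lambda>x. F (w x)) \<in> H10 \<Omega>" "AE x in lebesgue_on \<Omega>. wgrad \<Omega> (\<lambda>x. F (w x)) x = F' (w x) *\<^sub>R wgrad \<Omega> w x"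
    using H10_nonlinear[OF w Ck_const _ _ F(3-5) T, of 1] by (simp_all add: grad_const)
qed

text \<open>Approximate the modulus by \<open>sqrt ((t - c)^2 + e^2)\<close>, shifted to vanish at
  0. The derivatives converge to \<open>sgn (t - c)\<close> at every \<open>t\<close>, also at
  \<open>t = c\<close> where both are 0, so the level set where \<open>w\<close> equals
  \<open>c\<close> requires no special argument.\<close>

lemma H10_abs_shift:
  assumes w: "w \<in> H10 \<Omega>"
  shows "(\<lambda>x. \<bar>w x - c\<bar> - \<bar>c\<bar>) \<in> H10 \<Omega>"
    "AE x in lebesgue_on \<Omega>. wgrad \<Omega> (\<lambda>x. \<bar>w x - c\<bar> - \<bar>c\<bar>) x = sgn (w x - c) *\<^sub>R wgrad \<Omega> w x"
proof -
  let ?M = "lebesgue_on \<Omega>"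
  interpret finite_measure ?M by (rule finite_dom)
  define e where "e n = inverse (real (Suc n))" for n
  have e: "e n > 0" for n by (simp add: e_def)
  have elim: "e \<longlonglongrightarrow> 0" unfolding e_def by (rule LIMSEQ_inverse_real_of_nat)
  define F where "F n t = sqrt ((t - c)\<^sup>2 + (e n)\<^sup>2) - sqrt (c\<^sup>2 + (e n)\<^sup>2)" for n t
  define F' where "F' n t = (t - c) * (1 / sqrt ((t - c)\<^sup>2 + (e n)\<^sup>2))" for n t
  have CF: "Ck k (F n)" for k n
    using Ck_add[OF Ck_sqrt_shift[OF e, of k c n] Ck_const[of k "- sqrt (c\<^sup>2 + (e n)\<^sup>2)"]] by (simp add: F_def[abs_def])
  have F0: "F n 0 = 0" for n by (simp add: F_def)
  have dF: "(F n has_real_derivative F' n t) (at t)" for n t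
    unfolding F_def F'_def by (rule DERIV_cong[OF DERIV_diff[OF sqrt_shift_derivative[OF e] DERIV_const]]) simp
  have cF': "continuous_on UNIV (F' n)" for n
    unfolding F'_def[abs_def] by (rule Ck_continuous[OF Ck_mult[OF Ck_diff_const Ck_inverse_sqrt[OF e], of 0]])
  have F'1: "\<bar>F' n t\<bar> \<le> 1" for n t unfolding F'_def by (rule sqrt_shift_bounds(3)[OF e])
  note ch = H10_chain[OF w CF F0 dF cF' F'1]
  let ?l = "\<lambda>x. \<bar>w x - c\<bar> - \<bar>c\<bar>" and ?h = "\<lambda>x. sgn (w x - c) *\<^sub>R wgrad \<Omega> w x"
  have wm: "w \<in> borel_measurable ?M" using H10_L2[OF w] by (rule L2_measurable)
  have lm: "?l \<in> borel_measurable ?M" using wm by measurable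
  have sm: "(\<lambda>x. sgn (w x - c)) \<in> borel_measurable ?M" using wm by measurable
  have lL2: "?l \<in> L2 \<Omega>" by (rule L2I_dominated[OF lm H10_L2[OF w]]) (auto intro!: AE_I2)
  have hL2: "?h \<in> L2 \<Omega>"
    by (rule L2_mult_bounded(1)[OF wgrad_L2[OF w] sm, of 1]) (auto simp: abs_sgn_eq)
  have one: "(\<lambda>x. 1 :: real) \<in> L2 \<Omega>" by (simp add: L2_def)
  have lim1: "(\<lambda>n. l2_norm \<Omega> (\<lambda>x. F n (w x) - ?l x)) \<longlonglongrightarrow> 0"
  proof (rule Lim_null_comparison)
    show "\<forall>\<^sub>F n in sequentially. norm (l2_norm \<Omega> (\<lambda>x. F n (w x) - ?l x)) \<le> \<bar>2 * e n\<bar> * l2_norm \<Omega> (\<lambda>x. 1 :: real)"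
    proof (intro always_eventually allI)
      fix n
      have "\<bar>F n (w x) - ?l x\<bar> \<le> 2 * e n" for x
        using sqrt_shift_bounds(1,2)[OF e[of n], of "w x - c"] sqrt_shift_bounds(1,2)[OF e[of n], of c]
        unfolding F_def by linarith
      then show "norm (l2_norm \<Omega> (\<lambda>x. F n (w x) - ?l x)) \<le> \<bar>2 * e n\<bar> * l2_norm \<Omega> (\<lambda>x. 1 :: real)"
        using l2_norm_le_sup[OF L2_diff[OF H10_L2[OF ch(1)] lL2], of n "2 * e n"] by simp
    qed
    have "(\<lambda>n. \<bar>2 * e n\<bar> * l2_norm \<Omega> (\<lambda>x. 1 :: real)) \<longlonglongrightarrow> \<bar>2 * 0\<bar> * l2_norm \<Omega> (\<lambda>x. 1 :: real)"
      by (intro tendsto_intros elim)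
    then show "(\<lambda>n. \<bar>2 * e n\<bar> * l2_norm \<Omega> (\<lambda>x. 1 :: real)) \<longlonglongrightarrow> 0" by simp
  qed
  have eq: "l2_norm \<Omega> (\<lambda>x. wgrad \<Omega> (\<lambda>x. F n (w x)) x - ?h x) = l2_norm \<Omega> (\<lambda>x. (F' n (w x) - sgn (w x - c)) *\<^sub>R wgrad \<Omega> w x)" for n
  proof (rule l2_norm_cong_AE)
    show "AE x in ?M. wgrad \<Omega> (\<lambda>x. F n (w x)) x - ?h x = (F' n (w x) - sgn (w x - c)) *\<^sub>R wgrad \<Omega> w x"
      using ch(2)[of n] by eventually_elim (simp add: scaleR_left_diff_distrib)
    show "(\<lambda>x. wgrad \<Omega> (\<lambda>x. F n (w x)) x - ?h x) \<in> L2 \<Omega>" by (intro L2_diff wgrad_L2 ch hL2)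
    have Fm: "(\<lambda>x. F' n (w x)) \<in> borel_measurable ?M"
      using measurable_compose[OF wm borel_measurable_continuous_onI[OF cF']] by simp
    have "(\<lambda>x. F' n (w x) *\<^sub>R wgrad \<Omega> w x) \<in> L2 \<Omega>"
      by (rule L2_mult_bounded(1)[OF wgrad_L2[OF w] Fm, of 1]) (simp add: F'1)
    from L2_diff[OF this hL2] show "(\<lambda>x. (F' n (w x) - sgn (w x - c)) *\<^sub>R wgrad \<Omega> w x) \<in> L2 \<Omega>"
      by (simp add: scaleR_left_diff_distrib)
  qed
  have "(\<lambda>n. l2_norm \<Omega> (\<lambda>x. (F' n (w x) - sgn (w x - c)) *\<^sub>R wgrad \<Omega> w x)) \<longlonglongrightarrow> 0"
  proof (rule l2_norm_tendsto_0_dominated)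
    show "(\<lambda>x. (F' n (w x) - sgn (w x - c)) *\<^sub>R wgrad \<Omega> w x) \<in> borel_measurable ?M" for n
      using measurable_compose[OF wm borel_measurable_continuous_onI[OF cF']] sm L2_measurable[OF wgrad_L2[OF w]]
      by (intro borel_measurable_scaleR borel_measurable_diff) simp_all
    show "lc 2 (wgrad \<Omega> w) 0 (wgrad \<Omega> w) \<in> L2 \<Omega>" by (intro L2_lc wgrad_L2 w)
    show "AE x in ?M. norm ((F' n (w x) - sgn (w x - c)) *\<^sub>R wgrad \<Omega> w x) \<le> norm (lc 2 (wgrad \<Omega> w) 0 (wgrad \<Omega> w) x)" for n
    proof (rule AE_I2)
      fix x
      have "\<bar>sgn (w x - c)\<bar> \<le> 1" by (simp add: abs_sgn_eq)
      then have "\<bar>F' n (w x) - sgn (w x - c)\<bar> \<le> 2" using F'1[of n "w x"] by linarith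
      then show "norm ((F' n (w x) - sgn (w x - c)) *\<^sub>R wgrad \<Omega> w x) \<le> norm (lc 2 (wgrad \<Omega> w) 0 (wgrad \<Omega> w) x)"
        by (auto simp: lc_def intro!: mult_right_mono)
    qed
    show "AE x in ?M. (\<lambda>n. (F' n (w x) - sgn (w x - c)) *\<^sub>R wgrad \<Omega> w x) \<longlonglongrightarrow> 0"
    proof (rule AE_I2)
      fix x
      define s where "s = w x - c"
      have "(\<lambda>n. F' n (w x)) \<longlonglongrightarrow> sgn s"
      proof (cases "s = 0")
        case True
        then show ?thesis by (simp add: F'_def s_def)
      next
        case False
        have "(\<lambda>n. s * (1 / sqrt (s\<^sup>2 + (e n)\<^sup>2))) \<longlonglongrightarrow> s * (1 / sqrt (s\<^sup>2 + 0\<^sup>2))"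
          using False by (intro tendsto_intros elim) simp
        then show ?thesis using False by (simp add: F'_def s_def[symmetric] real_sgn_eq)
      qed
      then have "(\<lambda>n. (F' n (w x) - sgn (w x - c)) *\<^sub>R wgrad \<Omega> w x) \<longlonglongrightarrow> (sgn s - sgn (w x - c)) *\<^sub>R wgrad \<Omega> w x"
        by (intro tendsto_intros)
      then show "(\<lambda>n. (F' n (w x) - sgn (w x - c)) *\<^sub>R wgrad \<Omega> w x) \<longlonglongrightarrow> 0" by (simp add: s_def)
    qed
  qed
  then have lim2: "(\<lambda>n. l2_norm \<Omega> (\<lambda>x. wgrad \<Omega> (\<lambda>x. F n (w x)) x - ?h x)) \<longlonglongrightarrow> 0" unfolding eq .
  show "?l \<in> H10 \<Omega>" "AE x in ?M. wgrad \<Omega> ?l x = ?h x"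
    using H10_limit(1,2)[OF ch(1) lL2 hL2 lim1 lim2] by auto
qed

end

subsection \<open>A strong maximum principle\<close>

context open_bounded
begin

lemma indicator_L2:
  assumes "A \<in> sets lebesgue"
  shows "(indicator A :: 'a \<Rightarrow> real) \<in> L2 \<Omega>"
proof (rule bounded_L2[of _ 1])
  show "(indicator A :: 'a \<Rightarrow> real) \<in> borel_measurable (lebesgue_on \<Omega>)"
    using assms by (intro measurable_restrict_space1 borel_measurable_indicator)
qed (auto simp: indicator_def)

lemma indicator_mult_L2:
  fixes v :: "'a \<Rightarrow> 'b::euclidean_space"
  assumes "A \<in> sets lebesgue" "v \<in> L2 \<Omega>"
  shows "(\<lambda>x. indicator A x *\<^sub>R v x) \<in> L2 \<Omega>" "l2_norm \<Omega> (\<lambda>x. indicator A x *\<^sub>R v x) \<le> l2_norm \<Omega> v"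
  using L2_mult_bounded[OF assms(2) L2_measurable[OF indicator_L2[OF assms(1)]], of 1] by (auto simp: indicator_def)

text \<open>The left side is the variance form of Poincare's inequality on \<open>K\<close>,
  expressed by \<open>L^2\<close> quantities over \<open>\<Omega>\<close>. All its terms are
  continuous in \<open>H^1\<close>, so it passes from test functions to
  \<open>H10 \<Omega>\<close>.\<close>

lemma poincare_compact:
  assumes K: "compact K" "convex K" "K \<subseteq> \<Omega>"
  shows "\<exists>C\<ge>0. \<forall>v\<in>H10 \<Omega>. (l2_norm \<Omega> (indicator K :: 'a \<Rightarrow> real))\<^sup>2 * (l2_norm \<Omega> (\<lambda>x. indicator K x *\<^sub>R v x))\<^sup>2 - (l2_inner \<Omega> v (indicator K))\<^sup>2
    \<le> C * (l2_norm \<Omega> (\<lambda>x. indicator K x *\<^sub>R wgrad \<Omega> v x))\<^sup>2"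
proof -
  define D where "D = {y - x | x y. x \<in> K \<and> y \<in> K}"
  have D: "compact D"
  proof -
    have "D = {x - y | x y. x \<in> K \<and> y \<in> K}" unfolding D_def by blast
    then show ?thesis using compact_differences[OF K(1) K(1)] by simp
  qed
  obtain R where R: "\<And>h. h \<in> D \<Longrightarrow> norm h \<le> R" using compact_imp_bounded[OF D] by (auto simp: bounded_iff)
  have Kl: "K \<in> sets lebesgue" "K \<in> sets borel"
    using fmeasurableD[OF lmeasurable_compact[OF K(1)]] borel_compact[OF K(1)] by auto
  define m where "m = (l2_norm \<Omega> (indicator K :: 'a \<Rightarrow> real))\<^sup>2"
  have conv: "(LINT x|lborel. indicator K x * f x) = (LINT x|lebesgue_on \<Omega>. indicator K x * f x)"
    if "f \<in> borel_measurable borel" for f :: "'a \<Rightarrow> real"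
    using that Kl K(3) by (intro lebesgue_on_eq_lborel(1)[symmetric]) (auto simp: indicator_def)
  have m: "measure lborel K = m"
  proof -
    have "measure lborel K = (LINT x|lborel. indicator K x * (1::real))" by simp
    also have "\<dots> = (LINT x|lebesgue_on \<Omega>. indicator K x * (1::real))" by (rule conv) simp
    also have "\<dots> = m" unfolding m_def l2_norm_sq_int by (rule Bochner_Integration.integral_cong) (auto simp: indicator_def)
    finally show ?thesis .
  qed
  define C where "C = R\<^sup>2 * measure lborel D / 2"
  have C: "C \<ge> 0" by (simp add: C_def)
  have test: "m * (l2_norm \<Omega> (\<lambda>x. indicator K x *\<^sub>R f x))\<^sup>2 - (l2_inner \<Omega> f (indicator K))\<^sup>2
    \<le> C * (l2_norm \<Omega> (\<lambda>x. indicator K x *\<^sub>R grad f x))\<^sup>2" if f: "f \<in> test_functions \<Omega>" for f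
  proof -
    have C1: "Ck 1 f" using f by (rule test_functions_Ck)
    note [measurable] = Ck_measurable[OF C1]
    have 1: "(LINT x|lborel. indicator K x * (f x)\<^sup>2) = (l2_norm \<Omega> (\<lambda>x. indicator K x *\<^sub>R f x))\<^sup>2"
      unfolding l2_norm_sq_int by (subst conv) (auto simp: power_mult_distrib indicator_def intro!: Bochner_Integration.integral_cong)
    have 2: "(LINT x|lborel. indicator K x * f x) = l2_inner \<Omega> f (indicator K)"
      unfolding l2_inner_def by (subst conv) (auto simp: mult.commute)
    have 3: "(LINT x|lborel. indicator K x * (norm (grad f x))\<^sup>2) = (l2_norm \<Omega> (\<lambda>x. indicator K x *\<^sub>R grad f x))\<^sup>2"
      unfolding l2_norm_sq_int by (subst conv) (auto simp: power_mult_distrib indicator_def intro!: Bochner_Integration.integral_cong)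
    have "2 * (m * (l2_norm \<Omega> (\<lambda>x. indicator K x *\<^sub>R f x))\<^sup>2 - (l2_inner \<Omega> f (indicator K))\<^sup>2)
      \<le> R\<^sup>2 * measure lborel D * (l2_norm \<Omega> (\<lambda>x. indicator K x *\<^sub>R grad f x))\<^sup>2"
      using convex_poincare[OF C1 K(2,1) D _ R] unfolding 1 2 3 m by (auto simp: D_def)
    then show ?thesis by (simp add: C_def)
  qed
  have "m * (l2_norm \<Omega> (\<lambda>x. indicator K x *\<^sub>R v x))\<^sup>2 - (l2_inner \<Omega> v (indicator K))\<^sup>2
    \<le> C * (l2_norm \<Omega> (\<lambda>x. indicator K x *\<^sub>R wgrad \<Omega> v x))\<^sup>2" if v: "v \<in> H10 \<Omega>" for v
  proof -
    obtain \<phi> where \<phi>: "\<And>n. \<phi> n \<in> test_functions \<Omega>"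
      "(\<lambda>n. l2_norm \<Omega> (\<lambda>x. \<phi> n x - v x)) \<longlonglongrightarrow> 0" "(\<lambda>n. l2_norm \<Omega> (\<lambda>x. grad (\<phi> n) x - wgrad \<Omega> v x)) \<longlonglongrightarrow> 0"
      by (rule H10_approx[OF v]) blast
    have l1: "(\<lambda>n. l2_norm \<Omega> (\<lambda>x. indicator K x *\<^sub>R \<phi> n x)) \<longlonglongrightarrow> l2_norm \<Omega> (\<lambda>x. indicator K x *\<^sub>R v x)"
    proof (rule l2_norm_tendsto[OF indicator_mult_L2(1)[OF Kl(1) test_L2[OF \<phi>(1)]] indicator_mult_L2(1)[OF Kl(1) H10_L2[OF v]]])
      show "(\<lambda>n. l2_norm \<Omega> (\<lambda>x. indicator K x *\<^sub>R \<phi> n x - indicator K x *\<^sub>R v x)) \<longlonglongrightarrow> 0"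
        using indicator_mult_L2(2)[OF Kl(1) L2_diff[OF test_L2[OF \<phi>(1)] H10_L2[OF v]]]
        by (intro Lim_null_comparison[OF _ \<phi>(2)] always_eventually allI) (simp add: right_diff_distrib)
    qed
    have l2: "(\<lambda>n. l2_norm \<Omega> (\<lambda>x. indicator K x *\<^sub>R grad (\<phi> n) x)) \<longlonglongrightarrow> l2_norm \<Omega> (\<lambda>x. indicator K x *\<^sub>R wgrad \<Omega> v x)"
    proof (rule l2_norm_tendsto[OF indicator_mult_L2(1)[OF Kl(1) grad_L2[OF \<phi>(1)]] indicator_mult_L2(1)[OF Kl(1) wgrad_L2[OF v]]])
      show "(\<lambda>n. l2_norm \<Omega> (\<lambda>x. indicator K x *\<^sub>R grad (\<phi> n) x - indicator K x *\<^sub>R wgrad \<Omega> v x)) \<longlonglongrightarrow> 0"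
        using indicator_mult_L2(2)[OF Kl(1) L2_diff[OF grad_L2[OF \<phi>(1)] wgrad_L2[OF v]]]
        by (intro Lim_null_comparison[OF _ \<phi>(3)] always_eventually allI) (simp add: scaleR_right_diff_distrib)
    qed
    have l3: "(\<lambda>n. l2_inner \<Omega> (\<phi> n) (indicator K)) \<longlonglongrightarrow> l2_inner \<Omega> v (indicator K)"
      by (rule l2_inner_tendsto[OF test_L2[OF \<phi>(1)] H10_L2[OF v] indicator_L2[OF Kl(1)] \<phi>(2)])
    show ?thesis
      by (rule LIMSEQ_le[OF tendsto_diff[OF tendsto_mult[OF tendsto_const tendsto_power[OF l1]] tendsto_power[OF l3]]
          tendsto_mult[OF tendsto_const tendsto_power[OF l2]]]) (use test[OF \<phi>(1)] in auto)
  qed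
  then show ?thesis using C unfolding m_def by blast
qed

text \<open>Pointwise form of the energy estimate obtained by testing with \<open>\<chi>\<^sup>2 / (w + sqrt (w\<^sup>2 + e\<^sup>2))\<close>,
  where \<open>a\<close>, \<open>b\<close> stand for the gradients of \<open>- w\<close> and \<open>\<chi>\<close>.\<close>

lemma caccioppoli_pointwise:
  fixes a b :: "'b::real_inner" and w e c C \<chi>' :: real
  assumes e: "e > 0" and w: "w \<ge> 0" and c: "0 \<le> c" "c \<le> C"
  defines "S \<equiv> sqrt (w\<^sup>2 + e\<^sup>2)"
  defines "F \<equiv> (S - w) / e\<^sup>2" and "F' \<equiv> (1 - w / S) / e\<^sup>2"
  shows "1/8 * (\<chi>'\<^sup>2 * ((norm a)\<^sup>2 / S\<^sup>2)) \<le>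
    1/2 * (a \<bullet> (F *\<^sub>R (2 * \<chi>') *\<^sub>R b + (\<chi>'\<^sup>2 * F') *\<^sub>R a)) - c * w * (\<chi>'\<^sup>2 * F) + (norm b)\<^sup>2 + C * \<chi>'\<^sup>2"
proof -
  have S: "S > 0" "w \<le> S" "S\<^sup>2 = w\<^sup>2 + e\<^sup>2" using sqrt_shift_bounds[OF e, of w] w by (auto simp: S_def)
  define H where "H = w + S"
  have H: "H > 0" "S \<le> H" "H \<le> 2 * S" using S w by (auto simp: H_def)
  \<comment> \<open>Rationalising removes the cancellation: with \<open>H = w + S\<close> one gets
    \<open>F = 1 / H\<close> and \<open>F' = 1 / (H * S)\<close>, from which
    \<open>F^2 \<le> F'\<close> and \<open>w * F \<le> 1\<close> are visible.\<close>
  have eH: "e\<^sup>2 = (S - w) * H" using S by (simp add: H_def power2_eq_square algebra_simps)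
  have Sw: "S - w > 0"
  proof -
    have "e\<^sup>2 > 0" using e by simp
    then show ?thesis using eH H(1) by (simp add: zero_less_mult_iff)
  qed
  have F: "F = 1 / H" unfolding F_def eH using Sw H by simp
  have F': "F' = 1 / (H * S)"
  proof -
    have "1 - w / S = (S - w) / S" using S by (simp add: field_simps)
    then show ?thesis unfolding F'_def eH using Sw H S by simp
  qed
  have F'pos: "0 \<le> F'" unfolding F' using H S by simp
  have F2: "F\<^sup>2 \<le> F'" unfolding F F' using H S by (simp add: power2_eq_square frac_le)
  have F3: "1 / (2 * S\<^sup>2) \<le> F'" 
  proof -
    have "H * S \<le> 2 * S\<^sup>2" using mult_right_mono[OF H(3), of S] S(1) by (simp add: power2_eq_square)
    then show ?thesis unfolding F' using H(1) S(1) by (intro divide_left_mono) auto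
  qed
  have wF: "w * F \<le> 1" "0 \<le> F" unfolding F using H w S by (simp_all add: H_def)
  define T where "T = \<chi>'\<^sup>2 * (norm a)\<^sup>2"
  have T: "0 \<le> T" by (simp add: T_def)
  \<comment> \<open>Completing the square absorbs the mixed term at the price of
    \<open>(norm b)^2\<close> and a quarter of \<open>F^2 * T\<close>; since
    \<open>F^2 \<le> F'\<close>, a quarter of \<open>F' * T\<close> is left for the
    estimate.\<close>
  have "0 \<le> (norm ((1/2 * \<chi>' * F) *\<^sub>R a + b))\<^sup>2" by simp
  also have "\<dots> = (1/4) * (F\<^sup>2 * T) + \<chi>' * F * (a \<bullet> b) + (norm b)\<^sup>2"
    unfolding power2_norm_eq_inner T_def by (simp add: inner_add inner_commute power2_eq_square algebra_simps)
  finally have 1: "0 \<le> (1/4) * (F\<^sup>2 * T) + \<chi>' * F * (a \<bullet> b) + (norm b)\<^sup>2" .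
  have 2: "F\<^sup>2 * T \<le> F' * T" by (rule mult_right_mono[OF F2 T])
  have 3: "1 / (2 * S\<^sup>2) * T \<le> F' * T" by (rule mult_right_mono[OF F3 T])
  have 4: "c * w * (\<chi>'\<^sup>2 * F) \<le> C * \<chi>'\<^sup>2"
  proof -
    have "c * (w * F) \<le> C * 1" using c wF w by (intro mult_mono) auto
    from mult_right_mono[OF this, of "\<chi>'\<^sup>2"] show ?thesis by (simp add: algebra_simps)
  qed
  have 5: "1/2 * (a \<bullet> (F *\<^sub>R (2 * \<chi>') *\<^sub>R b + (\<chi>'\<^sup>2 * F') *\<^sub>R a)) = \<chi>' * F * (a \<bullet> b) + 1/2 * (F' * T)"
    unfolding T_def by (simp add: inner_add power2_norm_eq_inner algebra_simps)
  have 6: "1/8 * (\<chi>'\<^sup>2 * ((norm a)\<^sup>2 / S\<^sup>2)) = 1/4 * (1 / (2 * S\<^sup>2) * T)" by (simp add: T_def)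
  show ?thesis unfolding 5 6 using 1 2 3 4 by linarith
qed

text \<open>For a nonnegative supersolution \<open>w = k - u\<close> the gradient of \<open>arsinh (w / e)\<close> is bounded in
  \<open>L\<^sup>2(K)\<close> uniformly in \<open>e\<close>.\<close>

lemma log_gradient_bound:
  fixes k C :: real and c :: "'a \<Rightarrow> real"
  assumes u: "u \<in> H10 \<Omega>" "AE x in lebesgue_on \<Omega>. u x \<le> k"
    and c: "c \<in> borel_measurable (lebesgue_on \<Omega>)" "AE x in lebesgue_on \<Omega>. 0 \<le> c x \<and> c x \<le> C"
    and super: "\<And>\<psi>. \<psi> \<in> H10 \<Omega> \<Longrightarrow> AE x in lebesgue_on \<Omega>. 0 \<le> \<psi> x \<Longrightarrow>
      1/2 * l2_inner \<Omega> (wgrad \<Omega> u) (wgrad \<Omega> \<psi>) \<le> l2_inner \<Omega> (\<lambda>x. c x * (k - u x)) \<psi>"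
    and K: "compact K" "K \<subseteq> \<Omega>"
  shows "\<exists>B. \<forall>e>0. (\<lambda>x. arsinh ((k - u x) / e) - arsinh (k / e)) \<in> H10 \<Omega> \<and>
     (l2_norm \<Omega> (\<lambda>x. indicator K x *\<^sub>R wgrad \<Omega> (\<lambda>x. arsinh ((k - u x) / e) - arsinh (k / e)) x))\<^sup>2 \<le> B"
proof -
  let ?M = "lebesgue_on \<Omega>"
  obtain \<eta> c0 where \<eta>: "\<eta> \<in> test_functions \<Omega>" "\<And>x. 0 \<le> \<eta> x" "c0 > 0" "\<And>x. x \<in> K \<Longrightarrow> c0 \<le> \<eta> x"
    by (fact positive_test_function[OF open_dom K])
  \<comment> \<open>Free of the regularisation parameter \<open>e\<close>; this is the source of the
    uniformity.\<close>
  define D where "D = (l2_norm \<Omega> (grad \<eta>))\<^sup>2 + C * (l2_norm \<Omega> \<eta>)\<^sup>2"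
  have um: "u \<in> borel_measurable ?M" "wgrad \<Omega> u \<in> borel_measurable ?M"
    using H10_L2[OF u(1)] wgrad_L2[OF u(1)] by (auto intro: L2_measurable)
  have \<eta>m: "\<eta> \<in> borel_measurable ?M" using test_L2[OF \<eta>(1)] by (rule L2_measurable)
  have Kl: "K \<in> sets lebesgue" by (rule fmeasurableD[OF lmeasurable_compact[OF K(1)]])
  have main: "(\<lambda>x. arsinh ((k - u x) / e) - arsinh (k / e)) \<in> H10 \<Omega> \<and>
     (l2_norm \<Omega> (\<lambda>x. indicator K x *\<^sub>R wgrad \<Omega> (\<lambda>x. arsinh ((k - u x) / e) - arsinh (k / e)) x))\<^sup>2 \<le> 8 * D / c0\<^sup>2"
    if e: "e > 0" for e
  proof -
    define S where "S t = sqrt ((t - k)\<^sup>2 + e\<^sup>2)" for t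
    have S: "S t > 0" "e \<le> S t" for t using sqrt_shift_bounds[OF e, of "t - k"] by (auto simp: S_def)
    \<comment> \<open>With \<open>w = k - t\<close> this is
      \<open>1 / (w + sqrt (w^2 + e^2))\<close> in rationalised form, a smooth replacement of
      \<open>1 / (2 w)\<close>; multiplied by the squared cut-off it is the test function.\<close>
    define F where "F t = (S t + (t - k)) * (1 / e\<^sup>2)" for t
    define F' where "F' t = ((t - k) * (1 / S t) + 1) * (1 / e\<^sup>2)" for t
    have CS: "Ck j S" for j unfolding S_def[abs_def] by (rule Ck_sqrt_shift[OF e])
    have CF: "Ck j F" for j unfolding F_def[abs_def] by (intro Ck_mult[OF Ck_add[OF CS Ck_diff_const] Ck_const])
    have CF': "Ck j F'" for j
      unfolding F'_def[abs_def] S_def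
      by (intro Ck_mult[OF Ck_add[OF Ck_mult[OF Ck_diff_const Ck_inverse_sqrt[OF e]] Ck_const] Ck_const])
    have dF: "(F has_real_derivative F' t) (at t)" for t
      unfolding F_def[abs_def] F'_def S_def
      by (rule DERIV_cmult_right[OF DERIV_add[OF sqrt_shift_derivative[OF e]]]) (auto intro!: derivative_eq_intros)
    have F'b: "\<bar>F' t\<bar> \<le> 2 * (1 / e\<^sup>2)" for t
    proof -
      have "\<bar>(t - k) * (1 / S t) + 1\<bar> \<le> 2" using sqrt_shift_bounds(3)[OF e, of "t - k"] unfolding S_def by linarith
      then show ?thesis unfolding F'_def abs_mult using e by (intro mult_mono) auto
    qed
    have F0: "0 \<le> F t" for t
    proof -
      have "0 \<le> S t + (t - k)" using sqrt_shift_bounds(1)[OF e, of "t - k"] unfolding S_def by linarith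
      then show ?thesis unfolding F_def by simp
    qed
    define p where "p x = \<eta> x * \<eta> x" for x
    have p: "p \<in> test_functions \<Omega>" unfolding p_def by (rule test_functions_mult[OF test_functions_Ck[OF \<eta>(1)] \<eta>(1)])
    have gp: "grad p x = (2 * \<eta> x) *\<^sub>R grad \<eta> x" for x
    proof (rule grad_eqI)
      show "(p has_derivative (\<lambda>h. ((2 * \<eta> x) *\<^sub>R grad \<eta> x) \<bullet> h)) (at x)"
        unfolding p_def
        by (rule has_derivative_eq_rhs[OF has_derivative_mult[OF has_derivative_grad has_derivative_grad]])
          (auto intro: test_functions_differentiable[OF \<eta>(1)])
    qed
    obtain B1 B2 where B1: "\<And>x. norm (p x) \<le> B1" and B2: "\<And>x. norm (grad p x) \<le> B2"
      using test_bounded[OF p] grad_bounded[OF p] by blast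
    have T: "(\<lambda>x. p x * F (\<phi> x)) \<in> test_functions \<Omega>" if "\<phi> \<in> test_functions \<Omega>" for \<phi>
      using test_functions_mult[OF Ck_compose[OF CF test_functions_Ck[OF that]] p] by (simp add: mult.commute)
    have pB: "\<bar>p x\<bar> \<le> max B1 B2" "norm (grad p x) \<le> max B1 B2" for x
      using B1[of x] B2[of x] by auto
    note nl = H10_nonlinear[OF u(1) test_functions_Ck[OF p] pB dF Ck_continuous[OF CF'[of 0]] F'b T]
    define \<psi> where "\<psi> x = p x * F (u x)" for x
    have \<psi>: "\<psi> \<in> H10 \<Omega>" unfolding \<psi>_def by (rule nl)
    have g\<psi>: "AE x in ?M. wgrad \<Omega> \<psi> x = F (u x) *\<^sub>R grad p x + (p x * F' (u x)) *\<^sub>R wgrad \<Omega> u x"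
      unfolding \<psi>_def by (rule nl)
    have "AE x in ?M. 0 \<le> \<psi> x" unfolding \<psi>_def p_def using F0 \<eta>(2) by (intro AE_I2) simp
    from super[OF \<psi> this] have sup: "1/2 * l2_inner \<Omega> (wgrad \<Omega> u) (wgrad \<Omega> \<psi>) \<le> l2_inner \<Omega> (\<lambda>x. c x * (k - u x)) \<psi>" .
    define A where "A x = (\<eta> x)\<^sup>2 * ((norm (wgrad \<Omega> u x))\<^sup>2 / (S (u x))\<^sup>2)" for x
    have Sm: "(\<lambda>x. S (u x)) \<in> borel_measurable ?M" unfolding S_def using um(1) by measurable
    obtain B3 where B3: "\<And>x. norm (\<eta> x) \<le> B3" using test_bounded[OF \<eta>(1)] by blast
    have qm: "(\<lambda>x. \<eta> x / S (u x)) \<in> borel_measurable ?M" using \<eta>m Sm by (intro borel_measurable_divide)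
    have qb: "AE x in ?M. \<bar>\<eta> x / S (u x)\<bar> \<le> B3 / e"
      using B3 S e by (intro AE_I2) (auto simp: abs_mult intro!: frac_le order_trans[OF norm_ge_zero B3] order_trans[OF S(2) abs_ge_self])
    have q: "(\<lambda>x. (\<eta> x / S (u x)) *\<^sub>R wgrad \<Omega> u x) \<in> L2 \<Omega>"
      by (rule L2_mult_bounded(1)[OF wgrad_L2[OF u(1)] qm qb])
    have Aq: "A x = (norm ((\<eta> x / S (u x)) *\<^sub>R wgrad \<Omega> u x))\<^sup>2" for x
      by (simp add: A_def power_mult_distrib power_divide)
    have Ai: "integrable ?M A" unfolding Aq[abs_def] by (rule L2_sq_integrable[OF q])
    have cw: "(\<lambda>x. c x * (k - u x)) \<in> L2 \<Omega>"
    proof -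
      interpret finite_measure ?M by (rule finite_dom)
      have "(\<lambda>x. k :: real) \<in> L2 \<Omega>" by (simp add: L2_def)
      from L2_diff[OF this H10_L2[OF u(1)]] have ku: "(\<lambda>x. k - u x) \<in> L2 \<Omega>" .
      have "AE x in ?M. \<bar>c x\<bar> \<le> C" using c(2) by eventually_elim simp
      from L2_mult_bounded(1)[OF ku c(1) this] show ?thesis by simp
    qed
    have i1: "integrable ?M (\<lambda>x. wgrad \<Omega> u x \<bullet> wgrad \<Omega> \<psi> x)" by (intro integrable_inner_of_L2 wgrad_L2 u \<psi>)
    have i2: "integrable ?M (\<lambda>x. c x * (k - u x) * \<psi> x)" using integrable_inner_of_L2[OF cw H10_L2[OF \<psi>]] by simp
    have i3: "integrable ?M (\<lambda>x. (norm (grad \<eta> x))\<^sup>2)" by (intro L2_sq_integrable grad_L2 \<eta>)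
    have i4: "integrable ?M (\<lambda>x. (norm (\<eta> x))\<^sup>2)" by (intro L2_sq_integrable test_L2 \<eta>)
    have "(LINT x|?M. 1/8 * A x) \<le> (LINT x|?M. 1/2 * (wgrad \<Omega> u x \<bullet> wgrad \<Omega> \<psi> x) - c x * (k - u x) * \<psi> x + (norm (grad \<eta> x))\<^sup>2 + C * (norm (\<eta> x))\<^sup>2)"
    proof (rule integral_mono_AE)
      show "AE x in ?M. 1/8 * A x \<le> 1/2 * (wgrad \<Omega> u x \<bullet> wgrad \<Omega> \<psi> x) - c x * (k - u x) * \<psi> x + (norm (grad \<eta> x))\<^sup>2 + C * (norm (\<eta> x))\<^sup>2"
        using g\<psi> c(2) u(2)
      proof eventually_elim
        case (elim x)
        have w: "0 \<le> k - u x" using elim by simp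
        have Sx: "S (u x) = sqrt ((k - u x)\<^sup>2 + e\<^sup>2)" by (simp add: S_def power2_commute)
        have Fx: "F (u x) = (sqrt ((k - u x)\<^sup>2 + e\<^sup>2) - (k - u x)) / e\<^sup>2" unfolding F_def Sx by simp
        have F'x: "F' (u x) = (1 - (k - u x) / sqrt ((k - u x)\<^sup>2 + e\<^sup>2)) / e\<^sup>2"
        proof -
          have *: "(u x - k) * (1 / s) + 1 = 1 - (k - u x) / s" for s :: real by (simp add: divide_inverse algebra_simps)
          show ?thesis unfolding F'_def Sx * by simp
        qed
        have "wgrad \<Omega> \<psi> x = F (u x) *\<^sub>R (2 * \<eta> x) *\<^sub>R grad \<eta> x + ((\<eta> x)\<^sup>2 * F' (u x)) *\<^sub>R wgrad \<Omega> u x"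
          using elim by (simp only: gp) (simp add: p_def power2_eq_square)
        moreover have "\<psi> x = (\<eta> x)\<^sup>2 * F (u x)" by (simp add: \<psi>_def p_def power2_eq_square)
        ultimately show ?case
          using caccioppoli_pointwise[OF e w, of "c x" C "\<eta> x" "wgrad \<Omega> u x" "grad \<eta> x"] elim
          unfolding A_def Fx F'x Sx by simp
      qed
    qed (use Ai i1 i2 i3 i4 in auto)
    also have "\<dots> = 1/2 * l2_inner \<Omega> (wgrad \<Omega> u) (wgrad \<Omega> \<psi>) - l2_inner \<Omega> (\<lambda>x. c x * (k - u x)) \<psi> + D"
      using i1 i2 i3 i4 by (simp add: l2_inner_def D_def l2_norm_sq_int)
    also have "\<dots> \<le> D" using sup by simp
    finally have A_le: "(LINT x|?M. A x) \<le> 8 * D" by simp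
    \<comment> \<open>The subtracted constant makes \<open>V 0 = 0\<close>, as membership of
      \<open>V (u x)\<close> in \<open>H^1_0\<close> demands. Since \<open>V' = - 1 / S\<close>, the
      squared gradient of \<open>V (u x)\<close> is the quotient that occurs in \<open>A\<close>,
      and \<open>c0 \<le> \<eta>\<close> on \<open>K\<close> removes the cut-off.\<close>
    define V where "V t = arsinh ((k - t) / e) - arsinh (k / e)" for t
    define V' where "V' t = -1 * (1 / S t)" for t
    have dV: "(V has_real_derivative V' t) (at t)" for t
    proof -
      have "e * sqrt (((k - t) / e)\<^sup>2 + 1) = S t"
      proof -
        have "S t = sqrt (e\<^sup>2 * (((k - t) / e)\<^sup>2 + 1))" using e by (simp add: S_def power_divide distrib_left power2_commute[of k])
        then show ?thesis using e by (simp add: real_sqrt_mult)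
      qed
      then have "- (1 / e) * (1 / sqrt (((k - t) / e)\<^sup>2 + 1)) = V' t" unfolding V'_def using e by (auto simp: field_simps)
      moreover have "(V has_real_derivative - (1 / e) * (1 / sqrt (((k - t) / e)\<^sup>2 + 1))) (at t)"
      proof -
        have "((\<lambda>t. (k - t) / e) has_real_derivative - (1 / e)) (at t)"
          using e by (auto intro!: derivative_eq_intros)
        from DERIV_diff[OF DERIV_chain2[OF arsinh_real_has_field_derivative this] DERIV_const[of "arsinh (k / e)"]]
        show ?thesis unfolding V_def[abs_def] by (simp add: mult.commute)
      qed
      ultimately show ?thesis by simp
    qed
    have CV': "Ck j V'" for j unfolding V'_def[abs_def] S_def by (rule Ck_mult[OF Ck_const Ck_inverse_sqrt[OF e]])
    have CV: "Ck j V" for j by (rule Ck_SucD[OF Ck_real_SucI[OF dV CV']])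
    have V0: "V 0 = 0" by (simp add: V_def)
    have V'b: "\<bar>V' t\<bar> \<le> 1 / e" for t unfolding V'_def using S[of t] e by (simp add: abs_mult frac_le)
    note ch = H10_chain[OF u(1) CV V0 dV Ck_continuous[OF CV'[of 0]] V'b]
    have "(l2_norm \<Omega> (\<lambda>x. indicator K x *\<^sub>R wgrad \<Omega> (\<lambda>x. V (u x)) x))\<^sup>2 \<le> (LINT x|?M. (1 / c0\<^sup>2) * A x)"
      unfolding l2_norm_sq_int
    proof (rule integral_mono_AE[OF L2_sq_integrable[OF indicator_mult_L2(1)[OF Kl wgrad_L2[OF ch(1)]]]])
      show "integrable ?M (\<lambda>x. (1 / c0\<^sup>2) * A x)" by (intro integrable_mult_right Ai)
      show "AE x in ?M. (norm (indicator K x *\<^sub>R wgrad \<Omega> (\<lambda>x. V (u x)) x))\<^sup>2 \<le> (1 / c0\<^sup>2) * A x"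
        using ch(2)
      proof eventually_elim
        case (elim x)
        show ?case
        proof (cases "x \<in> K")
          case True
          have "c0\<^sup>2 \<le> (\<eta> x)\<^sup>2" using \<eta>(3) \<eta>(4)[OF True] by (intro power_mono) auto
          moreover have "0 \<le> (norm (wgrad \<Omega> u x))\<^sup>2 / (S (u x))\<^sup>2" by simp
          ultimately have "c0\<^sup>2 * ((norm (wgrad \<Omega> u x))\<^sup>2 / (S (u x))\<^sup>2) \<le> A x"
            unfolding A_def by (rule mult_right_mono)
          moreover have "(norm (indicator K x *\<^sub>R wgrad \<Omega> (\<lambda>x. V (u x)) x))\<^sup>2 = (norm (wgrad \<Omega> u x))\<^sup>2 / (S (u x))\<^sup>2"
            unfolding elim V'_def using True by (simp add: power_mult_distrib power_divide)
          ultimately show ?thesis using \<eta>(3) by (simp add: pos_le_divide_eq mult.commute)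
        qed (simp add: A_def)
      qed
    qed
    also have "\<dots> \<le> 8 * D / c0\<^sup>2" using A_le \<eta>(3) by (simp add: divide_right_mono)
    finally show ?thesis using ch(1) unfolding V_def by simp
  qed
  then show ?thesis by blast
qed

end

section \<open>From the logarithmic estimate to the strong maximum principle\<close>

context open_bounded
begin

lemma l2_norm_indicator_eq_0_iff:
  assumes "A \<in> sets lebesgue"
  shows "l2_norm \<Omega> (indicator A :: 'a \<Rightarrow> real) = 0 \<longleftrightarrow> (AE x in lebesgue_on \<Omega>. x \<notin> A)"
  using l2_norm_eq_0_iff[OF indicator_L2[OF assms]] by (simp add: indicator_eq_0_iff)

lemma dom_set_lebesgue:
  assumes "f \<in> borel_measurable (lebesgue_on \<Omega>)" "A \<in> sets borel"
  shows "{x \<in> \<Omega>. f x \<in> A} \<in> sets lebesgue"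
proof -
  have "f -` A \<inter> space (lebesgue_on \<Omega>) \<in> sets (lebesgue_on \<Omega>)" using assms by (rule measurable_sets)
  then have "f -` A \<inter> \<Omega> \<in> sets lebesgue" by (simp add: sets_restrict_space_iff)
  moreover have "{x \<in> \<Omega>. f x \<in> A} = f -` A \<inter> \<Omega>" by auto
  ultimately show ?thesis by simp
qed

text \<open>Poincare's inequality bounds \<open>arsinh (w / e)\<close> on \<open>K\<close> in mean square uniformly in \<open>e\<close>, because this
  function vanishes on the zero set of \<open>w\<close>, which has positive measure; then let \<open>e \<longrightarrow> 0\<close>.\<close>

lemma strong_maximum_local:
  fixes k C :: real and c :: "'a \<Rightarrow> real"
  assumes u: "u \<in> H10 \<Omega>" "AE x in lebesgue_on \<Omega>. u x \<le> k"
    and c: "c \<in> borel_measurable (lebesgue_on \<Omega>)" "AE x in lebesgue_on \<Omega>. 0 \<le> c x \<and> c x \<le> C"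
    and super: "\<And>\<psi>. \<psi> \<in> H10 \<Omega> \<Longrightarrow> AE x in lebesgue_on \<Omega>. 0 \<le> \<psi> x \<Longrightarrow>
      1/2 * l2_inner \<Omega> (wgrad \<Omega> u) (wgrad \<Omega> \<psi>) \<le> l2_inner \<Omega> (\<lambda>x. c x * (k - u x)) \<psi>"
    and K: "compact K" "convex K" "K \<subseteq> \<Omega>"
    and pos: "\<not> (AE x in lebesgue_on \<Omega>. x \<in> K \<longrightarrow> u x \<noteq> k)"
  shows "AE x in lebesgue_on \<Omega>. x \<in> K \<longrightarrow> u x = k"
proof -
  let ?M = "lebesgue_on \<Omega>"
  have um: "u \<in> borel_measurable ?M" using H10_L2[OF u(1)] by (rule L2_measurable)
  have Kl: "K \<in> sets lebesgue" by (rule fmeasurableD[OF lmeasurable_compact[OF K(1)]])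
  define E where "E = K \<inter> {x \<in> \<Omega>. u x \<in> {k}}"
  define E' where "E' = K \<inter> {x \<in> \<Omega>. u x \<in> - {k}}"
  have El: "E \<in> sets lebesgue" "E' \<in> sets lebesgue"
    unfolding E_def E'_def by (intro sets.Int Kl dom_set_lebesgue[OF um]; simp)+
  have KE: "K = E \<union> E'" "E \<inter> E' = {}" using K(3) by (auto simp: E_def E'_def)
  let ?i = "\<lambda>A. indicator A :: 'a \<Rightarrow> real"
  define m where "m = (l2_norm \<Omega> (?i K))\<^sup>2"
  define mE where "mE = (l2_norm \<Omega> (?i E))\<^sup>2"
  define mE' where "mE' = (l2_norm \<Omega> (?i E'))\<^sup>2"
  have mm: "m = mE + mE'"
  proof -
    have "?i K = lc 1 (?i E) 1 (?i E')" using KE by (auto simp: lc_def fun_eq_iff indicator_def)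
    moreover have "l2_inner \<Omega> (?i E) (?i E') = 0"
    proof -
      have "(\<lambda>x. ?i E x \<bullet> ?i E' x) = (\<lambda>x. 0)" using KE(2) by (auto simp: fun_eq_iff indicator_def)
      then show ?thesis unfolding l2_inner_def by simp
    qed
    ultimately show ?thesis
      unfolding m_def mE_def mE'_def l2_norm_sq
      using L2.ip_lc_self[OF indicator_L2[OF El(1)] indicator_L2[OF El(2)], of 1 1] by simp
  qed
  have mEpos: "mE > 0"
  proof -
    have "l2_norm \<Omega> (?i E) \<noteq> 0"
    proof
      assume "l2_norm \<Omega> (?i E) = 0"
      then have "AE x in ?M. x \<notin> E" using l2_norm_indicator_eq_0_iff[OF El(1)] by simp
      then have "AE x in ?M. x \<in> K \<longrightarrow> u x \<noteq> k" using AE_space by eventually_elim (auto simp: E_def)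
      then show False using pos by simp
    qed
    then show ?thesis unfolding mE_def by simp
  qed
  obtain B where B: "\<And>e. e > 0 \<Longrightarrow> (\<lambda>x. arsinh ((k - u x) / e) - arsinh (k / e)) \<in> H10 \<Omega> \<and>
     (l2_norm \<Omega> (\<lambda>x. indicator K x *\<^sub>R wgrad \<Omega> (\<lambda>x. arsinh ((k - u x) / e) - arsinh (k / e)) x))\<^sup>2 \<le> B"
    using log_gradient_bound[OF u c super K(1,3)] by blast
  obtain Cp where Cp: "Cp \<ge> 0" "\<And>v. v \<in> H10 \<Omega> \<Longrightarrow> m * (l2_norm \<Omega> (\<lambda>x. indicator K x *\<^sub>R v x))\<^sup>2 - (l2_inner \<Omega> v (?i K))\<^sup>2
    \<le> Cp * (l2_norm \<Omega> (\<lambda>x. indicator K x *\<^sub>R wgrad \<Omega> v x))\<^sup>2"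
    using poincare_compact[OF K] unfolding m_def by blast
  define Z where "Z = Cp * B"
  have J_le: "mE * (l2_norm \<Omega> (\<lambda>x. ?i K x * arsinh ((k - u x) / e)))\<^sup>2 \<le> Z" if e: "e > 0" for e
  proof -
    define a where "a = arsinh (k / e)"
    define v where "v x = arsinh ((k - u x) / e) - a" for x
    have v: "v \<in> H10 \<Omega>" "(l2_norm \<Omega> (\<lambda>x. indicator K x *\<^sub>R wgrad \<Omega> v x))\<^sup>2 \<le> B"
      using B[OF e] unfolding v_def a_def by auto
    define f where "f x = ?i K x * arsinh ((k - u x) / e)" for x
    define g where "g x = ?i K x * v x" for x
    have gL: "g \<in> L2 \<Omega>" unfolding g_def using indicator_mult_L2(1)[OF Kl H10_L2[OF v(1)]] by simp
    have fg: "f = lc 1 g a (?i K)" by (simp add: f_def g_def v_def lc_def fun_eq_iff algebra_simps)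
    have fL: "f \<in> L2 \<Omega>" unfolding fg by (intro L2_lc gL indicator_L2 Kl)
    define I where "I = l2_inner \<Omega> g (?i K)"
    have I: "l2_inner \<Omega> v (?i K) = I"
      unfolding I_def l2_inner_def g_def by (rule Bochner_Integration.integral_cong) (auto simp: indicator_def)
    \<comment> \<open>The variance over \<open>K\<close> does not change when the constant
      \<open>a\<close> is added, so the bound for \<open>v\<close> is one for the function
      \<open>arsinh (w / e)\<close> itself.\<close>
    have "m * (l2_norm \<Omega> f)\<^sup>2 - (l2_inner \<Omega> f (?i K))\<^sup>2 = m * (l2_norm \<Omega> g)\<^sup>2 - I\<^sup>2"
      unfolding fg l2_norm_sq l2_inner_lc[OF gL indicator_L2[OF Kl] indicator_L2[OF Kl]]
        L2.ip_lc_self[OF gL indicator_L2[OF Kl]] I_def[symmetric] m_def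
      by (simp add: power2_eq_square algebra_simps)
    also have "\<dots> \<le> Cp * (l2_norm \<Omega> (\<lambda>x. indicator K x *\<^sub>R wgrad \<Omega> v x))\<^sup>2"
      using Cp(2)[OF v(1)] by (simp add: I g_def[abs_def])
    also have "\<dots> \<le> Z" unfolding Z_def by (rule mult_left_mono[OF v(2) Cp(1)])
    finally have 1: "m * (l2_norm \<Omega> f)\<^sup>2 - (l2_inner \<Omega> f (?i K))\<^sup>2 \<le> Z" .
    \<comment> \<open>\<open>f\<close> vanishes on \<open>E\<close>, so its mean involves only
      \<open>E'\<close>; Cauchy-Schwarz there leaves \<open>mE\<close> times the squared norm of
      \<open>f\<close>, because \<open>m = mE + mE'\<close>.\<close>
    have "l2_inner \<Omega> f (?i K) = l2_inner \<Omega> f (?i E')"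
      unfolding l2_inner_def
      by (rule Bochner_Integration.integral_cong) (use KE in \<open>auto simp: f_def indicator_def E_def\<close>)
    then have "\<bar>l2_inner \<Omega> f (?i K)\<bar> \<le> l2_norm \<Omega> f * l2_norm \<Omega> (?i E')"
      using l2_cs[OF fL indicator_L2[OF El(2)]] by simp
    then have "(l2_inner \<Omega> f (?i K))\<^sup>2 \<le> (l2_norm \<Omega> f)\<^sup>2 * mE'"
      unfolding mE'_def power_mult_distrib[symmetric] by (metis abs_ge_zero power2_abs power_mono)
    then have "mE * (l2_norm \<Omega> f)\<^sup>2 \<le> m * (l2_norm \<Omega> f)\<^sup>2 - (l2_inner \<Omega> f (?i K))\<^sup>2"
      unfolding mm by (simp add: algebra_simps)
    with 1 show ?thesis unfolding f_def by linarith
  qed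
  have small: "AE x in ?M. x \<in> K \<longrightarrow> k - u x < a" if a: "a > 0" for a
  proof -
    define P where "P = K \<inter> {x \<in> \<Omega>. u x \<in> {..k - a}}"
    have P: "P \<in> sets lebesgue" unfolding P_def by (intro sets.Int Kl dom_set_lebesgue[OF um]) simp
    have le: "t\<^sup>2 * (mE * (l2_norm \<Omega> (?i P))\<^sup>2) \<le> Z" if t: "t > 0" for t :: real
    proof -
      \<comment> \<open>Then \<open>arsinh (a / e) = t\<close>, so the function is at least
        \<open>t\<close> on \<open>P\<close> and \<open>t^2\<close> times the measure of
        \<open>P\<close> is bounded uniformly in \<open>t\<close>. Hence \<open>P\<close> is a null
        set.\<close>
      define e where "e = a / sinh t"
      have e: "e > 0" using a t by (simp add: e_def)
      have ae: "a / e = sinh t" using a t by (simp add: e_def)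
      let ?f = "\<lambda>x. ?i K x * arsinh ((k - u x) / e)"
      have fL: "?f \<in> L2 \<Omega>"
      proof -
        have "(\<lambda>x. arsinh (k / e)) \<in> L2 \<Omega>"
          using finite_measure.emeasure_finite[OF finite_dom] by (intro bounded_L2[of _ "\<bar>arsinh (k / e)\<bar>"]) auto
        from L2_add[OF H10_L2[OF conjunct1[OF B[OF e]]] this] have "(\<lambda>x. arsinh ((k - u x) / e)) \<in> L2 \<Omega>" by simp
        from indicator_mult_L2(1)[OF Kl this] show ?thesis by simp
      qed
      have "AE x in ?M. norm (t * ?i P x) \<le> 1 * norm (?f x)"
      proof (rule AE_I2)
        fix x
        show "norm (t * ?i P x) \<le> 1 * norm (?f x)"
        proof (cases "x \<in> P")
          case True
          then have "a / e \<le> (k - u x) / e" using e by (auto simp: P_def intro!: divide_right_mono)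
          then have "arsinh (a / e) \<le> arsinh ((k - u x) / e)"
            by (meson arsinh_less_iff_real not_less)
          then have "t \<le> arsinh ((k - u x) / e)" unfolding ae by (simp add: arsinh_sinh_real)
          then show ?thesis using t True by (auto simp: P_def)
        qed simp
      qed
      moreover have "(\<lambda>x. t * ?i P x) \<in> borel_measurable ?M"
        by (intro borel_measurable_times borel_measurable_const L2_measurable[OF indicator_L2[OF P]])
      ultimately have "l2_norm \<Omega> (\<lambda>x. t * ?i P x) \<le> l2_norm \<Omega> ?f"
        using l2_norm_mono(2)[OF _ fL, of "\<lambda>x. t * ?i P x" 1] by simp
      from power_mono[OF this, of 2] have "(l2_norm \<Omega> (\<lambda>x. t * ?i P x))\<^sup>2 \<le> (l2_norm \<Omega> ?f)\<^sup>2" by simp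
      moreover have "(l2_norm \<Omega> (\<lambda>x. t * ?i P x))\<^sup>2 = t\<^sup>2 * (l2_norm \<Omega> (?i P))\<^sup>2"
        unfolding l2_norm_sq_int by (simp add: power_mult_distrib)
      ultimately have "mE * (t\<^sup>2 * (l2_norm \<Omega> (?i P))\<^sup>2) \<le> mE * (l2_norm \<Omega> ?f)\<^sup>2" using mEpos by simp
      with J_le[OF e] show ?thesis by (simp add: mult.left_commute)
    qed
    have "l2_norm \<Omega> (?i P) = 0"
    proof (rule ccontr)
      assume "l2_norm \<Omega> (?i P) \<noteq> 0"
      then have q: "mE * (l2_norm \<Omega> (?i P))\<^sup>2 > 0" using mEpos by simp
      define q where "q = mE * (l2_norm \<Omega> (?i P))\<^sup>2"
      have qp: "q > 0" using q by (simp add: q_def)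
      define t where "t = \<bar>Z\<bar> / q + 1"
      have t: "t \<ge> 1" using qp by (simp add: t_def)
      then have "t * 1 \<le> t * t" by (intro mult_left_mono) auto
      then have "t * q \<le> t\<^sup>2 * q" using qp by (simp add: power2_eq_square mult_right_mono)
      moreover have "t * q = \<bar>Z\<bar> + q" using qp by (simp add: t_def field_simps)
      ultimately show False using le[of t] t qp unfolding q_def[symmetric] by linarith
    qed
    then have "AE x in ?M. x \<notin> P" using l2_norm_indicator_eq_0_iff[OF P] by simp
    then show ?thesis using AE_space by eventually_elim (auto simp: P_def)
  qed
  have "AE x in ?M. \<forall>n::nat. x \<in> K \<longrightarrow> k - u x < inverse (real (Suc n))"
    by (subst AE_all_countable) (auto intro: small)
  then show ?thesis using u(2)
  proof eventually_elim
    case (elim x)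
    show ?case
    proof
      assume "x \<in> K"
      show "u x = k"
      proof (rule ccontr)
        assume "u x \<noteq> k"
        then have "0 < k - u x" using elim by simp
        then obtain n where "inverse (real (Suc n)) < k - u x" using reals_Archimedean by blast
        then show False using elim \<open>x \<in> K\<close> by (meson not_less_iff_gr_or_eq less_trans)
      qed
    qed
  qed
qed

text \<open>Cover \<open>\<Omega>\<close> by countably many boxes. If \<open>u = k\<close> on a
  non-null part of a box \<open>Q\<close>, then for any box \<open>X\<close> of the cover the convex
  hull of \<open>Q \<union> X\<close> is compact and lies in the convex set \<open>\<Omega>\<close>,
  and the local statement on that hull gives \<open>u = k\<close> almost everywhere on
  \<open>X\<close>.\<close>

lemma strong_maximum:
  fixes k C :: real and c :: "'a \<Rightarrow> real"
  assumes convex: "convex \<Omega>"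
    and u: "u \<in> H10 \<Omega>" "AE x in lebesgue_on \<Omega>. u x \<le> k"
    and c: "c \<in> borel_measurable (lebesgue_on \<Omega>)" "AE x in lebesgue_on \<Omega>. 0 \<le> c x \<and> c x \<le> C"
    and super: "\<And>\<psi>. \<psi> \<in> H10 \<Omega> \<Longrightarrow> AE x in lebesgue_on \<Omega>. 0 \<le> \<psi> x \<Longrightarrow>
      1/2 * l2_inner \<Omega> (wgrad \<Omega> u) (wgrad \<Omega> \<psi>) \<le> l2_inner \<Omega> (\<lambda>x. c x * (k - u x)) \<psi>"
  shows "(AE x in lebesgue_on \<Omega>. u x \<noteq> k) \<or> (AE x in lebesgue_on \<Omega>. u x = k)"
proof (rule disjCI)
  let ?M = "lebesgue_on \<Omega>"
  assume n: "\<not> (AE x in ?M. u x = k)"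
  show "AE x in ?M. u x \<noteq> k"
  proof (rule ccontr)
    assume p: "\<not> (AE x in ?M. u x \<noteq> k)"
    obtain \<D> where D: "countable \<D>" "\<D> \<subseteq> Pow \<Omega>" "\<And>X. X \<in> \<D> \<Longrightarrow> \<exists>a b. X = cbox a b" "\<Union>\<D> = \<Omega>"
      by (fact open_countable_Union_open_cbox[OF open_dom])
    have glue: "AE x in ?M. P x" if "\<And>X. X \<in> \<D> \<Longrightarrow> AE x in ?M. x \<in> X \<longrightarrow> P x" for P
    proof -
      have "AE x in ?M. \<forall>X\<in>\<D>. x \<in> X \<longrightarrow> P x" by (subst AE_ball_countable[OF D(1)]) (use that in blast)
      then show ?thesis using AE_space by eventually_elim (use D(4) in auto)
    qed
    obtain Q where Q: "Q \<in> \<D>" "\<not> (AE x in ?M. x \<in> Q \<longrightarrow> u x \<noteq> k)" using glue[of "\<lambda>x. u x \<noteq> k"] p by blast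
    have "AE x in ?M. x \<in> X \<longrightarrow> u x = k" if X: "X \<in> \<D>" for X
    proof -
      let ?K = "convex hull (Q \<union> X)"
      have "compact (Q \<union> X)" using D(3)[OF X] D(3)[OF Q(1)] by (auto intro!: compact_Un)
      then have K: "compact ?K" by (rule compact_convex_hull)
      have K': "?K \<subseteq> \<Omega>" using D(2) X Q(1) convex by (intro hull_minimal) auto
      have "\<not> (AE x in ?M. x \<in> ?K \<longrightarrow> u x \<noteq> k)"
      proof
        assume "AE x in ?M. x \<in> ?K \<longrightarrow> u x \<noteq> k"
        then have "AE x in ?M. x \<in> Q \<longrightarrow> u x \<noteq> k" by eventually_elim (auto intro: hull_inc)
        then show False using Q(2) by simp
      qed
      then have "AE x in ?M. x \<in> ?K \<longrightarrow> u x = k"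
        by (intro strong_maximum_local[OF u c super K convex_convex_hull K'])
      then show ?thesis by eventually_elim (auto intro: hull_inc)
    qed
    from glue[of "\<lambda>x. u x = k", OF this] n show False by simp
  qed
qed

end

subsection \<open>The bilinear forms of the Gross--Pitaevskii problem\<close>

locale gross_pitaevskii = open_bounded \<Omega> for \<Omega> :: "'a::euclidean_space set" +
  fixes V u :: "'a \<Rightarrow> real" and \<beta> ev :: real
  assumes convex_dom: "convex \<Omega>"
    and dim: "DIM('a) \<le> 3"
    and V_Linf: "V \<in> Linf \<Omega>" and V_nonneg: "AE x in lebesgue_on \<Omega>. V x \<ge> 0"
    and \<beta>_nonneg: "\<beta> \<ge> 0"
    and u_H10: "u \<in> H10 \<Omega>" and u_norm: "l2_norm \<Omega> u = 1"
    and u_pos: "AE x in lebesgue_on \<Omega>. u x > 0"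
    and u_eigen: "\<And>v. v \<in> H10 \<Omega> \<Longrightarrow> a_form \<Omega> V \<beta> u u v = ev * l2_inner \<Omega> u v"
begin

abbreviation "M \<equiv> lebesgue_on \<Omega>"
abbreviation a where "a \<equiv> a_form \<Omega> V \<beta>"

lemma V_measurable: "V \<in> borel_measurable M"
  using V_Linf by (simp add: Linf_def)

definition CV where "CV = (SOME c. 0 \<le> c \<and> (AE x in M. 0 \<le> V x \<and> V x \<le> c))"

lemma CV: "0 \<le> CV" "AE x in M. 0 \<le> V x \<and> V x \<le> CV"
proof -
  have fin: "linf_norm \<Omega> V < \<infinity>" using V_Linf by (simp add: Linf_def)
  have "\<exists>r::real. linf_norm \<Omega> V \<le> ereal r"
    using fin by (cases "linf_norm \<Omega> V") (auto intro: exI[of _ 0])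
  then obtain r where r: "linf_norm \<Omega> V \<le> ereal r" by blast
  have m: "(\<lambda>x. ereal \<bar>V x\<bar>) \<in> borel_measurable M" using V_measurable by measurable
  have "AE x in M. ereal \<bar>V x\<bar> \<le> linf_norm \<Omega> V" unfolding linf_norm_def by (rule esssup_AE)
  then have "AE x in M. 0 \<le> V x \<and> V x \<le> max r 0"
    using V_nonneg
  proof eventually_elim
    case (elim x)
    then have "ereal \<bar>V x\<bar> \<le> ereal r" using r by (meson order_trans)
    then show ?case using elim by simp
  qed
  then have "\<exists>c. 0 \<le> c \<and> (AE x in M. 0 \<le> V x \<and> V x \<le> c)" by (intro exI[of _ "max r 0"]) simp
  from someI_ex[OF this, folded CV_def] show "0 \<le> CV" "AE x in M. 0 \<le> V x \<and> V x \<le> CV" by blast+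
qed

lemma V_mult_L2:
  assumes "w \<in> L2 \<Omega>"
  shows "(\<lambda>x. V x * w x) \<in> L2 \<Omega>" "l2_norm \<Omega> (\<lambda>x. V x * w x) \<le> CV * l2_norm \<Omega> w"
proof -
  have "AE x in M. \<bar>V x\<bar> \<le> CV" using CV(2) by eventually_elim simp
  from L2_mult_bounded[OF assms V_measurable this] CV(1)
  show "(\<lambda>x. V x * w x) \<in> L2 \<Omega>" "l2_norm \<Omega> (\<lambda>x. V x * w x) \<le> CV * l2_norm \<Omega> w" by simp_all
qed

text \<open>The square root of the constant in \<open>H10_fourth_power\<close>, as needed for the
  \<open>L^2\<close> norm of a square.\<close>

definition K4 :: real where "K4 = sqrt (3 * 10^8)"

lemma K4_nonneg: "0 \<le> K4"
  by (simp add: K4_def)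

lemma sq_L2:
  assumes "w \<in> H10 \<Omega>"
  shows "(\<lambda>x. (w x)\<^sup>2) \<in> L2 \<Omega>" "l2_norm \<Omega> (\<lambda>x. (w x)\<^sup>2) \<le> K4 * (h1_norm \<Omega> w)\<^sup>2"
proof -
  have wm: "w \<in> borel_measurable M" using H10_L2[OF assms] by (rule L2_measurable)
  have e: "(norm ((w x)\<^sup>2))\<^sup>2 = w x ^ 4" for x by (simp add: power_mult[symmetric])
  show "(\<lambda>x. (w x)\<^sup>2) \<in> L2 \<Omega>"
    unfolding L2_def using wm H10_fourth_power(1)[OF dim assms] by (auto simp: e)
  have "(l2_norm \<Omega> (\<lambda>x. (w x)\<^sup>2))\<^sup>2 \<le> 3 * 10^8 * h1_norm \<Omega> w ^ 4"
    unfolding l2_norm_sq_int e by (rule H10_fourth_power(2)[OF dim assms])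
  also have "\<dots> = (K4 * (h1_norm \<Omega> w)\<^sup>2)\<^sup>2"
    by (simp add: K4_def power_mult_distrib power_mult[symmetric])
  finally show "l2_norm \<Omega> (\<lambda>x. (w x)\<^sup>2) \<le> K4 * (h1_norm \<Omega> w)\<^sup>2"
    by (rule power2_le_imp_le) (simp add: K4_nonneg)
qed

lemma mult_L2:
  assumes "w \<in> H10 \<Omega>" "v \<in> H10 \<Omega>"
  shows "(\<lambda>x. w x * v x) \<in> L2 \<Omega>" "l2_norm \<Omega> (\<lambda>x. w x * v x) \<le> K4 * (h1_norm \<Omega> w * h1_norm \<Omega> v)"
proof -
  have m: "(\<lambda>x. w x * v x) \<in> borel_measurable M"
    using assms by (intro borel_measurable_times L2_measurable H10_L2)
  have e: "(norm (w x * v x))\<^sup>2 = (w x)\<^sup>2 \<bullet> (v x)\<^sup>2" for x by (simp add: power_mult_distrib)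
  have i: "integrable M (\<lambda>x. (w x)\<^sup>2 \<bullet> (v x)\<^sup>2)" by (intro integrable_inner_of_L2 sq_L2 assms)
  then show "(\<lambda>x. w x * v x) \<in> L2 \<Omega>" using m by (simp add: L2_def power_mult_distrib)
  have "(l2_norm \<Omega> (\<lambda>x. w x * v x))\<^sup>2 = l2_inner \<Omega> (\<lambda>x. (w x)\<^sup>2) (\<lambda>x. (v x)\<^sup>2)"
    unfolding l2_norm_sq_int e l2_inner_def ..
  also have "\<dots> \<le> l2_norm \<Omega> (\<lambda>x. (w x)\<^sup>2) * l2_norm \<Omega> (\<lambda>x. (v x)\<^sup>2)"
    using l2_cs[OF sq_L2(1)[OF assms(1)] sq_L2(1)[OF assms(2)]] by simp
  also have "\<dots> \<le> (K4 * (h1_norm \<Omega> w)\<^sup>2) * (K4 * (h1_norm \<Omega> v)\<^sup>2)"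
    by (intro mult_mono sq_L2 assms) (auto simp: K4_nonneg)
  also have "\<dots> = (K4 * (h1_norm \<Omega> w * h1_norm \<Omega> v))\<^sup>2" by (simp add: power_mult_distrib power2_eq_square)
  finally show "l2_norm \<Omega> (\<lambda>x. w x * v x) \<le> K4 * (h1_norm \<Omega> w * h1_norm \<Omega> v)"
    by (rule power2_le_imp_le) (simp add: K4_nonneg)
qed

text \<open>The integral of a product of four functions, hence symmetric in its arguments. Grouped
  as an inner product of two products it is bounded through \<open>L^4\<close>, and it turns a
  change of the weight \<open>z\<close> in \<open>a z\<close> into polynomial algebra.\<close>

definition q :: "('a \<Rightarrow> real) \<Rightarrow> ('a \<Rightarrow> real) \<Rightarrow> ('a \<Rightarrow> real) \<Rightarrow> ('a \<Rightarrow> real) \<Rightarrow> real" where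
  "q z y w v = l2_inner \<Omega> (\<lambda>x. z x * y x) (\<lambda>x. w x * v x)"

lemma q_bound:
  assumes "z \<in> H10 \<Omega>" "y \<in> H10 \<Omega>" "w \<in> H10 \<Omega>" "v \<in> H10 \<Omega>"
  shows "\<bar>q z y w v\<bar> \<le> K4\<^sup>2 * (h1_norm \<Omega> z * h1_norm \<Omega> y * h1_norm \<Omega> w * h1_norm \<Omega> v)"
proof -
  have "\<bar>q z y w v\<bar> \<le> l2_norm \<Omega> (\<lambda>x. z x * y x) * l2_norm \<Omega> (\<lambda>x. w x * v x)"
    unfolding q_def by (intro l2_cs mult_L2 assms)
  also have "\<dots> \<le> (K4 * (h1_norm \<Omega> z * h1_norm \<Omega> y)) * (K4 * (h1_norm \<Omega> w * h1_norm \<Omega> v))"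
    by (intro mult_mono mult_L2 assms) (auto simp: K4_nonneg)
  finally show ?thesis by (simp add: power2_eq_square mult_ac)
qed

lemma q_integrable:
  assumes "z \<in> H10 \<Omega>" "y \<in> H10 \<Omega>" "w \<in> H10 \<Omega>" "v \<in> H10 \<Omega>"
  shows "integrable M (\<lambda>x. z x * y x * (w x * v x))"
  using integrable_inner_of_L2[OF mult_L2(1)[OF assms(1,2)] mult_L2(1)[OF assms(3,4)]] by simp

lemma q_int: "q z y w v = (LINT x|M. z x * y x * (w x * v x))"
  by (simp add: q_def l2_inner_def)

lemma q_perm: "q z y w v = q y z w v" "q z y w v = q w v z y" "q z y w v = q z w y v"
  unfolding q_int by (simp_all add: mult_ac)

lemma q_lc1:
  assumes "f \<in> H10 \<Omega>" "g \<in> H10 \<Omega>" "y \<in> H10 \<Omega>" "w \<in> H10 \<Omega>" "v \<in> H10 \<Omega>"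
  shows "q (lc s f t g) y w v = s * q f y w v + t * q g y w v"
proof -
  have "(\<lambda>x. lc s f t g x * y x) = lc s (\<lambda>x. f x * y x) t (\<lambda>x. g x * y x)"
    by (simp add: lc_def algebra_simps)
  then show ?thesis unfolding q_def using assms by (simp add: l2_inner_lc mult_L2)
qed

lemma a_eq:
  "a z w v = 1/2 * l2_inner \<Omega> (wgrad \<Omega> w) (wgrad \<Omega> v) + l2_inner \<Omega> (\<lambda>x. V x * w x) v + \<beta> * q z w z v"
proof -
  have "l2_inner \<Omega> (\<lambda>x. \<bar>z x\<bar>^2 * w x) v = q z w z v"
    unfolding q_int l2_inner_def by (simp add: power2_eq_square mult_ac)
  then show ?thesis by (simp add: a_form_def)
qed

lemma V_inner_commute: "l2_inner \<Omega> (\<lambda>x. V x * w x) v = l2_inner \<Omega> (\<lambda>x. V x * v x) w"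
  by (simp add: l2_inner_def mult_ac)

lemma V_inner_nonneg: "0 \<le> l2_inner \<Omega> (\<lambda>x. V x * w x) w"
  unfolding l2_inner_def
proof (rule integral_nonneg_AE)
  show "AE x in M. 0 \<le> (V x * w x) \<bullet> w x" using V_nonneg by eventually_elim (simp add: mult.assoc)
qed

lemma q_nonneg: "0 \<le> q z w z w"
  unfolding q_def by (simp add: l2_norm_sq[symmetric])

lemma a_commute: "a z w v = a z v w"
  unfolding a_eq using V_inner_commute[of w v] l2_inner_commute[of \<Omega> "wgrad \<Omega> w"] q_perm(2)[of z w z v] by simp

lemma a_lc:
  assumes "f \<in> H10 \<Omega>" "g \<in> H10 \<Omega>" "k \<in> H10 \<Omega>" "z \<in> H10 \<Omega>"
  shows "a z (lc s f t g) k = s * a z f k + t * a z g k"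
proof -
  have 1: "l2_inner \<Omega> (wgrad \<Omega> (lc s f t g)) (wgrad \<Omega> k) = s * l2_inner \<Omega> (wgrad \<Omega> f) (wgrad \<Omega> k) + t * l2_inner \<Omega> (wgrad \<Omega> g) (wgrad \<Omega> k)"
    by (intro wgrad_inner_lc H10_H1 wgrad_L2 assms)
  have "(\<lambda>x. V x * lc s f t g x) = lc s (\<lambda>x. V x * f x) t (\<lambda>x. V x * g x)" by (simp add: lc_def algebra_simps)
  then have 2: "l2_inner \<Omega> (\<lambda>x. V x * lc s f t g x) k = s * l2_inner \<Omega> (\<lambda>x. V x * f x) k + t * l2_inner \<Omega> (\<lambda>x. V x * g x) k"
    using assms by (simp add: l2_inner_lc V_mult_L2 H10_L2)
  have 3: "q z (lc s f t g) z k = s * q z f z k + t * q z g z k"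
    using q_lc1[OF assms(1,2,4,4,3), of s t] by (simp add: q_perm(1)[of z])
  show ?thesis unfolding a_eq 1 2 3 by (simp add: algebra_simps)
qed

lemma a_nonneg: "0 \<le> a z w w"
  unfolding a_eq using V_inner_nonneg[of w] q_nonneg[of z w] \<beta>_nonneg by (simp add: l2_norm_sq[symmetric])

definition P where "P = (SOME p. p > 0 \<and> (\<forall>w\<in>H10 \<Omega>. l2_norm \<Omega> w \<le> p * l2_norm \<Omega> (wgrad \<Omega> w)))"

lemma P: "P > 0" "w \<in> H10 \<Omega> \<Longrightarrow> l2_norm \<Omega> w \<le> P * l2_norm \<Omega> (wgrad \<Omega> w)"
proof -
  have "\<exists>p. p > 0 \<and> (\<forall>w\<in>H10 \<Omega>. l2_norm \<Omega> w \<le> p * l2_norm \<Omega> (wgrad \<Omega> w))" using poincare by blast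
  from someI_ex[OF this, folded P_def] show "P > 0" "w \<in> H10 \<Omega> \<Longrightarrow> l2_norm \<Omega> w \<le> P * l2_norm \<Omega> (wgrad \<Omega> w)"
    by blast+
qed

text \<open>The factor 2 comes from the coefficient 1/2 of the gradient term in \<open>a\<close>,
  and \<open>1 + P^2\<close> from Poincare's inequality.\<close>

definition \<gamma> where "\<gamma> = 1 / (2 * (1 + P\<^sup>2))"

lemma \<gamma>_pos: "\<gamma> > 0"
  unfolding \<gamma>_def by (simp add: add_pos_nonneg)

text \<open>Potential and density contribute nonnegatively, so the constant is the same for every
  weight \<open>z\<close>. The error estimate uses this for the moving weight
  \<open>u + h\<close>.\<close>

lemma a_coercive:
  assumes "w \<in> H10 \<Omega>"
  shows "\<gamma> * (h1_norm \<Omega> w)\<^sup>2 \<le> a z w w"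
proof -
  have "(l2_norm \<Omega> w)\<^sup>2 \<le> P\<^sup>2 * (l2_norm \<Omega> (wgrad \<Omega> w))\<^sup>2"
    using power_mono[OF P(2)[OF assms], of 2] by (simp add: power_mult_distrib)
  then have "(h1_norm \<Omega> w)\<^sup>2 \<le> (1 + P\<^sup>2) * (l2_norm \<Omega> (wgrad \<Omega> w))\<^sup>2"
    by (simp add: h1_norm_sq algebra_simps)
  then have "\<gamma> * (h1_norm \<Omega> w)\<^sup>2 \<le> \<gamma> * ((1 + P\<^sup>2) * (l2_norm \<Omega> (wgrad \<Omega> w))\<^sup>2)" using \<gamma>_pos by simp
  also have "\<dots> = 1/2 * (l2_norm \<Omega> (wgrad \<Omega> w))\<^sup>2"
  proof -
    define y where "y = 1 + P\<^sup>2"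
    have "y \<noteq> 0" using zero_le_power2[of P] unfolding y_def by linarith
    then have "1 / (2 * y) * (y * t) = 1/2 * t" for t by simp
    then show ?thesis unfolding \<gamma>_def y_def .
  qed
  also have "\<dots> \<le> a z w w"
    unfolding a_eq using V_inner_nonneg[of w] q_nonneg[of z w] \<beta>_nonneg by (simp add: l2_norm_sq[symmetric])
  finally show ?thesis .
qed

lemma a_bounded:
  assumes "w \<in> H10 \<Omega>" "v \<in> H10 \<Omega>" "z \<in> H10 \<Omega>"
  shows "\<bar>a z w v\<bar> \<le> (1 + CV + \<beta> * K4\<^sup>2 * (h1_norm \<Omega> z)\<^sup>2) * (h1_norm \<Omega> w * h1_norm \<Omega> v)"
proof -
  let ?h = "h1_norm \<Omega> w * h1_norm \<Omega> v"
  have h: "0 \<le> ?h" by simp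
  have 1: "\<bar>l2_inner \<Omega> (wgrad \<Omega> w) (wgrad \<Omega> v)\<bar> \<le> ?h"
    using l2_cs[OF wgrad_L2[OF assms(1)] wgrad_L2[OF assms(2)]] mult_mono[OF l2_le_h1(2)[of w] l2_le_h1(2)[of v]] by simp
  have 2: "\<bar>l2_inner \<Omega> (\<lambda>x. V x * w x) v\<bar> \<le> CV * ?h"
  proof -
    have "\<bar>l2_inner \<Omega> (\<lambda>x. V x * w x) v\<bar> \<le> l2_norm \<Omega> (\<lambda>x. V x * w x) * l2_norm \<Omega> v"
      by (intro l2_cs V_mult_L2 H10_L2 assms)
    also have "\<dots> \<le> (CV * h1_norm \<Omega> w) * h1_norm \<Omega> v"
      using V_mult_L2(2)[OF H10_L2[OF assms(1)]] mult_left_mono[OF l2_le_h1(1)[of w] CV(1)]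
      by (intro mult_mono l2_le_h1) (auto simp: CV)
    finally show ?thesis by (simp add: mult.assoc)
  qed
  have 3: "\<bar>\<beta> * q z w z v\<bar> \<le> \<beta> * K4\<^sup>2 * (h1_norm \<Omega> z)\<^sup>2 * ?h"
    using mult_left_mono[OF q_bound[OF assms(3,1,3,2)] \<beta>_nonneg] \<beta>_nonneg
    by (simp add: abs_mult power2_eq_square mult_ac)
  have "\<bar>a z w v\<bar> \<le> 1/2 * \<bar>l2_inner \<Omega> (wgrad \<Omega> w) (wgrad \<Omega> v)\<bar> + \<bar>l2_inner \<Omega> (\<lambda>x. V x * w x) v\<bar> + \<bar>\<beta> * q z w z v\<bar>"
    unfolding a_eq by linarith
  also have "\<dots> \<le> 1 * ?h + CV * ?h + \<beta> * K4\<^sup>2 * (h1_norm \<Omega> z)\<^sup>2 * ?h"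
    using 1 2 3 h by linarith
  finally show ?thesis by (simp add: algebra_simps)
qed

lemma sip_a: "z \<in> H10 \<Omega> \<Longrightarrow> sip (H10 \<Omega>) (a z)"
  by unfold_locales (auto simp: H10_lc test_H10[OF test_functions_zero] a_lc a_nonneg intro: a_commute)

lemma nrm_a_bounds:
  assumes z: "z \<in> H10 \<Omega>" and w: "w \<in> H10 \<Omega>"
  shows "sqrt \<gamma> * h1_norm \<Omega> w \<le> sip.nrm (a z) w"
    "sip.nrm (a z) w \<le> sqrt (1 + CV + \<beta> * K4\<^sup>2 * (h1_norm \<Omega> z)\<^sup>2) * h1_norm \<Omega> w"
proof -
  interpret sip "H10 \<Omega>" "a z" by (rule sip_a[OF z])
  have "sqrt (\<gamma> * (h1_norm \<Omega> w)\<^sup>2) \<le> nrm w" unfolding nrm_def using a_coercive[OF w] by simp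
  then show "sqrt \<gamma> * h1_norm \<Omega> w \<le> nrm w" by (simp add: real_sqrt_mult)
  have "nrm w \<le> sqrt ((1 + CV + \<beta> * K4\<^sup>2 * (h1_norm \<Omega> z)\<^sup>2) * (h1_norm \<Omega> w * h1_norm \<Omega> w))"
    unfolding nrm_def using a_bounded[OF w w z] by simp
  then show "nrm w \<le> sqrt (1 + CV + \<beta> * K4\<^sup>2 * (h1_norm \<Omega> z)\<^sup>2) * h1_norm \<Omega> w"
    by (simp add: real_sqrt_mult)
qed

text \<open>The seminorm of \<open>a z\<close> is equivalent to the \<open>H^1\<close> norm, so
  Cauchy sequences and limits carry over. It is applied to the whole space and to the complement of
  \<open>u\<close>.\<close>

lemma complete_subspace:
  assumes z: "z \<in> H10 \<Omega>" and S: "S \<subseteq> H10 \<Omega>" "(\<lambda>x. 0) \<in> S" "\<And>f g s t. f \<in> S \<Longrightarrow> g \<in> S \<Longrightarrow> lc s f t g \<in> S"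
    and closed: "\<And>h l. (\<And>n::nat. h n \<in> S) \<Longrightarrow> l \<in> H10 \<Omega> \<Longrightarrow> (\<lambda>n. h1_norm \<Omega> (\<lambda>x. h n x - l x)) \<longlonglongrightarrow> 0 \<Longrightarrow> l \<in> S"
  shows "complete_sip S (a z)"
proof -
  interpret A: sip "H10 \<Omega>" "a z" by (rule sip_a[OF z])
  interpret sip S "a z"
    using S by unfold_locales (auto simp: a_lc z subset_iff a_nonneg intro: a_commute)
  show ?thesis
  proof
    fix h :: "nat \<Rightarrow> 'a \<Rightarrow> real"
    assume h: "\<And>n. h n \<in> S" and c: "\<And>e. e > 0 \<Longrightarrow> \<exists>N. \<forall>m\<ge>N. \<forall>n\<ge>N. nrm (lc 1 (h m) (-1) (h n)) < e"
    have hH: "h n \<in> H10 \<Omega>" for n using h S(1) by blast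
    have g: "sqrt \<gamma> > 0" using \<gamma>_pos by simp
    have dH: "(\<lambda>x. f x - k x) \<in> H10 \<Omega>" if "f \<in> H10 \<Omega>" "k \<in> H10 \<Omega>" for f k
      using H10_lc[OF that, of 1 "-1"] by (simp add: lc_diff)
    have "\<exists>N. \<forall>m\<ge>N. \<forall>n\<ge>N. h1_norm \<Omega> (\<lambda>x. h m x - h n x) < e" if e: "e > 0" for e
    proof -
      obtain N where N: "\<forall>m\<ge>N. \<forall>n\<ge>N. nrm (\<lambda>x. h m x - h n x) < sqrt \<gamma> * e"
        using c[of "sqrt \<gamma> * e"] e g by (auto simp: lc_diff)
      have "h1_norm \<Omega> (\<lambda>x. h m x - h n x) < e" if "m \<ge> N" "n \<ge> N" for m n
      proof -
        have "sqrt \<gamma> * h1_norm \<Omega> (\<lambda>x. h m x - h n x) < sqrt \<gamma> * e"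
          using nrm_a_bounds(1)[OF z dH[OF hH hH], of m n] N that by (meson le_less_trans)
        then show ?thesis using g by (simp add: mult_less_cancel_left)
      qed
      then show ?thesis by blast
    qed
    then obtain l where l: "l \<in> H10 \<Omega>" "(\<lambda>n. h1_norm \<Omega> (\<lambda>x. h n x - l x)) \<longlonglongrightarrow> 0"
      by (rule H10_complete[OF hH])
    show "\<exists>l\<in>S. (\<lambda>n. nrm (lc 1 (h n) (-1) l)) \<longlonglongrightarrow> 0"
    proof
      show "l \<in> S" by (rule closed[OF h l])
      show "(\<lambda>n. nrm (lc 1 (h n) (-1) l)) \<longlonglongrightarrow> 0"
        unfolding lc_diff
      proof (rule Lim_null_comparison)
        show "\<forall>\<^sub>F n in sequentially. norm (nrm (\<lambda>x. h n x - l x)) \<le>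
          sqrt (1 + CV + \<beta> * K4\<^sup>2 * (h1_norm \<Omega> z)\<^sup>2) * h1_norm \<Omega> (\<lambda>x. h n x - l x)"
          using nrm_a_bounds(2)[OF z dH[OF hH l(1)]] A.nrm_nonneg[OF dH[OF hH l(1)]] by (intro always_eventually allI) simp
      qed (rule tendsto_mult_right_zero[OF l(2)])
    qed
  qed
qed

lemma complete_a: "z \<in> H10 \<Omega> \<Longrightarrow> complete_sip (H10 \<Omega>) (a z)"
  by (rule complete_subspace) (auto simp: H10_lc test_H10[OF test_functions_zero])

text \<open>Riesz representation for \<open>a z\<close> supplies a solution, so the choice in
  \<open>G_op\<close> really picks one.\<close>

lemma G_op:
  assumes z: "z \<in> H10 \<Omega>" and w: "w \<in> L2 \<Omega>"
  shows "G_op \<Omega> V \<beta> z w \<in> H10 \<Omega>" "\<phi> \<in> H10 \<Omega> \<Longrightarrow> a z (G_op \<Omega> V \<beta> z w) \<phi> = l2_inner \<Omega> w \<phi>"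
proof -
  interpret A: complete_sip "H10 \<Omega>" "a z" by (rule complete_a[OF z])
  have lin: "l2_inner \<Omega> w (lc s f t g) = s * l2_inner \<Omega> w f + t * l2_inner \<Omega> w g" if "f \<in> H10 \<Omega>" "g \<in> H10 \<Omega>" for f g s t
    by (rule L2.ip_lc_right[OF H10_L2[OF that(1)] H10_L2[OF that(2)] w])
  have bd: "\<bar>l2_inner \<Omega> w f\<bar> \<le> (l2_norm \<Omega> w / sqrt \<gamma>) * A.nrm f" if f: "f \<in> H10 \<Omega>" for f
  proof -
    have g: "sqrt \<gamma> > 0" using \<gamma>_pos by simp
    have "\<bar>l2_inner \<Omega> w f\<bar> \<le> l2_norm \<Omega> w * l2_norm \<Omega> f" by (intro l2_cs w H10_L2 f)
    also have "\<dots> \<le> l2_norm \<Omega> w * (A.nrm f / sqrt \<gamma>)"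
    proof (intro mult_left_mono)
      have "sqrt \<gamma> * l2_norm \<Omega> f \<le> A.nrm f"
        using order_trans[OF mult_left_mono[OF l2_le_h1(1)[of f]] nrm_a_bounds(1)[OF z f]] g by simp
      then show "l2_norm \<Omega> f \<le> A.nrm f / sqrt \<gamma>" using g by (simp add: pos_le_divide_eq mult.commute)
    qed simp
    finally show ?thesis by simp
  qed
  obtain y where "y \<in> H10 \<Omega>" "\<And>f. f \<in> H10 \<Omega> \<Longrightarrow> a z y f = l2_inner \<Omega> w f"
    by (rule A.riesz[of "l2_inner \<Omega> w", OF lin bd]) blast+
  then have ex: "\<exists>y. y \<in> H10 \<Omega> \<and> (\<forall>\<phi>\<in>H10 \<Omega>. a z y \<phi> = l2_inner \<Omega> w \<phi>)" by blast
  show "G_op \<Omega> V \<beta> z w \<in> H10 \<Omega>" "\<phi> \<in> H10 \<Omega> \<Longrightarrow> a z (G_op \<Omega> V \<beta> z w) \<phi> = l2_inner \<Omega> w \<phi>"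
    using someI_ex[OF ex] unfolding G_op_def by auto
qed

sublocale A: complete_sip "H10 \<Omega>" "a u"
  by (rule complete_a[OF u_H10])

lemma V_perp_H10: "V_perp \<Omega> u \<subseteq> H10 \<Omega>"
  by (auto simp: V_perp_def)

sublocale W: complete_sip "V_perp \<Omega> u" "a u"
proof (rule complete_subspace[OF u_H10 V_perp_H10])
  show "(\<lambda>x. 0) \<in> V_perp \<Omega> u"
    by (auto simp: V_perp_def l2_inner_def intro: test_H10[OF test_functions_zero])
  show "lc s f t g \<in> V_perp \<Omega> u" if "f \<in> V_perp \<Omega> u" "g \<in> V_perp \<Omega> u" for f g s t
    using that L2.ip_lc_right[OF H10_L2 H10_L2 H10_L2[OF u_H10], of f g s t] by (auto simp: V_perp_def H10_lc)
  fix h :: "nat \<Rightarrow> 'a \<Rightarrow> real" and l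
  assume h: "\<And>n. h n \<in> V_perp \<Omega> u" and l: "l \<in> H10 \<Omega>" and lim: "(\<lambda>n. h1_norm \<Omega> (\<lambda>x. h n x - l x)) \<longlonglongrightarrow> 0"
  have hH: "h n \<in> H10 \<Omega>" "l2_inner \<Omega> (h n) u = 0" for n using h l2_inner_commute[of \<Omega> u] by (auto simp: V_perp_def)
  have "(\<lambda>n. l2_norm \<Omega> (\<lambda>x. h n x - l x)) \<longlonglongrightarrow> 0"
    by (rule Lim_null_comparison[OF _ lim]) (simp add: l2_le_h1)
  from l2_inner_tendsto[OF H10_L2[OF hH(1)] H10_L2[OF l] H10_L2[OF u_H10] this]
  have "(\<lambda>n. 0) \<longlonglongrightarrow> l2_inner \<Omega> l u" by (simp add: hH)
  then have "l2_inner \<Omega> l u = 0" by (simp add: LIMSEQ_const_iff)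
  then show "l \<in> V_perp \<Omega> u" using l l2_inner_commute[of \<Omega> u] by (simp add: V_perp_def)
qed

lemma l2_le_nrm: "w \<in> H10 \<Omega> \<Longrightarrow> sqrt \<gamma> * l2_norm \<Omega> w \<le> A.nrm w"
  using order_trans[OF mult_left_mono[OF l2_le_h1(1)[of w]] nrm_a_bounds(1)[OF u_H10, of w]] \<gamma>_pos by simp

text \<open>A form controlled by \<open>L^2\<close> norms inherits compactness from Rellich's
  theorem, uniformly in the second argument. Its instances are the \<open>L^2\<close> inner product
  and the weighted form.\<close>

lemma compact_form:
  assumes B: "\<And>f w. f \<in> H10 \<Omega> \<Longrightarrow> w \<in> H10 \<Omega> \<Longrightarrow> \<bar>B f w\<bar> \<le> \<kappa> * l2_norm \<Omega> f * l2_norm \<Omega> w" and \<kappa>: "\<kappa> \<ge> 0"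
    and h: "\<And>n::nat. h n \<in> H10 \<Omega>" "\<And>n. A.nrm (h n) \<le> 1"
  shows "\<exists>r::nat\<Rightarrow>nat. strict_mono r \<and> (\<forall>e>0. \<exists>N. \<forall>m\<ge>N. \<forall>n\<ge>N. \<forall>w\<in>H10 \<Omega>.
        \<bar>B (lc 1 (h (r m)) (-1) (h (r n))) w\<bar> \<le> e * A.nrm w)"
proof -
  have g: "sqrt \<gamma> > 0" using \<gamma>_pos by simp
  have bd: "h1_norm \<Omega> (h n) \<le> 1 / sqrt \<gamma>" for n
    using order_trans[OF nrm_a_bounds(1)[OF u_H10 h(1)] h(2), of n] g by (simp add: pos_le_divide_eq mult.commute)
  obtain r where r: "strict_mono (r :: nat \<Rightarrow> nat)"
    "\<And>e. e > 0 \<Longrightarrow> \<exists>N. \<forall>m\<ge>N. \<forall>n\<ge>N. l2_norm \<Omega> (\<lambda>x. h (r m) x - h (r n) x) < e"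
    by (fact rellich[OF h(1) bd])
  have "\<exists>N. \<forall>m\<ge>N. \<forall>n\<ge>N. \<forall>w\<in>H10 \<Omega>. \<bar>B (lc 1 (h (r m)) (-1) (h (r n))) w\<bar> \<le> e * A.nrm w" if e: "e > 0" for e
  proof -
    have "e * sqrt \<gamma> / (\<kappa> + 1) > 0" using e g \<kappa> by simp
    from r(2)[OF this] obtain N where N: "\<forall>m\<ge>N. \<forall>n\<ge>N. l2_norm \<Omega> (\<lambda>x. h (r m) x - h (r n) x) < e * sqrt \<gamma> / (\<kappa> + 1)" by blast
    have "\<bar>B (lc 1 (h (r m)) (-1) (h (r n))) w\<bar> \<le> e * A.nrm w" if mn: "m \<ge> N" "n \<ge> N" and w: "w \<in> H10 \<Omega>" for m n w
    proof -
      let ?d = "l2_norm \<Omega> (\<lambda>x. h (r m) x - h (r n) x)"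
      have "\<bar>B (lc 1 (h (r m)) (-1) (h (r n))) w\<bar> \<le> \<kappa> * ?d * l2_norm \<Omega> w"
        using B[OF H10_lc[OF h(1) h(1)] w, of 1 "r m" "-1" "r n"] by (simp add: lc_diff)
      also have "\<dots> \<le> (e * sqrt \<gamma>) * l2_norm \<Omega> w"
      proof (intro mult_right_mono)
        have "\<kappa> * ?d \<le> (\<kappa> + 1) * ?d" by (intro mult_right_mono) auto
        also have "\<dots> \<le> e * sqrt \<gamma>"
        proof -
          have "?d < e * sqrt \<gamma> / (\<kappa> + 1)" using N mn by blast
          then show ?thesis using \<kappa> by (simp add: pos_less_divide_eq mult.commute less_imp_le)
        qed
        finally show "\<kappa> * ?d \<le> e * sqrt \<gamma>" .
      qed simp
      also have "\<dots> \<le> e * A.nrm w" using mult_left_mono[OF l2_le_nrm[OF w], of e] e by (simp add: mult.assoc)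
      finally show ?thesis .
    qed
    then show ?thesis by blast
  qed
  then show ?thesis using r(1) by blast
qed

end

subsection \<open>The spectrum of the linearised operator\<close>

context gross_pitaevskii
begin

lemma u_L2: "u \<in> L2 \<Omega>"
  by (rule H10_L2[OF u_H10])

lemma u_self: "l2_inner \<Omega> u u = 1"
  using u_norm l2_norm_sq[of \<Omega> u] by simp

lemma ev_pos: "ev > 0"
proof -
  have "\<gamma> * 1 \<le> \<gamma> * (h1_norm \<Omega> u)\<^sup>2"
    using power_mono[OF l2_le_h1(1)[of u], of 2] u_norm \<gamma>_pos by (intro mult_left_mono) auto
  also have "\<dots> \<le> ev" using a_coercive[OF u_H10, of u] u_eigen[OF u_H10] u_self by simp
  finally show ?thesis using \<gamma>_pos by simp
qed

lemma u_measurable: "u \<in> borel_measurable M"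
  using u_L2 by (rule L2_measurable)

text \<open>Weak maximum principle: test the eigenvalue equation with \<open>(u - k)\<^sup>+\<close>, where \<open>\<beta> k\<^sup>2 = ev\<close>.\<close>

lemma density_le_ev: "AE x in M. \<beta> * (u x)\<^sup>2 \<le> ev"
proof (cases "\<beta> = 0")
  case True
  then show ?thesis using ev_pos by simp
next
  case False
  then have \<beta>: "\<beta> > 0" using \<beta>_nonneg by simp
  define k where "k = sqrt (ev / \<beta>)"
  have k: "k > 0" "\<beta> * k\<^sup>2 = ev" using \<beta> ev_pos by (simp_all add: k_def)
  note abs = H10_abs_shift[OF u_H10, of k]
  \<comment> \<open>Because \<open>k > 0\<close>, the positive part \<open>(u - k)^+\<close> equals
    \<open>(\<bar>u - k\<bar> - \<bar>k\<bar> + u) / 2\<close>; both summands are known to lie in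
    \<open>H^1_0\<close>.\<close>
  define \<psi> where "\<psi> = lc (1/2) (\<lambda>x. \<bar>u x - k\<bar> - \<bar>k\<bar>) (1/2) u"
  have \<psi>: "\<psi> \<in> H10 \<Omega>" unfolding \<psi>_def by (rule H10_lc[OF abs(1) u_H10])
  have \<psi>x: "\<psi> x = max (u x - k) 0" for x using k(1) by (auto simp: \<psi>_def lc_def max_def abs_if field_simps)
  have grad: "0 \<le> l2_inner \<Omega> (wgrad \<Omega> u) (wgrad \<Omega> \<psi>)"
    unfolding l2_inner_def
  proof (rule integral_nonneg_AE)
    have "AE x in M. wgrad \<Omega> \<psi> x = lc (1/2) (wgrad \<Omega> (\<lambda>x. \<bar>u x - k\<bar> - \<bar>k\<bar>)) (1/2) (wgrad \<Omega> u) x"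
      unfolding \<psi>_def by (rule H1_lc(2)[OF H10_H1[OF abs(1)] H10_H1[OF u_H10]])
    then show "AE x in M. 0 \<le> wgrad \<Omega> u x \<bullet> wgrad \<Omega> \<psi> x"
      using abs(2)
    proof eventually_elim
      case (elim x)
      have "wgrad \<Omega> u x \<bullet> wgrad \<Omega> \<psi> x = (1/2 * sgn (u x - k) + 1/2) * (wgrad \<Omega> u x \<bullet> wgrad \<Omega> u x)"
        unfolding elim lc_def by (simp add: elim inner_add_right algebra_simps)
      moreover have "0 \<le> 1/2 * sgn (u x - k) + 1/2" by (simp add: sgn_if)
      ultimately show ?case by simp
    qed
  qed
  have Vn: "0 \<le> l2_inner \<Omega> (\<lambda>x. V x * u x) \<psi>"
    unfolding l2_inner_def
  proof (rule integral_nonneg_AE)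
    show "AE x in M. 0 \<le> (V x * u x) \<bullet> \<psi> x"
      using V_nonneg u_pos by eventually_elim (auto simp: \<psi>x intro!: mult_nonneg_nonneg)
  qed
  \<comment> \<open>\<open>F\<close> equals \<open>(\<beta> u^2 - ev) u \<psi>\<close>, which is
    nonnegative everywhere up to a null set. The eigenvalue equation makes its integral at most
    zero, so it vanishes and \<open>u\<close> cannot exceed \<open>k\<close>.\<close>
  define F where "F x = \<beta> * (u x * u x * (u x * \<psi> x)) - ev * (u x * \<psi> x)" for x
  have i: "integrable M (\<lambda>x. u x * \<psi> x)" using integrable_inner_of_L2[OF u_L2 H10_L2[OF \<psi>]] by simp
  have Fi: "integrable M F"
    unfolding F_def using q_integrable[OF u_H10 u_H10 u_H10 \<psi>] i by simp
  have "(LINT x|M. F x) = \<beta> * q u u u \<psi> - ev * l2_inner \<Omega> u \<psi>"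
    unfolding F_def q_int l2_inner_def using q_integrable[OF u_H10 u_H10 u_H10 \<psi>] i by simp
  also have "\<dots> \<le> 0" using u_eigen[OF \<psi>] grad Vn unfolding a_eq by linarith
  finally have Fle: "(LINT x|M. F x) \<le> 0" .
  have Fn: "AE x in M. 0 \<le> F x \<and> (F x = 0 \<longrightarrow> u x \<le> k)"
    using u_pos
  proof eventually_elim
    case (elim x)
    show ?case
    proof (cases "u x \<le> k")
      case True
      then show ?thesis by (simp add: F_def \<psi>x)
    next
      case False
      have F: "F x = (\<beta> * (u x)\<^sup>2 - ev) * (u x * \<psi> x)" by (simp add: F_def power2_eq_square algebra_simps)
      have "k\<^sup>2 < (u x)\<^sup>2" using False k(1) by (intro power_strict_mono) auto
      then have "\<beta> * k\<^sup>2 < \<beta> * (u x)\<^sup>2" using \<beta> by simp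
      then have "F x > 0" unfolding F using False elim k by (simp add: \<psi>x)
      then show ?thesis by simp
    qed
  qed
  have Fn': "AE x in M. 0 \<le> F x" using Fn by eventually_elim simp
  have "(LINT x|M. F x) = 0" using Fle integral_nonneg_AE[OF Fn'] by simp
  then have "AE x in M. F x = 0" using integral_nonneg_eq_0_iff_AE[OF Fi Fn'] by simp
  with Fn u_pos show ?thesis
  proof eventually_elim
    case (elim x)
    then have "(u x)\<^sup>2 \<le> k\<^sup>2" by (intro power_mono) auto
    then have "\<beta> * (u x)\<^sup>2 \<le> \<beta> * k\<^sup>2" using \<beta> by simp
    then show ?case using k by simp
  qed
qed

text \<open>By \<open>nn\<close> the form \<open>s a_u - t (., .)\<close> is a semi-inner product.
  \<open>v\<close> has seminorm zero in it and is therefore orthogonal to everything by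
  Cauchy-Schwarz: an extremal of the Rayleigh quotient solves the eigenvalue equation.\<close>

lemma form_kernel:
  assumes nn: "\<And>f. f \<in> H10 \<Omega> \<Longrightarrow> t * l2_inner \<Omega> f f \<le> s * a u f f"
    and v: "v \<in> H10 \<Omega>" "s * a u v v \<le> t * l2_inner \<Omega> v v" and w: "w \<in> H10 \<Omega>"
  shows "s * a u v w = t * l2_inner \<Omega> v w"
proof -
  interpret Q: sip "H10 \<Omega>" "\<lambda>f g. s * a u f g - t * l2_inner \<Omega> f g"
  proof
    fix f g k and x y :: real
    assume "f \<in> H10 \<Omega>" "g \<in> H10 \<Omega>" "k \<in> H10 \<Omega>"
    then show "s * a u (lc x f y g) k - t * l2_inner \<Omega> (lc x f y g) k =
      x * (s * a u f k - t * l2_inner \<Omega> f k) + y * (s * a u g k - t * l2_inner \<Omega> g k)"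
      by (simp add: a_lc u_H10 l2_inner_lc H10_L2 algebra_simps)
  next
    fix f g
    show "s * a u f g - t * l2_inner \<Omega> f g = s * a u g f - t * l2_inner \<Omega> g f"
      using a_commute[of u f g] l2_inner_commute[of \<Omega> f g] by simp
  qed (use nn in \<open>auto simp: H10_lc A.zero_closed\<close>)
  have "s * a u v v - t * l2_inner \<Omega> v v = 0" using nn[OF v(1)] v(2) by simp
  then have "(s * a u v w - t * l2_inner \<Omega> v w)\<^sup>2 \<le> 0" using Q.ip_cs_sq[OF v(1) w] by simp
  then show ?thesis by simp
qed

text \<open>Passing to the modulus cannot increase the gradient term, and the other terms see only
  the square of \<open>w\<close>; so extremals may be taken nonnegative.\<close>

lemma abs_H10:
  assumes w: "w \<in> H10 \<Omega>"
  shows "(\<lambda>x. \<bar>w x\<bar>) \<in> H10 \<Omega>" "a u (\<lambda>x. \<bar>w x\<bar>) (\<lambda>x. \<bar>w x\<bar>) \<le> a u w w"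
    "l2_inner \<Omega> (\<lambda>x. \<bar>w x\<bar>) (\<lambda>x. \<bar>w x\<bar>) = l2_inner \<Omega> w w"
proof -
  show H: "(\<lambda>x. \<bar>w x\<bar>) \<in> H10 \<Omega>" using H10_abs_shift(1)[OF w, of 0] by simp
  have g: "AE x in M. wgrad \<Omega> (\<lambda>x. \<bar>w x\<bar>) x = sgn (w x) *\<^sub>R wgrad \<Omega> w x"
    using H10_abs_shift(2)[OF w, of 0] by simp
  have "l2_inner \<Omega> (wgrad \<Omega> (\<lambda>x. \<bar>w x\<bar>)) (wgrad \<Omega> (\<lambda>x. \<bar>w x\<bar>)) \<le> l2_inner \<Omega> (wgrad \<Omega> w) (wgrad \<Omega> w)"
    unfolding l2_inner_def
  proof (rule integral_mono_AE)
    show "AE x in M. wgrad \<Omega> (\<lambda>x. \<bar>w x\<bar>) x \<bullet> wgrad \<Omega> (\<lambda>x. \<bar>w x\<bar>) x \<le> wgrad \<Omega> w x \<bullet> wgrad \<Omega> w x"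
      using g
    proof eventually_elim
      case (elim x)
      show ?case unfolding elim by (cases "w x = 0") (auto simp: sgn_if)
    qed
  qed (intro integrable_inner_of_L2 wgrad_L2 H w)+
  moreover have "l2_inner \<Omega> (\<lambda>x. V x * \<bar>w x\<bar>) (\<lambda>x. \<bar>w x\<bar>) = l2_inner \<Omega> (\<lambda>x. V x * w x) w"
    by (simp add: l2_inner_def mult.assoc)
  moreover have "q u (\<lambda>x. \<bar>w x\<bar>) u (\<lambda>x. \<bar>w x\<bar>) = q u w u w"
    unfolding q_int by (rule Bochner_Integration.integral_cong) (auto simp: abs_mult_self_eq mult_ac abs_if)
  ultimately show "a u (\<lambda>x. \<bar>w x\<bar>) (\<lambda>x. \<bar>w x\<bar>) \<le> a u w w" unfolding a_eq by simp
  show "l2_inner \<Omega> (\<lambda>x. \<bar>w x\<bar>) (\<lambda>x. \<bar>w x\<bar>) = l2_inner \<Omega> w w" by (simp add: l2_inner_def)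
qed

lemma pos_orthogonal_zero:
  assumes f: "f \<in> L2 \<Omega>" "AE x in M. 0 \<le> f x" "l2_inner \<Omega> u f = 0"
  shows "AE x in M. f x = 0"
proof -
  have n: "AE x in M. 0 \<le> u x \<bullet> f x" using u_pos f(2) by eventually_elim simp
  have "AE x in M. u x \<bullet> f x = 0"
    using integral_nonneg_eq_0_iff_AE[OF integrable_inner_of_L2[OF u_L2 f(1)] n] f(3) by (simp add: l2_inner_def)
  then show ?thesis using u_pos by eventually_elim auto
qed

text \<open>A minimiser \<open>v\<close> of the Rayleigh quotient may be replaced by \<open>\<bar>v\<bar>\<close>, which is not orthogonal to \<open>u > 0\<close>.\<close>

lemma ground_le:
  assumes w: "w \<in> H10 \<Omega>"
  shows "ev * l2_inner \<Omega> w w \<le> a u w w"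
proof -
  have g: "sqrt \<gamma> > 0" using \<gamma>_pos by simp
  have l2n: "l2_norm \<Omega> f \<le> (1 / sqrt \<gamma>) * A.nrm f" if "f \<in> H10 \<Omega>" for f
    using l2_le_nrm[OF that] g by (simp add: pos_le_divide_eq mult.commute)
  have bd: "\<bar>l2_inner \<Omega> f k\<bar> \<le> (1 / sqrt \<gamma>) * (1 / sqrt \<gamma>) * A.nrm f * A.nrm k" if "f \<in> H10 \<Omega>" "k \<in> H10 \<Omega>" for f k
  proof -
    have "\<bar>l2_inner \<Omega> f k\<bar> \<le> l2_norm \<Omega> f * l2_norm \<Omega> k" by (intro l2_cs H10_L2 that)
    also have "\<dots> \<le> ((1 / sqrt \<gamma>) * A.nrm f) * ((1 / sqrt \<gamma>) * A.nrm k)"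
      using g by (intro mult_mono l2n that mult_nonneg_nonneg A.nrm_nonneg) auto
    finally show ?thesis by (simp add: mult_ac)
  qed
  have cs: "\<bar>l2_inner \<Omega> f k\<bar> \<le> 1 * l2_norm \<Omega> f * l2_norm \<Omega> k" if "f \<in> H10 \<Omega>" "k \<in> H10 \<Omega>" for f k
    using l2_cs[OF H10_L2[OF that(1)] H10_L2[OF that(2)]] by simp
  obtain v \<nu> where v: "v \<in> H10 \<Omega>" "a u v v = 1" "\<nu> \<noteq> 0" "\<And>w. w \<in> H10 \<Omega> \<Longrightarrow> l2_inner \<Omega> v w = \<nu> * a u v w"
    "\<And>f. f \<in> H10 \<Omega> \<Longrightarrow> \<bar>l2_inner \<Omega> f f\<bar> \<le> \<bar>\<nu>\<bar> * a u f f"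
  proof (rule A.rayleigh_attained[of "l2_inner \<Omega>" "(1 / sqrt \<gamma>) * (1 / sqrt \<gamma>)" u])
    show "\<exists>r :: nat \<Rightarrow> nat. strict_mono r \<and> (\<forall>e>0. \<exists>N. \<forall>m\<ge>N. \<forall>n\<ge>N. \<forall>w\<in>H10 \<Omega>. \<bar>l2_inner \<Omega> (A.dif (h (r m)) (h (r n))) w\<bar> \<le> e * A.nrm w)"
      if "\<And>n. h n \<in> H10 \<Omega>" "\<And>n. A.nrm (h n) \<le> 1" for h :: "nat \<Rightarrow> 'a \<Rightarrow> real"
      by (rule compact_form[of "l2_inner \<Omega>" 1, OF cs zero_le_one that])
  qed (use bd u_H10 u_self l2_inner_commute in \<open>auto simp: l2_inner_lc H10_L2\<close>)
  have vv: "l2_inner \<Omega> v v = \<nu>" using v(4)[OF v(1)] v(2) by simp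
  then have \<nu>: "\<nu> > 0" using v(3) l2_norm_sq[of \<Omega> v] zero_le_power2[of "l2_norm \<Omega> v"] by simp
  let ?v = "\<lambda>x. \<bar>v x\<bar>"
  note av = abs_H10[OF v(1)]
  have nn: "1 * l2_inner \<Omega> f f \<le> \<nu> * a u f f" if "f \<in> H10 \<Omega>" for f using v(5)[OF that] \<nu> by simp
  have "\<nu> * a u ?v ?v \<le> \<nu> * 1" using av(2) v(2) \<nu> by simp
  then have le: "\<nu> * a u ?v ?v \<le> 1 * l2_inner \<Omega> ?v ?v" using av(3) vv by simp
  \<comment> \<open>Tested with \<open>u\<close>, the equation of \<open>\<bar>v\<bar>\<close>
    becomes a multiple of the positive number \<open>(u, \<bar>v\<bar>)\<close> on both sides, which
    identifies \<open>\<nu>\<close> as \<open>1 / ev\<close>.\<close>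
  have "\<nu> * a u ?v u = 1 * l2_inner \<Omega> ?v u" by (rule form_kernel[OF nn av(1) le u_H10])
  then have "\<nu> * (ev * l2_inner \<Omega> u ?v) = l2_inner \<Omega> u ?v"
    using a_commute[of u ?v u] u_eigen[OF av(1)] l2_inner_commute[of \<Omega> ?v u] by simp
  moreover have "l2_inner \<Omega> u ?v \<noteq> 0"
  proof
    assume "l2_inner \<Omega> u ?v = 0"
    then have "AE x in M. \<bar>v x\<bar> = 0" by (intro pos_orthogonal_zero H10_L2 av) auto
    then have "l2_norm \<Omega> v = 0" using l2_norm_eq_0_iff[OF H10_L2[OF v(1)]] by simp
    then show False using vv \<nu> l2_norm_sq[of \<Omega> v] by simp
  qed
  ultimately have "\<nu> * ev = 1" by (metis mult.assoc mult_cancel_right1)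
  moreover have "ev * l2_inner \<Omega> w w \<le> ev * (\<nu> * a u w w)" using nn[OF w] ev_pos by simp
  ultimately show ?thesis by (metis mult.assoc mult.commute mult_1)
qed

text \<open>If \<open>w\<close> is an eigenfunction orthogonal to \<open>u\<close>, so is \<open>w\<^sup>+\<close> an eigenfunction, and the strong
  maximum principle applies to it.\<close>

lemma ground_simple:
  assumes w: "w \<in> H10 \<Omega>" "\<And>v. v \<in> H10 \<Omega> \<Longrightarrow> a u w v = ev * l2_inner \<Omega> w v" "l2_inner \<Omega> u w = 0"
  shows "AE x in M. w x = 0"
proof -
  let ?v = "\<lambda>x. \<bar>w x\<bar>"
  note av = abs_H10[OF w(1)]
  have "1 * a u ?v ?v \<le> ev * l2_inner \<Omega> ?v ?v" using av w(2)[OF w(1)] by simp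
  then have eq: "1 * a u ?v v = ev * l2_inner \<Omega> ?v v" if "v \<in> H10 \<Omega>" for v
    using ground_le by (intro form_kernel[OF _ av(1) _ that]) auto
  define f where "f = lc (1/2) w (1/2) ?v"
  have f: "f \<in> H10 \<Omega>" unfolding f_def by (rule H10_lc[OF w(1) av(1)])
  have fx: "f x = max (w x) 0" for x by (simp add: f_def lc_def max_def abs_if)
  have feq: "a u f v = ev * l2_inner \<Omega> f v" if "v \<in> H10 \<Omega>" for v
    unfolding f_def using w(1,2) av(1) eq that by (simp add: a_lc u_H10 l2_inner_lc H10_L2 algebra_simps)
  define c where "c x = V x + \<beta> * (u x)\<^sup>2" for x
  have cm: "c \<in> borel_measurable M" unfolding c_def using V_measurable u_measurable by measurable
  have cb: "AE x in M. 0 \<le> c x \<and> c x \<le> CV + ev"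
    using CV(2) density_le_ev by eventually_elim (auto simp: c_def \<beta>_nonneg intro: add_mono)
  \<comment> \<open>The maximum principle is formulated for upper bounds, so it is applied to
    \<open>- f\<close> with bound 0. Then \<open>k - u\<close> in its hypothesis becomes
    \<open>f\<close>, and the coefficient \<open>c\<close> collects potential and density, while
    \<open>ev * f\<close> has the favourable sign.\<close>
  define g where "g = lc (-1) f 0 f"
  have g: "g \<in> H10 \<Omega>" unfolding g_def by (rule H10_lc[OF f f])
  have gx: "g x = - f x" for x by (simp add: g_def lc_def)
  have "(AE x in M. g x \<noteq> 0) \<or> (AE x in M. g x = 0)"
  proof (rule strong_maximum[OF convex_dom g _ cm cb])
    show "AE x in M. g x \<le> 0" by (simp add: gx fx)
    fix \<psi> assume \<psi>: "\<psi> \<in> H10 \<Omega>" "AE x in M. 0 \<le> \<psi> x"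
    have 1: "l2_inner \<Omega> (wgrad \<Omega> g) (wgrad \<Omega> \<psi>) = - l2_inner \<Omega> (wgrad \<Omega> f) (wgrad \<Omega> \<psi>)"
      unfolding g_def using wgrad_inner_lc[OF H10_H1[OF f] H10_H1[OF f] wgrad_L2[OF \<psi>(1)], of "-1" 0] by simp
    have i1: "integrable M (\<lambda>x. V x * f x * \<psi> x)" using integrable_inner_of_L2[OF V_mult_L2(1)[OF H10_L2[OF f]] H10_L2[OF \<psi>(1)]] by simp
    note i2 = q_integrable[OF u_H10 f u_H10 \<psi>(1)]
    have "l2_inner \<Omega> (\<lambda>x. c x * (0 - g x)) \<psi> = (LINT x|M. V x * f x * \<psi> x + \<beta> * (u x * f x * (u x * \<psi> x)))"
      unfolding l2_inner_def by (rule Bochner_Integration.integral_cong) (auto simp: c_def gx power2_eq_square algebra_simps)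
    also have "\<dots> = l2_inner \<Omega> (\<lambda>x. V x * f x) \<psi> + \<beta> * q u f u \<psi>"
      using i1 i2 by (simp add: l2_inner_def q_int)
    finally have 2: "l2_inner \<Omega> (\<lambda>x. c x * (0 - g x)) \<psi> = l2_inner \<Omega> (\<lambda>x. V x * f x) \<psi> + \<beta> * q u f u \<psi>" .
    have "0 \<le> l2_inner \<Omega> f \<psi>"
      unfolding l2_inner_def using \<psi>(2) by (intro integral_nonneg_AE) (auto simp: fx elim!: eventually_mono)
    then have "0 \<le> ev * l2_inner \<Omega> f \<psi>" using ev_pos by simp
    then show "1/2 * l2_inner \<Omega> (wgrad \<Omega> g) (wgrad \<Omega> \<psi>) \<le> l2_inner \<Omega> (\<lambda>x. c x * (0 - g x)) \<psi>"
      unfolding 1 2 using feq[OF \<psi>(1)] unfolding a_eq by linarith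
  qed
  then show ?thesis
  proof
    assume "AE x in M. g x \<noteq> 0"
    then have p: "AE x in M. w x > 0" by eventually_elim (auto simp: gx fx max_def split: if_splits)
    then have "AE x in M. 0 \<le> w x" by eventually_elim simp
    then show ?thesis by (rule pos_orthogonal_zero[OF H10_L2[OF w(1)] _ w(3)])
  next
    assume "AE x in M. g x = 0"
    then have n: "AE x in M. 0 \<le> - w x" by eventually_elim (auto simp: gx fx max_def split: if_splits)
    have "l2_inner \<Omega> u (\<lambda>x. - w x) = 0" using w(3) by (simp add: l2_inner_def)
    moreover have "(\<lambda>x. - w x) \<in> L2 \<Omega>" using L2_lc[OF H10_L2[OF w(1)] H10_L2[OF w(1)], of "-1" 0] by (simp add: lc_def)
    ultimately have "AE x in M. - w x = 0" using pos_orthogonal_zero[OF _ n] by simp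
    then show ?thesis by simp
  qed
qed

text \<open>With \<open>\<beta> k^2 = ev\<close> one has
  \<open>ev u - \<beta> u^3 = c (k - u)\<close> for \<open>c = \<beta> (k + u) u\<close>, which is
  bounded because \<open>0 < u \<le> k\<close>. After the nonnegative potential term is dropped, the
  strong maximum principle leaves only \<open>u = k\<close> as an alternative; a constant has zero
  weak gradient, and Poincare's inequality would then give \<open>u\<close> norm zero.\<close>

lemma density_less_ev:
  assumes \<beta>: "\<beta> > 0"
  shows "AE x in M. \<beta> * (u x)\<^sup>2 < ev"
proof -
  define k where "k = sqrt (ev / \<beta>)"
  have k: "k > 0" "\<beta> * k\<^sup>2 = ev" using \<beta> ev_pos by (simp_all add: k_def)
  have uk: "AE x in M. u x \<le> k"
    using density_le_ev u_pos
  proof eventually_elim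
    case (elim x)
    then have "(u x)\<^sup>2 \<le> ev / \<beta>" using \<beta> by (simp add: pos_le_divide_eq mult.commute)
    then show ?case unfolding k_def by (rule real_le_rsqrt)
  qed
  define c where "c x = \<beta> * (k + u x) * u x" for x
  have cm: "c \<in> borel_measurable M" unfolding c_def using u_measurable by measurable
  have cb: "AE x in M. 0 \<le> c x \<and> c x \<le> \<beta> * (k + k) * k"
    using uk u_pos
  proof eventually_elim
    case (elim x)
    then show ?case unfolding c_def using \<beta> k(1)
      by (intro conjI mult_nonneg_nonneg mult_mono add_left_mono) auto
  qed
  have "(AE x in M. u x \<noteq> k) \<or> (AE x in M. u x = k)"
  proof (rule strong_maximum[OF convex_dom u_H10 uk cm cb])
    fix \<psi> assume \<psi>: "\<psi> \<in> H10 \<Omega>" "AE x in M. 0 \<le> \<psi> x"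
    have "0 \<le> l2_inner \<Omega> (\<lambda>x. V x * u x) \<psi>"
      unfolding l2_inner_def
    proof (rule integral_nonneg_AE)
      show "AE x in M. 0 \<le> (V x * u x) \<bullet> \<psi> x" using V_nonneg u_pos \<psi>(2) by eventually_elim simp
    qed
    moreover have "l2_inner \<Omega> (\<lambda>x. c x * (k - u x)) \<psi> = ev * l2_inner \<Omega> u \<psi> - \<beta> * q u u u \<psi>"
    proof -
      have "l2_inner \<Omega> (\<lambda>x. c x * (k - u x)) \<psi> = (LINT x|M. ev * (u x * \<psi> x) - \<beta> * (u x * u x * (u x * \<psi> x)))"
        unfolding l2_inner_def
        by (rule Bochner_Integration.integral_cong) (auto simp: c_def k(2)[symmetric] power2_eq_square algebra_simps)
      also have "\<dots> = ev * l2_inner \<Omega> u \<psi> - \<beta> * q u u u \<psi>"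
        using integrable_inner_of_L2[OF u_L2 H10_L2[OF \<psi>(1)]] q_integrable[OF u_H10 u_H10 u_H10 \<psi>(1)]
        by (simp add: l2_inner_def q_int)
      finally show ?thesis .
    qed
    ultimately show "1/2 * l2_inner \<Omega> (wgrad \<Omega> u) (wgrad \<Omega> \<psi>) \<le> l2_inner \<Omega> (\<lambda>x. c x * (k - u x)) \<psi>"
      using u_eigen[OF \<psi>(1)] unfolding a_eq by linarith
  qed
  moreover have "\<not> (AE x in M. u x = k)"
  proof
    assume c: "AE x in M. u x = k"
    have "has_weak_gradient \<Omega> u (\<lambda>x. 0)"
      unfolding has_weak_gradient_def
    proof (intro ballI)
      fix \<phi> and b :: 'a assume \<phi>: "\<phi> \<in> test_functions \<Omega>" and b: "b \<in> Basis"
      have pt: "partial b \<phi> \<in> test_functions \<Omega>" by (rule test_functions_partial[OF \<phi> b])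
      have "(LINT x|M. u x * partial b \<phi> x) = (LINT x|M. k * partial b \<phi> x)"
      proof (rule integral_cong_AE)
        show "AE x in M. u x * partial b \<phi> x = k * partial b \<phi> x" using c by eventually_elim simp
      qed (use u_measurable L2_measurable[OF test_L2[OF pt]] in measurable)
      also have "\<dots> = k * (LINT x|M. partial b \<phi> x)" by simp
      also have "(LINT x|M. partial b \<phi> x) = (LINT x|lborel. partial b \<phi> x)"
      proof (rule lebesgue_on_eq_lborel(1)[OF dom_lebesgue])
        show "partial b \<phi> \<in> borel_measurable borel"
          by (rule borel_measurable_continuous_onI[OF Ck_continuous[OF test_functions_Ck[OF pt, of 0]]])
        show "partial b \<phi> x = 0" if "x \<notin> \<Omega>" for x using test_functionsE[OF pt] that by (metis subsetD)
      qed
      also have "\<dots> = 0" by (rule integral_partial_eq_0[OF \<phi> b])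
      finally show "(LINT x|M. u x * partial b \<phi> x) = - (LINT x|M. (0 \<bullet> b) * \<phi> x)" by simp
    qed
    from H1_I(2)[OF u_L2 L2_zero this] have "AE x in M. wgrad \<Omega> u x = 0" .
    then have "l2_norm \<Omega> (wgrad \<Omega> u) = 0" using l2_norm_eq_0_iff[OF wgrad_L2[OF u_H10]] by simp
    then show False using P(2)[OF u_H10] u_norm by simp
  qed
  ultimately have "AE x in M. u x \<noteq> k" by blast
  then show ?thesis using uk u_pos
  proof eventually_elim
    case (elim x)
    then have "(u x)\<^sup>2 < k\<^sup>2" by (intro power_strict_mono) auto
    then show ?case using \<beta> k(2) mult_strict_left_mono by fastforce
  qed
qed

end

section \<open>The first two eigenvalues and the gap between them\<close>

context gross_pitaevskii
begin

lemma eigenpair_orthogonal: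
  assumes "linearized_eigenpair \<Omega> V \<beta> u s w" "linearized_eigenpair \<Omega> V \<beta> u t v" "s \<noteq> t"
  shows "l2_inner \<Omega> w v = 0"
proof -
  have "s * l2_inner \<Omega> w v = t * l2_inner \<Omega> v w"
    using assms a_commute[of u w v] by (auto simp: linearized_eigenpair_def)
  then show ?thesis using assms(3) l2_inner_commute[of \<Omega> w v] by simp
qed

lemma perp_decomposition:
  assumes "w \<in> H10 \<Omega>"
  shows "lc 1 w (- l2_inner \<Omega> u w) u \<in> V_perp \<Omega> u"
  unfolding V_perp_def
  using H10_lc[OF assms u_H10] L2.ip_lc_right[OF H10_L2[OF assms] u_L2 u_L2] u_self by simp

lemma a_u_perp:
  assumes "w \<in> V_perp \<Omega> u"
  shows "a u u w = 0" "a u w u = 0" "w \<in> H10 \<Omega>" "l2_inner \<Omega> u w = 0" "l2_inner \<Omega> w u = 0"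
  using assms u_eigen[of w] a_commute[of u w u] l2_inner_commute[of \<Omega> w u] by (auto simp: V_perp_def)

lemma zero_imp_inner_zero:
  assumes "w \<in> L2 \<Omega>" "AE x in M. w x = 0" "f \<in> L2 \<Omega>"
  shows "l2_inner \<Omega> w f = 0"
  using l2_cs[OF assms(1,3)] l2_norm_eq_0_iff[OF assms(1)] assms(2) by simp

text \<open>Eigenfunctions for different eigenvalues are orthogonal, so the completeness clause of
  the enumeration forces every eigenvalue to be listed. This locates \<open>ev\<close>, and
  \<open>ground_le\<close> puts it first; \<open>lam 2 = ev\<close> would contradict simplicity. For
  the inequality on the complement of \<open>u\<close>, an extremal of the Rayleigh quotient there
  is an eigenfunction, and its value must be listed at an index of at least 2.\<close>

lemma spectral_gap:
  assumes lam: "ordered_linearized_eigenpairs \<Omega> V \<beta> u lam e"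
  shows "lam 1 = ev" "lam 2 > ev" "\<And>h. h \<in> V_perp \<Omega> u \<Longrightarrow> lam 2 * l2_inner \<Omega> h h \<le> a u h h"
proof -
  have ep: "linearized_eigenpair \<Omega> V \<beta> u (lam i) (e i)" if "i \<ge> 1" for i
    using lam that by (auto simp: ordered_linearized_eigenpairs_def)
  have mono: "lam i \<le> lam j" if "1 \<le> i" "i \<le> j" for i j
    using lam that by (auto simp: ordered_linearized_eigenpairs_def)
  have orth: "l2_inner \<Omega> (e i) (e j) = 0" if "1 \<le> i" "1 \<le> j" "i \<noteq> j" for i j
    using lam that by (auto simp: ordered_linearized_eigenpairs_def)
  have complete: "\<exists>i\<ge>1. l2_inner \<Omega> w (e i) \<noteq> 0" if "linearized_eigenpair \<Omega> V \<beta> u s w" for s w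
    using lam that by (auto simp: ordered_linearized_eigenpairs_def)
  have eH: "e i \<in> H10 \<Omega>" "l2_norm \<Omega> (e i) = 1" "\<And>v. v \<in> H10 \<Omega> \<Longrightarrow> a u (e i) v = lam i * l2_inner \<Omega> (e i) v" if "i \<ge> 1" for i
    using ep[OF that] by (auto simp: linearized_eigenpair_def)
  have ge: "ev \<le> lam i" if "i \<ge> 1" for i
    using ground_le[OF eH(1)[OF that]] eH(3)[OF that eH(1)[OF that]] eH(2)[OF that] l2_norm_sq[of \<Omega> "e i"] by simp
  have up: "linearized_eigenpair \<Omega> V \<beta> u ev u"
    using u_H10 u_norm u_eigen by (simp add: linearized_eigenpair_def)
  obtain i where i: "i \<ge> 1" "l2_inner \<Omega> u (e i) \<noteq> 0" using complete[OF up] by blast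
  then have "lam i = ev" using eigenpair_orthogonal[OF up ep[OF i(1)]] by metis
  then show lam1: "lam 1 = ev" using mono[of 1 i] i(1) ge[of 1] by simp
  have zero: "AE x in M. w x = 0" if "w \<in> H10 \<Omega>" "\<And>v. v \<in> H10 \<Omega> \<Longrightarrow> a u w v = ev * l2_inner \<Omega> w v" "l2_inner \<Omega> u w = 0" for w
    by (rule ground_simple[OF that])
  \<comment> \<open>Removing the \<open>u\<close>-component from \<open>e 1\<close> leaves a
    solution for \<open>ev\<close> that is orthogonal to \<open>u\<close>, hence zero:
    \<open>e 1\<close> is a multiple of \<open>u\<close>, and orthogonality to one means
    orthogonality to the other.\<close>
  define r where "r = lc 1 (e 1) (- l2_inner \<Omega> u (e 1)) u"
  have r: "r \<in> V_perp \<Omega> u" unfolding r_def by (rule perp_decomposition[OF eH(1)]) simp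
  have "a u r v = ev * l2_inner \<Omega> r v" if "v \<in> H10 \<Omega>" for v
    unfolding r_def using eH(1,3)[of 1] u_eigen lam1 that u_H10
    by (simp add: a_lc l2_inner_lc H10_L2 algebra_simps)
  then have r0: "AE x in M. r x = 0" using zero a_u_perp[OF r] by blast
  have e1: "l2_inner \<Omega> (e 1) f = l2_inner \<Omega> u (e 1) * l2_inner \<Omega> u f" if "f \<in> L2 \<Omega>" for f
  proof -
    have "l2_inner \<Omega> r f = 0" by (rule zero_imp_inner_zero[OF H10_L2[OF a_u_perp(3)[OF r]] r0 that])
    then show ?thesis unfolding r_def using that eH(1)[of 1] u_L2 by (simp add: l2_inner_lc H10_L2)
  qed
  have e1u: "l2_inner \<Omega> u (e 1) \<noteq> 0"
    using e1[OF H10_L2[OF eH(1)[of 1]]] eH(2)[of 1] l2_norm_sq[of \<Omega> "e 1"] by auto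
  have perp: "l2_inner \<Omega> u f = 0" if "f \<in> L2 \<Omega>" "l2_inner \<Omega> (e 1) f = 0" for f
    using e1[OF that(1)] that(2) e1u by simp
  have e2: "e 2 \<in> V_perp \<Omega> u"
    unfolding V_perp_def using eH(1)[of 2] perp[OF H10_L2[OF eH(1)[of 2]]] orth[of 1 2] by simp
  have "lam 2 \<noteq> ev"
  proof
    assume "lam 2 = ev"
    then have "AE x in M. e 2 x = 0" using zero[of "e 2"] eH(1,3)[of 2] a_u_perp[OF e2] by simp
    then have "l2_norm \<Omega> (e 2) = 0" using l2_norm_eq_0_iff[OF H10_L2[OF eH(1)[of 2]]] by simp
    then show False using eH(2)[of 2] by simp
  qed
  then show lam2: "lam 2 > ev" using ge[of 2] by simp
  have g: "sqrt \<gamma> > 0" using \<gamma>_pos by simp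
  have l2n: "l2_norm \<Omega> f \<le> (1 / sqrt \<gamma>) * A.nrm f" if "f \<in> H10 \<Omega>" for f
    using l2_le_nrm[OF that] g by (simp add: pos_le_divide_eq mult.commute)
  have bd: "\<bar>l2_inner \<Omega> f k\<bar> \<le> (1 / sqrt \<gamma>) * (1 / sqrt \<gamma>) * A.nrm f * A.nrm k" if "f \<in> H10 \<Omega>" "k \<in> H10 \<Omega>" for f k
  proof -
    have "\<bar>l2_inner \<Omega> f k\<bar> \<le> l2_norm \<Omega> f * l2_norm \<Omega> k" by (intro l2_cs H10_L2 that)
    also have "\<dots> \<le> ((1 / sqrt \<gamma>) * A.nrm f) * ((1 / sqrt \<gamma>) * A.nrm k)"
      using g by (intro mult_mono l2n that mult_nonneg_nonneg A.nrm_nonneg) auto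
    finally show ?thesis by (simp add: mult_ac)
  qed
  have cs: "\<bar>l2_inner \<Omega> f k\<bar> \<le> 1 * l2_norm \<Omega> f * l2_norm \<Omega> k" if "f \<in> H10 \<Omega>" "k \<in> H10 \<Omega>" for f k
    using l2_cs[OF H10_L2[OF that(1)] H10_L2[OF that(2)]] by simp
  have PH: "f \<in> H10 \<Omega>" if "f \<in> V_perp \<Omega> u" for f using that V_perp_H10 by blast
  obtain v \<nu> where v: "v \<in> V_perp \<Omega> u" "a u v v = 1" "\<nu> \<noteq> 0" "\<And>w. w \<in> V_perp \<Omega> u \<Longrightarrow> l2_inner \<Omega> v w = \<nu> * a u v w"
    "\<And>f. f \<in> V_perp \<Omega> u \<Longrightarrow> \<bar>l2_inner \<Omega> f f\<bar> \<le> \<bar>\<nu>\<bar> * a u f f"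
  proof (rule W.rayleigh_attained[of "l2_inner \<Omega>" "(1 / sqrt \<gamma>) * (1 / sqrt \<gamma>)" "e 2"])
    show "\<exists>r :: nat \<Rightarrow> nat. strict_mono r \<and> (\<forall>e>0. \<exists>N. \<forall>m\<ge>N. \<forall>n\<ge>N. \<forall>w\<in>V_perp \<Omega> u. \<bar>l2_inner \<Omega> (W.dif (h (r m)) (h (r n))) w\<bar> \<le> e * W.nrm w)"
      if h: "\<And>n. h n \<in> V_perp \<Omega> u" "\<And>n. W.nrm (h n) \<le> 1" for h :: "nat \<Rightarrow> 'a \<Rightarrow> real"
    proof -
      have "\<exists>r :: nat \<Rightarrow> nat. strict_mono r \<and> (\<forall>e>0. \<exists>N. \<forall>m\<ge>N. \<forall>n\<ge>N. \<forall>w\<in>H10 \<Omega>. \<bar>l2_inner \<Omega> (W.dif (h (r m)) (h (r n))) w\<bar> \<le> e * W.nrm w)"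
        by (rule compact_form[of "l2_inner \<Omega>" 1, OF cs zero_le_one PH[OF h(1)] h(2)])
      then show ?thesis using PH by meson
    qed
    show "l2_inner \<Omega> (e 2) (e 2) \<noteq> 0" using eH(2)[of 2] l2_norm_sq[of \<Omega> "e 2"] by simp
  qed (use bd PH e2 l2_inner_commute in \<open>auto simp: l2_inner_lc H10_L2\<close>)
  have vH: "v \<in> H10 \<Omega>" by (rule PH[OF v(1)])
  have vv: "l2_inner \<Omega> v v = \<nu>" using v(4)[OF v(1)] v(2) by simp
  then have \<nu>: "\<nu> > 0" using v(3) l2_norm_sq[of \<Omega> v] zero_le_power2[of "l2_norm \<Omega> v"] by simp
  \<comment> \<open>So far the equation of \<open>v\<close> is known only against the complement of
    \<open>u\<close>. It extends to all of \<open>H^1_0\<close>, because \<open>v\<close> is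
    orthogonal to \<open>u\<close> both in \<open>L^2\<close> and for \<open>a u\<close>.\<close>
  have vfull: "a u v w = (1 / \<nu>) * l2_inner \<Omega> v w" if w: "w \<in> H10 \<Omega>" for w
  proof -
    let ?w = "lc 1 w (- l2_inner \<Omega> u w) u"
    have "l2_inner \<Omega> v ?w = \<nu> * a u v ?w" by (rule v(4)[OF perp_decomposition[OF w]])
    moreover have "l2_inner \<Omega> v ?w = l2_inner \<Omega> v w"
      using L2.ip_lc_right[OF H10_L2[OF w] u_L2 H10_L2[OF vH]] a_u_perp(5)[OF v(1)] by simp
    moreover have "a u v ?w = a u v w"
      using A.ip_lc_right[OF w u_H10 vH] a_u_perp(2)[OF v(1)] by simp
    ultimately show ?thesis using \<nu> by simp
  qed
  define s where "s = 1 / l2_norm \<Omega> v"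
  have vn: "l2_norm \<Omega> v > 0" using vv \<nu> l2_norm_sq[of \<Omega> v] by (auto simp: less_le)
  define v1 where "v1 = lc s v 0 v"
  have v1ip: "l2_inner \<Omega> v1 f = s * l2_inner \<Omega> v f" if "f \<in> L2 \<Omega>" for f
    unfolding v1_def using l2_inner_lc[OF H10_L2[OF vH] H10_L2[OF vH] that] by simp
  have v1H: "v1 \<in> H10 \<Omega>" unfolding v1_def by (rule H10_lc[OF vH vH])
  have v1p: "linearized_eigenpair \<Omega> V \<beta> u (1 / \<nu>) v1"
    unfolding linearized_eigenpair_def
  proof (intro conjI ballI v1H)
    have "(l2_norm \<Omega> v1)\<^sup>2 = s\<^sup>2 * (l2_norm \<Omega> v)\<^sup>2"
      unfolding l2_norm_sq v1_def using L2.ip_lc_self[OF H10_L2[OF vH] H10_L2[OF vH], of s 0] by simp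
    also have "\<dots> = 1" using vn by (simp add: s_def power_divide)
    finally show "l2_norm \<Omega> v1 = 1" by (simp add: power2_eq_1_iff) (metis l2_norm_nonneg neg_0_le_iff_le not_one_le_zero)
    fix w assume w: "w \<in> H10 \<Omega>"
    show "a u v1 w = 1 / \<nu> * l2_inner \<Omega> v1 w"
      unfolding v1ip[OF H10_L2[OF w]] unfolding v1_def using a_lc[OF vH vH w u_H10, of s 0] vfull[OF w] by simp
  qed
  obtain j where j: "j \<ge> 1" "l2_inner \<Omega> v1 (e j) \<noteq> 0" using complete[OF v1p] by blast
  have "j \<noteq> 1"
  proof
    assume "j = 1"
    have "l2_inner \<Omega> v1 (e 1) = s * l2_inner \<Omega> v (e 1)" by (rule v1ip[OF H10_L2[OF eH(1)]]) simp
    also have "l2_inner \<Omega> v (e 1) = l2_inner \<Omega> u (e 1) * l2_inner \<Omega> u v"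
      using e1[OF H10_L2[OF vH]] l2_inner_commute[of \<Omega> v "e 1"] by simp
    also have "l2_inner \<Omega> u v = 0" by (rule a_u_perp(4)[OF v(1)])
    finally show False using j \<open>j = 1\<close> by simp
  qed
  then have "lam 2 \<le> lam j" using j(1) mono[of 2 j] by simp
  moreover have "lam j = 1 / \<nu>" using eigenpair_orthogonal[OF v1p ep[OF j(1)]] j(2) by metis
  ultimately have le: "lam 2 \<le> 1 / \<nu>" by simp
  show "lam 2 * l2_inner \<Omega> h h \<le> a u h h" if h: "h \<in> V_perp \<Omega> u" for h
  proof -
    have n: "0 \<le> l2_inner \<Omega> h h" unfolding l2_norm_sq[symmetric] by simp
    have "lam 2 * l2_inner \<Omega> h h \<le> 1 / \<nu> * l2_inner \<Omega> h h" by (rule mult_right_mono[OF le n])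
    also have "\<dots> \<le> 1 / \<nu> * (\<nu> * a u h h)" using v(5)[OF h] \<nu> by (intro mult_left_mono) auto
    also have "\<dots> = a u h h" using \<nu> by simp
    finally show ?thesis .
  qed
qed

subsection \<open>The weighted eigenvalue problem\<close>

text \<open>The left side of the weighted eigenvalue problem as a form on the whole space. To first
  order \<open>B h\<close> is the right side of the equation for the new error, as
  \<open>error_equation\<close> makes precise.\<close>

definition B :: "('a \<Rightarrow> real) \<Rightarrow> ('a \<Rightarrow> real) \<Rightarrow> real" where
  "B h w = l2_inner \<Omega> h (\<lambda>x. (ev - 2 * \<beta> * \<bar>u x\<bar>^2) * w x)"

text \<open>From \<open>0 \<le> \<beta> u^2 \<le> ev\<close> the weight lies between
  \<open>- ev\<close> and \<open>ev\<close>; a larger density would spoil the lower end.\<close>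

lemma weight_bounded: "AE x in M. \<bar>ev - 2 * \<beta> * \<bar>u x\<bar>^2\<bar> \<le> ev"
  using density_le_ev
proof eventually_elim
  case (elim x)
  have "0 \<le> \<beta> * (u x)\<^sup>2" using \<beta>_nonneg by simp
  then show ?case using elim by (simp add: abs_le_iff)
qed

lemma weight_mult_L2:
  assumes "w \<in> L2 \<Omega>"
  shows "(\<lambda>x. (ev - 2 * \<beta> * \<bar>u x\<bar>^2) * w x) \<in> L2 \<Omega>"
    "l2_norm \<Omega> (\<lambda>x. (ev - 2 * \<beta> * \<bar>u x\<bar>^2) * w x) \<le> ev * l2_norm \<Omega> w"
proof -
  have m: "(\<lambda>x. ev - 2 * \<beta> * \<bar>u x\<bar>^2) \<in> borel_measurable M" using u_measurable by measurable
  from L2_mult_bounded[OF assms m weight_bounded] ev_pos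
  show "(\<lambda>x. (ev - 2 * \<beta> * \<bar>u x\<bar>^2) * w x) \<in> L2 \<Omega>"
    "l2_norm \<Omega> (\<lambda>x. (ev - 2 * \<beta> * \<bar>u x\<bar>^2) * w x) \<le> ev * l2_norm \<Omega> w" by simp_all
qed

lemma B_bound:
  assumes "f \<in> L2 \<Omega>" "w \<in> L2 \<Omega>"
  shows "\<bar>B f w\<bar> \<le> ev * l2_norm \<Omega> f * l2_norm \<Omega> w"
proof -
  have "\<bar>B f w\<bar> \<le> l2_norm \<Omega> f * l2_norm \<Omega> (\<lambda>x. (ev - 2 * \<beta> * \<bar>u x\<bar>^2) * w x)"
    unfolding B_def by (intro l2_cs assms weight_mult_L2)
  also have "\<dots> \<le> l2_norm \<Omega> f * (ev * l2_norm \<Omega> w)" by (intro mult_left_mono weight_mult_L2 assms) simp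
  finally show ?thesis by (simp add: mult_ac)
qed

lemma B_lc: "f \<in> L2 \<Omega> \<Longrightarrow> g \<in> L2 \<Omega> \<Longrightarrow> w \<in> L2 \<Omega> \<Longrightarrow> B (lc s f t g) w = s * B f w + t * B g w"
  unfolding B_def by (intro l2_inner_lc weight_mult_L2)

lemma B_commute: "B f w = B w f"
  unfolding B_def l2_inner_def by (simp add: mult_ac)

lemma B_eq:
  assumes "f \<in> H10 \<Omega>" "w \<in> H10 \<Omega>"
  shows "B f w = ev * l2_inner \<Omega> f w - 2 * \<beta> * q u f u w"
proof -
  have "B f w = (LINT x|M. ev * (f x * w x) - 2 * \<beta> * (u x * f x * (u x * w x)))"
    unfolding B_def l2_inner_def
    by (rule Bochner_Integration.integral_cong) (auto simp: power2_eq_square algebra_simps)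
  then show ?thesis
    using integrable_inner_of_L2[OF H10_L2[OF assms(1)] H10_L2[OF assms(2)]] q_integrable[OF u_H10 assms(1) u_H10 assms(2)]
    by (simp add: l2_inner_def q_int)
qed

text \<open>For an eigenpair, \<open>lam 2 * \<bar>\<mu>\<bar> * a u v v\<close> is
  \<open>lam 2 * \<bar>B v v\<bar>\<close>, at most \<open>lam 2 * ev * (v, v)\<close> and so at
  most \<open>ev * a u v v\<close>; the positive factor \<open>a u v v\<close> cancels.\<close>

lemma rate_bounds:
  assumes lam: "ordered_linearized_eigenpairs \<Omega> V \<beta> u lam e" and mu: "weighted_eigenvalue \<Omega> V \<beta> u ev \<mu>"
  shows "\<bar>\<mu>\<bar> \<le> lam 1 / lam 2" "\<bar>\<mu>\<bar> = lam 1 / lam 2 \<Longrightarrow> \<beta> = 0"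
proof -
  note gap = spectral_gap[OF lam]
  have l2p: "lam 2 > 0" using gap(2) ev_pos by simp
  obtain v where v: "v \<in> V_perp \<Omega> u" "\<not> (AE x in M. v x = 0)" "\<And>w. w \<in> V_perp \<Omega> u \<Longrightarrow> B v w = \<mu> * a u v w"
    using mu unfolding weighted_eigenvalue_def B_def by blast
  have vH: "v \<in> H10 \<Omega>" using v(1) V_perp_H10 by blast
  have vp: "l2_inner \<Omega> v v > 0"
    using v(2) l2_norm_eq_0_iff[OF H10_L2[OF vH]] l2_norm_sq[of \<Omega> v] zero_less_power2[of "l2_norm \<Omega> v"] by simp
  have ap: "a u v v > 0" using gap(3)[OF v(1)] mult_pos_pos[OF l2p vp] by linarith
  have Bv: "\<bar>B v v\<bar> = \<bar>\<mu>\<bar> * a u v v" using v(3)[OF v(1)] ap by (simp add: abs_mult)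
  have B1: "\<bar>B v v\<bar> \<le> ev * l2_inner \<Omega> v v"
    using B_bound[OF H10_L2[OF vH] H10_L2[OF vH]] by (simp add: l2_norm_sq[symmetric] power2_eq_square mult.assoc)
  have "lam 2 * (\<bar>\<mu>\<bar> * a u v v) \<le> lam 2 * (ev * l2_inner \<Omega> v v)" using B1 Bv l2p by simp
  also have "\<dots> \<le> ev * a u v v" using mult_left_mono[OF gap(3)[OF v(1)], of ev] ev_pos by (simp add: mult_ac)
  finally have "(lam 2 * \<bar>\<mu>\<bar>) * a u v v \<le> ev * a u v v" by (simp add: mult.assoc)
  then have "lam 2 * \<bar>\<mu>\<bar> \<le> ev" using ap by (simp add: mult_le_cancel_right)
  then show "\<bar>\<mu>\<bar> \<le> lam 1 / lam 2" using l2p gap(1) by (simp add: pos_le_divide_eq mult.commute)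
  assume eq: "\<bar>\<mu>\<bar> = lam 1 / lam 2"
  show "\<beta> = 0"
  proof (rule ccontr)
    assume "\<beta> \<noteq> 0"
    then have \<beta>: "\<beta> > 0" using \<beta>_nonneg by simp
    have "ev * l2_inner \<Omega> v v \<le> ev * (a u v v / lam 2)"
      using gap(3)[OF v(1)] l2p ev_pos by (intro mult_left_mono) (auto simp: pos_le_divide_eq mult.commute)
    also have "\<dots> = \<bar>B v v\<bar>" unfolding Bv eq gap(1) by simp
    finally have ge: "ev * l2_inner \<Omega> v v \<le> \<bar>B v v\<bar>" .
    \<comment> \<open>In the case of equality the nonnegative function \<open>F\<close> has integral
      at most zero, so it vanishes almost everywhere. For \<open>\<beta> > 0\<close> the
      inequalities \<open>0 < \<beta> u^2 < ev\<close> make its first factor positive, which forces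
      \<open>v = 0\<close>.\<close>
    define F where "F x = (ev - \<bar>ev - 2 * \<beta> * \<bar>u x\<bar>^2\<bar>) * (v x * v x)" for x
    have i1: "integrable M (\<lambda>x. v x * v x)" using integrable_inner_of_L2[OF H10_L2[OF vH] H10_L2[OF vH]] by simp
    have i2: "integrable M (\<lambda>x. v x * ((ev - 2 * \<beta> * \<bar>u x\<bar>^2) * v x))"
      using integrable_inner_of_L2[OF H10_L2[OF vH] weight_mult_L2(1)[OF H10_L2[OF vH]]] by simp
    have Fe: "F x = ev * (v x * v x) - \<bar>v x * ((ev - 2 * \<beta> * \<bar>u x\<bar>^2) * v x)\<bar>" for x
    proof -
      have "v x * ((ev - 2 * \<beta> * \<bar>u x\<bar>^2) * v x) = (ev - 2 * \<beta> * \<bar>u x\<bar>^2) * (v x * v x)" by (simp only: mult_ac)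
      then have "\<bar>v x * ((ev - 2 * \<beta> * \<bar>u x\<bar>^2) * v x)\<bar> = \<bar>ev - 2 * \<beta> * \<bar>u x\<bar>^2\<bar> * (v x * v x)"
        by (simp only: abs_mult abs_mult_self_eq)
      then show ?thesis unfolding F_def by (simp only: left_diff_distrib)
    qed
    have Fi: "integrable M F" unfolding Fe[abs_def] using i1 i2 by simp
    have "(LINT x|M. F x) = ev * l2_inner \<Omega> v v - (LINT x|M. \<bar>v x * ((ev - 2 * \<beta> * \<bar>u x\<bar>^2) * v x)\<bar>)"
      unfolding Fe[abs_def] l2_inner_def using i1 i2 by simp
    also have "\<dots> \<le> ev * l2_inner \<Omega> v v - \<bar>B v v\<bar>"
      unfolding B_def l2_inner_def using integral_abs_bound[of M "\<lambda>x. v x * ((ev - 2 * \<beta> * \<bar>u x\<bar>^2) * v x)"] by simp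
    finally have Fle: "(LINT x|M. F x) \<le> 0" using ge by simp
    have Fn: "AE x in M. 0 \<le> F x" using weight_bounded by eventually_elim (auto simp: F_def)
    have "(LINT x|M. F x) = 0" using Fle integral_nonneg_AE[OF Fn] by simp
    then have "AE x in M. F x = 0" using integral_nonneg_eq_0_iff_AE[OF Fi Fn] by simp
    then have "AE x in M. v x = 0"
      using density_less_ev[OF \<beta>] u_pos
    proof eventually_elim
      case (elim x)
      have "0 < \<beta> * (u x)\<^sup>2" using elim \<beta> by simp
      then have "\<bar>ev - 2 * \<beta> * \<bar>u x\<bar>^2\<bar> < ev" using elim by (simp add: abs_less_iff)
      then show ?case using elim by (simp add: F_def)
    qed
    then show False using v(2) by simp
  qed
qed

text \<open>If the quadratic form of \<open>B\<close> is zero on the complement, there is nothing to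
  bound; otherwise its Rayleigh maximum is a weighted eigenvalue and is dominated by
  \<open>\<mu>\<close>. Polarisation extends the diagonal bound to two different arguments.\<close>

lemma largest_bounds_form:
  assumes mu: "largest_weighted_eigenvalue \<Omega> V \<beta> u ev \<mu>" and f: "f \<in> V_perp \<Omega> u" and w: "w \<in> V_perp \<Omega> u"
  shows "\<bar>B f w\<bar> \<le> \<bar>\<mu>\<bar> * A.nrm f * A.nrm w"
proof -
  have PH: "f \<in> H10 \<Omega>" if "f \<in> V_perp \<Omega> u" for f using that V_perp_H10 by blast
  have B_W: "B (lc s f t g) k = s * B f k + t * B g k" if "f \<in> V_perp \<Omega> u" "g \<in> V_perp \<Omega> u" "k \<in> V_perp \<Omega> u" for f g k s t
    by (intro B_lc H10_L2 PH that)
  have le: "\<bar>B f f\<bar> \<le> \<bar>\<mu>\<bar> * a u f f" if f: "f \<in> V_perp \<Omega> u" for f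
  proof (cases "\<exists>f0\<in>V_perp \<Omega> u. B f0 f0 \<noteq> 0")
    case False
    then show ?thesis using f a_nonneg[of u f] by simp
  next
    case True
    then obtain f0 where f0: "f0 \<in> V_perp \<Omega> u" "B f0 f0 \<noteq> 0" by blast
    have g: "sqrt \<gamma> > 0" using \<gamma>_pos by simp
    have l2n: "l2_norm \<Omega> f \<le> (1 / sqrt \<gamma>) * A.nrm f" if "f \<in> H10 \<Omega>" for f
      using l2_le_nrm[OF that] g by (simp add: pos_le_divide_eq mult.commute)
    have bd: "\<bar>B f k\<bar> \<le> (ev * (1 / sqrt \<gamma>) * (1 / sqrt \<gamma>)) * A.nrm f * A.nrm k" if "f \<in> H10 \<Omega>" "k \<in> H10 \<Omega>" for f k
    proof -
      have "\<bar>B f k\<bar> \<le> ev * (l2_norm \<Omega> f * l2_norm \<Omega> k)" using B_bound[OF H10_L2[OF that(1)] H10_L2[OF that(2)]] by (simp add: mult.assoc)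
      also have "\<dots> \<le> ev * (((1 / sqrt \<gamma>) * A.nrm f) * ((1 / sqrt \<gamma>) * A.nrm k))"
        using g ev_pos by (intro mult_left_mono mult_mono l2n that mult_nonneg_nonneg A.nrm_nonneg) auto
      finally show ?thesis by (simp add: mult_ac)
    qed
    obtain v \<nu> where v: "v \<in> V_perp \<Omega> u" "a u v v = 1" "\<nu> \<noteq> 0" "\<And>w. w \<in> V_perp \<Omega> u \<Longrightarrow> B v w = \<nu> * a u v w"
      "\<And>f. f \<in> V_perp \<Omega> u \<Longrightarrow> \<bar>B f f\<bar> \<le> \<bar>\<nu>\<bar> * a u f f"
    proof (rule W.rayleigh_attained[of B "ev * (1 / sqrt \<gamma>) * (1 / sqrt \<gamma>)" f0])
      show "\<exists>r :: nat \<Rightarrow> nat. strict_mono r \<and> (\<forall>e>0. \<exists>N. \<forall>m\<ge>N. \<forall>n\<ge>N. \<forall>w\<in>V_perp \<Omega> u. \<bar>B (W.dif (h (r m)) (h (r n))) w\<bar> \<le> e * W.nrm w)"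
        if h: "\<And>n. h n \<in> V_perp \<Omega> u" "\<And>n. W.nrm (h n) \<le> 1" for h :: "nat \<Rightarrow> 'a \<Rightarrow> real"
      proof -
        have "\<exists>r :: nat \<Rightarrow> nat. strict_mono r \<and> (\<forall>e>0. \<exists>N. \<forall>m\<ge>N. \<forall>n\<ge>N. \<forall>w\<in>H10 \<Omega>. \<bar>B (W.dif (h (r m)) (h (r n))) w\<bar> \<le> e * W.nrm w)"
          by (rule compact_form[of B ev, OF B_bound[OF H10_L2 H10_L2] less_imp_le[OF ev_pos] PH[OF h(1)] h(2)])
        then show ?thesis using PH by meson
      qed
    qed (use bd PH f0 B_commute B_W in auto)
    have "weighted_eigenvalue \<Omega> V \<beta> u ev \<nu>"
      unfolding weighted_eigenvalue_def
    proof (intro bexI[OF _ v(1)] conjI ballI)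
      show "\<not> (AE x in M. v x = 0)"
      proof
        assume "AE x in M. v x = 0"
        then have "l2_norm \<Omega> v = 0" using l2_norm_eq_0_iff[OF H10_L2[OF PH[OF v(1)]]] by simp
        then have "B v v = 0" using B_bound[OF H10_L2[OF PH[OF v(1)]] H10_L2[OF PH[OF v(1)]]] by simp
        then show False using v(4)[OF v(1)] v(2,3) by simp
      qed
      show "l2_inner \<Omega> v (\<lambda>x. (ev - 2 * \<beta> * \<bar>u x\<bar>^2) * w x) = \<nu> * a u v w" if "w \<in> V_perp \<Omega> u" for w
        using v(4)[OF that] unfolding B_def .
    qed
    then have "\<bar>\<nu>\<bar> \<le> \<bar>\<mu>\<bar>" using mu by (simp add: largest_weighted_eigenvalue_def)
    then have "\<bar>\<nu>\<bar> * a u f f \<le> \<bar>\<mu>\<bar> * a u f f" by (intro mult_right_mono a_nonneg)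
    then show ?thesis using v(5)[OF f] by simp
  qed
  show ?thesis by (rule W.polarized_bound[of B, OF B_W B_commute le f w]) auto
qed

end

subsection \<open>Local convergence of the inverse iteration\<close>

context gross_pitaevskii
begin

text \<open>The embedding constant from the norm of \<open>a u\<close> into \<open>H^1\<close>, and
  hence into \<open>L^2\<close>.\<close>

definition \<kappa> where "\<kappa> = 1 / sqrt \<gamma>"

lemma \<kappa>_pos: "\<kappa> > 0"
  using \<gamma>_pos by (simp add: \<kappa>_def)

lemma h1_le_nrm: "w \<in> H10 \<Omega> \<Longrightarrow> h1_norm \<Omega> w \<le> \<kappa> * A.nrm w"
  using nrm_a_bounds(1)[OF u_H10, of w] \<gamma>_pos by (simp add: \<kappa>_def pos_le_divide_eq mult.commute)

lemma l2_le_kappa_nrm: "w \<in> H10 \<Omega> \<Longrightarrow> l2_norm \<Omega> w \<le> \<kappa> * A.nrm w"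
  using l2_le_nrm[of w] \<gamma>_pos by (simp add: \<kappa>_def pos_le_divide_eq mult.commute)

lemma q_nrm_bound:
  assumes "z \<in> H10 \<Omega>" "y \<in> H10 \<Omega>" "w \<in> H10 \<Omega>" "v \<in> H10 \<Omega>"
  shows "\<bar>q z y w v\<bar> \<le> K4\<^sup>2 * \<kappa>^4 * (A.nrm z * A.nrm y * A.nrm w * A.nrm v)"
proof -
  have k: "0 \<le> \<kappa>" using \<kappa>_pos by simp
  note n = assms[THEN A.nrm_nonneg]
  have "\<bar>q z y w v\<bar> \<le> K4\<^sup>2 * (h1_norm \<Omega> z * h1_norm \<Omega> y * h1_norm \<Omega> w * h1_norm \<Omega> v)"
    by (rule q_bound[OF assms])
  also have "\<dots> \<le> K4\<^sup>2 * ((\<kappa> * A.nrm z) * (\<kappa> * A.nrm y) * (\<kappa> * A.nrm w) * (\<kappa> * A.nrm v))"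
    using k n by (intro mult_left_mono mult_mono h1_le_nrm assms mult_nonneg_nonneg) auto
  also have "\<dots> = K4\<^sup>2 * \<kappa>^4 * (A.nrm z * A.nrm y * A.nrm w * A.nrm v)"
    by (simp add: numeral_eq_Suc)
  finally show ?thesis .
qed

lemma q_shift:
  assumes h: "h \<in> H10 \<Omega>" "w \<in> H10 \<Omega>" "\<phi> \<in> H10 \<Omega>"
  shows "q (lc 1 h 1 u) w (lc 1 h 1 u) \<phi> = q u w u \<phi> + (2 * q u h w \<phi> + q h h w \<phi>)"
proof -
  note v = H10_lc[OF h(1) u_H10, of 1 1]
  have "q (lc 1 h 1 u) w (lc 1 h 1 u) \<phi> = q h w (lc 1 h 1 u) \<phi> + q u w (lc 1 h 1 u) \<phi>"
    using q_lc1[OF h(1) u_H10 h(2) v h(3), of 1 1] by simp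
  also have "\<dots> = q (lc 1 h 1 u) \<phi> h w + q (lc 1 h 1 u) \<phi> u w"
    using q_perm(2)[of h w] q_perm(2)[of u w] by simp
  also have "\<dots> = (q h \<phi> h w + q u \<phi> h w) + (q h \<phi> u w + q u \<phi> u w)"
    using q_lc1[OF h(1) u_H10 h(3) h(1) h(2), of 1 1] q_lc1[OF h(1) u_H10 h(3) u_H10 h(2), of 1 1] by simp
  also have "\<dots> = q u w u \<phi> + (2 * q u h w \<phi> + q h h w \<phi>)"
    unfolding q_int by (simp add: mult_ac)
  finally show ?thesis .
qed

lemma a_shift:
  assumes "h \<in> H10 \<Omega>" "w \<in> H10 \<Omega>" "\<phi> \<in> H10 \<Omega>"
  shows "a (lc 1 h 1 u) w \<phi> = a u w \<phi> + \<beta> * (2 * q u h w \<phi> + q h h w \<phi>)"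
  unfolding a_eq q_shift[OF assms] by (simp add: algebra_simps)

text \<open>\<open>U\<close> is the energy norm of \<open>u\<close>, \<open>c2\<close> passes from
  the \<open>H^1\<close> norm to the energy norm, and \<open>Q\<close> bounds
  \<open>\<beta> * q\<close> in energy norms. \<open>C1\<close> is the first-order bound for the
  unnormalised error, \<open>C2\<close> bounds the quadratic remainder of its equation, and
  \<open>C3\<close> adds the effect of the \<open>u\<close>-component of \<open>h\<close>.\<close>

definition U where "U = A.nrm u"
definition c2 where "c2 = sqrt (1 + CV + \<beta> * K4\<^sup>2 * (h1_norm \<Omega> u)\<^sup>2)"
definition Q where "Q = \<beta> * (K4\<^sup>2 * \<kappa>^4)"
definition C1 where "C1 = c2\<^sup>2 / \<gamma> * (ev * \<kappa>\<^sup>2 + Q * (2 * U\<^sup>2 + U))"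
definition C2 where "C2 = Q * (U + 2 * U * C1 + C1)"
definition C3 where "C3 = ev * \<kappa>^3 / 2 + C2"

lemma constants_nonneg: "0 \<le> U" "1 \<le> c2" "0 \<le> Q" "0 \<le> C1" "0 \<le> C2" "0 \<le> C3"
proof -
  show U: "0 \<le> U" unfolding U_def by (simp add: u_H10)
  show "1 \<le> c2" unfolding c2_def using CV(1) \<beta>_nonneg by simp
  show Q: "0 \<le> Q" unfolding Q_def using \<beta>_nonneg \<kappa>_pos by simp
  show C1: "0 \<le> C1" unfolding C1_def using \<gamma>_pos ev_pos U Q by simp
  show C2: "0 \<le> C2" unfolding C2_def using U Q C1 by simp
  show "0 \<le> C3" unfolding C3_def using C2 ev_pos \<kappa>_pos by simp
qed

lemma q_beta_bound:
  assumes "z \<in> H10 \<Omega>" "y \<in> H10 \<Omega>" "w \<in> H10 \<Omega>" "v \<in> H10 \<Omega>"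
  shows "\<bar>\<beta> * q z y w v\<bar> \<le> Q * (A.nrm z * A.nrm y * A.nrm w * A.nrm v)"
  using mult_left_mono[OF q_nrm_bound[OF assms] \<beta>_nonneg] \<beta>_nonneg by (simp add: Q_def abs_mult mult.assoc)

text \<open>
  For a normalised \<open>v = u + h\<close> the function \<open>y = ev * G_v v - u\<close> is the unnormalised error of the
  next iterate.
\<close>

lemma error_equation:
  assumes h: "h \<in> H10 \<Omega>" and \<phi>: "\<phi> \<in> H10 \<Omega>" and z: "z \<in> H10 \<Omega>"
    and Gz: "\<And>\<phi>. \<phi> \<in> H10 \<Omega> \<Longrightarrow> a (lc 1 h 1 u) z \<phi> = l2_inner \<Omega> (lc 1 h 1 u) \<phi>"
  shows "a (lc 1 h 1 u) (lc ev z (-1) u) \<phi> = ev * l2_inner \<Omega> h \<phi> - \<beta> * (2 * q u h u \<phi> + q h h u \<phi>)"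
    "a u (lc ev z (-1) u) \<phi> = B h \<phi> - \<beta> * q h h u \<phi> -
       \<beta> * (2 * q u h (lc ev z (-1) u) \<phi> + q h h (lc ev z (-1) u) \<phi>)"
proof -
  note v = H10_lc[OF h u_H10, of 1 1]
  note y = H10_lc[OF z u_H10, of ev "-1"]
  have "a (lc 1 h 1 u) (lc ev z (-1) u) \<phi> = ev * l2_inner \<Omega> (lc 1 h 1 u) \<phi> - a (lc 1 h 1 u) u \<phi>"
    using a_lc[OF z u_H10 \<phi> v, of ev "-1"] Gz[OF \<phi>] by simp
  also have "\<dots> = ev * l2_inner \<Omega> h \<phi> - \<beta> * (2 * q u h u \<phi> + q h h u \<phi>)"
    unfolding a_shift[OF h u_H10 \<phi>] u_eigen[OF \<phi>] l2_inner_lc[OF H10_L2[OF h] u_L2 H10_L2[OF \<phi>]]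
    by (simp add: algebra_simps)
  finally show 1: "a (lc 1 h 1 u) (lc ev z (-1) u) \<phi> = ev * l2_inner \<Omega> h \<phi> - \<beta> * (2 * q u h u \<phi> + q h h u \<phi>)" .
  \<comment> \<open>Exchanging the weight \<open>u + h\<close> for \<open>u\<close> moves the terms
    that contain both \<open>h\<close> and the new error to the right, and
    \<open>ev (h, \<phi>) - 2 \<beta> q u h u \<phi>\<close> is \<open>B h \<phi>\<close>.\<close>
  show "a u (lc ev z (-1) u) \<phi> = B h \<phi> - \<beta> * q h h u \<phi> -
       \<beta> * (2 * q u h (lc ev z (-1) u) \<phi> + q h h (lc ev z (-1) u) \<phi>)"
    using 1 a_shift[OF h y \<phi>] B_eq[OF h \<phi>] q_perm(3)[of u h u \<phi>] q_perm(2)[of u h u \<phi>] q_perm(1)[of u h]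
    by (simp add: algebra_simps)
qed

text \<open>Test the equation with the error itself and use coercivity with the weight
  \<open>u + h\<close>. The constant may exceed 1; the bound only serves to show that products of
  \<open>h\<close> with the new error are quadratic in \<open>h\<close>.\<close>

lemma error_bound:
  assumes h: "h \<in> H10 \<Omega>" "A.nrm h \<le> 1" and z: "z \<in> H10 \<Omega>"
    and Gz: "\<And>\<phi>. \<phi> \<in> H10 \<Omega> \<Longrightarrow> a (lc 1 h 1 u) z \<phi> = l2_inner \<Omega> (lc 1 h 1 u) \<phi>"
  shows "A.nrm (lc ev z (-1) u) \<le> C1 * A.nrm h"
proof -
  define y where "y = lc ev z (-1) u"
  define s where "s = A.nrm h"
  define t where "t = A.nrm y"
  have y: "y \<in> H10 \<Omega>" unfolding y_def by (rule H10_lc[OF z u_H10])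
  have s: "0 \<le> s" "s \<le> 1" and t: "0 \<le> t" using h y by (auto simp: s_def t_def)
  have U: "0 \<le> U" and Q: "0 \<le> Q" by (rule constants_nonneg)+
  have c: "c2 > 0" using constants_nonneg(2) by simp
  have "t \<le> c2 * h1_norm \<Omega> y" unfolding t_def c2_def by (rule nrm_a_bounds(2)[OF u_H10 y])
  then have "t\<^sup>2 \<le> (c2 * h1_norm \<Omega> y)\<^sup>2" using t by (rule power_mono)
  then have "\<gamma> * t\<^sup>2 \<le> c2\<^sup>2 * (\<gamma> * (h1_norm \<Omega> y)\<^sup>2)"
    using \<gamma>_pos by (simp add: power_mult_distrib)
  also have "\<dots> \<le> c2\<^sup>2 * a (lc 1 h 1 u) y y" by (intro mult_left_mono a_coercive y) simp
  also have "a (lc 1 h 1 u) y y = ev * l2_inner \<Omega> h y - \<beta> * (2 * q u h u y + q h h u y)"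
    using error_equation(1)[OF h(1) y z Gz] unfolding y_def by blast
  also have "c2\<^sup>2 * \<dots> \<le> c2\<^sup>2 * ((ev * \<kappa>\<^sup>2 + Q * (2 * U\<^sup>2 + U)) * (s * t))"
  proof (intro mult_left_mono)
    have "l2_inner \<Omega> h y \<le> l2_norm \<Omega> h * l2_norm \<Omega> y"
      using l2_cs[OF H10_L2[OF h(1)] H10_L2[OF y]] by simp
    also have "\<dots> \<le> (\<kappa> * s) * (\<kappa> * t)"
      unfolding s_def t_def using \<kappa>_pos h(1) by (intro mult_mono l2_le_kappa_nrm y) auto
    finally have "ev * l2_inner \<Omega> h y \<le> ev * ((\<kappa> * s) * (\<kappa> * t))" using ev_pos by (intro mult_left_mono) auto
    then have 1: "ev * l2_inner \<Omega> h y \<le> ev * \<kappa>\<^sup>2 * (s * t)" by (simp add: power2_eq_square mult_ac)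
    have 2: "\<bar>\<beta> * q u h u y\<bar> \<le> Q * (U * s * U * t)"
      using q_beta_bound[OF u_H10 h(1) u_H10 y] by (simp add: U_def s_def t_def)
    have 3: "\<bar>\<beta> * q h h u y\<bar> \<le> Q * (s * s * U * t)"
      using q_beta_bound[OF h(1) h(1) u_H10 y] by (simp add: U_def s_def t_def)
    have "s * s * (U * t) \<le> 1 * s * (U * t)" using s t U by (intro mult_right_mono) auto
    then have "Q * (s * s * U * t) \<le> Q * (s * U * t)" using Q by (intro mult_left_mono) (auto simp: mult_ac)
    then have 3: "\<bar>\<beta> * q h h u y\<bar> \<le> Q * (s * U * t)" using 3 by linarith
    have "ev * l2_inner \<Omega> h y - \<beta> * (2 * q u h u y + q h h u y)
        \<le> ev * \<kappa>\<^sup>2 * (s * t) + 2 * (Q * (U * s * U * t)) + Q * (s * U * t)"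
      using 1 2 3 by (simp only: distrib_left mult.left_commute[of \<beta> 2])
    also have "\<dots> = (ev * \<kappa>\<^sup>2 + Q * (2 * U\<^sup>2 + U)) * (s * t)" by (simp add: power2_eq_square algebra_simps)
    finally show "ev * l2_inner \<Omega> h y - \<beta> * (2 * q u h u y + q h h u y)
      \<le> (ev * \<kappa>\<^sup>2 + Q * (2 * U\<^sup>2 + U)) * (s * t)" .
  qed simp
  also have "\<dots> = \<gamma> * (C1 * s * t)"
  proof -
    have "\<gamma> * (c2\<^sup>2 / \<gamma> * D * s * t) = c2\<^sup>2 * (D * (s * t))" for D using \<gamma>_pos by simp
    then show ?thesis unfolding C1_def by simp
  qed
  finally have "t * t \<le> (C1 * s) * t" using \<gamma>_pos by (simp add: power2_eq_square mult.assoc)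
  then have "t \<le> C1 * s" using constants_nonneg(4) s t by (cases "t = 0") auto
  then show ?thesis by (simp add: t_def s_def y_def)
qed

text \<open>Test with \<open>p\<close>, the component of \<open>y\<close> orthogonal to
  \<open>u\<close>: since \<open>a u u p = 0\<close>, the left side is the squared norm of
  \<open>p\<close>. On the right, \<open>h\<close> is split into \<open>w\<close>, orthogonal to
  \<open>u\<close>, where \<open>\<mu>\<close> applies, and \<open>\<alpha>\<close> times
  \<open>u\<close>, where \<open>\<alpha>\<close> is quadratic in \<open>h\<close>.\<close>

lemma error_perp_bound:
  assumes h: "h \<in> H10 \<Omega>" "A.nrm h \<le> 1" and v1: "l2_norm \<Omega> (lc 1 h 1 u) = 1" and z: "z \<in> H10 \<Omega>"
    and Gz: "\<And>\<phi>. \<phi> \<in> H10 \<Omega> \<Longrightarrow> a (lc 1 h 1 u) z \<phi> = l2_inner \<Omega> (lc 1 h 1 u) \<phi>"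
    and \<mu>: "0 \<le> \<mu>" "\<And>f w. f \<in> V_perp \<Omega> u \<Longrightarrow> w \<in> V_perp \<Omega> u \<Longrightarrow> \<bar>B f w\<bar> \<le> \<mu> * A.nrm f * A.nrm w"
    and y: "y = lc ev z (-1) u"
  shows "A.nrm (lc 1 y (- l2_inner \<Omega> u y) u) \<le> \<mu> * A.nrm h + C3 * (A.nrm h)\<^sup>2"
proof -
  define p where "p = lc 1 y (- l2_inner \<Omega> u y) u"
  define \<alpha> where "\<alpha> = l2_inner \<Omega> u h"
  define w where "w = lc 1 h (- \<alpha>) u"
  define s where "s = A.nrm h"
  define r where "r = A.nrm p"
  have yH: "y \<in> H10 \<Omega>" unfolding y by (rule H10_lc[OF z u_H10])
  have p: "p \<in> V_perp \<Omega> u" unfolding p_def by (rule perp_decomposition[OF yH])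
  have w: "w \<in> V_perp \<Omega> u" unfolding w_def \<alpha>_def by (rule perp_decomposition[OF h(1)])
  note pH = a_u_perp(3)[OF p] and wH = a_u_perp(3)[OF w]
  have s: "0 \<le> s" "s \<le> 1" and r: "0 \<le> r" using h pH by (auto simp: s_def r_def)
  have U: "0 \<le> U" and Q: "0 \<le> Q" by (rule constants_nonneg)+
  have ys: "A.nrm y \<le> C1 * s" using error_bound[OF h z Gz] by (simp add: y s_def)
  have yn: "0 \<le> A.nrm y" using yH by simp
  have R: "\<bar>a u y p - B h p\<bar> \<le> C2 * s\<^sup>2 * r"
  proof -
    have e: "a u y p - B h p = - (\<beta> * q h h u p) - 2 * (\<beta> * q u h y p) - \<beta> * q h h y p"
      using error_equation(2)[OF h(1) pH z Gz] unfolding y by (simp add: algebra_simps)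
    have 1: "\<bar>\<beta> * q h h u p\<bar> \<le> Q * (s * s * U * r)"
      using q_beta_bound[OF h(1) h(1) u_H10 pH] by (simp add: U_def s_def r_def)
    have "\<bar>\<beta> * q u h y p\<bar> \<le> Q * (U * s * A.nrm y * r)"
      using q_beta_bound[OF u_H10 h(1) yH pH] by (simp add: U_def s_def r_def)
    also have "\<dots> \<le> Q * (U * s * (C1 * s) * r)"
      using Q U s r ys by (intro mult_left_mono mult_right_mono mult_nonneg_nonneg) auto
    finally have 2: "\<bar>\<beta> * q u h y p\<bar> \<le> Q * (U * s * (C1 * s) * r)" .
    have "\<bar>\<beta> * q h h y p\<bar> \<le> Q * (s * s * A.nrm y * r)"
      using q_beta_bound[OF h(1) h(1) yH pH] by (simp add: U_def s_def r_def)
    also have "\<dots> \<le> Q * (s * s * C1 * r)"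
    proof -
      have "C1 * s \<le> C1" using constants_nonneg(4) s by (simp add: mult_left_le)
      then show ?thesis
        using Q s r ys by (intro mult_left_mono mult_right_mono mult_nonneg_nonneg) auto
    qed
    finally have 3: "\<bar>\<beta> * q h h y p\<bar> \<le> Q * (s * s * C1 * r)" .
    have "\<bar>a u y p - B h p\<bar> \<le> Q * (s * s * U * r) + 2 * (Q * (U * s * (C1 * s) * r)) + Q * (s * s * C1 * r)"
      unfolding e using 1 2 3 by linarith
    also have "\<dots> = C2 * s\<^sup>2 * r" unfolding C2_def by (simp add: power2_eq_square algebra_simps)
    finally show ?thesis .
  qed
  \<comment> \<open>Both \<open>u\<close> and \<open>u + h\<close> have norm 1, so
    \<open>2 \<alpha> = - |h|^2\<close>.\<close>
  have \<alpha>: "\<bar>\<alpha>\<bar> \<le> \<kappa>\<^sup>2 * s\<^sup>2 / 2"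
  proof -
    have "1 = l2_inner \<Omega> h h + 2 * \<alpha> + 1"
      using L2.ip_lc_self[OF H10_L2[OF h(1)] u_L2, of 1 1] l2_norm_sq[of \<Omega> "lc 1 h 1 u"] v1 u_self
        l2_inner_commute[of \<Omega> h u] by (simp add: \<alpha>_def)
    then have "\<bar>\<alpha>\<bar> = (l2_norm \<Omega> h)\<^sup>2 / 2" using l2_norm_sq[of \<Omega> h] zero_le_power2[of "l2_norm \<Omega> h"] by linarith
    also have "\<dots> \<le> (\<kappa> * s)\<^sup>2 / 2" unfolding s_def by (intro divide_right_mono power_mono l2_le_kappa_nrm h(1)) auto
    finally show ?thesis by (simp add: power_mult_distrib)
  qed
  \<comment> \<open>Removing the \<open>u\<close>-component is an orthogonal projection for
    \<open>a u\<close> as well, so no constant appears in front of \<open>\<mu>\<close>.\<close>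
  have ws: "A.nrm w \<le> s"
  proof -
    have hu: "a u h u = ev * \<alpha>" using u_eigen[OF h(1)] a_commute[of u h u] by (simp add: \<alpha>_def)
    have uu: "a u u u = ev" using u_eigen[OF u_H10] u_self by simp
    have "a u w w = a u h h - ev * \<alpha>\<^sup>2"
      unfolding w_def using A.ip_lc_self[OF h(1) u_H10, of 1 "- \<alpha>"] hu uu by (simp add: power2_eq_square algebra_simps)
    then have "(A.nrm w)\<^sup>2 \<le> s\<^sup>2" unfolding s_def A.nrm_sq[OF wH] A.nrm_sq[OF h(1)] using ev_pos by simp
    then show ?thesis by (rule power2_le_imp_le) (rule s(1))
  qed
  have "B h p = B w p + \<alpha> * B u p"
    unfolding w_def using B_lc[OF H10_L2[OF h(1)] u_L2 H10_L2[OF pH], of 1 "- \<alpha>"] by simp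
  moreover have "\<bar>B w p\<bar> \<le> \<mu> * s * r"
  proof -
    have "\<bar>B w p\<bar> \<le> \<mu> * A.nrm w * r" unfolding r_def by (rule \<mu>(2)[OF w p])
    also have "\<dots> \<le> \<mu> * s * r" by (intro mult_right_mono mult_left_mono ws \<mu>(1) r)
    finally show ?thesis .
  qed
  moreover have "\<bar>\<alpha> * B u p\<bar> \<le> ev * \<kappa>^3 / 2 * s\<^sup>2 * r"
  proof -
    have "\<bar>B u p\<bar> \<le> ev * l2_norm \<Omega> p" using B_bound[OF u_L2 H10_L2[OF pH]] u_norm by simp
    also have "\<dots> \<le> ev * (\<kappa> * r)" unfolding r_def using ev_pos by (intro mult_left_mono l2_le_kappa_nrm pH) auto
    finally have "\<bar>\<alpha>\<bar> * \<bar>B u p\<bar> \<le> (\<kappa>\<^sup>2 * s\<^sup>2 / 2) * (ev * (\<kappa> * r))"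
      using \<alpha> by (intro mult_mono) auto
    then show ?thesis by (simp add: abs_mult power2_eq_square power3_eq_cube mult_ac)
  qed
  ultimately have "a u y p \<le> \<mu> * s * r + ev * \<kappa>^3 / 2 * s\<^sup>2 * r + C2 * s\<^sup>2 * r" using R by linarith
  also have "a u y p = r * r"
  proof -
    have "a u p p = a u y p"
      using A.ip_lc[OF yH u_H10 pH, of 1 "- l2_inner \<Omega> u y"] a_u_perp(1)[OF p] by (simp add: p_def)
    then show ?thesis using A.nrm_sq[OF pH] by (simp add: r_def power2_eq_square)
  qed
  also have "\<mu> * s * r + ev * \<kappa>^3 / 2 * s\<^sup>2 * r + C2 * s\<^sup>2 * r = (\<mu> * s + C3 * s\<^sup>2) * r"
    unfolding C3_def by (simp add: algebra_simps)
  finally have "r * r \<le> (\<mu> * s + C3 * s\<^sup>2) * r" .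
  moreover have "0 \<le> \<mu> * s + C3 * s\<^sup>2" using \<mu>(1) s constants_nonneg(6) by simp
  ultimately have "r \<le> \<mu> * s + C3 * s\<^sup>2" using r by (cases "r = 0") auto
  then show ?thesis by (simp add: r_def s_def p_def)
qed

end

text \<open>To be read with \<open>N = |u + y|\<close>, \<open>g = (u, y)\<close> and
  \<open>n = |y|\<close>. The difference \<open>N^2 - (1 + g)^2 = n^2 - g^2\<close> has no linear
  part, so the \<open>u\<close>-component \<open>(1 + g) / N\<close> of the normalised iterate
  differs from 1 only quadratically.\<close>

lemma normalization_estimates:
  fixes N g n :: real
  assumes N: "0 \<le> N" "N\<^sup>2 = 1 + 2 * g + n\<^sup>2" and n: "0 \<le> n" "n \<le> 1/2" and g: "\<bar>g\<bar> \<le> n"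
  shows "1/2 \<le> N" "1 / N \<le> 1 + 2 * n" "\<bar>(1 + g) / N - 1\<bar> \<le> 2 * n\<^sup>2"
proof -
  have "N\<^sup>2 \<ge> (1 - n)\<^sup>2" unfolding N(2) using g by (simp add: power2_diff)
  then have Nn: "1 - n \<le> N" using N(1) by (rule power2_le_imp_le)
  then show N2: "1/2 \<le> N" using n by simp
  have "1 \<le> (1 + 2 * n) * N"
  proof -
    have "1 \<le> (1 + 2 * n) * (1 - n)"
    proof -
      have "n * n \<le> n * (1/2)" using n by (intro mult_left_mono) auto
      then show ?thesis by (simp add: algebra_simps)
    qed
    also have "\<dots> \<le> (1 + 2 * n) * N" using Nn n by (intro mult_left_mono) auto
    finally show ?thesis .
  qed
  then show "1 / N \<le> 1 + 2 * n" using N2 by (simp add: pos_divide_le_eq)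
  have g2: "g\<^sup>2 \<le> n\<^sup>2" using g n by (simp add: abs_le_square_iff[symmetric])
  have "\<bar>N - (1 + g)\<bar> * (N + (1 + g)) = \<bar>N\<^sup>2 - (1 + g)\<^sup>2\<bar>"
  proof -
    have "0 \<le> N + (1 + g)" using N2 g n by linarith
    then have "\<bar>N - (1 + g)\<bar> * (N + (1 + g)) = \<bar>(N - (1 + g)) * (N + (1 + g))\<bar>" by (simp add: abs_mult)
    then show ?thesis by (simp add: power2_eq_square algebra_simps)
  qed
  also have "\<dots> \<le> n\<^sup>2" unfolding N(2) using g2 by (simp add: power2_sum)
  finally have "\<bar>N - (1 + g)\<bar> * (N + (1 + g)) \<le> n\<^sup>2" .
  moreover have "\<bar>N - (1 + g)\<bar> * 1 \<le> \<bar>N - (1 + g)\<bar> * (N + (1 + g))"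
    using N2 g n by (intro mult_left_mono) linarith+
  ultimately have d: "\<bar>N - (1 + g)\<bar> \<le> n\<^sup>2" by simp
  have "(1 + g) / N - 1 = - (N - (1 + g)) / N" using N2 by (simp add: field_simps)
  then have "\<bar>(1 + g) / N - 1\<bar> = \<bar>N - (1 + g)\<bar> / N" using N2 by simp
  also have "\<dots> \<le> n\<^sup>2 / (1/2)" using d N2 by (intro frac_le) auto
  finally show "\<bar>(1 + g) / N - 1\<bar> \<le> 2 * n\<^sup>2" by simp
qed

section \<open>The contraction step with normalisation, and its iteration\<close>

context gross_pitaevskii
begin

text \<open>Within this distance of \<open>u\<close> the unnormalised error has \<open>L^2\<close>
  norm at most 1/2, as \<open>normalization_estimates\<close> requires. \<open>C4\<close> collects
  all quadratic contributions of one step.\<close>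

definition \<delta>0 where "\<delta>0 = 1 / (1 + 2 * (\<kappa> * C1))"
definition C4 where "C4 = 2 * (\<kappa> * C1)\<^sup>2 * U + 2 * (\<kappa> * C1) + 2 * C3"

lemma \<delta>0: "0 < \<delta>0" "\<delta>0 \<le> 1" "\<kappa> * C1 * \<delta>0 \<le> 1/2"
proof -
  define t where "t = \<kappa> * C1"
  have "0 \<le> t" using \<kappa>_pos constants_nonneg(4) by (simp add: t_def)
  then show "0 < \<delta>0" "\<delta>0 \<le> 1" "\<kappa> * C1 * \<delta>0 \<le> 1/2"
    unfolding \<delta>0_def t_def[symmetric] by (auto simp: field_simps)
qed

lemma C4_nonneg: "0 \<le> C4"
  unfolding C4_def using constants_nonneg(1,4,6) \<kappa>_pos by simp

text \<open>The new error is \<open>((1 + g) / N - 1) u + p / N\<close>. Its first coefficient is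
  quadratic, \<open>p\<close> is bounded by \<open>error_perp_bound\<close>, and
  \<open>1 / N \<le> 1 + 2 n\<close> costs a further quadratic term only.\<close>

lemma iteration_step:
  assumes v: "v \<in> H10 \<Omega>" "l2_norm \<Omega> v = 1" "A.nrm (lc 1 v (-1) u) \<le> \<delta>0"
    and \<mu>: "0 \<le> \<mu>" "\<mu> \<le> 1" "\<And>f w. f \<in> V_perp \<Omega> u \<Longrightarrow> w \<in> V_perp \<Omega> u \<Longrightarrow> \<bar>B f w\<bar> \<le> \<mu> * A.nrm f * A.nrm w"
    and z: "z = G_op \<Omega> V \<beta> v v" and v': "v' = (\<lambda>x. z x / l2_norm \<Omega> z)"
  shows "v' \<in> H10 \<Omega>" "l2_norm \<Omega> v' = 1"
    "A.nrm (lc 1 v' (-1) u) \<le> \<mu> * A.nrm (lc 1 v (-1) u) + C4 * (A.nrm (lc 1 v (-1) u))\<^sup>2"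
proof -
  define h where "h = lc 1 v (-1) u"
  define s where "s = A.nrm h"
  define y where "y = lc ev z (-1) u"
  define g where "g = l2_inner \<Omega> u y"
  define p where "p = lc 1 y (- g) u"
  \<comment> \<open>\<open>z\<close> and \<open>ev * z = u + y\<close> have the same normalisation;
    the second form is close to \<open>u\<close>.\<close>
  define N where "N = ev * l2_norm \<Omega> z"
  define n where "n = l2_norm \<Omega> y"
  have vh: "v = lc 1 h 1 u" by (simp add: h_def lc_def)
  have hH: "h \<in> H10 \<Omega>" unfolding h_def by (rule H10_lc[OF v(1) u_H10])
  have zH: "z \<in> H10 \<Omega>" unfolding z by (rule G_op(1)[OF v(1) H10_L2[OF v(1)]])
  have Gz: "a (lc 1 h 1 u) z \<phi> = l2_inner \<Omega> (lc 1 h 1 u) \<phi>" if "\<phi> \<in> H10 \<Omega>" for \<phi>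
    using G_op(2)[OF v(1) H10_L2[OF v(1)] that] unfolding z vh[symmetric] .
  have yH: "y \<in> H10 \<Omega>" unfolding y_def by (rule H10_lc[OF zH u_H10])
  have pH: "p \<in> H10 \<Omega>" unfolding p_def by (rule H10_lc[OF yH u_H10])
  have s0: "0 \<le> s" using hH by (simp add: s_def)
  have sd: "s \<le> \<delta>0" using v(3) by (simp add: s_def h_def)
  then have h1: "A.nrm h \<le> 1" using \<delta>0(2) by (simp add: s_def)
  have k: "0 \<le> \<kappa> * C1" using \<kappa>_pos constants_nonneg(4) by simp
  have "A.nrm y \<le> C1 * s"
    unfolding s_def y_def by (rule error_bound[OF hH h1 zH]) (rule Gz)
  then have "\<kappa> * A.nrm y \<le> \<kappa> * (C1 * s)" using \<kappa>_pos by simp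
  then have "n \<le> \<kappa> * (C1 * s)"
    unfolding n_def using l2_le_kappa_nrm[OF yH] by simp
  then have ns: "n \<le> \<kappa> * C1 * s" by (simp add: mult.assoc)
  also have "\<dots> \<le> \<kappa> * C1 * \<delta>0" by (intro mult_left_mono sd k)
  finally have n: "0 \<le> n" "n \<le> 1/2" using \<delta>0(3) by (auto simp: n_def)
  have gn: "\<bar>g\<bar> \<le> n" using l2_cs[OF u_L2 H10_L2[OF yH]] u_norm by (simp add: g_def n_def)
  have N2: "N\<^sup>2 = 1 + 2 * g + n\<^sup>2"
  proof -
    have "ev *\<^sub>R z x = u x + y x" for x by (simp add: y_def lc_def)
    then have "lc ev z 0 z = lc 1 u 1 y" by (simp add: lc_def)
    then have "l2_inner \<Omega> (lc ev z 0 z) (lc ev z 0 z) = l2_inner \<Omega> (lc 1 u 1 y) (lc 1 u 1 y)" by simp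
    then show ?thesis
      using L2.ip_lc_self[OF H10_L2[OF zH] H10_L2[OF zH], of ev 0] L2.ip_lc_self[OF u_L2 H10_L2[OF yH], of 1 1] u_self
      by (simp add: N_def power_mult_distrib l2_norm_sq g_def n_def)
  qed
  have N0: "0 \<le> N" using ev_pos by (simp add: N_def)
  note est = normalization_estimates[OF N0 N2 n gn]
  have z0: "l2_norm \<Omega> z > 0" using est(1) ev_pos by (auto simp: N_def less_le)
  have v'lc: "v' = lc (1 / l2_norm \<Omega> z) z 0 z" unfolding v' by (simp add: lc_def)
  show "v' \<in> H10 \<Omega>" unfolding v'lc by (rule H10_lc[OF zH zH])
  have "(l2_norm \<Omega> v')\<^sup>2 = (1 / l2_norm \<Omega> z)\<^sup>2 * (l2_norm \<Omega> z)\<^sup>2"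
    unfolding l2_norm_sq v'lc using L2.ip_lc_self[OF H10_L2[OF zH] H10_L2[OF zH], of "1 / l2_norm \<Omega> z" 0] by simp
  also have "\<dots> = 1\<^sup>2" using z0 by (simp add: power_divide)
  finally show "l2_norm \<Omega> v' = 1" by (rule power2_eq_imp_eq) auto
  have "lc 1 v' (-1) u = lc ((1 + g) / N - 1) u (1 / N) p"
  proof
    fix x
    have ez: "ev * z x = N * v' x" using z0 by (simp add: N_def v')
    have "N > 0" using est(1) by simp
    then show "lc 1 v' (-1) u x = lc ((1 + g) / N - 1) u (1 / N) p x"
      unfolding p_def y_def by (simp add: lc_def ez field_simps)
  qed
  then have "A.nrm (lc 1 v' (-1) u) \<le> \<bar>(1 + g) / N - 1\<bar> * U + \<bar>1 / N\<bar> * A.nrm p"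
    using A.nrm_lc_le[OF u_H10 pH, of "(1 + g) / N - 1" "1 / N"] by (simp add: U_def)
  also have "\<dots> \<le> 2 * (\<kappa> * C1 * s)\<^sup>2 * U + (\<mu> * s + 2 * (\<kappa> * C1 * s) * s + 2 * (C3 * s\<^sup>2))"
  proof (intro add_mono mult_right_mono)
    show "\<bar>(1 + g) / N - 1\<bar> \<le> 2 * (\<kappa> * C1 * s)\<^sup>2" using est(3) power_mono[OF ns n(1), of 2] by simp
    show "0 \<le> U" by (rule constants_nonneg)
    have "\<bar>1 / N\<bar> * A.nrm p \<le> (1 + 2 * n) * (\<mu> * s + C3 * s\<^sup>2)"
    proof (intro mult_mono)
      show "\<bar>1 / N\<bar> \<le> 1 + 2 * n" using est(2) N0 by simp
      show "A.nrm p \<le> \<mu> * s + C3 * s\<^sup>2"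
        unfolding p_def g_def s_def
        by (rule error_perp_bound[OF hH h1 _ zH Gz \<mu>(1,3) y_def]) (use v(2) vh in auto)
    qed (use n pH in auto)
    also have "\<dots> = \<mu> * s + 2 * n * (\<mu> * s) + (1 + 2 * n) * (C3 * s\<^sup>2)" by (simp add: algebra_simps)
    also have "\<dots> \<le> \<mu> * s + 2 * (\<kappa> * C1 * s) * s + 2 * (C3 * s\<^sup>2)"
    proof (intro add_mono order_refl)
      have "\<mu> * s \<le> s" using \<mu> s0 by (simp add: mult_left_le_one_le)
      then show "2 * n * (\<mu> * s) \<le> 2 * (\<kappa> * C1 * s) * s"
        using ns n(1) \<mu>(1) s0 k by (intro mult_mono) auto
      show "(1 + 2 * n) * (C3 * s\<^sup>2) \<le> 2 * (C3 * s\<^sup>2)"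
        using n constants_nonneg(6) by (intro mult_right_mono) auto
    qed
    finally show "\<bar>1 / N\<bar> * A.nrm p \<le> \<mu> * s + 2 * (\<kappa> * C1 * s) * s + 2 * (C3 * s\<^sup>2)" .
  qed
  also have "\<dots> = \<mu> * s + C4 * s\<^sup>2" unfolding C4_def by (simp add: power2_eq_square algebra_simps)
  finally show "A.nrm (lc 1 v' (-1) u) \<le> \<mu> * A.nrm (lc 1 v (-1) u) + C4 * (A.nrm (lc 1 v (-1) u))\<^sup>2"
    by (simp add: s_def h_def)
qed

text \<open>In a small ball one factor of the quadratic term \<open>C4 s^2\<close> is absorbed by
  the gap \<open>\<rho> - \<mu>\<close>, so every step contracts by \<open>\<rho>\<close> and
  remains in the ball.\<close>

lemma iteration_converges:
  assumes \<mu>: "0 \<le> \<mu>" "\<mu> < 1" "\<And>f w. f \<in> V_perp \<Omega> u \<Longrightarrow> w \<in> V_perp \<Omega> u \<Longrightarrow> \<bar>B f w\<bar> \<le> \<mu> * A.nrm f * A.nrm w"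
    and \<epsilon>: "\<epsilon> > 0"
  shows "\<exists>S C. H10_neighborhood \<Omega> u S \<and> C > 0 \<and>
       (\<forall>u0\<in>S. l2_norm \<Omega> u0 = 1 \<longrightarrow>
          (\<forall>n\<ge>1. h1_norm \<Omega> (\<lambda>x. inverse_iteration \<Omega> V \<beta> u0 n x - u x)
                    \<le> C * (\<mu> + \<epsilon>) ^ n * h1_norm \<Omega> (\<lambda>x. u0 x - u x)))"
proof -
  \<comment> \<open>The minimum keeps \<open>\<rho> \<le> 1\<close> for large
    \<open>\<epsilon>\<close> as well; otherwise the iterates could leave the ball in which the step
    estimate is valid.\<close>
  define \<rho> where "\<rho> = \<mu> + min \<epsilon> (1 - \<mu>)"
  have \<rho>: "\<mu> < \<rho>" "\<rho> \<le> 1" "\<rho> \<le> \<mu> + \<epsilon>" using \<epsilon> \<mu> by (auto simp: \<rho>_def)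
  define \<delta> where "\<delta> = min \<delta>0 ((\<rho> - \<mu>) / (C4 + 1))"
  have C4: "0 \<le> C4" by (rule C4_nonneg)
  have \<delta>: "0 < \<delta>" "\<delta> \<le> \<delta>0" "C4 * \<delta> \<le> \<rho> - \<mu>"
  proof -
    show d0: "0 < \<delta>" "\<delta> \<le> \<delta>0" using \<delta>0(1) \<rho> C4 by (auto simp: \<delta>_def)
    have "\<delta> \<le> (\<rho> - \<mu>) / (C4 + 1)" by (simp add: \<delta>_def)
    then have "\<delta> * (C4 + 1) \<le> \<rho> - \<mu>" using C4 by (simp add: pos_le_divide_eq)
    then show "C4 * \<delta> \<le> \<rho> - \<mu>" using d0 by (simp add: algebra_simps)
  qed
  have c: "c2 > 0" using constants_nonneg(2) by simp
  \<comment> \<open>The radius is measured in the \<open>H^1\<close> norm; dividing by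
    \<open>c2\<close> ensures energy distance below \<open>\<delta>\<close>.\<close>
  define S where "S = {v \<in> H10 \<Omega>. h1_norm \<Omega> (\<lambda>x. v x - u x) < \<delta> / c2}"
  have dif: "lc 1 f (-1) u \<in> H10 \<Omega>" if "f \<in> H10 \<Omega>" for f by (rule H10_lc[OF that u_H10])
  have le: "A.nrm (lc 1 f (-1) u) \<le> c2 * h1_norm \<Omega> (\<lambda>x. f x - u x)" if "f \<in> H10 \<Omega>" for f
    using nrm_a_bounds(2)[OF u_H10 dif[OF that]] unfolding c2_def lc_diff .
  show ?thesis
  proof (intro exI[of _ S] exI[of _ "\<kappa> * c2"] conjI ballI impI allI)
    show "H10_neighborhood \<Omega> u S"
      unfolding H10_neighborhood_def S_def using \<delta>(1) c by (auto intro!: exI[of _ "\<delta> / c2"])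
    show "\<kappa> * c2 > 0" using \<kappa>_pos c by simp
    fix u0 and n :: nat assume u0: "u0 \<in> S" "l2_norm \<Omega> u0 = 1"
    let ?f = "inverse_iteration \<Omega> V \<beta> u0"
    let ?s = "\<lambda>n. A.nrm (lc 1 (?f n) (-1) u)"
    have u0H: "u0 \<in> H10 \<Omega>" using u0 by (simp add: S_def)
    have "?s 0 < \<delta>"
    proof -
      have "h1_norm \<Omega> (\<lambda>x. u0 x - u x) < \<delta> / c2" using u0 by (simp add: S_def)
      then have "c2 * h1_norm \<Omega> (\<lambda>x. u0 x - u x) < \<delta>" using c by (simp add: pos_less_divide_eq mult.commute)
      then show ?thesis using le[OF u0H] by simp
    qed
    then have s0: "?s 0 \<le> \<delta>" "0 \<le> ?s 0" using dif[OF u0H] by auto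
    have main: "?f n \<in> H10 \<Omega> \<and> l2_norm \<Omega> (?f n) = 1 \<and> ?s n \<le> \<rho> ^ n * ?s 0" for n
    proof (induction n)
      case 0
      show ?case using u0H u0 by simp
    next
      case (Suc n)
      then have IH: "?f n \<in> H10 \<Omega>" "l2_norm \<Omega> (?f n) = 1" "?s n \<le> \<rho> ^ n * ?s 0" by auto
      have "\<rho> ^ n * ?s 0 \<le> 1 * ?s 0" using \<rho> \<mu>(1) s0(2) by (intro mult_right_mono power_le_one) auto
      then have sn: "?s n \<le> \<delta>" using IH(3) s0(1) by linarith
      have sn0: "0 \<le> ?s n" using dif[OF IH(1)] by simp
      define z where "z = G_op \<Omega> V \<beta> (?f n) (?f n)"
      have f: "?f (Suc n) = (\<lambda>x. z x / l2_norm \<Omega> z)" by (simp add: z_def Let_def)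
      have \<mu>1: "\<mu> \<le> 1" using \<mu>(2) by simp
      note st = iteration_step[OF IH(1,2) order_trans[OF sn \<delta>(2)] \<mu>(1) \<mu>1 \<mu>(3) z_def f]
      have "?s (Suc n) \<le> \<mu> * ?s n + C4 * (?s n)\<^sup>2" by (rule st(3))
      also have "\<dots> = (\<mu> + C4 * ?s n) * ?s n" by (simp add: power2_eq_square algebra_simps)
      also have "\<dots> \<le> \<rho> * ?s n"
      proof (intro mult_right_mono sn0)
        have "C4 * ?s n \<le> C4 * \<delta>" by (intro mult_left_mono sn C4)
        then show "\<mu> + C4 * ?s n \<le> \<rho>" using \<delta>(3) by simp
      qed
      also have "\<dots> \<le> \<rho> * (\<rho> ^ n * ?s 0)" using \<rho> \<mu>(1) by (intro mult_left_mono IH(3)) auto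
      finally show ?case using st(1,2) by (simp only: power_Suc mult.assoc)
    qed
    have "h1_norm \<Omega> (\<lambda>x. ?f n x - u x) \<le> \<kappa> * ?s n"
      using h1_le_nrm[OF dif] main[of n] by (simp add: lc_diff)
    also have "\<dots> \<le> \<kappa> * ((\<mu> + \<epsilon>) ^ n * (c2 * h1_norm \<Omega> (\<lambda>x. u0 x - u x)))"
    proof (intro mult_left_mono)
      have "?s n \<le> \<rho> ^ n * ?s 0" using main by blast
      also have "\<dots> \<le> (\<mu> + \<epsilon>) ^ n * (c2 * h1_norm \<Omega> (\<lambda>x. u0 x - u x))"
        using \<rho> \<mu>(1) \<epsilon> s0(2) le[OF u0H] by (intro mult_mono power_mono) auto
      finally show "?s n \<le> (\<mu> + \<epsilon>) ^ n * (c2 * h1_norm \<Omega> (\<lambda>x. u0 x - u x))" .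
    qed (use \<kappa>_pos in simp)
    finally show "h1_norm \<Omega> (\<lambda>x. ?f n x - u x) \<le> \<kappa> * c2 * (\<mu> + \<epsilon>) ^ n * h1_norm \<Omega> (\<lambda>x. u0 x - u x)"
      by (simp add: mult_ac)
  qed
qed

end

theorem mainTheorem2:
  fixes \<Omega> :: "'a::euclidean_space set"
    and V u :: "'a \<Rightarrow> real"
    and \<beta> ev \<mu>\<^sub>1 :: real
    and lam :: "nat \<Rightarrow> real"
    and e :: "nat \<Rightarrow> 'a \<Rightarrow> real"
  assumes dim: "DIM('a) \<in> {1, 2, 3}"
    and A1: "open \<Omega>" "\<Omega> \<noteq> {}" "bounded \<Omega>" "convex \<Omega>"
    and A2: "V \<in> Linf \<Omega>" "AE x in lebesgue_on \<Omega>. V x \<ge> 0"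
    and A3: "\<beta> \<ge> 0"
    and A4: "\<forall>x\<in>\<Omega>. \<forall>\<epsilon>>0. linf_norm (\<Omega> \<inter> ball x \<epsilon>) V > 0"
    and u: "ground_state \<Omega> V \<beta> u"
    and ev: "ground_state_eigenvalue \<Omega> V \<beta> u ev"
    and lam: "ordered_linearized_eigenpairs \<Omega> V \<beta> u lam e"
    and mu: "largest_weighted_eigenvalue \<Omega> V \<beta> u ev \<mu>\<^sub>1"
  shows "\<bar>\<mu>\<^sub>1\<bar> < 1 \<and>
    (\<forall>\<epsilon>>0. \<exists>S C. H10_neighborhood \<Omega> u S \<and> C > 0 \<and>
       (\<forall>u0\<in>S. l2_norm \<Omega> u0 = 1 \<longrightarrow>
          (\<forall>n\<ge>1. h1_norm \<Omega> (\<lambda>x. inverse_iteration \<Omega> V \<beta> u0 n x - u x)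
                    \<le> C * (\<bar>\<mu>\<^sub>1\<bar> + \<epsilon>) ^ n * h1_norm \<Omega> (\<lambda>x. u0 x - u x)))) \<and>
    \<bar>\<mu>\<^sub>1\<bar> \<le> lam 1 / lam 2 \<and>
    (\<bar>\<mu>\<^sub>1\<bar> = lam 1 / lam 2 \<longrightarrow> \<beta> = 0)"
proof -
  interpret gross_pitaevskii \<Omega> V u \<beta> ev
    by unfold_locales
      (use assms in \<open>auto simp: ground_state_def ground_state_eigenvalue_def\<close>)
  have we: "weighted_eigenvalue \<Omega> V \<beta> u ev \<mu>\<^sub>1" using mu by (simp add: largest_weighted_eigenvalue_def)
  note rate = rate_bounds[OF lam we]
  have "lam 1 / lam 2 < 1" using spectral_gap(1,2)[OF lam] ev_pos by simp
  then have lt: "\<bar>\<mu>\<^sub>1\<bar> < 1" using rate(1) by simp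
  have "\<exists>S C. H10_neighborhood \<Omega> u S \<and> C > 0 \<and>
       (\<forall>u0\<in>S. l2_norm \<Omega> u0 = 1 \<longrightarrow>
          (\<forall>n\<ge>1. h1_norm \<Omega> (\<lambda>x. inverse_iteration \<Omega> V \<beta> u0 n x - u x)
                    \<le> C * (\<bar>\<mu>\<^sub>1\<bar> + \<epsilon>) ^ n * h1_norm \<Omega> (\<lambda>x. u0 x - u x)))" if "\<epsilon> > 0" for \<epsilon>
    by (rule iteration_converges[OF abs_ge_zero lt largest_bounds_form[OF mu] that])
  then show ?thesis using lt rate by blast
qed

end
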